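(* Let $H$ be a normal subgroup of a finite group $G$, $\bar G=G/H$, let $P$ be a $p$-subgroup of $G$, let $B$ be an $H$-interior $G$-algebra over $\mathcal{O}$, and let $A=B\otimes_{\mathcal{O}H}\mathcal{O}G$. With $K=\operatorname{Aut}_{\bar G}(P)$, $K_1=\operatorname{Aut}_{\bar 1}(P)$ and the subgroups $U'\trianglelefteq U$ of $G$ defined in the context, the extended Brauer quotient $\bar N_A^{\operatorname{Aut}(P)}(P)$ is the $U/U'$-graded $N_G(P)$-interior algebra $\bar N_A^K(P)$, whose identity component is the $N_G^{K_1}(P)$-interior algebra $$\bar N_A^{K_1}(P)=\bigoplus_{g'\in U'/H}\bar N^{K_1}_{B\otimes g'}(P),$$ and for any $\tilde g\in U/U'$, corresponding to $\tilde\varphi\in K/K_1$, the $\tilde g$-component is $$\bar N_A^K(P)_{\tilde g}=\bigoplus_{\varphi_{\bar z}\in\tilde\varphi;\ \bar z\in\tilde g}(B\otimes z)(\Delta_{\varphi_{\bar z}}(P)),$$ where the sum runs over pairs consisting of $\bar z=zH\in U/H$ contained in the coset $\tilde g$ and $\varphi_{\bar z}\in\tilde\varphi$ satisfying $\overline{\varphi_{\bar z}(u)}=\overline{u^z}$ for any $u\in P$.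
   Context: $\mathcal{O}$ is a complete discrete valuation ring with maximal ideal $J(\mathcal{O})$ and residue field $k$ of characteristic $p>0$. Write $u^g=g^{-1}ug$; a bar denotes images in $\bar G=G/H$; $\bar P$ is the image of $P$ in $\bar G$. An $H$-interior $G$-algebra is an $\mathcal{O}$-algebra $B$ with a right action $b\mapsto b^g$ of $G$ by algebra automorphisms and a unital $G$-equivariant algebra homomorphism $\mathcal{O}H\to B$ such that $b^h=h^{-1}bh$ for $h\in H$. Then $A=B\otimes_{\mathcal{O}H}\mathcal{O}G=\bigoplus_{\bar g\in\bar G}B\otimes g$ is a $\bar G$-graded algebra with $(b\otimes g)(b'\otimes g')=b\,(b')^{g^{-1}}\otimes gg'$, and $G$-interior via $g\mapsto 1\otimes g$. The submodule $B\otimes g$ depends only on $\bar g$. Convention: the product in $\operatorname{Aut}(P)$ is $\varphi\psi:=\psi\circ\varphi$ (first apply $\varphi$). For $x\in N_G(P)$ let $\varphi_x(u)=u^x$. For $\varphi\in\operatorname{Aut}(P)$, $Q\le P$ and an $\mathcal{O}$-submodule $M\subseteq A$ stable under $m\mapsto u^{-1}m\varphi(u)$ $(u\in P)$, put $M^{\Delta_\varphi(Q)}=\{m\in M\mid um=m\varphi(u)\ \forall u\in Q\}$; for $Q<P$ let $M_{\Delta_\varphi(Q)}^{\Delta_\varphi(P)}$ be the set of elements $\sum_{u\in[Q\backslash P]}u^{-1}c\varphi(u)$ with $c\in M^{\Delta_\varphi(Q)}$ (sum over representatives of the cosets $Qu$), and $$M(\Delta_\varphi(P))=M^{\Delta_\varphi(P)}\Big/\Big(\sum_{Q<P}M^{\Delta_\varphi(P)}_{\Delta_\varphi(Q)}+J(\mathcal{O})M^{\Delta_\varphi(P)}\Big).$$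 For $L\le\operatorname{Aut}(P)$ put $\bar N_A^L(P)=\bigoplus_{\varphi\in L}A(\Delta_\varphi(P))$; it is an $L$-graded $k$-algebra with multiplication induced by that of $A$ (if $a\in A^{\Delta_\varphi(P)}$, $b\in A^{\Delta_\psi(P)}$ then $ab\in A^{\Delta_{\varphi\psi}(P)}$). If $M$ is stable for all $\varphi\in L$, put $\bar N_M^L(P)=\bigoplus_{\varphi\in L}M(\Delta_\varphi(P))$. $K=\operatorname{Aut}_{\bar G}(P)=\{\varphi\in\operatorname{Aut}(P)\mid \exists\,\bar g\in\bar G\ \forall u\in P:\ \overline{\varphi(u)}=\overline{u^g}\}$ and $K_1=\operatorname{Aut}_{\bar 1}(P)=\{\varphi\in\operatorname{Aut}(P)\mid\overline{\varphi(u)}=\bar u\ \forall u\in P\}$, a normal subgroup of $K$. $N^K_{\bar G}(\bar P)$ is the subgroup of those $\bar g\in N_{\bar G}(\bar P)$ for which there is $\varphi\in K$ with $\overline{\varphi(u)}=\overline{u^g}$ for all $u\in P$; $U$ is the inverse image of $N^K_{\bar G}(\bar P)$ in $G$, and $U'$ the inverse image of $C_{\bar G}(\bar P)$ in $G$. One has $U'\trianglelefteq U$ and an isomorphism $K/K_1\simeq U/U'$ sending the class $\tilde\varphi$ of $\varphi$ to the class $\tilde g$ of any $g$ with $\overline{\varphi(u)}=\overline{u^g}$ for all $u\in P$; this is the correspondence $\tilde\varphi\leftrightarrow\tilde g$. For $L\le \operatorname{Aut}(P)$, $N_G^L(P)=\{x\in N_G(P)\mid\varphi_x\in L\}$; in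 particular $N_G^K(P)=N_G(P)$ and $N_G^{K_1}(P)=N_G(P)\cap U'$. The interior structures are given by sending $x$ to the class of $1\otimes x$ in the $\varphi_x$-component. *)

theory Defs
  imports "HOL-Algebra.Ring_Divisibility" "HOL-Algebra.Ideal_Product" "HOL-Algebra.Group_Action"
begin

section \<open>Coefficient ring and algebras\<close>

primrec ideal_pow :: "('r, 'm) ring_scheme \<Rightarrow> 'r set \<Rightarrow> nat \<Rightarrow> 'r set" where
  "ideal_pow R I 0 = carrier R"
| "ideal_pow R I (Suc n) = ideal_prod R (ideal_pow R I n) I"

text \<open>
  A discrete valuation ring is a local principal ideal domain that is not a field.
  Completeness: every coherent sequence has exactly one \<open>J\<close>-adic limit, that is,
  \<open>R\<close> is the inverse limit of the rings \<open>R / J^n\<close>.  The last two assumptions say that the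
  residue field has characteristic \<open>p > 0\<close>.
\<close>

locale complete_dvr = principal_domain R for R (structure) +
  fixes J and p :: nat
  assumes not_field: "\<not> field R"
    and maximal: "maximalideal J R"
    and local: "\<And>I. maximalideal I R \<Longrightarrow> I = J"
    and complete: "\<And>x :: nat \<Rightarrow> _. (\<And>n. x n \<in> carrier R) \<Longrightarrow>
          (\<And>n. x (Suc n) \<ominus> x n \<in> ideal_pow R J n) \<Longrightarrow>
          \<exists>!l. l \<in> carrier R \<and> (\<forall>n. x n \<ominus> l \<in> ideal_pow R J n)"
    and char_pos: "p > 0"
    and residue_char: "\<And>n :: nat.
          add_pow (R Quot J) n \<one>\<^bsub>R Quot J\<^esub> = \<zero>\<^bsub>R Quot J\<^esub> \<longleftrightarrow> p dvd n"

text \<open>Unital associative algebras; the locale \<^locale>\<open>algebra\<close> is restricted to commutative ones.\<close>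

locale assoc_algebra = module + ring M +
  assumes smult_mult_left: "\<lbrakk>a \<in> carrier R; x \<in> carrier M; y \<in> carrier M\<rbrakk> \<Longrightarrow>
            (a \<odot>\<^bsub>M\<^esub> x) \<otimes>\<^bsub>M\<^esub> y = a \<odot>\<^bsub>M\<^esub> (x \<otimes>\<^bsub>M\<^esub> y)"
    and smult_mult_right: "\<lbrakk>a \<in> carrier R; x \<in> carrier M; y \<in> carrier M\<rbrakk> \<Longrightarrow>
            x \<otimes>\<^bsub>M\<^esub> (a \<odot>\<^bsub>M\<^esub> y) = a \<odot>\<^bsub>M\<^esub> (x \<otimes>\<^bsub>M\<^esub> y)"

definition lin_map ::
  "('r, 'm) ring_scheme \<Rightarrow> ('r, 'a) module \<Rightarrow> ('r, 'b) module \<Rightarrow> ('a \<Rightarrow> 'b) set" where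
  "lin_map R M N = {f \<in> carrier M \<rightarrow> carrier N.
     (\<forall>x\<in>carrier M. \<forall>y\<in>carrier M. f (x \<oplus>\<^bsub>M\<^esub> y) = f x \<oplus>\<^bsub>N\<^esub> f y) \<and>
     (\<forall>r\<in>carrier R. \<forall>x\<in>carrier M. f (r \<odot>\<^bsub>M\<^esub> x) = r \<odot>\<^bsub>N\<^esub> f x)}"

definition alg_hom ::
  "('r, 'm) ring_scheme \<Rightarrow> ('r, 'a) module \<Rightarrow> ('r, 'b) module \<Rightarrow> ('a \<Rightarrow> 'b) set" where
  "alg_hom R A B = ring_hom A B \<inter> lin_map R A B"

text \<open>\<open>N\<close> is the direct sum of the modules \<open>V i\<close> via the maps \<open>j i\<close>.\<close>

definition is_direct_sum ::
  "('r, 'm) ring_scheme \<Rightarrow> 'i set \<Rightarrow> ('i \<Rightarrow> ('r, 'a) module) \<Rightarrow> ('i \<Rightarrow> 'a \<Rightarrow> 'b) \<Rightarrow>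
   ('r, 'b) module \<Rightarrow> bool" where
  "is_direct_sum R I V j N \<longleftrightarrow>
     finite I \<and> module R N \<and> (\<forall>i\<in>I. module R (V i) \<and> j i \<in> lin_map R (V i) N) \<and>
     bij_betw (\<lambda>f. \<Oplus>\<^bsub>N\<^esub>i\<in>I. j i (f i)) (\<Pi>\<^sub>E i\<in>I. carrier (V i)) (carrier N)"

definition graded_algebra ::
  "('r, 'm) ring_scheme \<Rightarrow> 'i monoid \<Rightarrow> ('i \<Rightarrow> 'a set) \<Rightarrow> ('r, 'a) module \<Rightarrow> bool" where
  "graded_algebra R V Nc N \<longleftrightarrow>
     group V \<and> assoc_algebra R N \<and> (\<forall>i\<in>carrier V. submodule (Nc i) R N) \<and>
     is_direct_sum R (carrier V) (\<lambda>i. N\<lparr>carrier := Nc i\<rparr>) (\<lambda>i a. a) N \<and>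
     (\<forall>i\<in>carrier V. \<forall>j\<in>carrier V. \<forall>a\<in>Nc i. \<forall>b\<in>Nc j.
        a \<otimes>\<^bsub>N\<^esub> b \<in> Nc (i \<otimes>\<^bsub>V\<^esub> j))"

definition interior_algebra ::
  "('r, 'm) ring_scheme \<Rightarrow> 'g monoid \<Rightarrow> ('g \<Rightarrow> 'a) \<Rightarrow> ('r, 'a) module \<Rightarrow> bool" where
  "interior_algebra R V \<iota> N \<longleftrightarrow>
     group V \<and> assoc_algebra R N \<and> \<iota> \<in> hom V (units_of N)"


section \<open>Interior \<open>G\<close>-algebras and the induced algebra\<close>

text \<open>\<open>u^g\<close>\<close>
definition conj_by :: "'g monoid \<Rightarrow> 'g \<Rightarrow> 'g \<Rightarrow> 'g" where
  "conj_by G u g = inv\<^bsub>G\<^esub> g \<otimes>\<^bsub>G\<^esub> u \<otimes>\<^bsub>G\<^esub> g"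

definition group_algebra :: "'r ring \<Rightarrow> 'g monoid \<Rightarrow> ('r, 'g \<Rightarrow> 'r) module" where
  "group_algebra R G =
    \<lparr>carrier = carrier G \<rightarrow>\<^sub>E carrier R,
     monoid.mult = (\<lambda>x y. \<lambda>g\<in>carrier G. \<Oplus>\<^bsub>R\<^esub>s\<in>carrier G. x s \<otimes>\<^bsub>R\<^esub> y (inv\<^bsub>G\<^esub> s \<otimes>\<^bsub>G\<^esub> g)),
     one = (\<lambda>g\<in>carrier G. if g = \<one>\<^bsub>G\<^esub> then \<one>\<^bsub>R\<^esub> else \<zero>\<^bsub>R\<^esub>),
     zero = (\<lambda>g\<in>carrier G. \<zero>\<^bsub>R\<^esub>),
     add = (\<lambda>x y. \<lambda>g\<in>carrier G. x g \<oplus>\<^bsub>R\<^esub> y g),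
     smult = (\<lambda>r x. \<lambda>g\<in>carrier G. r \<otimes>\<^bsub>R\<^esub> x g)\<rparr>"

definition ga_basis :: "'r ring \<Rightarrow> 'g monoid \<Rightarrow> 'g \<Rightarrow> 'g \<Rightarrow> 'r" where
  "ga_basis R G g = (\<lambda>x\<in>carrier G. if x = g then \<one>\<^bsub>R\<^esub> else \<zero>\<^bsub>R\<^esub>)"

text \<open>The right action of \<open>G\<close> on \<open>RH\<close> extending \<open>h \<mapsto> h^g\<close>.\<close>
definition ga_conj :: "'g monoid \<Rightarrow> 'g set \<Rightarrow> ('g \<Rightarrow> 'r) \<Rightarrow> 'g \<Rightarrow> 'g \<Rightarrow> 'r" where
  "ga_conj G H x g = (\<lambda>h\<in>H. x (g \<otimes>\<^bsub>G\<^esub> h \<otimes>\<^bsub>G\<^esub> inv\<^bsub>G\<^esub> g))"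

definition ga_incl :: "'r ring \<Rightarrow> 'g monoid \<Rightarrow> 'g set \<Rightarrow> ('g \<Rightarrow> 'r) \<Rightarrow> 'g \<Rightarrow> 'r" where
  "ga_incl R G H x = (\<lambda>g\<in>carrier G. if g \<in> H then x g else \<zero>\<^bsub>R\<^esub>)"

locale interior_G_algebra = normal H G + assoc_algebra R B
  for R :: "'r ring" and G :: "'g monoid" and H and B :: "('r, 'b) module" +
  fixes act :: "'b \<Rightarrow> 'g \<Rightarrow> 'b" and \<sigma> :: "('g \<Rightarrow> 'r) \<Rightarrow> 'b"
  assumes act_hom: "g \<in> carrier G \<Longrightarrow> (\<lambda>b. act b g) \<in> alg_hom R B B"
    and act_one: "b \<in> carrier B \<Longrightarrow> act b \<one>\<^bsub>G\<^esub> = b"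
    and act_mult: "\<lbrakk>b \<in> carrier B; g \<in> carrier G; g' \<in> carrier G\<rbrakk> \<Longrightarrow>
          act (act b g) g' = act b (g \<otimes>\<^bsub>G\<^esub> g')"
    and struct_hom: "\<sigma> \<in> alg_hom R (group_algebra R (G\<lparr>carrier := H\<rparr>)) B"
    and struct_equivariant:
          "\<lbrakk>x \<in> carrier (group_algebra R (G\<lparr>carrier := H\<rparr>)); g \<in> carrier G\<rbrakk> \<Longrightarrow>
          \<sigma> (ga_conj G H x g) = act (\<sigma> x) g"
    and act_interior: "\<lbrakk>b \<in> carrier B; h \<in> H\<rbrakk> \<Longrightarrow>
          act b h = \<sigma> (ga_basis R (G\<lparr>carrier := H\<rparr>) (inv\<^bsub>G\<^esub> h)) \<otimes>\<^bsub>B\<^esub> b \<otimes>\<^bsub>B\<^esub>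
                    \<sigma> (ga_basis R (G\<lparr>carrier := H\<rparr>) h)"

text \<open>
  \<open>B \<otimes>\<^sub>R RG\<close>, with \<open>\<Sum> b\<^sub>g \<otimes> g\<close> encoded as the family \<open>g \<mapsto> b\<^sub>g\<close>, and with the
  multiplication \<open>(b \<otimes> g)(b' \<otimes> g') = b (b')^{g^{-1}} \<otimes> gg'\<close>.
\<close>
definition skew_algebra ::
  "'g monoid \<Rightarrow> ('r, 'b) module \<Rightarrow> ('b \<Rightarrow> 'g \<Rightarrow> 'b) \<Rightarrow> ('r, 'g \<Rightarrow> 'b) module" where
  "skew_algebra G B act =
    \<lparr>carrier = carrier G \<rightarrow>\<^sub>E carrier B,
     monoid.mult = (\<lambda>f f'. \<lambda>x\<in>carrier G. \<Oplus>\<^bsub>B\<^esub>g\<in>carrier G.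
               f g \<otimes>\<^bsub>B\<^esub> act (f' (inv\<^bsub>G\<^esub> g \<otimes>\<^bsub>G\<^esub> x)) (inv\<^bsub>G\<^esub> g)),
     one = (\<lambda>x\<in>carrier G. if x = \<one>\<^bsub>G\<^esub> then \<one>\<^bsub>B\<^esub> else \<zero>\<^bsub>B\<^esub>),
     zero = (\<lambda>x\<in>carrier G. \<zero>\<^bsub>B\<^esub>),
     add = (\<lambda>f f'. \<lambda>x\<in>carrier G. f x \<oplus>\<^bsub>B\<^esub> f' x),
     smult = (\<lambda>r f. \<lambda>x\<in>carrier G. r \<odot>\<^bsub>B\<^esub> f x)\<rparr>"

text \<open>The pure tensor \<open>b \<otimes> y\<close> in \<open>B \<otimes>\<^sub>R RG\<close>.\<close>
definition pure_tensor ::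
  "'g monoid \<Rightarrow> ('r, 'b) module \<Rightarrow> 'b \<Rightarrow> ('g \<Rightarrow> 'r) \<Rightarrow> 'g \<Rightarrow> 'b" where
  "pure_tensor G B b y = (\<lambda>g\<in>carrier G. y g \<odot>\<^bsub>B\<^esub> b)"

text \<open>
  The kernel of \<open>B \<otimes>\<^sub>R RG \<rightarrow> B \<otimes>\<^bsub>RH\<^esub> RG\<close>, generated by the elements
  \<open>b x \<otimes> y - b \<otimes> x y\<close> with \<open>x \<in> RH\<close>, \<open>y \<in> RG\<close>.
\<close>
definition balance_rel ::
  "'r ring \<Rightarrow> 'g monoid \<Rightarrow> 'g set \<Rightarrow> ('r, 'b) module \<Rightarrow> ('b \<Rightarrow> 'g \<Rightarrow> 'b) \<Rightarrow>
   (('g \<Rightarrow> 'r) \<Rightarrow> 'b) \<Rightarrow> ('g \<Rightarrow> 'b) set" where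
  "balance_rel R G H B act \<sigma> = generate (add_monoid (skew_algebra G B act))
     {pure_tensor G B (b \<otimes>\<^bsub>B\<^esub> \<sigma> x) y \<ominus>\<^bsub>skew_algebra G B act\<^esub>
      pure_tensor G B b (ga_incl R G H x \<otimes>\<^bsub>group_algebra R G\<^esub> y) | b x y.
        b \<in> carrier B \<and> x \<in> carrier (group_algebra R (G\<lparr>carrier := H\<rparr>)) \<and>
        y \<in> carrier (group_algebra R G)}"

text \<open>\<open>A = B \<otimes>\<^bsub>RH\<^esub> RG\<close>\<close>
definition induced_algebra ::
  "'r ring \<Rightarrow> 'g monoid \<Rightarrow> 'g set \<Rightarrow> ('r, 'b) module \<Rightarrow> ('b \<Rightarrow> 'g \<Rightarrow> 'b) \<Rightarrow>
   (('g \<Rightarrow> 'r) \<Rightarrow> 'b) \<Rightarrow> ('r, ('g \<Rightarrow> 'b) set) module" where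
  "induced_algebra R G H B act \<sigma> =
    (let S = skew_algebra G B act; I = balance_rel R G H B act \<sigma> in
     \<lparr>carrier = carrier (S Quot I),
      monoid.mult = monoid.mult (S Quot I),
      one = \<one>\<^bsub>S Quot I\<^esub>,
      zero = \<zero>\<^bsub>S Quot I\<^esub>,
      ring.add = ring.add (S Quot I),
      smult = (\<lambda>r Y. \<Union>x\<in>Y. I +>\<^bsub>S\<^esub> (r \<odot>\<^bsub>S\<^esub> x))\<rparr>)"

text \<open>\<open>b \<otimes> g\<close> as an element of \<open>A\<close>\<close>
definition tens ::
  "'r ring \<Rightarrow> 'g monoid \<Rightarrow> 'g set \<Rightarrow> ('r, 'b) module \<Rightarrow> ('b \<Rightarrow> 'g \<Rightarrow> 'b) \<Rightarrow>
   (('g \<Rightarrow> 'r) \<Rightarrow> 'b) \<Rightarrow> 'b \<Rightarrow> 'g \<Rightarrow> ('g \<Rightarrow> 'b) set" where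
  "tens R G H B act \<sigma> b g =
     balance_rel R G H B act \<sigma> +>\<^bsub>skew_algebra G B act\<^esub> pure_tensor G B b (ga_basis R G g)"

text \<open>\<open>B \<otimes> z\<close> for a coset \<open>C = zH\<close>; the submodule is the same for all representatives \<open>z\<close>.\<close>
definition tens_part ::
  "'r ring \<Rightarrow> 'g monoid \<Rightarrow> 'g set \<Rightarrow> ('r, 'b) module \<Rightarrow> ('b \<Rightarrow> 'g \<Rightarrow> 'b) \<Rightarrow>
   (('g \<Rightarrow> 'r) \<Rightarrow> 'b) \<Rightarrow> 'g set \<Rightarrow> ('g \<Rightarrow> 'b) set set" where
  "tens_part R G H B act \<sigma> C = {tens R G H B act \<sigma> b z | b z. b \<in> carrier B \<and> z \<in> C}"


section \<open>The groups attached to \<open>P\<close>\<close>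

text \<open>\<open>Aut(P)\<close> with the product \<open>\<phi>\<psi> = \<psi> \<circ> \<phi>\<close>, opposite to that of \<^const>\<open>AutoGroup\<close>.\<close>
definition Aut_grp :: "'g monoid \<Rightarrow> 'g set \<Rightarrow> ('g \<Rightarrow> 'g) monoid" where
  "Aut_grp G P =
    \<lparr>carrier = auto (G\<lparr>carrier := P\<rparr>),
     monoid.mult = (\<lambda>\<phi> \<psi>. \<psi> \<otimes>\<^bsub>AutoGroup (G\<lparr>carrier := P\<rparr>)\<^esub> \<phi>),
     one = \<one>\<^bsub>AutoGroup (G\<lparr>carrier := P\<rparr>)\<^esub>\<rparr>"

abbreviation Aut :: "'g monoid \<Rightarrow> 'g set \<Rightarrow> ('g \<Rightarrow> 'g) set" where
  "Aut G P \<equiv> carrier (Aut_grp G P)"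

text \<open>\<open>\<phi>(u)\<close> and \<open>u^g\<close> have the same image in \<open>G/H\<close> for all \<open>u \<in> P\<close>.\<close>
definition lifts_conj :: "'g monoid \<Rightarrow> 'g set \<Rightarrow> 'g set \<Rightarrow> ('g \<Rightarrow> 'g) \<Rightarrow> 'g \<Rightarrow> bool" where
  "lifts_conj G H P \<phi> g \<longleftrightarrow> (\<forall>u\<in>P. H #>\<^bsub>G\<^esub> \<phi> u = H #>\<^bsub>G\<^esub> conj_by G u g)"

text \<open>\<open>K\<close>\<close>
definition Aut_quot :: "'g monoid \<Rightarrow> 'g set \<Rightarrow> 'g set \<Rightarrow> ('g \<Rightarrow> 'g) set" where
  "Aut_quot G H P = {\<phi> \<in> Aut G P. \<exists>g\<in>carrier G. lifts_conj G H P \<phi> g}"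

text \<open>\<open>K\<^sub>1\<close>\<close>
definition Aut_quot_one :: "'g monoid \<Rightarrow> 'g set \<Rightarrow> 'g set \<Rightarrow> ('g \<Rightarrow> 'g) set" where
  "Aut_quot_one G H P = {\<phi> \<in> Aut G P. \<forall>u\<in>P. H #>\<^bsub>G\<^esub> \<phi> u = H #>\<^bsub>G\<^esub> u}"

definition image_in_quot :: "'g monoid \<Rightarrow> 'g set \<Rightarrow> 'g set \<Rightarrow> 'g set set" where
  "image_in_quot G H P = (\<lambda>u. H #>\<^bsub>G\<^esub> u) ` P"

definition centralizer :: "'g monoid \<Rightarrow> 'g set \<Rightarrow> 'g set" where
  "centralizer G S = {g \<in> carrier G. \<forall>s\<in>S. g \<otimes>\<^bsub>G\<^esub> s = s \<otimes>\<^bsub>G\<^esub> g}"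

text \<open>The subgroup \<open>N^K_{G/H}(P')\<close> of \<open>G/H\<close>, where \<open>P'\<close> is the image of \<open>P\<close>.\<close>
definition norm_quot :: "'g monoid \<Rightarrow> 'g set \<Rightarrow> 'g set \<Rightarrow> 'g set set" where
  "norm_quot G H P = {C \<in> normalizer (G Mod H) (image_in_quot G H P).
     \<exists>g\<in>C. \<exists>\<phi>\<in>Aut_quot G H P. lifts_conj G H P \<phi> g}"

text \<open>\<open>U\<close>\<close>
definition norm_preimage :: "'g monoid \<Rightarrow> 'g set \<Rightarrow> 'g set \<Rightarrow> 'g set" where
  "norm_preimage G H P = {g \<in> carrier G. H #>\<^bsub>G\<^esub> g \<in> norm_quot G H P}"

text \<open>\<open>U'\<close>\<close>
definition cent_preimage :: "'g monoid \<Rightarrow> 'g set \<Rightarrow> 'g set \<Rightarrow> 'g set" where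
  "cent_preimage G H P =
     {g \<in> carrier G. H #>\<^bsub>G\<^esub> g \<in> centralizer (G Mod H) (image_in_quot G H P)}"

definition KK1 :: "'g monoid \<Rightarrow> 'g set \<Rightarrow> 'g set \<Rightarrow> ('g \<Rightarrow> 'g) set monoid" where
  "KK1 G H P = (Aut_grp G P)\<lparr>carrier := Aut_quot G H P\<rparr> Mod Aut_quot_one G H P"

definition UU' :: "'g monoid \<Rightarrow> 'g set \<Rightarrow> 'g set \<Rightarrow> 'g set monoid" where
  "UU' G H P = G\<lparr>carrier := norm_preimage G H P\<rparr> Mod cent_preimage G H P"

text \<open>
  The correspondence \<open>K/K\<^sub>1 \<rightarrow> U/U'\<close>: the elements \<open>g\<close> with the same effect as some member
  of the class \<open>\<Phi>\<close> form a single coset of \<open>U'\<close> in \<open>U\<close>.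
\<close>
definition class_corr ::
  "'g monoid \<Rightarrow> 'g set \<Rightarrow> 'g set \<Rightarrow> ('g \<Rightarrow> 'g) set \<Rightarrow> 'g set" where
  "class_corr G H P \<Phi> = {g \<in> norm_preimage G H P. \<exists>\<phi>\<in>\<Phi>. lifts_conj G H P \<phi> g}"

text \<open>\<open>\<phi>\<^sub>x\<close>\<close>
definition conj_aut :: "'g monoid \<Rightarrow> 'g set \<Rightarrow> 'g \<Rightarrow> 'g \<Rightarrow> 'g" where
  "conj_aut G P x = (\<lambda>u\<in>P. conj_by G u x)"

text \<open>\<open>N_G^L(P)\<close>\<close>
definition norm_in :: "'g monoid \<Rightarrow> 'g set \<Rightarrow> ('g \<Rightarrow> 'g) set \<Rightarrow> 'g set" where
  "norm_in G P L = {x \<in> normalizer G P. conj_aut G P x \<in> L}"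


section \<open>Extended Brauer quotients\<close>

text \<open>
  Throughout, \<open>A\<close> is a \<open>G\<close>-interior algebra with structure map \<open>\<iota>\<close> over a local ring with
  maximal ideal \<open>J\<close>, and \<open>M\<close> is a submodule of \<open>A\<close>; the products \<open>u m\<close> and \<open>m u\<close> are
  formed with \<open>\<iota> u\<close>.
\<close>

definition br_fixed ::
  "('r, 'a) module \<Rightarrow> ('g \<Rightarrow> 'a) \<Rightarrow> 'a set \<Rightarrow> ('g \<Rightarrow> 'g) \<Rightarrow> 'g set \<Rightarrow> 'a set" where
  "br_fixed A \<iota> M \<phi> Q = {m \<in> M. \<forall>u\<in>Q. \<iota> u \<otimes>\<^bsub>A\<^esub> m = m \<otimes>\<^bsub>A\<^esub> \<iota> (\<phi> u)}"

definition right_transversal :: "'g monoid \<Rightarrow> 'g set \<Rightarrow> 'g set \<Rightarrow> 'g set \<Rightarrow> bool" where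
  "right_transversal G Q P T \<longleftrightarrow> T \<subseteq> P \<and> (\<forall>u\<in>P. \<exists>!t. t \<in> T \<and> u \<in> Q #>\<^bsub>G\<^esub> t)"

definition br_trace ::
  "'g monoid \<Rightarrow> 'g set \<Rightarrow> ('r, 'a) module \<Rightarrow> ('g \<Rightarrow> 'a) \<Rightarrow> 'a set \<Rightarrow> ('g \<Rightarrow> 'g) \<Rightarrow> 'g set \<Rightarrow>
   'a set" where
  "br_trace G P A \<iota> M \<phi> Q =
     {\<Oplus>\<^bsub>A\<^esub>u\<in>T. \<iota> (inv\<^bsub>G\<^esub> u) \<otimes>\<^bsub>A\<^esub> c \<otimes>\<^bsub>A\<^esub> \<iota> (\<phi> u) | c T.
        c \<in> br_fixed A \<iota> M \<phi> Q \<and> right_transversal G Q P T}"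

definition br_ker ::
  "'g monoid \<Rightarrow> 'g set \<Rightarrow> 'r set \<Rightarrow> ('r, 'a) module \<Rightarrow> ('g \<Rightarrow> 'a) \<Rightarrow> 'a set \<Rightarrow> ('g \<Rightarrow> 'g) \<Rightarrow>
   'a set" where
  "br_ker G P J A \<iota> M \<phi> = generate (add_monoid A)
     ((\<Union>Q\<in>{Q. subgroup Q (G\<lparr>carrier := P\<rparr>) \<and> Q \<noteq> P}. br_trace G P A \<iota> M \<phi> Q) \<union>
      {r \<odot>\<^bsub>A\<^esub> m | r m. r \<in> J \<and> m \<in> br_fixed A \<iota> M \<phi> P})"

text \<open>
  \<open>M(\<Delta>\<^sub>\<phi>(P))\<close> as a module over the residue field.  The record type also
  demands a multiplication and a unit, which have no meaning here.
\<close>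
definition br_quot ::
  "'g monoid \<Rightarrow> 'g set \<Rightarrow> 'r set \<Rightarrow> ('r, 'a) module \<Rightarrow> ('g \<Rightarrow> 'a) \<Rightarrow> 'a set \<Rightarrow> ('g \<Rightarrow> 'g) \<Rightarrow>
   ('r set, 'a set) module" where
  "br_quot G P J A \<iota> M \<phi> =
    (let D = br_ker G P J A \<iota> M \<phi> in
     \<lparr>carrier = {D +>\<^bsub>A\<^esub> m | m. m \<in> br_fixed A \<iota> M \<phi> P},
      monoid.mult = undefined,
      one = undefined,
      zero = D,
      add = (\<lambda>Y Z. Y <+>\<^bsub>A\<^esub> Z),
      smult = (\<lambda>c Y. \<Union>r\<in>c. \<Union>x\<in>Y. D +>\<^bsub>A\<^esub> (r \<odot>\<^bsub>A\<^esub> x))\<rparr>)"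

text \<open>The map \<open>M(\<Delta>\<^sub>\<phi>(P)) \<rightarrow> A(\<Delta>\<^sub>\<phi>(P))\<close> induced by the inclusion of \<open>M\<close> in \<open>A\<close>.\<close>
definition br_incl ::
  "'g monoid \<Rightarrow> 'g set \<Rightarrow> 'r set \<Rightarrow> ('r, 'a) module \<Rightarrow> ('g \<Rightarrow> 'a) \<Rightarrow> ('g \<Rightarrow> 'g) \<Rightarrow> 'a set \<Rightarrow>
   'a set" where
  "br_incl G P J A \<iota> \<phi> Y = (\<Union>x\<in>Y. br_ker G P J A \<iota> (carrier A) \<phi> +>\<^bsub>A\<^esub> x)"

text \<open>
  The direct sum of the \<open>M(\<Delta>\<^sub>\<phi>(P))\<close>, \<open>\<phi> \<in> L\<close>, for a set \<open>L\<close> of automorphisms of \<open>P\<close>.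
  Its elements are encoded as families indexed by all of \<open>Aut(P)\<close> that vanish outside \<open>L\<close>, so
  that the direct sum over a subset of \<open>L\<close> is a subset of the direct sum over \<open>L\<close>.
  Multiplication and unit are meaningful for \<open>M = A\<close> and \<open>L\<close> a subgroup:
  there the product of the classes of \<open>a\<close> and \<open>b\<close> in degrees \<open>\<phi>\<close> and \<open>\<psi>\<close> is the
  class of \<open>ab\<close> in degree \<open>\<phi>\<psi>\<close>.
\<close>
definition ext_brauer ::
  "'g monoid \<Rightarrow> 'g set \<Rightarrow> 'r set \<Rightarrow> ('r, 'a) module \<Rightarrow> ('g \<Rightarrow> 'a) \<Rightarrow> 'a set \<Rightarrow> ('g \<Rightarrow> 'g) set \<Rightarrow>
   ('r set, ('g \<Rightarrow> 'g) \<Rightarrow> 'a set) module" where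
  "ext_brauer G P J A \<iota> M L =
    (let V = br_quot G P J A \<iota> M; D = br_ker G P J A \<iota> M in
     \<lparr>carrier = {f \<in> (\<Pi>\<^sub>E \<phi>\<in>Aut G P. carrier (V \<phi>)). \<forall>\<phi>\<in>Aut G P - L. f \<phi> = \<zero>\<^bsub>V \<phi>\<^esub>},
      monoid.mult = (\<lambda>f f'. \<lambda>\<chi>\<in>Aut G P. \<Oplus>\<^bsub>V \<chi>\<^esub>\<phi>\<in>Aut G P.
        \<Union>a\<in>f \<phi>. \<Union>b\<in>f' (inv\<^bsub>Aut_grp G P\<^esub> \<phi> \<otimes>\<^bsub>Aut_grp G P\<^esub> \<chi>). D \<chi> +>\<^bsub>A\<^esub> (a \<otimes>\<^bsub>A\<^esub> b)),
      one = (\<lambda>\<phi>\<in>Aut G P. if \<phi> = \<one>\<^bsub>Aut_grp G P\<^esub> then D \<phi> +>\<^bsub>A\<^esub> \<one>\<^bsub>A\<^esub> else \<zero>\<^bsub>V \<phi>\<^esub>),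
      zero = (\<lambda>\<phi>\<in>Aut G P. \<zero>\<^bsub>V \<phi>\<^esub>),
      add = (\<lambda>f f'. \<lambda>\<phi>\<in>Aut G P. f \<phi> \<oplus>\<^bsub>V \<phi>\<^esub> f' \<phi>),
      smult = (\<lambda>c f. \<lambda>\<phi>\<in>Aut G P. c \<odot>\<^bsub>V \<phi>\<^esub> f \<phi>)\<rparr>)"

text \<open>The map between direct sums induced by the inclusion of \<open>M\<close> in \<open>A\<close>.\<close>
definition ext_brauer_incl ::
  "'g monoid \<Rightarrow> 'g set \<Rightarrow> 'r set \<Rightarrow> ('r, 'a) module \<Rightarrow> ('g \<Rightarrow> 'a) \<Rightarrow>
   (('g \<Rightarrow> 'g) \<Rightarrow> 'a set) \<Rightarrow> ('g \<Rightarrow> 'g) \<Rightarrow> 'a set" where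
  "ext_brauer_incl G P J A \<iota> f = (\<lambda>\<phi>\<in>Aut G P. br_incl G P J A \<iota> \<phi> (f \<phi>))"

text \<open>The map \<open>M(\<Delta>\<^sub>\<phi>(P)) \<rightarrow> A(\<Delta>\<^sub>\<phi>(P))\<close> followed by the insertion in degree \<open>\<phi>\<close>.\<close>
definition br_insert ::
  "'g monoid \<Rightarrow> 'g set \<Rightarrow> 'r set \<Rightarrow> ('r, 'a) module \<Rightarrow> ('g \<Rightarrow> 'a) \<Rightarrow> ('g \<Rightarrow> 'g) \<Rightarrow>
   'a set \<Rightarrow> ('g \<Rightarrow> 'g) \<Rightarrow> 'a set" where
  "br_insert G P J A \<iota> \<phi> Y = (\<lambda>\<psi>\<in>Aut G P.
     if \<psi> = \<phi> then br_incl G P J A \<iota> \<phi> Y else br_ker G P J A \<iota> (carrier A) \<psi>)"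

text \<open>The interior structure: \<open>x\<close> goes to the class of \<open>\<iota> x\<close> in degree \<open>\<phi>\<^sub>x\<close>.\<close>
definition ext_brauer_struct ::
  "'g monoid \<Rightarrow> 'g set \<Rightarrow> 'r set \<Rightarrow> ('r, 'a) module \<Rightarrow> ('g \<Rightarrow> 'a) \<Rightarrow> 'g \<Rightarrow>
   ('g \<Rightarrow> 'g) \<Rightarrow> 'a set" where
  "ext_brauer_struct G P J A \<iota> x = (\<lambda>\<psi>\<in>Aut G P.
     if \<psi> = conj_aut G P x then br_ker G P J A \<iota> (carrier A) \<psi> +>\<^bsub>A\<^esub> \<iota> x
     else br_ker G P J A \<iota> (carrier A) \<psi>)"

text \<open>
  The \<open>U/U'\<close>-grading: the component of degree \<open>C\<close> consists of the summands
  \<open>A(\<Delta>\<^sub>\<phi>(P))\<close> with \<open>\<phi> \<in> K\<close> whose class modulo \<open>K\<^sub>1\<close> corresponds to \<open>C\<close>.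
\<close>
definition grade ::
  "'g monoid \<Rightarrow> 'g set \<Rightarrow> 'g set \<Rightarrow> 'r set \<Rightarrow> ('r, 'a) module \<Rightarrow> ('g \<Rightarrow> 'a) \<Rightarrow> 'g set \<Rightarrow>
   (('g \<Rightarrow> 'g) \<Rightarrow> 'a set) set" where
  "grade G H P J A \<iota> C = carrier (ext_brauer G P J A \<iota> (carrier A)
     {\<phi> \<in> Aut_quot G H P.
        class_corr G H P (Aut_quot_one G H P #>\<^bsub>Aut_grp G P\<^esub> \<phi>) = C})"

end

theory Submission
  imports Defs
begin

text \<open>
  For \<open>\<phi> \<in> Aut(P)\<close> the group \<open>P\<close> acts on \<open>A\<close> by \<open>m \<mapsto> u\<^sup>-\<^sup>1 m \<phi>(u)\<close>, and this action permutes the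
  components \<open>B \<otimes> z\<close> like \<open>zH \<mapsto> u\<^sup>-\<^sup>1 z \<phi>(u) H\<close>.  The coset \<open>zH\<close> is fixed exactly if \<open>\<phi>\<close> and conjugation
  by \<open>z\<close> agree modulo \<open>H\<close>.  In a fixed element the components along a nontrivial orbit of cosets
  add up to a trace from a proper subgroup (the stabilizer of one of the cosets), so only the
  fixed cosets contribute to \<open>A(\<Delta>\<^sub>\<phi>(P))\<close>; conversely the projection onto a fixed coset
  commutes with the action and hence maps traces to traces.  So \<open>A(\<Delta>\<^sub>\<phi>(P))\<close> is the direct sum of
  the \<open>(B \<otimes> z)(\<Delta>\<^sub>\<phi>(P))\<close> over the fixed cosets, which vanishes for \<open>\<phi> \<notin> K\<close>.  The
  grading by \<open>U/U'\<close> is the grading by \<open>K\<close>, made coarser along \<open>K \<rightarrow> K/K\<^sub>1 \<simeq> U/U'\<close>.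

  All algebras are obtained as images of skew group algebras: \<open>A\<close> is a quotient of \<open>B \<otimes> RG\<close>, and
  the extended Brauer quotient is a quotient of a subalgebra of the group algebra of \<open>Aut(P)\<close>
  over \<open>A\<close>.
\<close>

text \<open>Two gaps have to be bridged. First, A is given by relations, and an additive subgroup
  spanned by relations does not show which elements survive. The coefficients
  \<open>\<Theta> f x\<close> answer this: they vanish exactly on the kernel, so questions about A
  become computations with them. Second, the kernel defining M(\<Delta>) uses only traces of
  elements of M. For M = B \<otimes> z it could a priori be smaller than the part of the kernel for
  A that lies in M, so the map into A(\<Delta>) is not evidently injective. The projection onto a
  fixed coset turns each trace in A into a trace inside B \<otimes> z, and this gives the
  retraction.

  The pairs (\<phi>, g) such that \<phi> agrees with conjugation by g modulo H form a subgroup of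
  Aut(P) x G. Its projections are K and U, its fibres over 1 are K1 and U', so the isomorphism of
  K/K1 with U/U' is an instance of Goursat's lemma. For \<phi> in K1 the fixed cosets are those in
  U', the same for every \<phi>; hence the identity component can be grouped by cosets.\<close>

section \<open>Transport of algebra structures and direct sums\<close>

text \<open>A surjection compatible with the operations carries every module law to its target, so
  no law has to be checked on cosets. The scalars may change along \<rho>, because Brauer quotients
  are modules over \<open>R Quot J\<close> while their representatives form modules over R.\<close>

lemma module_surj:
  assumes M: "module R M" and R': "cring R'" and rho: "\<rho> \<in> ring_hom R R'" "\<rho> ` carrier R = carrier R'"
    and h: "h ` carrier M = carrier N"
    and add: "\<And>x y. x \<in> carrier M \<Longrightarrow> y \<in> carrier M \<Longrightarrow> h (x \<oplus>\<^bsub>M\<^esub> y) = h x \<oplus>\<^bsub>N\<^esub> h y"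
    and zero: "h \<zero>\<^bsub>M\<^esub> = \<zero>\<^bsub>N\<^esub>"
    and smult: "\<And>r x. r \<in> carrier R \<Longrightarrow> x \<in> carrier M \<Longrightarrow> h (r \<odot>\<^bsub>M\<^esub> x) = \<rho> r \<odot>\<^bsub>N\<^esub> h x"
  shows "module R' N"
proof -
  interpret M: module R M by fact
  have surj: "\<exists>x\<in>carrier M. y = h x" if "y \<in> carrier N" for y using h that by auto
  have cl: "h x \<in> carrier N" if "x \<in> carrier M" for x using h that by auto
  have rsurj: "\<exists>x\<in>carrier R. y = \<rho> x" if "y \<in> carrier R'" for y using rho that by auto
  show ?thesis
  proof (rule moduleI[OF R'])
    show "abelian_group N"
    proof (rule abelian_groupI)
      fix x y assume "x \<in> carrier N" "y \<in> carrier N"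
      then show "x \<oplus>\<^bsub>N\<^esub> y \<in> carrier N"
        by (metis surj cl add M.M.add.m_closed)
    next
      show "\<zero>\<^bsub>N\<^esub> \<in> carrier N" using zero cl by (metis M.M.zero_closed)
    next
      fix x y z assume "x \<in> carrier N" "y \<in> carrier N" "z \<in> carrier N"
      then obtain a b c where "a \<in> carrier M" "b \<in> carrier M" "c \<in> carrier M" "x = h a" "y = h b" "z = h c"
        by (metis surj)
      then show "x \<oplus>\<^bsub>N\<^esub> y \<oplus>\<^bsub>N\<^esub> z = x \<oplus>\<^bsub>N\<^esub> (y \<oplus>\<^bsub>N\<^esub> z)"
        by (simp flip: add add: M.M.a_assoc)
    next
      fix x y assume "x \<in> carrier N" "y \<in> carrier N"
      then show "x \<oplus>\<^bsub>N\<^esub> y = y \<oplus>\<^bsub>N\<^esub> x"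
        by (metis surj add M.M.a_comm)
    next
      fix x assume "x \<in> carrier N"
      then show "\<zero>\<^bsub>N\<^esub> \<oplus>\<^bsub>N\<^esub> x = x"
        by (metis surj add zero M.M.l_zero M.M.zero_closed)
    next
      fix x assume "x \<in> carrier N"
      then obtain a where a: "a \<in> carrier M" "x = h a" using surj by blast
      show "\<exists>y\<in>carrier N. y \<oplus>\<^bsub>N\<^esub> x = \<zero>\<^bsub>N\<^esub>"
        by (rule bexI[of _ "h (\<ominus>\<^bsub>M\<^esub> a)"]) (use a cl in \<open>simp_all flip: add zero add: M.M.l_neg\<close>)
    qed
  next
    fix a x assume "a \<in> carrier R'" "x \<in> carrier N"
    then show "a \<odot>\<^bsub>N\<^esub> x \<in> carrier N"
      by (metis surj rsurj cl smult M.smult_closed)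
  next
    fix a b x assume "a \<in> carrier R'" "b \<in> carrier R'" "x \<in> carrier N"
    then obtain r s m where *: "r \<in> carrier R" "s \<in> carrier R" "m \<in> carrier M" "a = \<rho> r" "b = \<rho> s" "x = h m"
      by (metis surj rsurj)
    then show "(a \<oplus>\<^bsub>R'\<^esub> b) \<odot>\<^bsub>N\<^esub> x = a \<odot>\<^bsub>N\<^esub> x \<oplus>\<^bsub>N\<^esub> b \<odot>\<^bsub>N\<^esub> x"
      by (simp flip: add smult ring_hom_add[OF rho(1)] add: M.smult_l_distr)
    from * show "(a \<otimes>\<^bsub>R'\<^esub> b) \<odot>\<^bsub>N\<^esub> x = a \<odot>\<^bsub>N\<^esub> (b \<odot>\<^bsub>N\<^esub> x)"
      by (simp flip: add smult ring_hom_mult[OF rho(1)] add: M.smult_assoc1)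
  next
    fix a x y assume "a \<in> carrier R'" "x \<in> carrier N" "y \<in> carrier N"
    then obtain r s m where "r \<in> carrier R" "s \<in> carrier M" "m \<in> carrier M" "a = \<rho> r" "y = h s" "x = h m"
      by (metis surj rsurj)
    then show "a \<odot>\<^bsub>N\<^esub> (x \<oplus>\<^bsub>N\<^esub> y) = a \<odot>\<^bsub>N\<^esub> x \<oplus>\<^bsub>N\<^esub> a \<odot>\<^bsub>N\<^esub> y"
      by (simp flip: add smult add: M.smult_r_distr)
  next
    fix x assume "x \<in> carrier N"
    then show "\<one>\<^bsub>R'\<^esub> \<odot>\<^bsub>N\<^esub> x = x"
      by (metis surj smult M.smult_one M.R.one_closed ring_hom_one[OF rho(1)])
  qed
qed

text \<open>It yields A from the skew algebra, with \<rho> the identity, and the extended Brauer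
  quotient from families of fixed elements, with \<rho> the reduction modulo J.\<close>

lemma assoc_algebra_surj:
  assumes M: "assoc_algebra R M" and R': "cring R'" and rho: "\<rho> \<in> ring_hom R R'" "\<rho> ` carrier R = carrier R'"
    and h: "h ` carrier M = carrier N"
    and add: "\<And>x y. x \<in> carrier M \<Longrightarrow> y \<in> carrier M \<Longrightarrow> h (x \<oplus>\<^bsub>M\<^esub> y) = h x \<oplus>\<^bsub>N\<^esub> h y"
    and zero: "h \<zero>\<^bsub>M\<^esub> = \<zero>\<^bsub>N\<^esub>"
    and smult: "\<And>r x. r \<in> carrier R \<Longrightarrow> x \<in> carrier M \<Longrightarrow> h (r \<odot>\<^bsub>M\<^esub> x) = \<rho> r \<odot>\<^bsub>N\<^esub> h x"
    and mult: "\<And>x y. x \<in> carrier M \<Longrightarrow> y \<in> carrier M \<Longrightarrow> h (x \<otimes>\<^bsub>M\<^esub> y) = h x \<otimes>\<^bsub>N\<^esub> h y"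
    and one: "h \<one>\<^bsub>M\<^esub> = \<one>\<^bsub>N\<^esub>"
  shows "assoc_algebra R' N"
proof -
  interpret M: assoc_algebra R M by fact
  have surj: "\<exists>x\<in>carrier M. y = h x" if "y \<in> carrier N" for y using h that by auto
  have cl: "h x \<in> carrier N" if "x \<in> carrier M" for x using h that by auto
  have rsurj: "\<exists>x\<in>carrier R. y = \<rho> x" if "y \<in> carrier R'" for y using rho that by auto
  have mod: "module R' N" by (rule module_surj[OF M.module_axioms R' rho h add zero smult])
  then interpret N: module R' N .
  have "ring N"
  proof (rule ringI[OF N.M.abelian_group_axioms])
    show "Group.monoid N"
    proof (rule monoidI)
      fix x y assume "x \<in> carrier N" "y \<in> carrier N"
      then show "x \<otimes>\<^bsub>N\<^esub> y \<in> carrier N"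
        by (metis surj cl mult M.m_closed)
    next
      show "\<one>\<^bsub>N\<^esub> \<in> carrier N" using one cl by (metis M.one_closed)
    next
      fix x y z assume "x \<in> carrier N" "y \<in> carrier N" "z \<in> carrier N"
      then obtain a b c where "a \<in> carrier M" "b \<in> carrier M" "c \<in> carrier M" "x = h a" "y = h b" "z = h c"
        by (metis surj)
      then show "x \<otimes>\<^bsub>N\<^esub> y \<otimes>\<^bsub>N\<^esub> z = x \<otimes>\<^bsub>N\<^esub> (y \<otimes>\<^bsub>N\<^esub> z)"
        by (simp flip: mult add: M.m_assoc)
    next
      fix x assume "x \<in> carrier N"
      then show "\<one>\<^bsub>N\<^esub> \<otimes>\<^bsub>N\<^esub> x = x" "x \<otimes>\<^bsub>N\<^esub> \<one>\<^bsub>N\<^esub> = x"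
        by (metis surj mult one M.l_one M.one_closed, metis surj mult one M.r_one \<open>x \<in> carrier N\<close> M.one_closed)
    qed
  next
    fix x y z assume "x \<in> carrier N" "y \<in> carrier N" "z \<in> carrier N"
    then obtain a b c where *: "a \<in> carrier M" "b \<in> carrier M" "c \<in> carrier M" "x = h a" "y = h b" "z = h c"
      by (metis surj)
    then show "(x \<oplus>\<^bsub>N\<^esub> y) \<otimes>\<^bsub>N\<^esub> z = x \<otimes>\<^bsub>N\<^esub> z \<oplus>\<^bsub>N\<^esub> y \<otimes>\<^bsub>N\<^esub> z"
      by (simp flip: mult add add: M.l_distr)
    from * show "z \<otimes>\<^bsub>N\<^esub> (x \<oplus>\<^bsub>N\<^esub> y) = z \<otimes>\<^bsub>N\<^esub> x \<oplus>\<^bsub>N\<^esub> z \<otimes>\<^bsub>N\<^esub> y"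
      by (simp flip: mult add add: M.r_distr)
  qed
  moreover have "assoc_algebra_axioms R' N"
  proof
    fix a x y assume "a \<in> carrier R'" "x \<in> carrier N" "y \<in> carrier N"
    then obtain r s m where *: "r \<in> carrier R" "s \<in> carrier M" "m \<in> carrier M" "a = \<rho> r" "y = h s" "x = h m"
      by (metis surj rsurj)
    then show "a \<odot>\<^bsub>N\<^esub> x \<otimes>\<^bsub>N\<^esub> y = a \<odot>\<^bsub>N\<^esub> (x \<otimes>\<^bsub>N\<^esub> y)"
      by (simp flip: mult smult add: M.smult_mult_left)
    from * show "x \<otimes>\<^bsub>N\<^esub> (a \<odot>\<^bsub>N\<^esub> y) = a \<odot>\<^bsub>N\<^esub> (x \<otimes>\<^bsub>N\<^esub> y)"
      by (simp flip: mult smult add: M.smult_mult_right)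
  qed
  ultimately show ?thesis using mod by (intro assoc_algebra.intro)
qed

lemma assoc_algebra_sub:
  assumes M: "assoc_algebra R M" and T: "submodule T R M" and one: "\<one>\<^bsub>M\<^esub> \<in> T"
    and mult: "\<And>x y. x \<in> T \<Longrightarrow> y \<in> T \<Longrightarrow> x \<otimes>\<^bsub>M\<^esub> y \<in> T"
  shows "assoc_algebra R (M\<lparr>carrier := T\<rparr>)"
proof -
  interpret M: assoc_algebra R M by fact
  have mod: "module R (M\<lparr>carrier := T\<rparr>)" using T M.module_axioms by (rule submodule.submodule_is_module)
  have sub: "T \<subseteq> carrier M" using M.submoduleE(1)[OF T] .
  interpret N: module R "M\<lparr>carrier := T\<rparr>" by fact
  have "ring (M\<lparr>carrier := T\<rparr>)"
    by (rule ringI[OF N.M.abelian_group_axioms])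
       (use sub one mult in \<open>auto intro!: monoidI simp: M.m_assoc M.l_distr M.r_distr subset_iff\<close>)
  moreover have "assoc_algebra_axioms R (M\<lparr>carrier := T\<rparr>)"
    by standard (use sub in \<open>auto simp: M.smult_mult_left M.smult_mult_right subset_iff\<close>)
  ultimately show ?thesis using mod by (intro assoc_algebra.intro)
qed

text \<open>Additivity is required only on a submonoid T because the class of an element lies in the
  Brauer quotient only if the element is fixed. With h the identity, the first conclusion is closure
  of T under finite sums.\<close>

lemma finsum_hom:
  assumes M: "abelian_monoid M" and N: "abelian_monoid N" and T: "T \<subseteq> carrier M" and zT: "\<zero>\<^bsub>M\<^esub> \<in> T"
    and aT: "\<And>x y. x \<in> T \<Longrightarrow> y \<in> T \<Longrightarrow> x \<oplus>\<^bsub>M\<^esub> y \<in> T"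
    and h: "\<And>x. x \<in> T \<Longrightarrow> h x \<in> carrier N"
    and add: "\<And>x y. x \<in> T \<Longrightarrow> y \<in> T \<Longrightarrow> h (x \<oplus>\<^bsub>M\<^esub> y) = h x \<oplus>\<^bsub>N\<^esub> h y"
    and zero: "h \<zero>\<^bsub>M\<^esub> = \<zero>\<^bsub>N\<^esub>"
    and I: "finite I" and f: "\<And>i. i \<in> I \<Longrightarrow> f i \<in> T"
  shows "finsum M f I \<in> T" and "h (finsum M f I) = (\<Oplus>\<^bsub>N\<^esub>i\<in>I. h (f i))"
proof -
  interpret M: abelian_monoid M by fact
  interpret N: abelian_monoid N by fact
  have "finsum M f I \<in> T \<and> h (finsum M f I) = (\<Oplus>\<^bsub>N\<^esub>i\<in>I. h (f i))"
    using I f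
  proof (induct I)
    case empty then show ?case by (simp add: zT zero)
  next
    case (insert i I)
    then have "f \<in> I \<rightarrow> carrier M" "f i \<in> carrier M" "(\<lambda>i. h (f i)) \<in> I \<rightarrow> carrier N" "h (f i) \<in> carrier N"
      using T h by auto
    with insert show ?case by (simp add: aT add)
  qed
  then show "finsum M f I \<in> T" "h (finsum M f I) = (\<Oplus>\<^bsub>N\<^esub>i\<in>I. h (f i))" by auto
qed

lemma finsum_single:
  assumes "abelian_monoid N" "finite I" "i \<in> I" "x \<in> carrier N"
  shows "(\<Oplus>\<^bsub>N\<^esub>k\<in>I. if k = i then x else \<zero>\<^bsub>N\<^esub>) = x"
proof -
  interpret N: abelian_monoid N by fact
  show ?thesis
    using N.add.finprod_singleton[of i I "\<lambda>_. x"] assms by (simp add: eq_commute[of i])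
qed

text \<open>The maps q are coordinates for the insertions j: q i after j k is the identity or zero,
  and the composites j i after q i sum to the identity. Together they form the inverse of the
  summation map. Linearity is demanded of j, additivity of q.\<close>

lemma is_direct_sumI:
  assumes I: "finite I" and N: "module R N" and V: "\<And>i. i \<in> I \<Longrightarrow> module R (V i)"
    and j: "\<And>i. i \<in> I \<Longrightarrow> j i \<in> lin_map R (V i) N"
    and q: "\<And>i n. i \<in> I \<Longrightarrow> n \<in> carrier N \<Longrightarrow> q i n \<in> carrier (V i)"
    and qadd: "\<And>i m n. i \<in> I \<Longrightarrow> m \<in> carrier N \<Longrightarrow> n \<in> carrier N \<Longrightarrow> q i (m \<oplus>\<^bsub>N\<^esub> n) = q i m \<oplus>\<^bsub>V i\<^esub> q i n"
    and qj: "\<And>i x. i \<in> I \<Longrightarrow> x \<in> carrier (V i) \<Longrightarrow> q i (j i x) = x"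
    and qj0: "\<And>i k x. i \<in> I \<Longrightarrow> k \<in> I \<Longrightarrow> i \<noteq> k \<Longrightarrow> x \<in> carrier (V k) \<Longrightarrow> q i (j k x) = \<zero>\<^bsub>V i\<^esub>"
    and sum: "\<And>n. n \<in> carrier N \<Longrightarrow> (\<Oplus>\<^bsub>N\<^esub>i\<in>I. j i (q i n)) = n"
  shows "is_direct_sum R I V j N"
proof -
  interpret N: module R N by fact
  have jc: "j i x \<in> carrier N" if "i \<in> I" "x \<in> carrier (V i)" for i x
    using j[OF that(1)] that(2) by (auto simp: lin_map_def)
  have q0: "q i \<zero>\<^bsub>N\<^esub> = \<zero>\<^bsub>V i\<^esub>" if "i \<in> I" for i
  proof -
    interpret V: module R "V i" using V that .
    show ?thesis using qadd[OF that N.M.zero_closed N.M.zero_closed] q[OF that N.M.zero_closed]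
      by (metis N.M.l_zero N.M.zero_closed V.M.add.r_cancel_one')
  qed
  have proj: "q i (\<Oplus>\<^bsub>N\<^esub>k\<in>I. j k (f k)) = f i" if f: "f \<in> (\<Pi>\<^sub>E i\<in>I. carrier (V i))" and i: "i \<in> I" for f i
  proof -
    interpret V: module R "V i" using V i .
    have fk: "f k \<in> carrier (V k)" if "k \<in> I" for k using f that by (rule PiE_mem)
    have "q i (\<Oplus>\<^bsub>N\<^esub>k\<in>I. j k (f k)) = (\<Oplus>\<^bsub>V i\<^esub>k\<in>I. q i (j k (f k)))"
      by (rule finsum_hom(2)[where T="carrier N"])
         (use i f I q qadd q0 jc in \<open>auto simp: PiE_def Pi_def N.M.abelian_monoid_axioms V.M.abelian_monoid_axioms\<close>)
    also have "\<dots> = (\<Oplus>\<^bsub>V i\<^esub>k\<in>I. if k = i then f i else \<zero>\<^bsub>V i\<^esub>)"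
      by (rule V.M.finsum_cong') (use fk i qj qj0 in auto)
    also have "\<dots> = f i" by (rule finsum_single) (use f i I in \<open>auto simp: V.M.abelian_monoid_axioms\<close>)
    finally show ?thesis .
  qed
  have "bij_betw (\<lambda>f. \<Oplus>\<^bsub>N\<^esub>i\<in>I. j i (f i)) (\<Pi>\<^sub>E i\<in>I. carrier (V i)) (carrier N)"
  proof (rule bij_betw_byWitness[where f'="\<lambda>n. \<lambda>i\<in>I. q i n"])
    show "\<forall>f\<in>\<Pi>\<^sub>E i\<in>I. carrier (V i). (\<lambda>i\<in>I. q i (\<Oplus>\<^bsub>N\<^esub>i\<in>I. j i (f i))) = f"
      by (auto simp: proj fun_eq_iff PiE_def extensional_def)
    show "\<forall>n\<in>carrier N. (\<Oplus>\<^bsub>N\<^esub>i\<in>I. j i ((\<lambda>i\<in>I. q i n) i)) = n"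
    proof
      fix n assume n: "n \<in> carrier N"
      have "(\<Oplus>\<^bsub>N\<^esub>i\<in>I. j i ((\<lambda>i\<in>I. q i n) i)) = (\<Oplus>\<^bsub>N\<^esub>i\<in>I. j i (q i n))"
        by (rule N.M.finsum_cong') (use n jc q in auto)
      then show "(\<Oplus>\<^bsub>N\<^esub>i\<in>I. j i ((\<lambda>i\<in>I. q i n) i)) = n" using sum[OF n] by simp
    qed
    show "(\<lambda>f. \<Oplus>\<^bsub>N\<^esub>i\<in>I. j i (f i)) ` (\<Pi>\<^sub>E i\<in>I. carrier (V i)) \<subseteq> carrier N"
      by (auto intro!: N.M.finsum_closed jc)
    show "(\<lambda>n. \<lambda>i\<in>I. q i n) ` carrier N \<subseteq> (\<Pi>\<^sub>E i\<in>I. carrier (V i))"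
      using q by auto
  qed
  then show ?thesis using assms by (auto simp: is_direct_sum_def)
qed

section \<open>Skew group algebras\<close>

lemma (in abelian_monoid) finsum_swap:
  assumes "finite A" "finite B" and f: "\<And>x y. x \<in> A \<Longrightarrow> y \<in> B \<Longrightarrow> f x y \<in> carrier G"
  shows "(\<Oplus>x\<in>A. \<Oplus>y\<in>B. f x y) = (\<Oplus>y\<in>B. \<Oplus>x\<in>A. f x y)"
  using assms(1) f
proof (induct A)
  case empty
  then show ?case by simp
next
  case (insert a A)
  have "(\<Oplus>y\<in>B. f a y \<oplus> (\<Oplus>x\<in>A. f x y)) = (\<Oplus>y\<in>B. f a y) \<oplus> (\<Oplus>y\<in>B. \<Oplus>x\<in>A. f x y)"
    using insert by (intro finsum_addf) auto
  moreover have "(\<Oplus>y\<in>B. \<Oplus>x\<in>insert a A. f x y) = (\<Oplus>y\<in>B. f a y \<oplus> (\<Oplus>x\<in>A. f x y))"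
    using insert by (intro finsum_cong') auto
  ultimately show ?case
    using insert by simp
qed

lemma (in abelian_monoid) finsum_split_add:
  assumes "\<And>i. i \<in> I \<Longrightarrow> f i = g i \<oplus> h i" "\<And>i. i \<in> I \<Longrightarrow> g i \<in> carrier G" "\<And>i. i \<in> I \<Longrightarrow> h i \<in> carrier G"
  shows "(\<Oplus>i\<in>I. f i) = (\<Oplus>i\<in>I. g i) \<oplus> (\<Oplus>i\<in>I. h i)"
  using finsum_cong'[of I I "\<lambda>i. g i \<oplus> h i" f] finsum_addf[of g I h] assms by auto

lemma (in abelian_monoid) finsum_bij:
  assumes "bij_betw h A B" and "\<And>x. x \<in> B \<Longrightarrow> f x \<in> carrier G"
  shows "(\<Oplus>x\<in>B. f x) = (\<Oplus>x\<in>A. f (h x))"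
  using assms finsum_reindex[of f h A] by (auto simp: bij_betw_def)

lemma (in group) bij_mult_left: "k \<in> carrier G \<Longrightarrow> bij_betw (\<lambda>g. k \<otimes> g) (carrier G) (carrier G)"
  by (rule bij_betw_byWitness[where f'="\<lambda>g. inv k \<otimes> g"]) (auto simp: m_assoc[symmetric])

lemma (in group) inv_mult_cancel_left [simp]:
  "g \<in> carrier G \<Longrightarrow> x \<in> carrier G \<Longrightarrow> inv g \<otimes> (g \<otimes> x) = x"
  "g \<in> carrier G \<Longrightarrow> x \<in> carrier G \<Longrightarrow> g \<otimes> (inv g \<otimes> x) = x"
  by (simp_all add: m_assoc[symmetric])

text \<open>Three instances occur: B with its given action, the coefficient ring with trivial
  action, and A with the trivial action of Aut(P). The skew algebra is then B \<otimes> RG, an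
  ordinary group algebra, and the algebra of A-valued families on Aut(P), respectively.\<close>

locale G_algebra = G: group G + B: assoc_algebra R B
  for G :: "'g monoid" and R :: "('r, 'n) ring_scheme" and B :: "('r, 'b) module" +
  fixes act :: "'b \<Rightarrow> 'g \<Rightarrow> 'b"
  assumes finite_group: "finite (carrier G)"
    and act_hom: "g \<in> carrier G \<Longrightarrow> (\<lambda>b. act b g) \<in> alg_hom R B B"
    and act_one: "b \<in> carrier B \<Longrightarrow> act b \<one>\<^bsub>G\<^esub> = b"
    and act_mult: "\<lbrakk>b \<in> carrier B; g \<in> carrier G; g' \<in> carrier G\<rbrakk> \<Longrightarrow>
          act (act b g) g' = act b (g \<otimes>\<^bsub>G\<^esub> g')"
begin

lemma act_closed [simp]: "b \<in> carrier B \<Longrightarrow> g \<in> carrier G \<Longrightarrow> act b g \<in> carrier B"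
  and act_add: "b \<in> carrier B \<Longrightarrow> c \<in> carrier B \<Longrightarrow> g \<in> carrier G \<Longrightarrow> act (b \<oplus>\<^bsub>B\<^esub> c) g = act b g \<oplus>\<^bsub>B\<^esub> act c g"
  and act_prod: "b \<in> carrier B \<Longrightarrow> c \<in> carrier B \<Longrightarrow> g \<in> carrier G \<Longrightarrow> act (b \<otimes>\<^bsub>B\<^esub> c) g = act b g \<otimes>\<^bsub>B\<^esub> act c g"
  and act_unit [simp]: "g \<in> carrier G \<Longrightarrow> act \<one>\<^bsub>B\<^esub> g = \<one>\<^bsub>B\<^esub>"
  and act_smult: "r \<in> carrier R \<Longrightarrow> b \<in> carrier B \<Longrightarrow> g \<in> carrier G \<Longrightarrow> act (r \<odot>\<^bsub>B\<^esub> b) g = r \<odot>\<^bsub>B\<^esub> act b g"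
  using act_hom[of g] by (auto simp: alg_hom_def lin_map_def ring_hom_def Pi_def)

lemma act_zero [simp]: assumes "g \<in> carrier G" shows "act \<zero>\<^bsub>B\<^esub> g = \<zero>\<^bsub>B\<^esub>"
  using act_add[of "\<zero>\<^bsub>B\<^esub>" "\<zero>\<^bsub>B\<^esub>" g] assms
  by (metis B.add.r_cancel_one' B.l_zero B.zero_closed act_closed)

lemma act_finsum:
  assumes "g \<in> carrier G" "finite I" "\<And>i. i \<in> I \<Longrightarrow> f i \<in> carrier B"
  shows "act (\<Oplus>\<^bsub>B\<^esub>i\<in>I. f i) g = (\<Oplus>\<^bsub>B\<^esub>i\<in>I. act (f i) g)"
  by (rule finsum_hom(2)[where T="carrier B"])
     (use assms act_add B.abelian_monoid_axioms in auto)

section \<open>The convolution algebra of families indexed by the group\<close>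

abbreviation "S \<equiv> skew_algebra G B act"

lemma carrier_skew: "f \<in> carrier S \<longleftrightarrow> f \<in> carrier G \<rightarrow>\<^sub>E carrier B"
  by (simp add: skew_algebra_def)

lemma skew_closed [simp, intro]: "f \<in> carrier S \<Longrightarrow> g \<in> carrier G \<Longrightarrow> f g \<in> carrier B"
  by (auto simp: carrier_skew)

lemma skewI: "(\<And>g. g \<in> carrier G \<Longrightarrow> f g \<in> carrier B) \<Longrightarrow> restrict f (carrier G) \<in> carrier S"
  by (auto simp: carrier_skew)

lemma skew_eqI:
  "f \<in> carrier S \<Longrightarrow> f' \<in> carrier S \<Longrightarrow> (\<And>g. g \<in> carrier G \<Longrightarrow> f g = f' g) \<Longrightarrow> f = f'"
  by (auto simp: carrier_skew intro: PiE_ext)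

lemma skew_add: "f \<oplus>\<^bsub>S\<^esub> f' = (\<lambda>x\<in>carrier G. f x \<oplus>\<^bsub>B\<^esub> f' x)"
  and skew_smult: "r \<odot>\<^bsub>S\<^esub> f = (\<lambda>x\<in>carrier G. r \<odot>\<^bsub>B\<^esub> f x)"
  and skew_zero: "\<zero>\<^bsub>S\<^esub> = (\<lambda>x\<in>carrier G. \<zero>\<^bsub>B\<^esub>)"
  and skew_one: "\<one>\<^bsub>S\<^esub> = (\<lambda>x\<in>carrier G. if x = \<one>\<^bsub>G\<^esub> then \<one>\<^bsub>B\<^esub> else \<zero>\<^bsub>B\<^esub>)"
  and skew_mult: "f \<otimes>\<^bsub>S\<^esub> f' = (\<lambda>x\<in>carrier G. \<Oplus>\<^bsub>B\<^esub>g\<in>carrier G.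
               f g \<otimes>\<^bsub>B\<^esub> act (f' (inv\<^bsub>G\<^esub> g \<otimes>\<^bsub>G\<^esub> x)) (inv\<^bsub>G\<^esub> g))"
  by (simp_all add: skew_algebra_def)

lemma skew_mult_closed: "f \<in> carrier S \<Longrightarrow> f' \<in> carrier S \<Longrightarrow> f \<otimes>\<^bsub>S\<^esub> f' \<in> carrier S"
  unfolding skew_mult by (intro skewI B.finsum_closed) auto

text \<open>Both sides sum the same terms over the factorizations of x into three factors. For a
  fixed first factor k the substitution g = ks turns one enumeration into the other.\<close>

lemma skew_assoc:
  assumes f: "f \<in> carrier S" "f' \<in> carrier S" "f'' \<in> carrier S"
  shows "f \<otimes>\<^bsub>S\<^esub> f' \<otimes>\<^bsub>S\<^esub> f'' = f \<otimes>\<^bsub>S\<^esub> (f' \<otimes>\<^bsub>S\<^esub> f'')"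
proof (rule skew_eqI)
  fix x assume x: "x \<in> carrier G"
  let ?t = "\<lambda>g k. f k \<otimes>\<^bsub>B\<^esub> act (f' (inv\<^bsub>G\<^esub> k \<otimes>\<^bsub>G\<^esub> g)) (inv\<^bsub>G\<^esub> k) \<otimes>\<^bsub>B\<^esub> act (f'' (inv\<^bsub>G\<^esub> g \<otimes>\<^bsub>G\<^esub> x)) (inv\<^bsub>G\<^esub> g)"
  have "(f \<otimes>\<^bsub>S\<^esub> f' \<otimes>\<^bsub>S\<^esub> f'') x = (\<Oplus>\<^bsub>B\<^esub>g\<in>carrier G. \<Oplus>\<^bsub>B\<^esub>k\<in>carrier G. ?t g k)"
    unfolding skew_mult using x f finite_group
    by (auto intro!: B.finsum_cong' B.finsum_closed B.finsum_ldistr)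
  also have "\<dots> = (\<Oplus>\<^bsub>B\<^esub>k\<in>carrier G. \<Oplus>\<^bsub>B\<^esub>g\<in>carrier G. ?t g k)"
    using x f finite_group by (intro B.finsum_swap) auto
  also have "\<dots> = (\<Oplus>\<^bsub>B\<^esub>k\<in>carrier G. \<Oplus>\<^bsub>B\<^esub>s\<in>carrier G. ?t (k \<otimes>\<^bsub>G\<^esub> s) k)"
    using x f finite_group
    by (intro B.finsum_cong' B.finsum_bij[OF G.bij_mult_left] refl) (auto intro!: B.finsum_closed)
  also have "\<dots> = (\<Oplus>\<^bsub>B\<^esub>k\<in>carrier G. f k \<otimes>\<^bsub>B\<^esub> (\<Oplus>\<^bsub>B\<^esub>s\<in>carrier G. act (f' s \<otimes>\<^bsub>B\<^esub>
      act (f'' (inv\<^bsub>G\<^esub> s \<otimes>\<^bsub>G\<^esub> (inv\<^bsub>G\<^esub> k \<otimes>\<^bsub>G\<^esub> x))) (inv\<^bsub>G\<^esub> s)) (inv\<^bsub>G\<^esub> k)))"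
  proof (intro B.finsum_cong' refl)
    fix k assume k: "k \<in> carrier G"
    show "(\<Oplus>\<^bsub>B\<^esub>s\<in>carrier G. ?t (k \<otimes>\<^bsub>G\<^esub> s) k) = f k \<otimes>\<^bsub>B\<^esub> (\<Oplus>\<^bsub>B\<^esub>s\<in>carrier G. act (f' s \<otimes>\<^bsub>B\<^esub>
      act (f'' (inv\<^bsub>G\<^esub> s \<otimes>\<^bsub>G\<^esub> (inv\<^bsub>G\<^esub> k \<otimes>\<^bsub>G\<^esub> x))) (inv\<^bsub>G\<^esub> s)) (inv\<^bsub>G\<^esub> k))"
      using x f k finite_group
      by (subst B.finsum_rdistr)
         (auto intro!: B.finsum_cong' simp: act_prod act_mult B.m_assoc G.inv_mult_group G.m_assoc)
  qed (use x f in \<open>auto intro!: B.finsum_closed\<close>)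
  also have "\<dots> = (f \<otimes>\<^bsub>S\<^esub> (f' \<otimes>\<^bsub>S\<^esub> f'')) x"
    unfolding skew_mult using x f finite_group
    by (auto intro!: B.finsum_cong' B.finsum_closed simp: act_finsum)
  finally show "(f \<otimes>\<^bsub>S\<^esub> f' \<otimes>\<^bsub>S\<^esub> f'') x = (f \<otimes>\<^bsub>S\<^esub> (f' \<otimes>\<^bsub>S\<^esub> f'')) x" .
qed (use f in \<open>auto intro!: skew_mult_closed\<close>)

lemma finsum_delta:
  assumes "i \<in> carrier G" "x \<in> carrier B" "\<And>k. k \<in> carrier G \<Longrightarrow> F k = (if k = i then x else \<zero>\<^bsub>B\<^esub>)"
  shows "(\<Oplus>\<^bsub>B\<^esub>k\<in>carrier G. F k) = x"
proof -
  have "(\<Oplus>\<^bsub>B\<^esub>k\<in>carrier G. F k) = (\<Oplus>\<^bsub>B\<^esub>k\<in>carrier G. if k = i then x else \<zero>\<^bsub>B\<^esub>)"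
    using assms by (intro B.finsum_cong') auto
  then show ?thesis using finsum_single[OF B.abelian_monoid_axioms finite_group] assms by simp
qed

text \<open>The pure tensor b \<otimes> g.\<close>

definition single :: "'g \<Rightarrow> 'b \<Rightarrow> 'g \<Rightarrow> 'b" where
  "single g b = (\<lambda>x\<in>carrier G. if x = g then b else \<zero>\<^bsub>B\<^esub>)"

lemma single_closed [simp]: "b \<in> carrier B \<Longrightarrow> single g b \<in> carrier S"
  by (auto simp: single_def carrier_skew)

lemma skew_one_single: "\<one>\<^bsub>S\<^esub> = single \<one>\<^bsub>G\<^esub> \<one>\<^bsub>B\<^esub>"
  by (simp add: skew_one single_def)

lemma single_mult_apply:
  assumes "g \<in> carrier G" "b \<in> carrier B" "f \<in> carrier S" "x \<in> carrier G"
  shows "(single g b \<otimes>\<^bsub>S\<^esub> f) x = b \<otimes>\<^bsub>B\<^esub> act (f (inv\<^bsub>G\<^esub> g \<otimes>\<^bsub>G\<^esub> x)) (inv\<^bsub>G\<^esub> g)"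
  unfolding skew_mult using assms
  by (auto simp: single_def intro!: finsum_delta[where i=g])

lemma mult_single_apply:
  assumes "g \<in> carrier G" "b \<in> carrier B" "f \<in> carrier S" "x \<in> carrier G"
  shows "(f \<otimes>\<^bsub>S\<^esub> single g b) x = f (x \<otimes>\<^bsub>G\<^esub> inv\<^bsub>G\<^esub> g) \<otimes>\<^bsub>B\<^esub> act b (g \<otimes>\<^bsub>G\<^esub> inv\<^bsub>G\<^esub> x)"
proof -
  have "inv\<^bsub>G\<^esub> k \<otimes>\<^bsub>G\<^esub> x = g \<longleftrightarrow> k = x \<otimes>\<^bsub>G\<^esub> inv\<^bsub>G\<^esub> g" if "k \<in> carrier G" for k
    using assms that by (metis G.inv_closed G.inv_solve_left G.inv_solve_right' G.inv_inv)
  with assms show ?thesis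
    unfolding skew_mult
    by (auto simp: single_def G.inv_mult_group intro!: finsum_delta[where i="x \<otimes>\<^bsub>G\<^esub> inv\<^bsub>G\<^esub> g"])
qed

lemma single_mult_single:
  assumes "g \<in> carrier G" "g' \<in> carrier G" "b \<in> carrier B" "b' \<in> carrier B"
  shows "single g b \<otimes>\<^bsub>S\<^esub> single g' b' = single (g \<otimes>\<^bsub>G\<^esub> g') (b \<otimes>\<^bsub>B\<^esub> act b' (inv\<^bsub>G\<^esub> g))"
proof (rule skew_eqI)
  fix x assume x: "x \<in> carrier G"
  have "inv\<^bsub>G\<^esub> g \<otimes>\<^bsub>G\<^esub> x = g' \<longleftrightarrow> x = g \<otimes>\<^bsub>G\<^esub> g'"
    using assms x by (metis G.inv_mult_cancel_left)
  then show "(single g b \<otimes>\<^bsub>S\<^esub> single g' b') x = single (g \<otimes>\<^bsub>G\<^esub> g') (b \<otimes>\<^bsub>B\<^esub> act b' (inv\<^bsub>G\<^esub> g)) x"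
    using assms x by (auto simp: single_mult_apply) (auto simp: single_def)
qed (use assms in \<open>auto intro!: skew_mult_closed\<close>)

lemma skew_module: "module R S"
proof (rule moduleI)
  show "abelian_group S"
  proof (rule abelian_groupI)
    fix x y z assume "x \<in> carrier S" "y \<in> carrier S" "z \<in> carrier S"
    then show "x \<oplus>\<^bsub>S\<^esub> y \<oplus>\<^bsub>S\<^esub> z = x \<oplus>\<^bsub>S\<^esub> (y \<oplus>\<^bsub>S\<^esub> z)"
      unfolding skew_add by (auto intro!: restrict_ext simp: B.a_assoc)
  next
    fix x y assume "x \<in> carrier S" "y \<in> carrier S"
    then show "x \<oplus>\<^bsub>S\<^esub> y = y \<oplus>\<^bsub>S\<^esub> x"
      unfolding skew_add by (auto intro!: restrict_ext simp: B.a_comm)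
  next
    fix x assume x: "x \<in> carrier S"
    then show "\<zero>\<^bsub>S\<^esub> \<oplus>\<^bsub>S\<^esub> x = x"
      unfolding skew_add skew_zero by (intro skew_eqI skewI) auto
    show "\<exists>y\<in>carrier S. y \<oplus>\<^bsub>S\<^esub> x = \<zero>\<^bsub>S\<^esub>"
      using x unfolding skew_add skew_zero
      by (intro bexI[of _ "\<lambda>g\<in>carrier G. \<ominus>\<^bsub>B\<^esub> x g"] skewI) (auto simp: B.l_neg intro!: restrict_ext)
  qed (auto simp: skew_add skew_zero intro!: skewI)
qed (auto simp: skew_add skew_smult B.smult_l_distr B.smult_r_distr B.smult_assoc1 B.R.is_cring
      intro!: restrict_ext skewI skew_eqI[OF skewI])

lemma skew_assoc_algebra: "assoc_algebra R S"
proof (intro assoc_algebra.intro skew_module ringI)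
  interpret S: module R S by (rule skew_module)
  show "abelian_group S" by (rule S.M.abelian_group_axioms)
  show "Group.monoid S"
  proof (rule monoidI)
    fix x assume x: "x \<in> carrier S"
    show "\<one>\<^bsub>S\<^esub> \<otimes>\<^bsub>S\<^esub> x = x" unfolding skew_one_single
      using x by (intro skew_eqI) (auto simp: single_mult_apply skew_mult_closed act_one)
    show "x \<otimes>\<^bsub>S\<^esub> \<one>\<^bsub>S\<^esub> = x" unfolding skew_one_single
      using x by (intro skew_eqI) (auto simp: mult_single_apply skew_mult_closed act_one)
  qed (auto simp: skew_one_single skew_assoc intro: skew_mult_closed)
  fix x y z assume c: "x \<in> carrier S" "y \<in> carrier S" "z \<in> carrier S"
  then show "(x \<oplus>\<^bsub>S\<^esub> y) \<otimes>\<^bsub>S\<^esub> z = x \<otimes>\<^bsub>S\<^esub> z \<oplus>\<^bsub>S\<^esub> y \<otimes>\<^bsub>S\<^esub> z"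
    unfolding skew_add skew_mult
    by (auto simp: B.l_distr intro!: restrict_ext B.finsum_split_add)
  from c show "z \<otimes>\<^bsub>S\<^esub> (x \<oplus>\<^bsub>S\<^esub> y) = z \<otimes>\<^bsub>S\<^esub> x \<oplus>\<^bsub>S\<^esub> z \<otimes>\<^bsub>S\<^esub> y"
    unfolding skew_add skew_mult
    by (auto simp: B.r_distr act_add intro!: restrict_ext B.finsum_split_add)
next
  show "assoc_algebra_axioms R S"
  proof
    fix a x y assume c: "a \<in> carrier R" "x \<in> carrier S" "y \<in> carrier S"
    then show "a \<odot>\<^bsub>S\<^esub> x \<otimes>\<^bsub>S\<^esub> y = a \<odot>\<^bsub>S\<^esub> (x \<otimes>\<^bsub>S\<^esub> y)"
      unfolding skew_smult skew_mult using finite_group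
      by (auto intro!: restrict_ext B.finsum_cong' simp: B.finsum_smult_ldistr B.smult_mult_left)
    from c show "x \<otimes>\<^bsub>S\<^esub> (a \<odot>\<^bsub>S\<^esub> y) = a \<odot>\<^bsub>S\<^esub> (x \<otimes>\<^bsub>S\<^esub> y)"
      unfolding skew_smult skew_mult using finite_group
      by (auto intro!: restrict_ext B.finsum_cong' simp: B.finsum_smult_ldistr B.smult_mult_right act_smult)
  qed
qed

sublocale S: assoc_algebra R S by (rule skew_assoc_algebra)

lemma skew_finsum_apply:
  assumes "finite I" "\<And>i. i \<in> I \<Longrightarrow> f i \<in> carrier S" "x \<in> carrier G"
  shows "(\<Oplus>\<^bsub>S\<^esub>i\<in>I. f i) x = (\<Oplus>\<^bsub>B\<^esub>i\<in>I. f i x)"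
proof (rule finsum_hom(2)[where T="carrier S" and h="\<lambda>f. f x"])
  show "(f \<oplus>\<^bsub>S\<^esub> f') x = f x \<oplus>\<^bsub>B\<^esub> f' x" for f f' using assms by (simp add: skew_add)
  show "\<zero>\<^bsub>S\<^esub> x = \<zero>\<^bsub>B\<^esub>" using assms by (simp add: skew_zero)
qed (use assms B.abelian_monoid_axioms S.abelian_monoid_axioms in auto)

lemma skew_minus_apply:
  assumes "f \<in> carrier S" "x \<in> carrier G"
  shows "(\<ominus>\<^bsub>S\<^esub> f) x = \<ominus>\<^bsub>B\<^esub> f x"
proof (rule B.minus_equality[symmetric])
  have "(\<ominus>\<^bsub>S\<^esub> f \<oplus>\<^bsub>S\<^esub> f) x = \<zero>\<^bsub>B\<^esub>" using assms by (simp add: S.l_neg skew_zero)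
  then show "(\<ominus>\<^bsub>S\<^esub> f) x \<oplus>\<^bsub>B\<^esub> f x = \<zero>\<^bsub>B\<^esub>" using assms by (simp add: skew_add)
qed (use assms in auto)

text \<open>The expansion into pure tensors; it serves linear maps on group algebras and the
  rewriting of an element modulo the balancing relations.\<close>

lemma skew_sum_singles:
  assumes "f \<in> carrier S"
  shows "f = (\<Oplus>\<^bsub>S\<^esub>g\<in>carrier G. single g (f g))"
proof (rule skew_eqI)
  fix x assume x: "x \<in> carrier G"
  then have "(\<Oplus>\<^bsub>S\<^esub>g\<in>carrier G. single g (f g)) x = (\<Oplus>\<^bsub>B\<^esub>g\<in>carrier G. single g (f g) x)"
    using assms by (intro skew_finsum_apply finite_group) auto
  also have "\<dots> = f x" using x assms by (intro finsum_delta[where i=x]) (auto simp: single_def)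
  finally show "f x = (\<Oplus>\<^bsub>S\<^esub>g\<in>carrier G. single g (f g)) x" by simp
qed (use assms in \<open>auto intro!: S.finsum_closed\<close>)

end

lemma G_algebra_trivial:
  assumes "group G" "assoc_algebra R B" "finite (carrier G)"
  shows "G_algebra G R B (\<lambda>b g. b)"
  using assms by (auto simp: G_algebra_def G_algebra_axioms_def alg_hom_def lin_map_def ring_hom_def)

section \<open>The kernel of the balancing map\<close>

text \<open>The ring as an algebra over itself, in the record type that \<open>skew_algebra\<close>
  expects. Group algebras become the case of the trivial action, so that their laws need no separate
  proof.\<close>

definition regular_module :: "'r ring \<Rightarrow> ('r, 'r) module" where
  "regular_module R = \<lparr>carrier = carrier R, monoid.mult = monoid.mult R, one = \<one>\<^bsub>R\<^esub>, zero = \<zero>\<^bsub>R\<^esub>,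
     add = ring.add R, smult = monoid.mult R\<rparr>"

lemma regular_module_simps [simp]:
  "carrier (regular_module R) = carrier R" "\<one>\<^bsub>regular_module R\<^esub> = \<one>\<^bsub>R\<^esub>" "\<zero>\<^bsub>regular_module R\<^esub> = \<zero>\<^bsub>R\<^esub>"
  "x \<otimes>\<^bsub>regular_module R\<^esub> y = x \<otimes>\<^bsub>R\<^esub> y" "x \<oplus>\<^bsub>regular_module R\<^esub> y = x \<oplus>\<^bsub>R\<^esub> y" "x \<odot>\<^bsub>regular_module R\<^esub> y = x \<otimes>\<^bsub>R\<^esub> y"
  by (simp_all add: regular_module_def)

lemma finsum_regular_module [simp]: "finsum (regular_module R) f I = finsum R f I"
  by (simp add: finsum_def finprod_def regular_module_def)

lemma regular_module_assoc_algebra: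
  assumes "cring R" shows "assoc_algebra R (regular_module R)"
proof -
  interpret cring R by fact
  have "abelian_group (regular_module R)"
    by (rule abelian_groupI) (auto simp: a_ac intro: l_neg)
  then show ?thesis
    by (intro assoc_algebra.intro ringI moduleI monoidI assoc_algebra_axioms.intro)
       (auto simp: m_assoc l_distr r_distr is_cring m_lcomm)
qed

lemma group_algebra_eq: "group_algebra R \<Gamma> = skew_algebra \<Gamma> (regular_module R) (\<lambda>b g. b)"
  unfolding group_algebra_def skew_algebra_def finsum_regular_module regular_module_simps by (rule refl)

context
  fixes R :: "'r ring" and \<Gamma> :: "'g monoid"
  assumes R: "cring R" and \<Gamma>: "group \<Gamma>" and fin: "finite (carrier \<Gamma>)"
begin

interpretation R: cring R by (rule R)
interpretation \<Gamma>: group \<Gamma> by (rule \<Gamma>)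

interpretation ga: G_algebra \<Gamma> R "regular_module R" "\<lambda>b g. b"
  by (intro G_algebra_trivial \<Gamma> fin regular_module_assoc_algebra R)

lemma ga_basis_single: "ga_basis R \<Gamma> g = ga.single g \<one>\<^bsub>R\<^esub>"
  by (simp add: ga_basis_def ga.single_def cong: if_cong)

lemma ga_basis_closed: "ga_basis R \<Gamma> g \<in> carrier (group_algebra R \<Gamma>)"
  unfolding ga_basis_single group_algebra_eq by (rule ga.single_closed) simp

lemma ga_basis_mult:
  assumes "g \<in> carrier \<Gamma>" "g' \<in> carrier \<Gamma>"
  shows "ga_basis R \<Gamma> g \<otimes>\<^bsub>group_algebra R \<Gamma>\<^esub> ga_basis R \<Gamma> g' = ga_basis R \<Gamma> (g \<otimes>\<^bsub>\<Gamma>\<^esub> g')"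
  unfolding ga_basis_single group_algebra_eq
  by (subst ga.single_mult_single) (use assms in simp_all)

lemma ga_one: "\<one>\<^bsub>group_algebra R \<Gamma>\<^esub> = ga_basis R \<Gamma> \<one>\<^bsub>\<Gamma>\<^esub>"
  by (simp add: ga_basis_def group_algebra_def)

text \<open>A linear map on a group algebra is determined by the images of the group elements. This
  reduces the structure map \<sigma> to a function on H.\<close>

lemma ga_lin_map_expand:
  assumes N: "module R N" and \<sigma>: "\<sigma> \<in> lin_map R (group_algebra R \<Gamma>) N" and x: "x \<in> carrier (group_algebra R \<Gamma>)"
  shows "\<sigma> x = (\<Oplus>\<^bsub>N\<^esub>g\<in>carrier \<Gamma>. x g \<odot>\<^bsub>N\<^esub> \<sigma> (ga_basis R \<Gamma> g))"
proof -
  interpret N: module R N by fact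
  have xg: "x g \<in> carrier R" if "g \<in> carrier \<Gamma>" for g
    using x that by (auto simp: group_algebra_def)
  have single: "ga.single g (x g) = x g \<odot>\<^bsub>group_algebra R \<Gamma>\<^esub> ga_basis R \<Gamma> g" if "g \<in> carrier \<Gamma>" for g
    using that xg by (auto simp: ga.single_def group_algebra_def ga_basis_def fun_eq_iff)
  have sing_cl: "ga.single g (x g) \<in> carrier (group_algebra R \<Gamma>)" if "g \<in> carrier \<Gamma>" for g
    unfolding group_algebra_eq using xg that by (intro ga.single_closed) simp
  have x_sum: "x = (\<Oplus>\<^bsub>group_algebra R \<Gamma>\<^esub>g\<in>carrier \<Gamma>. ga.single g (x g))"
    using x unfolding group_algebra_eq by (rule ga.skew_sum_singles)
  have mod: "module R (group_algebra R \<Gamma>)"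
    unfolding group_algebra_eq by (rule ga.skew_module)
  then interpret RG: module R "group_algebra R \<Gamma>" .
  have add: "\<sigma> (y \<oplus>\<^bsub>group_algebra R \<Gamma>\<^esub> z) = \<sigma> y \<oplus>\<^bsub>N\<^esub> \<sigma> z"
    if "y \<in> carrier (group_algebra R \<Gamma>)" "z \<in> carrier (group_algebra R \<Gamma>)" for y z
    using \<sigma> that by (auto simp: lin_map_def)
  have sm: "\<sigma> (r \<odot>\<^bsub>group_algebra R \<Gamma>\<^esub> z) = r \<odot>\<^bsub>N\<^esub> \<sigma> z"
    if "r \<in> carrier R" "z \<in> carrier (group_algebra R \<Gamma>)" for r z
    using \<sigma> that by (auto simp: lin_map_def)
  have cl: "\<sigma> y \<in> carrier N" if "y \<in> carrier (group_algebra R \<Gamma>)" for y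
    using \<sigma> that by (auto simp: lin_map_def)
  have zero: "\<sigma> \<zero>\<^bsub>group_algebra R \<Gamma>\<^esub> = \<zero>\<^bsub>N\<^esub>"
    using add[of "\<zero>\<^bsub>group_algebra R \<Gamma>\<^esub>" "\<zero>\<^bsub>group_algebra R \<Gamma>\<^esub>"] cl[OF RG.M.zero_closed]
    by (metis N.M.add.r_cancel_one' RG.M.l_zero RG.M.zero_closed)
  have "\<sigma> x = (\<Oplus>\<^bsub>N\<^esub>g\<in>carrier \<Gamma>. \<sigma> (ga.single g (x g)))"
    by (subst x_sum, rule finsum_hom(2)[where T="carrier (group_algebra R \<Gamma>)"])
       (use add cl zero fin sing_cl RG.M.abelian_monoid_axioms N.M.abelian_monoid_axioms in auto)
  also have "\<dots> = (\<Oplus>\<^bsub>N\<^esub>g\<in>carrier \<Gamma>. x g \<odot>\<^bsub>N\<^esub> \<sigma> (ga_basis R \<Gamma> g))"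
    by (rule N.M.finsum_cong') (use xg cl ga_basis_closed single sm in auto)
  finally show ?thesis .
qed

end

text \<open>The assumptions of \<open>interior_G_algebra\<close>, placed on top of
  \<open>G_algebra\<close> and thus with finiteness of G, which sums over G and H require.\<close>

locale induced_G_algebra = G_algebra G R B act + H: normal H G
  for G :: "'g monoid" and R :: "'r ring" and B :: "('r, 'b) module" and act and H +
  fixes \<sigma> :: "('g \<Rightarrow> 'r) \<Rightarrow> 'b"
  assumes struct_hom: "\<sigma> \<in> alg_hom R (group_algebra R (G\<lparr>carrier := H\<rparr>)) B"
    and struct_equivariant:
          "\<lbrakk>x \<in> carrier (group_algebra R (G\<lparr>carrier := H\<rparr>)); g \<in> carrier G\<rbrakk> \<Longrightarrow>
          \<sigma> (ga_conj G H x g) = act (\<sigma> x) g"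
    and act_interior: "\<lbrakk>b \<in> carrier B; h \<in> H\<rbrakk> \<Longrightarrow>
          act b h = \<sigma> (ga_basis R (G\<lparr>carrier := H\<rparr>) (inv\<^bsub>G\<^esub> h)) \<otimes>\<^bsub>B\<^esub> b \<otimes>\<^bsub>B\<^esub>
                    \<sigma> (ga_basis R (G\<lparr>carrier := H\<rparr>) h)"
begin

lemma finite_H: "finite H" using H.subset finite_group finite_subset by blast

lemma H_group: "group (G\<lparr>carrier := H\<rparr>)" by (rule H.subgroup_is_group[OF G.is_group])

lemma H_carrier [simp, intro]: "h \<in> H \<Longrightarrow> h \<in> carrier G" using H.subset by auto

definition e :: "'g \<Rightarrow> 'b" where "e h = \<sigma> (ga_basis R (G\<lparr>carrier := H\<rparr>) h)"

lemma ga_H: "ga_basis R (G\<lparr>carrier := H\<rparr>) h \<in> carrier (group_algebra R (G\<lparr>carrier := H\<rparr>))"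
  by (rule ga_basis_closed) (use B.R.is_cring H_group finite_H in auto)

lemma \<sigma>_closed: "x \<in> carrier (group_algebra R (G\<lparr>carrier := H\<rparr>)) \<Longrightarrow> \<sigma> x \<in> carrier B"
  using struct_hom by (auto simp: alg_hom_def lin_map_def)

lemma e_closed [simp]: "e h \<in> carrier B"
  unfolding e_def by (intro \<sigma>_closed ga_H)

lemma e_mult: "h \<in> H \<Longrightarrow> k \<in> H \<Longrightarrow> e h \<otimes>\<^bsub>B\<^esub> e k = e (h \<otimes>\<^bsub>G\<^esub> k)"
  using ga_basis_mult[OF B.R.is_cring H_group, of h k] struct_hom finite_H
    ring_hom_mult[of \<sigma> _ B, OF _ ga_H ga_H, of h k]
  by (simp add: e_def alg_hom_def)

lemma e_one: "e \<one>\<^bsub>G\<^esub> = \<one>\<^bsub>B\<^esub>"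
  using ga_one[OF B.R.is_cring H_group] struct_hom finite_H
  by (auto simp: e_def alg_hom_def ring_hom_def)

lemma act_e:
  assumes h: "h \<in> H" and g: "g \<in> carrier G"
  shows "act (e h) g = e (inv\<^bsub>G\<^esub> g \<otimes>\<^bsub>G\<^esub> h \<otimes>\<^bsub>G\<^esub> g)"
proof -
  have "g \<otimes>\<^bsub>G\<^esub> x \<otimes>\<^bsub>G\<^esub> inv\<^bsub>G\<^esub> g \<in> H" if "x \<in> H" for x
    using H.inv_op_closed2 g that by auto
  moreover have "g \<otimes>\<^bsub>G\<^esub> x \<otimes>\<^bsub>G\<^esub> inv\<^bsub>G\<^esub> g = h \<longleftrightarrow> x = inv\<^bsub>G\<^esub> g \<otimes>\<^bsub>G\<^esub> h \<otimes>\<^bsub>G\<^esub> g" if "x \<in> H" for x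
    using assms that by (auto simp: G.m_assoc)
  ultimately have "ga_conj G H (ga_basis R (G\<lparr>carrier := H\<rparr>) h) g =
      ga_basis R (G\<lparr>carrier := H\<rparr>) (inv\<^bsub>G\<^esub> g \<otimes>\<^bsub>G\<^esub> h \<otimes>\<^bsub>G\<^esub> g)"
    by (auto simp: ga_conj_def ga_basis_def)
  then show ?thesis using struct_equivariant[OF ga_H g, of h] by (simp add: e_def)
qed

lemma act_H: "b \<in> carrier B \<Longrightarrow> h \<in> H \<Longrightarrow> act b h = e (inv\<^bsub>G\<^esub> h) \<otimes>\<^bsub>B\<^esub> b \<otimes>\<^bsub>B\<^esub> e h"
  using act_interior by (simp add: e_def)

lemma \<sigma>_expand:
  "x \<in> carrier (group_algebra R (G\<lparr>carrier := H\<rparr>)) \<Longrightarrow> \<sigma> x = (\<Oplus>\<^bsub>B\<^esub>h\<in>H. x h \<odot>\<^bsub>B\<^esub> e h)"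
  using ga_lin_map_expand[OF B.R.is_cring H_group _ B.module_axioms, of \<sigma> x] struct_hom finite_H
  by (auto simp: e_def alg_hom_def)

text \<open>
  \<open>b h \<otimes> x = b \<otimes> h x\<close> in \<open>A\<close>, so \<open>\<Sum>\<^sub>h f(hx) \<otimes> hx = \<Theta> f x \<otimes> x\<close>: these coefficients
  determine the class of \<open>f\<close> in \<open>A\<close>.
\<close>
definition \<Theta> :: "('g \<Rightarrow> 'b) \<Rightarrow> 'g \<Rightarrow> 'b" where
  "\<Theta> f x = (\<Oplus>\<^bsub>B\<^esub>h\<in>H. f (h \<otimes>\<^bsub>G\<^esub> x) \<otimes>\<^bsub>B\<^esub> e h)"

lemma \<Theta>_closed [simp]: "f \<in> carrier S \<Longrightarrow> x \<in> carrier G \<Longrightarrow> \<Theta> f x \<in> carrier B"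
  unfolding \<Theta>_def by (intro B.finsum_closed) auto

lemma \<Theta>_add:
  "f \<in> carrier S \<Longrightarrow> f' \<in> carrier S \<Longrightarrow> x \<in> carrier G \<Longrightarrow> \<Theta> (f \<oplus>\<^bsub>S\<^esub> f') x = \<Theta> f x \<oplus>\<^bsub>B\<^esub> \<Theta> f' x"
  unfolding \<Theta>_def by (intro B.finsum_split_add) (auto simp: skew_add B.l_distr)

lemma \<Theta>_zero: "x \<in> carrier G \<Longrightarrow> \<Theta> \<zero>\<^bsub>S\<^esub> x = \<zero>\<^bsub>B\<^esub>"
  unfolding \<Theta>_def by (intro B.add.finprod_one_eqI) (auto simp: skew_zero)

lemma \<Theta>_smult:
  "r \<in> carrier R \<Longrightarrow> f \<in> carrier S \<Longrightarrow> x \<in> carrier G \<Longrightarrow> \<Theta> (r \<odot>\<^bsub>S\<^esub> f) x = r \<odot>\<^bsub>B\<^esub> \<Theta> f x"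
  unfolding \<Theta>_def
  by (subst B.finsum_smult_ldistr) (auto intro!: B.finsum_cong' finite_H simp: skew_smult B.smult_mult_left)

lemma \<Theta>_minus:
  assumes "f \<in> carrier S" "x \<in> carrier G" shows "\<Theta> (\<ominus>\<^bsub>S\<^esub> f) x = \<ominus>\<^bsub>B\<^esub> \<Theta> f x"
  using assms \<Theta>_add[of "\<ominus>\<^bsub>S\<^esub> f" f x] \<Theta>_zero[of x]
  by (intro B.minus_equality[symmetric]) (auto simp: S.l_neg)

lemma bij_H_right: assumes "k \<in> H" shows "bij_betw (\<lambda>h. h \<otimes>\<^bsub>G\<^esub> k) H H"
  by (rule bij_betw_byWitness[where f'="\<lambda>h. h \<otimes>\<^bsub>G\<^esub> inv\<^bsub>G\<^esub> k"]) (use assms in \<open>auto simp: G.m_assoc\<close>)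

text \<open>In A one has b \<otimes> x = b e(k^-1) \<otimes> kx, so the coefficients at different
  representatives of a coset differ by such a factor. In the sum it appears as a shift of H.\<close>

lemma \<Theta>_translate:
  assumes f: "f \<in> carrier S" and k: "k \<in> H" and x: "x \<in> carrier G"
  shows "\<Theta> f (k \<otimes>\<^bsub>G\<^esub> x) = \<Theta> f x \<otimes>\<^bsub>B\<^esub> e (inv\<^bsub>G\<^esub> k)"
proof -
  have "\<Theta> f x \<otimes>\<^bsub>B\<^esub> e (inv\<^bsub>G\<^esub> k) = (\<Oplus>\<^bsub>B\<^esub>h\<in>H. f (h \<otimes>\<^bsub>G\<^esub> x) \<otimes>\<^bsub>B\<^esub> e (h \<otimes>\<^bsub>G\<^esub> inv\<^bsub>G\<^esub> k))"
    unfolding \<Theta>_def using assms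
    by (subst B.finsum_ldistr) (auto intro!: B.finsum_cong' finite_H simp: B.m_assoc e_mult)
  also have "\<dots> = (\<Oplus>\<^bsub>B\<^esub>h\<in>H. f (h \<otimes>\<^bsub>G\<^esub> k \<otimes>\<^bsub>G\<^esub> x) \<otimes>\<^bsub>B\<^esub> e (h \<otimes>\<^bsub>G\<^esub> k \<otimes>\<^bsub>G\<^esub> inv\<^bsub>G\<^esub> k))"
    using assms by (intro B.finsum_bij[OF bij_H_right]) auto
  also have "\<dots> = \<Theta> f (k \<otimes>\<^bsub>G\<^esub> x)"
    unfolding \<Theta>_def using assms by (auto intro!: B.finsum_cong' simp: G.m_assoc)
  finally show ?thesis by simp
qed

text \<open>The second factor enters only through its coefficients, so \<open>Ker\<close> is closed
  under multiplication from the left. The substitution of ghg^-1 for h works because equivariance of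
  \<sigma> rewrites \<open>e\<close> of that conjugate as the action of g^-1 on \<open>e h\<close>,
  which moves \<open>e h\<close> inside the action.\<close>

lemma \<Theta>_mult_right:
  assumes f: "f \<in> carrier S" "f' \<in> carrier S" and x: "x \<in> carrier G"
  shows "\<Theta> (f \<otimes>\<^bsub>S\<^esub> f') x =
    (\<Oplus>\<^bsub>B\<^esub>g\<in>carrier G. f g \<otimes>\<^bsub>B\<^esub> act (\<Theta> f' (inv\<^bsub>G\<^esub> g \<otimes>\<^bsub>G\<^esub> x)) (inv\<^bsub>G\<^esub> g))"
proof -
  let ?t = "\<lambda>h g. f g \<otimes>\<^bsub>B\<^esub> act (f' (inv\<^bsub>G\<^esub> g \<otimes>\<^bsub>G\<^esub> (h \<otimes>\<^bsub>G\<^esub> x))) (inv\<^bsub>G\<^esub> g) \<otimes>\<^bsub>B\<^esub> e h"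
  have "\<Theta> (f \<otimes>\<^bsub>S\<^esub> f') x = (\<Oplus>\<^bsub>B\<^esub>h\<in>H. \<Oplus>\<^bsub>B\<^esub>g\<in>carrier G. ?t h g)"
    unfolding \<Theta>_def skew_mult using assms finite_group
    by (auto intro!: B.finsum_cong' B.finsum_closed B.finsum_ldistr)
  also have "\<dots> = (\<Oplus>\<^bsub>B\<^esub>g\<in>carrier G. \<Oplus>\<^bsub>B\<^esub>h\<in>H. ?t h g)"
    using assms finite_group finite_H by (intro B.finsum_swap) auto
  also have "\<dots> = (\<Oplus>\<^bsub>B\<^esub>g\<in>carrier G. f g \<otimes>\<^bsub>B\<^esub> act (\<Theta> f' (inv\<^bsub>G\<^esub> g \<otimes>\<^bsub>G\<^esub> x)) (inv\<^bsub>G\<^esub> g))"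
  proof (intro B.finsum_cong' refl)
    fix g assume g: "g \<in> carrier G"
    have bij: "bij_betw (\<lambda>h. g \<otimes>\<^bsub>G\<^esub> h \<otimes>\<^bsub>G\<^esub> inv\<^bsub>G\<^esub> g) H H"
      by (rule bij_betw_byWitness[where f'="\<lambda>h. inv\<^bsub>G\<^esub> g \<otimes>\<^bsub>G\<^esub> h \<otimes>\<^bsub>G\<^esub> g"])
         (use g H.inv_op_closed1 H.inv_op_closed2 in \<open>auto simp: G.m_assoc\<close>)
    have "(\<Oplus>\<^bsub>B\<^esub>h\<in>H. ?t h g) = (\<Oplus>\<^bsub>B\<^esub>h\<in>H. ?t (g \<otimes>\<^bsub>G\<^esub> h \<otimes>\<^bsub>G\<^esub> inv\<^bsub>G\<^esub> g) g)"
      using g assms by (intro B.finsum_bij[OF bij]) auto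
    also have "\<dots> = (\<Oplus>\<^bsub>B\<^esub>h\<in>H. f g \<otimes>\<^bsub>B\<^esub> act (f' (h \<otimes>\<^bsub>G\<^esub> (inv\<^bsub>G\<^esub> g \<otimes>\<^bsub>G\<^esub> x)) \<otimes>\<^bsub>B\<^esub> e h) (inv\<^bsub>G\<^esub> g))"
      using g assms by (intro B.finsum_cong' refl) (auto simp: act_prod act_e B.m_assoc G.m_assoc)
    also have "\<dots> = f g \<otimes>\<^bsub>B\<^esub> act (\<Theta> f' (inv\<^bsub>G\<^esub> g \<otimes>\<^bsub>G\<^esub> x)) (inv\<^bsub>G\<^esub> g)"
      unfolding \<Theta>_def using g assms finite_H
      by (subst act_finsum) (auto intro!: B.finsum_rdistr[symmetric])
    finally show "(\<Oplus>\<^bsub>B\<^esub>h\<in>H. ?t h g) = f g \<otimes>\<^bsub>B\<^esub> act (\<Theta> f' (inv\<^bsub>G\<^esub> g \<otimes>\<^bsub>G\<^esub> x)) (inv\<^bsub>G\<^esub> g)" .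
  qed (use assms in auto)
  finally show ?thesis .
qed

text \<open>The counterpart for the first factor, giving closure of \<open>Ker\<close> under
  multiplication from the right. After substituting hg for g, the action of h^-1 is conjugation by
  \<open>e h\<close>, by the interior axiom, and its right-hand factor cancels against the
  \<open>e h\<close> of the sum.\<close>

lemma \<Theta>_mult_left:
  assumes f: "f \<in> carrier S" "f' \<in> carrier S" and x: "x \<in> carrier G"
  shows "\<Theta> (f \<otimes>\<^bsub>S\<^esub> f') x =
    (\<Oplus>\<^bsub>B\<^esub>g\<in>carrier G. \<Theta> f g \<otimes>\<^bsub>B\<^esub> act (f' (inv\<^bsub>G\<^esub> g \<otimes>\<^bsub>G\<^esub> x)) (inv\<^bsub>G\<^esub> g))"
proof -
  let ?c = "\<lambda>g. act (f' (inv\<^bsub>G\<^esub> g \<otimes>\<^bsub>G\<^esub> x)) (inv\<^bsub>G\<^esub> g)"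
  let ?t = "\<lambda>h g. f g \<otimes>\<^bsub>B\<^esub> act (f' (inv\<^bsub>G\<^esub> g \<otimes>\<^bsub>G\<^esub> (h \<otimes>\<^bsub>G\<^esub> x))) (inv\<^bsub>G\<^esub> g) \<otimes>\<^bsub>B\<^esub> e h"
  have "\<Theta> (f \<otimes>\<^bsub>S\<^esub> f') x = (\<Oplus>\<^bsub>B\<^esub>h\<in>H. \<Oplus>\<^bsub>B\<^esub>g\<in>carrier G. ?t h g)"
    unfolding \<Theta>_def skew_mult using assms finite_group
    by (auto intro!: B.finsum_cong' B.finsum_closed B.finsum_ldistr)
  also have "\<dots> = (\<Oplus>\<^bsub>B\<^esub>h\<in>H. \<Oplus>\<^bsub>B\<^esub>g\<in>carrier G. f (h \<otimes>\<^bsub>G\<^esub> g) \<otimes>\<^bsub>B\<^esub> e h \<otimes>\<^bsub>B\<^esub> ?c g)"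
  proof (rule B.finsum_cong'[OF refl])
    fix h assume h: "h \<in> H"
    have "(\<Oplus>\<^bsub>B\<^esub>g\<in>carrier G. ?t h g) = (\<Oplus>\<^bsub>B\<^esub>g\<in>carrier G. ?t h (h \<otimes>\<^bsub>G\<^esub> g))"
      using h assms by (intro B.finsum_bij[OF G.bij_mult_left]) auto
    also have "\<dots> = (\<Oplus>\<^bsub>B\<^esub>g\<in>carrier G. f (h \<otimes>\<^bsub>G\<^esub> g) \<otimes>\<^bsub>B\<^esub> e h \<otimes>\<^bsub>B\<^esub> ?c g)"
    proof (intro B.finsum_cong' refl)
      fix g assume g: "g \<in> carrier G"
      have "act (f' (inv\<^bsub>G\<^esub> (h \<otimes>\<^bsub>G\<^esub> g) \<otimes>\<^bsub>G\<^esub> (h \<otimes>\<^bsub>G\<^esub> x))) (inv\<^bsub>G\<^esub> (h \<otimes>\<^bsub>G\<^esub> g)) = act (?c g) (inv\<^bsub>G\<^esub> h)"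
        using h g assms by (simp add: act_mult G.inv_mult_group G.m_assoc)
      also have "\<dots> = e h \<otimes>\<^bsub>B\<^esub> ?c g \<otimes>\<^bsub>B\<^esub> e (inv\<^bsub>G\<^esub> h)"
        using h g assms by (subst act_H) auto
      finally show "?t h (h \<otimes>\<^bsub>G\<^esub> g) = f (h \<otimes>\<^bsub>G\<^esub> g) \<otimes>\<^bsub>B\<^esub> e h \<otimes>\<^bsub>B\<^esub> ?c g"
        using h g assms by (simp add: B.m_assoc e_mult e_one)
    qed (use h assms in auto)
    finally show "(\<Oplus>\<^bsub>B\<^esub>g\<in>carrier G. ?t h g) = (\<Oplus>\<^bsub>B\<^esub>g\<in>carrier G. f (h \<otimes>\<^bsub>G\<^esub> g) \<otimes>\<^bsub>B\<^esub> e h \<otimes>\<^bsub>B\<^esub> ?c g)" .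
  qed (use assms in \<open>auto intro!: B.finsum_closed\<close>)
  also have "\<dots> = (\<Oplus>\<^bsub>B\<^esub>g\<in>carrier G. \<Oplus>\<^bsub>B\<^esub>h\<in>H. f (h \<otimes>\<^bsub>G\<^esub> g) \<otimes>\<^bsub>B\<^esub> e h \<otimes>\<^bsub>B\<^esub> ?c g)"
    using assms finite_group finite_H by (intro B.finsum_swap) auto
  also have "\<dots> = (\<Oplus>\<^bsub>B\<^esub>g\<in>carrier G. \<Theta> f g \<otimes>\<^bsub>B\<^esub> ?c g)"
    unfolding \<Theta>_def using assms finite_H
    by (auto intro!: B.finsum_cong' B.finsum_ldistr[symmetric] B.finsum_closed)
  finally show ?thesis .
qed

definition Ker :: "('g \<Rightarrow> 'b) set" where
  "Ker = {f \<in> carrier S. \<forall>x\<in>carrier G. \<Theta> f x = \<zero>\<^bsub>B\<^esub>}"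

lemma Ker_subgroup: "subgroup Ker (add_monoid S)"
  by (rule S.add.subgroupI)
     (auto simp: Ker_def \<Theta>_add \<Theta>_zero \<Theta>_minus a_inv_def[symmetric] intro!: exI[of _ "\<zero>\<^bsub>S\<^esub>"])

lemma Ker_ideal: "ideal Ker S"
proof (rule idealI)
  fix a x assume "a \<in> Ker" "x \<in> carrier S"
  then have ax: "a \<in> carrier S" "x \<in> carrier S" "\<And>g. g \<in> carrier G \<Longrightarrow> \<Theta> a g = \<zero>\<^bsub>B\<^esub>"
    by (auto simp: Ker_def)
  then show "x \<otimes>\<^bsub>S\<^esub> a \<in> Ker"
    by (auto simp: Ker_def \<Theta>_mult_right intro!: B.add.finprod_one_eqI)
  from ax show "a \<otimes>\<^bsub>S\<^esub> x \<in> Ker"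
    by (auto simp: Ker_def \<Theta>_mult_left intro!: B.add.finprod_one_eqI)
qed (auto simp: S.ring_axioms Ker_subgroup)

text \<open>Only h = z x^-1 can contribute, and this element belongs to H exactly when x lies in
  Hz.\<close>

lemma \<Theta>_single:
  assumes "z \<in> carrier G" "b \<in> carrier B" "x \<in> carrier G"
  shows "\<Theta> (single z b) x = (if x \<in> H #>\<^bsub>G\<^esub> z then b \<otimes>\<^bsub>B\<^esub> e (z \<otimes>\<^bsub>G\<^esub> inv\<^bsub>G\<^esub> x) else \<zero>\<^bsub>B\<^esub>)"
proof -
  have eq: "h \<otimes>\<^bsub>G\<^esub> x = z \<longleftrightarrow> h = z \<otimes>\<^bsub>G\<^esub> inv\<^bsub>G\<^esub> x" if "h \<in> H" for h
    using assms that by (auto simp: G.m_assoc)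
  have iff: "x \<in> H #>\<^bsub>G\<^esub> z \<longleftrightarrow> z \<otimes>\<^bsub>G\<^esub> inv\<^bsub>G\<^esub> x \<in> H"
    using assms G.repr_independence H.rcos_module H.subgroup_axioms
    by (metis G.repr_independence G.rcos_self subgroup.rcos_module G.is_group)
  have "\<Theta> (single z b) x = (\<Oplus>\<^bsub>B\<^esub>h\<in>H. if h = z \<otimes>\<^bsub>G\<^esub> inv\<^bsub>G\<^esub> x then b \<otimes>\<^bsub>B\<^esub> e (z \<otimes>\<^bsub>G\<^esub> inv\<^bsub>G\<^esub> x) else \<zero>\<^bsub>B\<^esub>)"
    unfolding \<Theta>_def using assms by (auto intro!: B.finsum_cong' simp: single_def eq)
  also have "\<dots> = (if z \<otimes>\<^bsub>G\<^esub> inv\<^bsub>G\<^esub> x \<in> H then b \<otimes>\<^bsub>B\<^esub> e (z \<otimes>\<^bsub>G\<^esub> inv\<^bsub>G\<^esub> x) else \<zero>\<^bsub>B\<^esub>)"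
    using assms finite_H
    by (auto intro!: finsum_single[OF B.abelian_monoid_axioms] B.add.finprod_one_eqI)
  finally show ?thesis using iff by simp
qed

section \<open>Comparison of the balancing relations with \<open>Ker\<close>\<close>

abbreviation "I \<equiv> balance_rel R G H B act \<sigma>"

lemma pure_tensor_basis: "b \<in> carrier B \<Longrightarrow> pure_tensor G B b (ga_basis R G g) = single g b"
  by (auto simp: pure_tensor_def ga_basis_def single_def)

lemma pure_tensor_closed:
  "b \<in> carrier B \<Longrightarrow> y \<in> carrier (group_algebra R G) \<Longrightarrow> pure_tensor G B b y \<in> carrier S"
  unfolding pure_tensor_def by (rule skewI) (auto simp: group_algebra_def)

lemma ga_incl_mult_apply:
  assumes x: "x \<in> carrier (group_algebra R (G\<lparr>carrier := H\<rparr>))" and y: "y \<in> carrier (group_algebra R G)"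
    and z: "z \<in> carrier G"
  shows "(ga_incl R G H x \<otimes>\<^bsub>group_algebra R G\<^esub> y) z = (\<Oplus>\<^bsub>R\<^esub>k\<in>H. x k \<otimes>\<^bsub>R\<^esub> y (inv\<^bsub>G\<^esub> k \<otimes>\<^bsub>G\<^esub> z))"
proof -
  have xc: "x k \<in> carrier R" if "k \<in> H" for k using x that by (auto simp: group_algebra_def)
  have yc: "y k \<in> carrier R" if "k \<in> carrier G" for k using y that by (auto simp: group_algebra_def)
  have "(ga_incl R G H x \<otimes>\<^bsub>group_algebra R G\<^esub> y) z =
      (\<Oplus>\<^bsub>R\<^esub>k\<in>carrier G. ga_incl R G H x k \<otimes>\<^bsub>R\<^esub> y (inv\<^bsub>G\<^esub> k \<otimes>\<^bsub>G\<^esub> z))"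
    using z by (simp add: group_algebra_def)
  also have "\<dots> = (\<Oplus>\<^bsub>R\<^esub>k\<in>H. x k \<otimes>\<^bsub>R\<^esub> y (inv\<^bsub>G\<^esub> k \<otimes>\<^bsub>G\<^esub> z))"
    by (rule B.R.add.finprod_mono_neutral_cong_right)
       (use finite_group xc yc z in \<open>auto simp: ga_incl_def\<close>)
  finally show ?thesis .
qed

lemma ga_incl_mult_closed:
  assumes x: "x \<in> carrier (group_algebra R (G\<lparr>carrier := H\<rparr>))" and y: "y \<in> carrier (group_algebra R G)"
  shows "ga_incl R G H x \<otimes>\<^bsub>group_algebra R G\<^esub> y \<in> carrier (group_algebra R G)"
proof -
  have "(\<Oplus>\<^bsub>R\<^esub>k\<in>H. x k \<otimes>\<^bsub>R\<^esub> y (inv\<^bsub>G\<^esub> k \<otimes>\<^bsub>G\<^esub> z)) \<in> carrier R" if "z \<in> carrier G" for z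
    using x y that by (intro B.R.finsum_closed) (auto simp: group_algebra_def intro!: B.R.m_closed)
  then have "(ga_incl R G H x \<otimes>\<^bsub>group_algebra R G\<^esub> y) z \<in> carrier R" if "z \<in> carrier G" for z
    using ga_incl_mult_apply[OF x y] that by simp
  moreover have "ga_incl R G H x \<otimes>\<^bsub>group_algebra R G\<^esub> y \<in> extensional (carrier G)"
    by (simp add: group_algebra_def)
  ultimately show ?thesis by (auto simp: group_algebra_def PiE_def)
qed

text \<open>Once \<sigma> x is expanded over H, both sides are double sums over H x H. Substituting
  kh for h matches them: k disappears from the argument of y, and e(kh) splits into the product of
  \<open>e k\<close> and \<open>e h\<close>.\<close>

lemma \<Theta>_balance:
  assumes b: "b \<in> carrier B" and x: "x \<in> carrier (group_algebra R (G\<lparr>carrier := H\<rparr>))"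
    and y: "y \<in> carrier (group_algebra R G)" and z: "z \<in> carrier G"
  shows "\<Theta> (pure_tensor G B (b \<otimes>\<^bsub>B\<^esub> \<sigma> x) y) z =
    \<Theta> (pure_tensor G B b (ga_incl R G H x \<otimes>\<^bsub>group_algebra R G\<^esub> y)) z"
proof -
  have xc: "x k \<in> carrier R" if "k \<in> H" for k using x that by (auto simp: group_algebra_def)
  have yc: "y k \<in> carrier R" if "k \<in> carrier G" for k using y that by (auto simp: group_algebra_def)
  have bij: "bij_betw (\<lambda>h. k \<otimes>\<^bsub>G\<^esub> h) H H" if "k \<in> H" for k
    by (rule bij_betw_byWitness[where f'="\<lambda>h. inv\<^bsub>G\<^esub> k \<otimes>\<^bsub>G\<^esub> h"]) (use that in auto)
  let ?t = "\<lambda>h k. (x k \<otimes>\<^bsub>R\<^esub> y (inv\<^bsub>G\<^esub> k \<otimes>\<^bsub>G\<^esub> (h \<otimes>\<^bsub>G\<^esub> z))) \<odot>\<^bsub>B\<^esub> (b \<otimes>\<^bsub>B\<^esub> e h)"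
  have "\<Theta> (pure_tensor G B b (ga_incl R G H x \<otimes>\<^bsub>group_algebra R G\<^esub> y)) z =
      (\<Oplus>\<^bsub>B\<^esub>h\<in>H. \<Oplus>\<^bsub>B\<^esub>k\<in>H. ?t h k)"
    unfolding \<Theta>_def
  proof (rule B.finsum_cong'[OF refl])
    fix h assume h: "h \<in> H"
    have c: "x k \<otimes>\<^bsub>R\<^esub> y (inv\<^bsub>G\<^esub> k \<otimes>\<^bsub>G\<^esub> (h \<otimes>\<^bsub>G\<^esub> z)) \<in> carrier R" if "k \<in> H" for k
      using that xc yc h z by auto
    have "pure_tensor G B b (ga_incl R G H x \<otimes>\<^bsub>group_algebra R G\<^esub> y) (h \<otimes>\<^bsub>G\<^esub> z) \<otimes>\<^bsub>B\<^esub> e h =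
       (\<Oplus>\<^bsub>R\<^esub>k\<in>H. x k \<otimes>\<^bsub>R\<^esub> y (inv\<^bsub>G\<^esub> k \<otimes>\<^bsub>G\<^esub> (h \<otimes>\<^bsub>G\<^esub> z))) \<odot>\<^bsub>B\<^esub> (b \<otimes>\<^bsub>B\<^esub> e h)"
      using h z b c by (simp add: pure_tensor_def ga_incl_mult_apply[OF x y] B.smult_mult_left)
    also have "\<dots> = (\<Oplus>\<^bsub>B\<^esub>k\<in>H. ?t h k)"
      by (rule finsum_hom(2)[where T="carrier R" and h="\<lambda>r. r \<odot>\<^bsub>B\<^esub> (b \<otimes>\<^bsub>B\<^esub> e h)"])
         (use b c finite_H B.R.abelian_monoid_axioms B.abelian_monoid_axioms
           in \<open>auto simp: B.smult_l_distr\<close>)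
    finally show "pure_tensor G B b (ga_incl R G H x \<otimes>\<^bsub>group_algebra R G\<^esub> y) (h \<otimes>\<^bsub>G\<^esub> z) \<otimes>\<^bsub>B\<^esub> e h =
       (\<Oplus>\<^bsub>B\<^esub>k\<in>H. ?t h k)" .
  qed (use b xc yc z in \<open>auto intro!: B.finsum_closed\<close>)
  also have "\<dots> = (\<Oplus>\<^bsub>B\<^esub>k\<in>H. \<Oplus>\<^bsub>B\<^esub>h\<in>H. ?t h k)"
    using b xc yc z finite_H by (intro B.finsum_swap) auto
  also have "\<dots> = (\<Oplus>\<^bsub>B\<^esub>k\<in>H. \<Oplus>\<^bsub>B\<^esub>h\<in>H. y (h \<otimes>\<^bsub>G\<^esub> z) \<odot>\<^bsub>B\<^esub> (b \<otimes>\<^bsub>B\<^esub> (x k \<odot>\<^bsub>B\<^esub> e k) \<otimes>\<^bsub>B\<^esub> e h))"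
  proof (rule B.finsum_cong'[OF refl])
    fix k assume k: "k \<in> H"
    have "(\<Oplus>\<^bsub>B\<^esub>h\<in>H. ?t h k) = (\<Oplus>\<^bsub>B\<^esub>h\<in>H. ?t (k \<otimes>\<^bsub>G\<^esub> h) k)"
      using b xc yc z k by (intro B.finsum_bij[OF bij]) auto
    also have "\<dots> = (\<Oplus>\<^bsub>B\<^esub>h\<in>H. y (h \<otimes>\<^bsub>G\<^esub> z) \<odot>\<^bsub>B\<^esub> (b \<otimes>\<^bsub>B\<^esub> (x k \<odot>\<^bsub>B\<^esub> e k) \<otimes>\<^bsub>B\<^esub> e h))"
      using b xc yc z k
      by (intro B.finsum_cong' refl)
         (auto simp: G.m_assoc B.smult_mult_left B.smult_mult_right B.m_assoc e_mult
           B.R.m_comm[of "x k"] B.smult_assoc1)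
    finally show "(\<Oplus>\<^bsub>B\<^esub>h\<in>H. ?t h k) = (\<Oplus>\<^bsub>B\<^esub>h\<in>H. y (h \<otimes>\<^bsub>G\<^esub> z) \<odot>\<^bsub>B\<^esub> (b \<otimes>\<^bsub>B\<^esub> (x k \<odot>\<^bsub>B\<^esub> e k) \<otimes>\<^bsub>B\<^esub> e h))" .
  qed (use b xc yc z in \<open>auto intro!: B.finsum_closed\<close>)
  also have "\<dots> = (\<Oplus>\<^bsub>B\<^esub>h\<in>H. \<Oplus>\<^bsub>B\<^esub>k\<in>H. y (h \<otimes>\<^bsub>G\<^esub> z) \<odot>\<^bsub>B\<^esub> (b \<otimes>\<^bsub>B\<^esub> (x k \<odot>\<^bsub>B\<^esub> e k) \<otimes>\<^bsub>B\<^esub> e h))"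
    using b xc yc z finite_H by (intro B.finsum_swap) auto
  also have "\<dots> = \<Theta> (pure_tensor G B (b \<otimes>\<^bsub>B\<^esub> \<sigma> x) y) z"
    unfolding \<Theta>_def
  proof (rule B.finsum_cong'[OF refl])
    fix h assume h: "h \<in> H"
    have "pure_tensor G B (b \<otimes>\<^bsub>B\<^esub> \<sigma> x) y (h \<otimes>\<^bsub>G\<^esub> z) \<otimes>\<^bsub>B\<^esub> e h =
       y (h \<otimes>\<^bsub>G\<^esub> z) \<odot>\<^bsub>B\<^esub> (b \<otimes>\<^bsub>B\<^esub> (\<Oplus>\<^bsub>B\<^esub>k\<in>H. x k \<odot>\<^bsub>B\<^esub> e k) \<otimes>\<^bsub>B\<^esub> e h)"
      using h z b yc \<sigma>_closed[OF x] by (simp add: pure_tensor_def \<sigma>_expand[OF x] B.smult_mult_left)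
    also have "\<dots> = (\<Oplus>\<^bsub>B\<^esub>k\<in>H. y (h \<otimes>\<^bsub>G\<^esub> z) \<odot>\<^bsub>B\<^esub> (b \<otimes>\<^bsub>B\<^esub> (x k \<odot>\<^bsub>B\<^esub> e k) \<otimes>\<^bsub>B\<^esub> e h))"
      by (rule finsum_hom(2)[where T="carrier B" and h="\<lambda>c. y (h \<otimes>\<^bsub>G\<^esub> z) \<odot>\<^bsub>B\<^esub> (b \<otimes>\<^bsub>B\<^esub> c \<otimes>\<^bsub>B\<^esub> e h)"])
         (use b xc yc h z finite_H B.abelian_monoid_axioms
           in \<open>auto simp: B.smult_r_distr B.r_distr B.l_distr\<close>)
    finally show "(\<Oplus>\<^bsub>B\<^esub>k\<in>H. y (h \<otimes>\<^bsub>G\<^esub> z) \<odot>\<^bsub>B\<^esub> (b \<otimes>\<^bsub>B\<^esub> (x k \<odot>\<^bsub>B\<^esub> e k) \<otimes>\<^bsub>B\<^esub> e h)) =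
      pure_tensor G B (b \<otimes>\<^bsub>B\<^esub> \<sigma> x) y (h \<otimes>\<^bsub>G\<^esub> z) \<otimes>\<^bsub>B\<^esub> e h" by simp
  next
    have "pure_tensor G B (b \<otimes>\<^bsub>B\<^esub> \<sigma> x) y \<in> carrier S"
      using pure_tensor_closed \<sigma>_closed x y b by simp
    then show "(\<lambda>h. pure_tensor G B (b \<otimes>\<^bsub>B\<^esub> \<sigma> x) y (h \<otimes>\<^bsub>G\<^esub> z) \<otimes>\<^bsub>B\<^esub> e h) \<in> H \<rightarrow> carrier B"
      using z by auto
  qed
  finally show ?thesis by simp
qed

definition gens :: "('g \<Rightarrow> 'b) set" where
  "gens = {pure_tensor G B (b \<otimes>\<^bsub>B\<^esub> \<sigma> x) y \<ominus>\<^bsub>S\<^esub>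
      pure_tensor G B b (ga_incl R G H x \<otimes>\<^bsub>group_algebra R G\<^esub> y) | b x y.
        b \<in> carrier B \<and> x \<in> carrier (group_algebra R (G\<lparr>carrier := H\<rparr>)) \<and>
        y \<in> carrier (group_algebra R G)}"

lemma I_def: "I = generate (add_monoid S) gens"
  by (simp add: balance_rel_def gens_def)

lemma gens_Ker: "gens \<subseteq> Ker"
proof
  fix w assume "w \<in> gens"
  then obtain b x y where w: "w = pure_tensor G B (b \<otimes>\<^bsub>B\<^esub> \<sigma> x) y \<ominus>\<^bsub>S\<^esub>
      pure_tensor G B b (ga_incl R G H x \<otimes>\<^bsub>group_algebra R G\<^esub> y)"
    and c: "b \<in> carrier B" "x \<in> carrier (group_algebra R (G\<lparr>carrier := H\<rparr>))" "y \<in> carrier (group_algebra R G)"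
    by (auto simp: gens_def)
  have cl: "pure_tensor G B (b \<otimes>\<^bsub>B\<^esub> \<sigma> x) y \<in> carrier S"
    "pure_tensor G B b (ga_incl R G H x \<otimes>\<^bsub>group_algebra R G\<^esub> y) \<in> carrier S"
    using c \<sigma>_closed pure_tensor_closed ga_incl_mult_closed by auto
  then show "w \<in> Ker"
    unfolding w Ker_def using c by (auto simp: a_minus_def \<Theta>_add \<Theta>_minus \<Theta>_balance B.r_neg)
qed

lemma ga_incl_basis_mult:
  assumes "h \<in> H" "z \<in> carrier G"
  shows "ga_incl R G H (ga_basis R (G\<lparr>carrier := H\<rparr>) h) \<otimes>\<^bsub>group_algebra R G\<^esub> ga_basis R G z =
    ga_basis R G (h \<otimes>\<^bsub>G\<^esub> z)"
proof -
  have "ga_incl R G H (ga_basis R (G\<lparr>carrier := H\<rparr>) h) = ga_basis R G h"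
    using assms by (auto simp: ga_incl_def ga_basis_def fun_eq_iff)
  then show ?thesis using ga_basis_mult[OF B.R.is_cring G.is_group finite_group, of h z] assms by simp
qed

text \<open>The balancing relation for a group element h and a group element z. These instances are
  enough to carry any element to coset representatives.\<close>

lemma I_single:
  assumes "b \<in> carrier B" "h \<in> H" "z \<in> carrier G"
  shows "single z (b \<otimes>\<^bsub>B\<^esub> e h) \<ominus>\<^bsub>S\<^esub> single (h \<otimes>\<^bsub>G\<^esub> z) b \<in> I"
proof -
  have "pure_tensor G B (b \<otimes>\<^bsub>B\<^esub> e h) (ga_basis R G z) \<ominus>\<^bsub>S\<^esub> pure_tensor G B b (ga_basis R G (h \<otimes>\<^bsub>G\<^esub> z)) \<in> gens"
    unfolding gens_def mem_Collect_eq using assms ga_H ga_incl_basis_mult[of h z]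
      ga_basis_closed[OF B.R.is_cring G.is_group finite_group]
    by (intro exI[of _ b] exI[of _ "ga_basis R (G\<lparr>carrier := H\<rparr>) h"] exI[of _ "ga_basis R G z"])
       (simp add: e_def)
  then show ?thesis using assms unfolding I_def
    by (simp add: pure_tensor_basis generate.incl)
qed

text \<open>Modulo the relations an element can be moved to coset representatives, and its
  coefficients there are values of \<Theta>; if these vanish, the element is itself a relation.
  Since \<open>Ker\<close> is an ideal, so is the additive subgroup generated by the relations,
  which makes the quotient a ring.\<close>

lemma I_eq_Ker: "I = Ker"
proof
  show "I \<subseteq> Ker" unfolding I_def by (rule S.add.generate_subgroup_incl[OF gens_Ker Ker_subgroup])
next
  have I_sub: "subgroup I (add_monoid S)"
    unfolding I_def by (rule S.add.generate_is_subgroup) (use gens_Ker in \<open>auto simp: Ker_def\<close>)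
  show "Ker \<subseteq> I"
  proof
    fix f assume "f \<in> Ker"
    then have f: "f \<in> carrier S" and \<Theta>0: "\<And>x. x \<in> carrier G \<Longrightarrow> \<Theta> f x = \<zero>\<^bsub>B\<^esub>" by (auto simp: Ker_def)
    \<comment> \<open>The choice depends on the coset only as a set, so r is constant on each
      coset.\<close>
    define r where "r g = (SOME y. y \<in> H #>\<^bsub>G\<^esub> g)" for g
    have r: "r g \<in> H #>\<^bsub>G\<^esub> g" if "g \<in> carrier G" for g
      unfolding r_def by (rule someI) (rule G.rcos_self[OF that H.subgroup_axioms])
    have rG [simp]: "r g \<in> carrier G" if "g \<in> carrier G" for g
      using r[OF that] that G.r_coset_subset_G H.subset by blast
    have r_cong: "r g = r x" if "g \<in> H #>\<^bsub>G\<^esub> x" "x \<in> carrier G" for g x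
      using G.repr_independence[OF that H.subgroup_axioms] by (simp add: r_def)
    have rH: "g \<otimes>\<^bsub>G\<^esub> inv\<^bsub>G\<^esub> r g \<in> H" if "g \<in> carrier G" for g
    proof -
      from r[OF that] obtain h where "h \<in> H" "r g = h \<otimes>\<^bsub>G\<^esub> g" by (auto simp: r_coset_def)
      then show ?thesis using that by (simp add: G.inv_mult_group flip: G.m_assoc)
    qed
    \<comment> \<open>The tensor f(g) \<otimes> g rewritten at the representative of its coset; the
      difference is an instance of \<open>I_single\<close>.\<close>
    define d where "d g = single (r g) (f g \<otimes>\<^bsub>B\<^esub> e (g \<otimes>\<^bsub>G\<^esub> inv\<^bsub>G\<^esub> r g))" for g
    have dI: "d g \<ominus>\<^bsub>S\<^esub> single g (f g) \<in> I" if "g \<in> carrier G" for g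
      using I_single[of "f g" "g \<otimes>\<^bsub>G\<^esub> inv\<^bsub>G\<^esub> r g" "r g"] that rH[OF that] f by (simp add: d_def G.m_assoc)
    have dc: "d g \<in> carrier S" if "g \<in> carrier G" for g using that f by (simp add: d_def)
    have "(\<Oplus>\<^bsub>S\<^esub>g\<in>carrier G. d g) = \<zero>\<^bsub>S\<^esub>"
    proof (rule skew_eqI)
      fix x assume x: "x \<in> carrier G"
      have "(\<Oplus>\<^bsub>S\<^esub>g\<in>carrier G. d g) x = (\<Oplus>\<^bsub>B\<^esub>g\<in>carrier G. d g x)"
        using x dc by (intro skew_finsum_apply finite_group) auto
      \<comment> \<open>The elements d g are supported on chosen representatives. At such an x the
        contributions come from g in Hx and add up to \<open>\<Theta> f x\<close>.\<close>
      also have "\<dots> = \<zero>\<^bsub>B\<^esub>"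
      proof (cases "r x = x")
        case False
        have "d g x = \<zero>\<^bsub>B\<^esub>" if "g \<in> carrier G" for g
        proof -
          have "x \<noteq> r g" using False r_cong[OF r[OF that] that] by metis
          then show ?thesis using x by (simp add: d_def single_def)
        qed
        then show ?thesis by (intro B.add.finprod_one_eqI) auto
      next
        case True
        have r_iff: "x = r g \<longleftrightarrow> g \<in> H #>\<^bsub>G\<^esub> x" if g: "g \<in> carrier G" for g
        proof
          assume "x = r g"
          then have "x \<in> H #>\<^bsub>G\<^esub> g" using r[OF g] by simp
          then show "g \<in> H #>\<^bsub>G\<^esub> x"
            using G.repr_independence[OF _ g H.subgroup_axioms, of x] G.rcos_self[OF g H.subgroup_axioms] by metis
        next
          assume "g \<in> H #>\<^bsub>G\<^esub> x"
          then show "x = r g" using r_cong[OF _ x] True by simp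
        qed
        have "(\<Oplus>\<^bsub>B\<^esub>g\<in>carrier G. d g x) = (\<Oplus>\<^bsub>B\<^esub>g\<in>H #>\<^bsub>G\<^esub> x. f g \<otimes>\<^bsub>B\<^esub> e (g \<otimes>\<^bsub>G\<^esub> inv\<^bsub>G\<^esub> x))"
          using x f G.r_coset_subset_G[OF H.subset x] finite_group
          by (intro B.add.finprod_mono_neutral_cong_right)
             (auto simp: d_def single_def r_iff)
        also have "\<dots> = (\<Oplus>\<^bsub>B\<^esub>h\<in>H. f (h \<otimes>\<^bsub>G\<^esub> x) \<otimes>\<^bsub>B\<^esub> e (h \<otimes>\<^bsub>G\<^esub> x \<otimes>\<^bsub>G\<^esub> inv\<^bsub>G\<^esub> x))"
        proof (rule B.finsum_bij)
          show "bij_betw (\<lambda>h. h \<otimes>\<^bsub>G\<^esub> x) H (H #>\<^bsub>G\<^esub> x)"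
            using x by (auto simp: bij_betw_def r_coset_def intro!: inj_onI)
        qed (use x f G.r_coset_subset_G[OF H.subset x] in auto)
        also have "\<dots> = \<Theta> f x"
          unfolding \<Theta>_def using x f by (intro B.finsum_cong' refl) (auto simp: G.m_assoc)
        finally show ?thesis using \<Theta>0[OF x] by simp
      qed
      finally show "(\<Oplus>\<^bsub>S\<^esub>g\<in>carrier G. d g) x = \<zero>\<^bsub>S\<^esub> x" using x by (simp add: skew_zero)
    qed (use dc in \<open>auto intro!: S.finsum_closed\<close>)
    moreover have "(\<Oplus>\<^bsub>S\<^esub>g\<in>carrier G. d g) =
      (\<Oplus>\<^bsub>S\<^esub>g\<in>carrier G. d g \<ominus>\<^bsub>S\<^esub> single g (f g)) \<oplus>\<^bsub>S\<^esub> (\<Oplus>\<^bsub>S\<^esub>g\<in>carrier G. single g (f g))"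
      using dc f by (intro S.finsum_split_add) (simp_all add: a_minus_def S.a_assoc S.l_neg)
    moreover have "(\<Oplus>\<^bsub>S\<^esub>g\<in>carrier G. d g \<ominus>\<^bsub>S\<^esub> single g (f g)) \<in> I"
      by (rule finsum_hom(1)[where T=I and h="\<lambda>x. x" and N=S])
         (use dI finite_group subgroup.m_closed[OF I_sub] subgroup.one_closed[OF I_sub]
           subgroup.subset[OF I_sub] S.abelian_monoid_axioms in auto)
    moreover note skew_sum_singles[OF f, symmetric]
    ultimately obtain i where i: "i \<in> I" "i \<oplus>\<^bsub>S\<^esub> f = \<zero>\<^bsub>S\<^esub>" by simp
    then have "f = \<ominus>\<^bsub>S\<^esub> i"
      using f subgroup.subset[OF I_sub] S.minus_equality[of f i] S.a_comm[of i f] by auto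
    then show "f \<in> I" using subgroup.m_inv_closed[OF I_sub i(1)] by (simp add: a_inv_def)
  qed
qed

end

section \<open>The induced algebra and its coset components\<close>

lemma (in normal) r_coset_translate:
  assumes "u \<in> carrier G" "z \<in> carrier G" "v \<in> carrier G"
  shows "(\<lambda>x. u \<otimes> x \<otimes> v) ` (H #> z) = H #> (u \<otimes> z \<otimes> v)"
proof (intro equalityI subsetI)
  fix y assume "y \<in> (\<lambda>x. u \<otimes> x \<otimes> v) ` (H #> z)"
  then obtain h where h: "h \<in> H" "y = u \<otimes> (h \<otimes> z) \<otimes> v" by (auto simp: r_coset_def)
  then have "y = (u \<otimes> h \<otimes> inv u) \<otimes> (u \<otimes> z \<otimes> v)"
    using assms by (simp add: m_assoc)
  then show "y \<in> H #> (u \<otimes> z \<otimes> v)"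
    using inv_op_closed2[OF assms(1) h(1)] by (auto simp: r_coset_def)
next
  fix y assume "y \<in> H #> (u \<otimes> z \<otimes> v)"
  then obtain h where h: "h \<in> H" "y = h \<otimes> (u \<otimes> z \<otimes> v)" by (auto simp: r_coset_def)
  then have "y = u \<otimes> ((inv u \<otimes> h \<otimes> u) \<otimes> z) \<otimes> v"
    using assms by (simp add: m_assoc)
  then show "y \<in> (\<lambda>x. u \<otimes> x \<otimes> v) ` (H #> z)"
    using inv_op_closed1[OF assms(1) h(1)] by (auto simp: r_coset_def)
qed

context induced_G_algebra
begin

section \<open>A as a quotient of the skew algebra\<close>

abbreviation "A \<equiv> induced_algebra R G H B act \<sigma>"

sublocale I: ideal I S using Ker_ideal by (simp add: I_eq_Ker)

definition cls :: "('g \<Rightarrow> 'b) \<Rightarrow> ('g \<Rightarrow> 'b) set" where "cls f = I +>\<^bsub>S\<^esub> f"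

text \<open>The working criterion for equality in A: scalar multiplication and the coset projections
  are well defined because \<Theta> of the result depends only on \<Theta> of the argument.\<close>

lemma cls_eq_iff:
  "f \<in> carrier S \<Longrightarrow> f' \<in> carrier S \<Longrightarrow> cls f = cls f' \<longleftrightarrow> (\<forall>x\<in>carrier G. \<Theta> f x = \<Theta> f' x)"
proof -
  assume f: "f \<in> carrier S" "f' \<in> carrier S"
  have "cls f = cls f' \<longleftrightarrow> f \<ominus>\<^bsub>S\<^esub> f' \<in> I"
    unfolding cls_def using f S.quotient_eq_iff_same_a_r_cos[OF I.ideal_axioms] by blast
  also have "\<dots> \<longleftrightarrow> (\<forall>x\<in>carrier G. \<Theta> f x \<oplus>\<^bsub>B\<^esub> \<ominus>\<^bsub>B\<^esub> \<Theta> f' x = \<zero>\<^bsub>B\<^esub>)"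
    using f S.minus_closed[OF f] unfolding I_eq_Ker Ker_def mem_Collect_eq
    by (simp only: simp_thms a_minus_def \<Theta>_add \<Theta>_minus S.a_inv_closed cong: ball_cong)
  also have "\<dots> \<longleftrightarrow> (\<forall>x\<in>carrier G. \<Theta> f x = \<Theta> f' x)"
  proof (intro ball_cong refl)
    fix x assume "x \<in> carrier G"
    then have "\<Theta> f x \<in> carrier B" "\<Theta> f' x \<in> carrier B" using f by auto
    then show "\<Theta> f x \<oplus>\<^bsub>B\<^esub> \<ominus>\<^bsub>B\<^esub> \<Theta> f' x = \<zero>\<^bsub>B\<^esub> \<longleftrightarrow> \<Theta> f x = \<Theta> f' x"
      using B.r_right_minus_eq[of "\<Theta> f x" "\<Theta> f' x"] by (simp only: a_minus_def)
  qed
  finally show ?thesis .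
qed

lemma mem_cls: "f \<in> carrier S \<Longrightarrow> f' \<in> cls f \<longleftrightarrow> f' \<in> carrier S \<and> cls f' = cls f"
  using I.a_rcos_self S.a_r_coset_subset_G[OF I.a_subset, of f]
    S.a_repr_independence[OF _ _ I.a_subgroup, of f' f]
  unfolding cls_def by blast

text \<open>Maps on the quotient are written as unions over a class; if all members give the same
  set, the union is its value at any representative.\<close>

lemma cls_Union:
  assumes "f \<in> carrier S" "\<And>f'. f' \<in> carrier S \<Longrightarrow> cls f' = cls f \<Longrightarrow> F f' = F f"
  shows "(\<Union>x\<in>cls f. F x) = F f"
proof -
  have "F x = F f" if "x \<in> cls f" for x using assms that mem_cls by blast
  moreover have "f \<in> cls f" using assms(1) mem_cls by blast
  ultimately show ?thesis by blast
qed

lemma carrier_A: "carrier A = cls ` carrier S"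
  by (auto simp: induced_algebra_def Let_def FactRing_def A_RCOSETS_def RCOSETS_def cls_def a_r_coset_def)

lemma cls_closed [simp]: "f \<in> carrier S \<Longrightarrow> cls f \<in> carrier A"
  by (simp add: carrier_A)

lemma cls_add: "f \<in> carrier S \<Longrightarrow> f' \<in> carrier S \<Longrightarrow> cls f \<oplus>\<^bsub>A\<^esub> cls f' = cls (f \<oplus>\<^bsub>S\<^esub> f')"
  by (simp add: induced_algebra_def Let_def FactRing_def cls_def I.a_rcos_sum)

lemma cls_mult: "f \<in> carrier S \<Longrightarrow> f' \<in> carrier S \<Longrightarrow> cls f \<otimes>\<^bsub>A\<^esub> cls f' = cls (f \<otimes>\<^bsub>S\<^esub> f')"
  by (simp add: induced_algebra_def Let_def FactRing_def cls_def I.rcoset_mult_add)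

lemma cls_zero: "cls \<zero>\<^bsub>S\<^esub> = \<zero>\<^bsub>A\<^esub>"
  by (simp add: induced_algebra_def Let_def FactRing_def cls_def I.a_subset)

lemma cls_one: "cls \<one>\<^bsub>S\<^esub> = \<one>\<^bsub>A\<^esub>"
  by (simp add: induced_algebra_def Let_def FactRing_def cls_def)

lemma cls_smult: assumes "r \<in> carrier R" "f \<in> carrier S" shows "r \<odot>\<^bsub>A\<^esub> cls f = cls (r \<odot>\<^bsub>S\<^esub> f)"
proof -
  have "r \<odot>\<^bsub>A\<^esub> cls f = (\<Union>x\<in>cls f. cls (r \<odot>\<^bsub>S\<^esub> x))"
    by (simp add: induced_algebra_def Let_def cls_def)
  also have "\<dots> = cls (r \<odot>\<^bsub>S\<^esub> f)"
    using assms by (intro cls_Union) (auto simp: cls_eq_iff \<Theta>_smult)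
  finally show ?thesis .
qed

lemma A_assoc_algebra: "assoc_algebra R A"
proof (rule assoc_algebra_surj[OF S.assoc_algebra_axioms B.R.is_cring, where \<rho>="\<lambda>r. r" and h=cls])
  show "(\<lambda>r. r) \<in> ring_hom R R" by (auto simp: ring_hom_def)
qed (auto simp: carrier_A cls_add cls_mult cls_zero cls_one cls_smult)

sublocale A: assoc_algebra R A by (rule A_assoc_algebra)

definition \<iota> :: "'g \<Rightarrow> ('g \<Rightarrow> 'b) set" where "\<iota> = tens R G H B act \<sigma> \<one>\<^bsub>B\<^esub>"

lemma tens_cls: "b \<in> carrier B \<Longrightarrow> tens R G H B act \<sigma> b g = cls (single g b)"
  by (simp add: tens_def cls_def pure_tensor_basis)

lemma \<iota>_cls: "\<iota> g = cls (single g \<one>\<^bsub>B\<^esub>)" by (simp add: \<iota>_def tens_cls)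

lemma \<iota>_hom: "\<iota> \<in> hom G (units_of A)"
proof (rule homI)
  have mult: "\<iota> g \<otimes>\<^bsub>A\<^esub> \<iota> g' = \<iota> (g \<otimes>\<^bsub>G\<^esub> g')" if "g \<in> carrier G" "g' \<in> carrier G" for g g'
    using that by (simp add: \<iota>_cls cls_mult single_mult_single)
  have one: "\<iota> \<one>\<^bsub>G\<^esub> = \<one>\<^bsub>A\<^esub>" by (simp add: \<iota>_cls flip: cls_one skew_one_single)
  fix g g' assume g: "g \<in> carrier G" "g' \<in> carrier G"
  have cl: "\<iota> x \<in> carrier A" for x by (simp add: \<iota>_cls)
  have "\<iota> g \<otimes>\<^bsub>A\<^esub> \<iota> (inv\<^bsub>G\<^esub> g) = \<one>\<^bsub>A\<^esub>" "\<iota> (inv\<^bsub>G\<^esub> g) \<otimes>\<^bsub>A\<^esub> \<iota> g = \<one>\<^bsub>A\<^esub>"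
    using g by (simp_all add: mult one)
  then have "\<iota> g \<in> Units A" using cl unfolding Units_def by blast
  then show "\<iota> g \<in> carrier (units_of A)" by (simp add: units_of_carrier)
  show "\<iota> (g \<otimes>\<^bsub>G\<^esub> g') = \<iota> g \<otimes>\<^bsub>units_of A\<^esub> \<iota> g'" using mult[OF g] by (simp add: units_of_mult)
qed

section \<open>The components along cosets and their projections\<close>

definition restr :: "'g set \<Rightarrow> ('g \<Rightarrow> 'b) \<Rightarrow> 'g \<Rightarrow> 'b" where
  "restr C f = (\<lambda>x\<in>carrier G. if x \<in> C then f x else \<zero>\<^bsub>B\<^esub>)"

lemma restr_closed [simp]: "f \<in> carrier S \<Longrightarrow> restr C f \<in> carrier S"
  unfolding restr_def by (rule skewI) auto

lemma rcosets_mult_left: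
  assumes C: "C \<in> rcosets\<^bsub>G\<^esub> H" and "h \<in> H" "x \<in> carrier G"
  shows "h \<otimes>\<^bsub>G\<^esub> x \<in> C \<longleftrightarrow> x \<in> C"
proof -
  obtain z where z: "z \<in> carrier G" "C = H #>\<^bsub>G\<^esub> z" using C by (auto simp: RCOSETS_def)
  have "x \<in> H #>\<^bsub>G\<^esub> z" if "h \<otimes>\<^bsub>G\<^esub> x \<in> H #>\<^bsub>G\<^esub> z"
  proof -
    from that obtain k where k: "k \<in> H" "h \<otimes>\<^bsub>G\<^esub> x = k \<otimes>\<^bsub>G\<^esub> z" by (auto simp: r_coset_def)
    then have "x = inv\<^bsub>G\<^esub> h \<otimes>\<^bsub>G\<^esub> k \<otimes>\<^bsub>G\<^esub> z" using assms z
      by (metis G.inv_closed G.inv_mult_cancel_left(1) G.m_assoc H_carrier)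
    then show ?thesis using k assms by (auto simp: r_coset_def)
  qed
  moreover have "h \<otimes>\<^bsub>G\<^esub> x \<in> H #>\<^bsub>G\<^esub> z" if "x \<in> H #>\<^bsub>G\<^esub> z"
    using that assms z by (auto simp: r_coset_def simp flip: G.m_assoc)
  ultimately show ?thesis using z by auto
qed

text \<open>A coset of H is stable under left multiplication by H, so cutting f down to C keeps the
  whole sum defining \<open>\<Theta> f x\<close> or removes all of it.\<close>

lemma \<Theta>_restr:
  assumes C: "C \<in> rcosets\<^bsub>G\<^esub> H" and f: "f \<in> carrier S" and x: "x \<in> carrier G"
  shows "\<Theta> (restr C f) x = (if x \<in> C then \<Theta> f x else \<zero>\<^bsub>B\<^esub>)"
proof -
  have "\<Theta> (restr C f) x = (\<Oplus>\<^bsub>B\<^esub>h\<in>H. if x \<in> C then f (h \<otimes>\<^bsub>G\<^esub> x) \<otimes>\<^bsub>B\<^esub> e h else \<zero>\<^bsub>B\<^esub>)"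
    unfolding \<Theta>_def using assms
    by (intro B.finsum_cong' refl) (auto simp: restr_def rcosets_mult_left)
  then show ?thesis by (simp add: \<Theta>_def)
qed

text \<open>The projection of A onto B \<otimes> z for C = zH, induced by restriction of families to
  C.\<close>

definition \<pi> :: "'g set \<Rightarrow> ('g \<Rightarrow> 'b) set \<Rightarrow> ('g \<Rightarrow> 'b) set" where
  "\<pi> C Y = (\<Union>f\<in>Y. cls (restr C f))"

lemma \<pi>_cls: "C \<in> rcosets\<^bsub>G\<^esub> H \<Longrightarrow> f \<in> carrier S \<Longrightarrow> \<pi> C (cls f) = cls (restr C f)"
  unfolding \<pi>_def by (intro cls_Union) (auto simp: cls_eq_iff \<Theta>_restr)

lemma \<pi>_lin_map:
  assumes C: "C \<in> rcosets\<^bsub>G\<^esub> H" shows "\<pi> C \<in> lin_map R A A"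
proof -
  have "restr C (f \<oplus>\<^bsub>S\<^esub> f') = restr C f \<oplus>\<^bsub>S\<^esub> restr C f'" for f f'
    by (auto simp: restr_def skew_add)
  moreover have "restr C (r \<odot>\<^bsub>S\<^esub> f) = r \<odot>\<^bsub>S\<^esub> restr C f" if "r \<in> carrier R" for r f
    using that by (auto simp: restr_def skew_smult)
  ultimately show ?thesis
    by (auto simp: lin_map_def carrier_A \<pi>_cls C cls_add cls_smult)
qed

lemma \<pi>_\<pi>:
  assumes C: "C \<in> rcosets\<^bsub>G\<^esub> H" "D \<in> rcosets\<^bsub>G\<^esub> H" and a: "a \<in> carrier A"
  shows "\<pi> C (\<pi> D a) = (if C = D then \<pi> C a else \<zero>\<^bsub>A\<^esub>)"
proof -
  obtain f where f: "f \<in> carrier S" "a = cls f" using a by (auto simp: carrier_A)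
  show ?thesis
  proof (cases "C = D")
    case True
    have "restr D (restr D f) = restr D f" by (auto simp: restr_def)
    then show ?thesis using True f C by (simp add: \<pi>_cls)
  next
    case False
    then have "C \<inter> D = {}"
      using C G.rcos_disjoint[OF H.subgroup_axioms] by (auto simp: pairwise_def disjnt_def)
    then have "restr C (restr D f) = \<zero>\<^bsub>S\<^esub>"
      by (auto simp: restr_def skew_zero intro!: restrict_ext)
    then show ?thesis using False f C by (simp add: \<pi>_cls cls_zero)
  qed
qed

lemma finite_rcosets: "finite (rcosets\<^bsub>G\<^esub> H)"
  using finite_group by (simp add: RCOSETS_def)

lemma cls_finsum:
  assumes "finite J" "\<And>i. i \<in> J \<Longrightarrow> F i \<in> carrier S"
  shows "cls (\<Oplus>\<^bsub>S\<^esub>i\<in>J. F i) = (\<Oplus>\<^bsub>A\<^esub>i\<in>J. cls (F i))"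
  by (rule finsum_hom(2)[where T="carrier S"])
     (use assms S.abelian_monoid_axioms A.abelian_monoid_axioms in \<open>auto simp: cls_add cls_zero\<close>)

lemma \<pi>_sum:
  assumes a: "a \<in> carrier A"
  shows "a = (\<Oplus>\<^bsub>A\<^esub>C\<in>rcosets\<^bsub>G\<^esub> H. \<pi> C a)"
proof -
  obtain f where f: "f \<in> carrier S" "a = cls f" using a by (auto simp: carrier_A)
  have "(\<Oplus>\<^bsub>S\<^esub>C\<in>rcosets\<^bsub>G\<^esub> H. restr C f) = f"
  proof (rule skew_eqI)
    fix x assume x: "x \<in> carrier G"
    have 1: "H #>\<^bsub>G\<^esub> x \<in> rcosets\<^bsub>G\<^esub> H" using x G.rcosetsI[OF H.subset] by auto
    have 2: "x \<in> C \<longleftrightarrow> C = H #>\<^bsub>G\<^esub> x" if CH: "C \<in> rcosets\<^bsub>G\<^esub> H" for C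
    proof
      assume "x \<in> C"
      moreover obtain z where "z \<in> carrier G" "C = H #>\<^bsub>G\<^esub> z" using CH by (auto simp: RCOSETS_def)
      ultimately show "C = H #>\<^bsub>G\<^esub> x" using G.repr_independence[OF _ _ H.subgroup_axioms] by auto
    qed (use x G.rcos_self H.subgroup_axioms in auto)
    have "(\<Oplus>\<^bsub>S\<^esub>C\<in>rcosets\<^bsub>G\<^esub> H. restr C f) x = (\<Oplus>\<^bsub>B\<^esub>C\<in>rcosets\<^bsub>G\<^esub> H. restr C f x)"
      using f x by (intro skew_finsum_apply finite_rcosets) auto
    also have "\<dots> = (\<Oplus>\<^bsub>B\<^esub>C\<in>rcosets\<^bsub>G\<^esub> H. if C = H #>\<^bsub>G\<^esub> x then f x else \<zero>\<^bsub>B\<^esub>)"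
      using f x by (intro B.finsum_cong' refl) (auto simp: restr_def 2)
    also have "\<dots> = f x"
      using f x 1 by (intro finsum_single[OF B.abelian_monoid_axioms finite_rcosets]) auto
    finally show "(\<Oplus>\<^bsub>S\<^esub>C\<in>rcosets\<^bsub>G\<^esub> H. restr C f) x = f x" .
  qed (use f in \<open>auto intro!: S.finsum_closed\<close>)
  then have "a = (\<Oplus>\<^bsub>A\<^esub>C\<in>rcosets\<^bsub>G\<^esub> H. cls (restr C f))"
    using cls_finsum[OF finite_rcosets, of "\<lambda>C. restr C f"] f by simp
  also have "\<dots> = (\<Oplus>\<^bsub>A\<^esub>C\<in>rcosets\<^bsub>G\<^esub> H. \<pi> C a)"
    using f by (intro A.finsum_cong' refl) (auto simp: \<pi>_cls)
  finally show ?thesis .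
qed

lemma rcosets_translate:
  assumes C: "C \<in> rcosets\<^bsub>G\<^esub> H" and uv: "u \<in> carrier G" "v \<in> carrier G"
  shows "(\<lambda>x. u \<otimes>\<^bsub>G\<^esub> x \<otimes>\<^bsub>G\<^esub> v) ` C \<in> rcosets\<^bsub>G\<^esub> H"
proof -
  obtain z where z: "z \<in> carrier G" "C = H #>\<^bsub>G\<^esub> z" using C by (auto simp: RCOSETS_def)
  then show ?thesis using H.r_coset_translate[of u z v] uv G.rcosetsI[OF H.subset] by auto
qed

text \<open>Multiplication by u on the left and v on the right carries B \<otimes> z to B \<otimes>
  uzv. Applied to u^-1 and \<phi>(u), this is the compatibility of the projections with the action
  of P on A.\<close>

lemma \<pi>_translate:
  assumes C: "C \<in> rcosets\<^bsub>G\<^esub> H" and uv: "u \<in> carrier G" "v \<in> carrier G" and a: "a \<in> carrier A"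
  shows "\<pi> ((\<lambda>x. u \<otimes>\<^bsub>G\<^esub> x \<otimes>\<^bsub>G\<^esub> v) ` C) (\<iota> u \<otimes>\<^bsub>A\<^esub> a \<otimes>\<^bsub>A\<^esub> \<iota> v) = \<iota> u \<otimes>\<^bsub>A\<^esub> \<pi> C a \<otimes>\<^bsub>A\<^esub> \<iota> v"
proof -
  obtain f where f: "f \<in> carrier S" "a = cls f" using a by (auto simp: carrier_A)
  have val: "(single u \<one>\<^bsub>B\<^esub> \<otimes>\<^bsub>S\<^esub> g \<otimes>\<^bsub>S\<^esub> single v \<one>\<^bsub>B\<^esub>) x =
      act (g (inv\<^bsub>G\<^esub> u \<otimes>\<^bsub>G\<^esub> (x \<otimes>\<^bsub>G\<^esub> inv\<^bsub>G\<^esub> v))) (inv\<^bsub>G\<^esub> u)" if "g \<in> carrier S" "x \<in> carrier G" for g x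
    using that uv by (simp add: mult_single_apply single_mult_apply)
  have mem: "x \<in> (\<lambda>x. u \<otimes>\<^bsub>G\<^esub> x \<otimes>\<^bsub>G\<^esub> v) ` C \<longleftrightarrow> inv\<^bsub>G\<^esub> u \<otimes>\<^bsub>G\<^esub> (x \<otimes>\<^bsub>G\<^esub> inv\<^bsub>G\<^esub> v) \<in> C" if x: "x \<in> carrier G" for x
  proof
    assume "x \<in> (\<lambda>x. u \<otimes>\<^bsub>G\<^esub> x \<otimes>\<^bsub>G\<^esub> v) ` C"
    then obtain y where y: "y \<in> C" "x = u \<otimes>\<^bsub>G\<^esub> y \<otimes>\<^bsub>G\<^esub> v" by auto
    then have "y \<in> carrier G" using H.rcosets_carrier[OF G.is_group C] by blast
    then show "inv\<^bsub>G\<^esub> u \<otimes>\<^bsub>G\<^esub> (x \<otimes>\<^bsub>G\<^esub> inv\<^bsub>G\<^esub> v) \<in> C" using y uv by (simp add: G.m_assoc)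
  next
    assume "inv\<^bsub>G\<^esub> u \<otimes>\<^bsub>G\<^esub> (x \<otimes>\<^bsub>G\<^esub> inv\<^bsub>G\<^esub> v) \<in> C"
    then show "x \<in> (\<lambda>x. u \<otimes>\<^bsub>G\<^esub> x \<otimes>\<^bsub>G\<^esub> v) ` C"
      by (rule rev_image_eqI) (use uv x in \<open>simp add: G.m_assoc\<close>)
  qed
  have cl: "single u \<one>\<^bsub>B\<^esub> \<otimes>\<^bsub>S\<^esub> g \<otimes>\<^bsub>S\<^esub> single v \<one>\<^bsub>B\<^esub> \<in> carrier S" if "g \<in> carrier S" for g
    using that by simp
  have "restr ((\<lambda>x. u \<otimes>\<^bsub>G\<^esub> x \<otimes>\<^bsub>G\<^esub> v) ` C) (single u \<one>\<^bsub>B\<^esub> \<otimes>\<^bsub>S\<^esub> f \<otimes>\<^bsub>S\<^esub> single v \<one>\<^bsub>B\<^esub>) =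
      single u \<one>\<^bsub>B\<^esub> \<otimes>\<^bsub>S\<^esub> restr C f \<otimes>\<^bsub>S\<^esub> single v \<one>\<^bsub>B\<^esub>"
  proof (rule skew_eqI)
    fix x assume x: "x \<in> carrier G"
    have "restr ((\<lambda>x. u \<otimes>\<^bsub>G\<^esub> x \<otimes>\<^bsub>G\<^esub> v) ` C) (single u \<one>\<^bsub>B\<^esub> \<otimes>\<^bsub>S\<^esub> f \<otimes>\<^bsub>S\<^esub> single v \<one>\<^bsub>B\<^esub>) x =
      (if inv\<^bsub>G\<^esub> u \<otimes>\<^bsub>G\<^esub> (x \<otimes>\<^bsub>G\<^esub> inv\<^bsub>G\<^esub> v) \<in> C then act (f (inv\<^bsub>G\<^esub> u \<otimes>\<^bsub>G\<^esub> (x \<otimes>\<^bsub>G\<^esub> inv\<^bsub>G\<^esub> v))) (inv\<^bsub>G\<^esub> u) else \<zero>\<^bsub>B\<^esub>)"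
      using x by (simp add: restr_def mem val[OF f(1)] del: image_iff)
    also have "\<dots> = (single u \<one>\<^bsub>B\<^esub> \<otimes>\<^bsub>S\<^esub> restr C f \<otimes>\<^bsub>S\<^esub> single v \<one>\<^bsub>B\<^esub>) x"
      using x uv by (simp add: val[OF restr_closed[OF f(1)]]) (simp add: restr_def)
    finally show "restr ((\<lambda>x. u \<otimes>\<^bsub>G\<^esub> x \<otimes>\<^bsub>G\<^esub> v) ` C) (single u \<one>\<^bsub>B\<^esub> \<otimes>\<^bsub>S\<^esub> f \<otimes>\<^bsub>S\<^esub> single v \<one>\<^bsub>B\<^esub>) x =
      (single u \<one>\<^bsub>B\<^esub> \<otimes>\<^bsub>S\<^esub> restr C f \<otimes>\<^bsub>S\<^esub> single v \<one>\<^bsub>B\<^esub>) x" .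
  qed (use f cl in auto)
  then show ?thesis
    using f C rcosets_translate[OF C uv] cl[OF f(1)]
    by (simp add: \<iota>_cls cls_mult \<pi>_cls)
qed

text \<open>The set of tensors b \<otimes> z, with b in B and z running through a coset, is not
  visibly closed under addition. As the image of a linear projection it is a submodule.\<close>

lemma tens_part_eq:
  assumes C: "C \<in> rcosets\<^bsub>G\<^esub> H" shows "tens_part R G H B act \<sigma> C = \<pi> C ` carrier A"
proof (intro equalityI subsetI)
  fix a assume "a \<in> tens_part R G H B act \<sigma> C"
  then obtain b z where bz: "b \<in> carrier B" "z \<in> C" "a = cls (single z b)"
    by (auto simp: tens_part_def tens_cls)
  have "restr C (single z b) = single z b" using bz by (auto simp: restr_def single_def)
  then have "a = \<pi> C a" using bz C \<pi>_cls[OF C, of "single z b"] by simp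
  moreover have "a \<in> carrier A" using bz by simp
  ultimately show "a \<in> \<pi> C ` carrier A" by (rule image_eqI)
next
  fix a assume "a \<in> \<pi> C ` carrier A"
  then obtain f where f: "f \<in> carrier S" "a = cls (restr C f)" using C by (auto simp: carrier_A \<pi>_cls)
  obtain z where z: "z \<in> carrier G" "C = H #>\<^bsub>G\<^esub> z" using C by (auto simp: RCOSETS_def)
  have zC: "z \<in> C" using z G.rcos_self H.subgroup_axioms by auto
  \<comment> \<open>All of f on C is collected at the single representative z; by
    \<open>\<Theta>_translate\<close> the coefficient at z determines those at the other points of
    C.\<close>
  have "\<Theta> (restr C f) x = \<Theta> (single z (\<Theta> f z)) x" if x: "x \<in> carrier G" for x
  proof (cases "x \<in> C")
    case True
    then obtain k where k: "k \<in> H" "x = k \<otimes>\<^bsub>G\<^esub> z" by (auto simp: z r_coset_def)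
    then have "\<Theta> f x = \<Theta> f z \<otimes>\<^bsub>B\<^esub> e (inv\<^bsub>G\<^esub> k)" using f z by (simp add: \<Theta>_translate)
    moreover have "z \<otimes>\<^bsub>G\<^esub> inv\<^bsub>G\<^esub> x = inv\<^bsub>G\<^esub> k" using k z by (simp add: G.inv_mult_group)
    ultimately show ?thesis using True x z f C by (simp add: \<Theta>_restr \<Theta>_single)
  next
    case False
    then show ?thesis using x z f C by (simp add: \<Theta>_restr \<Theta>_single)
  qed
  then have "a = cls (single z (\<Theta> f z))" using f z by (simp add: cls_eq_iff)
  then show "a \<in> tens_part R G H B act \<sigma> C"
    unfolding tens_part_def mem_Collect_eq using f z zC
    by (intro exI[of _ "\<Theta> f z"] exI[of _ z]) (simp add: tens_cls)
qed

end

section \<open>Automorphisms lifting conjugation in the quotient group\<close>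

lemma Aut_eq: "Aut G P = hom (G\<lparr>carrier := P\<rparr>) (G\<lparr>carrier := P\<rparr>) \<inter> Bij P"
  by (simp add: Aut_grp_def auto_def)

lemma Aut_mult: "\<phi> \<in> Aut G P \<Longrightarrow> \<psi> \<in> Aut G P \<Longrightarrow> \<phi> \<otimes>\<^bsub>Aut_grp G P\<^esub> \<psi> = compose P \<psi> \<phi>"
  by (simp add: Aut_grp_def AutoGroup_def BijGroup_def auto_def)

lemma Aut_one: "\<one>\<^bsub>Aut_grp G P\<^esub> = (\<lambda>u\<in>P. u)"
  by (simp add: Aut_grp_def AutoGroup_def BijGroup_def)

lemma Aut_closed: "\<phi> \<in> Aut G P \<Longrightarrow> u \<in> P \<Longrightarrow> \<phi> u \<in> P"
  by (auto simp: Aut_eq hom_def)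

lemma Aut_hom: "\<phi> \<in> Aut G P \<Longrightarrow> u \<in> P \<Longrightarrow> v \<in> P \<Longrightarrow> \<phi> (u \<otimes>\<^bsub>G\<^esub> v) = \<phi> u \<otimes>\<^bsub>G\<^esub> \<phi> v"
  by (auto simp: Aut_eq hom_def)

lemma Aut_bij: "\<phi> \<in> Aut G P \<Longrightarrow> bij_betw \<phi> P P"
  by (simp add: Aut_eq Bij_def)

lemma Aut_apply_mult:
  "\<phi> \<in> Aut G P \<Longrightarrow> \<psi> \<in> Aut G P \<Longrightarrow> u \<in> P \<Longrightarrow> (\<phi> \<otimes>\<^bsub>Aut_grp G P\<^esub> \<psi>) u = \<psi> (\<phi> u)"
  by (simp add: Aut_mult compose_def)

lemma Aut_apply_one: "u \<in> P \<Longrightarrow> \<one>\<^bsub>Aut_grp G P\<^esub> u = u"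
  by (simp add: Aut_one)

text \<open>The product is opposite to that of \<open>AutoGroup\<close>, so right inverses there
  become the left inverses needed here.\<close>

lemma Aut_grp_group:
  assumes "group G" "subgroup P G" shows "group (Aut_grp G P)"
proof -
  interpret Ag: group "AutoGroup (G\<lparr>carrier := P\<rparr>)"
    by (rule group.AutoGroup) (rule subgroup.subgroup_is_group[OF assms(2,1)])
  have c: "Aut G P = carrier (AutoGroup (G\<lparr>carrier := P\<rparr>))"
    by (simp add: Aut_grp_def AutoGroup_def)
  have m: "\<phi> \<otimes>\<^bsub>Aut_grp G P\<^esub> \<psi> = \<psi> \<otimes>\<^bsub>AutoGroup (G\<lparr>carrier := P\<rparr>)\<^esub> \<phi>" for \<phi> \<psi>
    by (simp add: Aut_grp_def)
  have o: "\<one>\<^bsub>Aut_grp G P\<^esub> = \<one>\<^bsub>AutoGroup (G\<lparr>carrier := P\<rparr>)\<^esub>"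
    by (simp add: Aut_grp_def)
  show ?thesis
    by (rule groupI) (auto simp: c m o Ag.m_assoc intro: Ag.r_inv Ag.inv_closed)
qed

lemma Aut_inv_apply:
  assumes "group G" "subgroup P G" "\<phi> \<in> Aut G P" "u \<in> P"
  shows "inv\<^bsub>Aut_grp G P\<^esub> \<phi> \<in> Aut G P" "(inv\<^bsub>Aut_grp G P\<^esub> \<phi>) (\<phi> u) = u" "\<phi> ((inv\<^bsub>Aut_grp G P\<^esub> \<phi>) u) = u"
proof -
  interpret Ag: group "Aut_grp G P" by (rule Aut_grp_group[OF assms(1,2)])
  show c: "inv\<^bsub>Aut_grp G P\<^esub> \<phi> \<in> Aut G P" using assms by simp
  show "(inv\<^bsub>Aut_grp G P\<^esub> \<phi>) (\<phi> u) = u"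
    using Aut_apply_mult[OF assms(3) c assms(4)] Aut_apply_one[OF assms(4)] assms by (metis Ag.r_inv)
  show "\<phi> ((inv\<^bsub>Aut_grp G P\<^esub> \<phi>) u) = u"
    using Aut_apply_mult[OF c assms(3,4)] Aut_apply_one[OF assms(4)] assms by (metis Ag.l_inv)
qed

lemma finite_Aut:
  assumes "finite P" shows "finite (Aut G P)"
proof (rule finite_subset)
  show "Aut G P \<subseteq> P \<rightarrow>\<^sub>E P"
    by (auto simp: Aut_eq Bij_def hom_def PiE_def)
qed (use assms in \<open>auto intro: finite_PiE\<close>)

lemma normalizer_conj:
  assumes G: "group G" and P: "subgroup P G" and x: "x \<in> normalizer G P"
  shows "x \<in> carrier G" "u \<in> P \<Longrightarrow> x \<otimes>\<^bsub>G\<^esub> u \<otimes>\<^bsub>G\<^esub> inv\<^bsub>G\<^esub> x \<in> P" "u \<in> P \<Longrightarrow> conj_by G u x \<in> P"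
proof -
  interpret group G by fact
  have PG: "P \<subseteq> carrier G" using subgroup.subset[OF P] .
  have *: "y \<otimes>\<^bsub>G\<^esub> u \<otimes>\<^bsub>G\<^esub> inv\<^bsub>G\<^esub> y \<in> P" if "y \<in> normalizer G P" "u \<in> P" for y u
  proof -
    have "y <#\<^bsub>G\<^esub> P #>\<^bsub>G\<^esub> inv\<^bsub>G\<^esub> y = P" using that PG by (simp add: normalizer_def stabilizer_def)
    then show ?thesis using that by (auto simp: l_coset_def r_coset_def)
  qed
  show xG: "x \<in> carrier G" using x by (simp add: normalizer_def stabilizer_def)
  show "x \<otimes>\<^bsub>G\<^esub> u \<otimes>\<^bsub>G\<^esub> inv\<^bsub>G\<^esub> x \<in> P" if "u \<in> P" using *[OF x that] .
  have "inv\<^bsub>G\<^esub> x \<in> normalizer G P"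
    using normalizer_imp_subgroup[OF PG] x by (simp add: subgroup.m_inv_closed)
  then show "conj_by G u x \<in> P" if "u \<in> P" using *[of "inv\<^bsub>G\<^esub> x" u] that xG by (simp add: conj_by_def)
qed

lemma conj_aut_Aut:
  assumes G: "group G" and P: "subgroup P G" and x: "x \<in> normalizer G P"
  shows "conj_aut G P x \<in> Aut G P"
proof -
  interpret group G by fact
  have PG: "u \<in> P \<Longrightarrow> u \<in> carrier G" for u using subgroup.subset[OF P] by auto
  note n = normalizer_conj[OF G P x]
  have "bij_betw (conj_aut G P x) P P"
    by (rule bij_betw_byWitness[where f'="\<lambda>u. x \<otimes>\<^bsub>G\<^esub> u \<otimes>\<^bsub>G\<^esub> inv\<^bsub>G\<^esub> x"])
       (use n PG in \<open>auto simp: conj_aut_def conj_by_def m_assoc\<close>)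
  moreover have "conj_aut G P x \<in> hom (G\<lparr>carrier := P\<rparr>) (G\<lparr>carrier := P\<rparr>)"
    using n PG subgroup.m_closed[OF P] by (auto simp: hom_def conj_aut_def conj_by_def m_assoc)
  ultimately show ?thesis by (auto simp: Aut_eq Bij_def conj_aut_def)
qed

text \<open>The reversed product of automorphisms is what makes this hold without swapping factors:
  conjugating by xy means conjugating by x first and then by y.\<close>

lemma conj_aut_mult:
  assumes G: "group G" and P: "subgroup P G" and x: "x \<in> normalizer G P" and y: "y \<in> normalizer G P"
  shows "conj_aut G P (x \<otimes>\<^bsub>G\<^esub> y) = conj_aut G P x \<otimes>\<^bsub>Aut_grp G P\<^esub> conj_aut G P y"
proof -
  interpret group G by fact
  have PG: "u \<in> P \<Longrightarrow> u \<in> carrier G" for u using subgroup.subset[OF P] by auto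
  note n = normalizer_conj[OF G P x] normalizer_conj(1)[OF G P y]
  show ?thesis
    unfolding Aut_mult[OF conj_aut_Aut[OF G P x] conj_aut_Aut[OF G P y]] compose_def
    using n PG by (auto simp: conj_aut_def conj_by_def m_assoc inv_mult_group intro!: restrict_ext)
qed

text \<open>Products in \<open>G Mod H\<close> are to stay group products, accessible to the group
  laws, instead of being unfolded into products of sets.\<close>

declare mult_FactGroup [simp del] one_FactGroup [simp del]

section \<open>The correspondence between K modulo K1 and U modulo U'\<close>

locale quotient_automorphisms = H: normal H G for H and G :: "'g monoid" +
  fixes P :: "'g set"
  assumes P: "subgroup P G"
begin

abbreviation "Q \<equiv> G Mod H"
abbreviation "q \<equiv> \<lambda>x. H #>\<^bsub>G\<^esub> x"
abbreviation "Ag \<equiv> Aut_grp G P"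
abbreviation "lifts \<equiv> lifts_conj G H P"
abbreviation "K \<equiv> Aut_quot G H P"
abbreviation "K1 \<equiv> Aut_quot_one G H P"
abbreviation "U \<equiv> norm_preimage G H P"
abbreviation "U' \<equiv> cent_preimage G H P"

sublocale Q: group Q by (rule H.factorgroup_is_group)
sublocale Ag: group Ag by (rule Aut_grp_group[OF H.is_group P])

lemma P_carrier [simp, intro]: "u \<in> P \<Longrightarrow> u \<in> carrier G"
  using subgroup.subset[OF P] by auto

lemma q_mult: "x \<in> carrier G \<Longrightarrow> y \<in> carrier G \<Longrightarrow> q (x \<otimes>\<^bsub>G\<^esub> y) = q x \<otimes>\<^bsub>Q\<^esub> q y"
  by (simp add: FactGroup_def H.rcos_sum)

lemma q_closed [simp]: "x \<in> carrier G \<Longrightarrow> q x \<in> carrier Q"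
  using H.rcosetsI[OF H.subset] by (simp add: FactGroup_def)

lemma q_one: "q \<one>\<^bsub>G\<^esub> = \<one>\<^bsub>Q\<^esub>"
  using H.coset_mult_one[OF H.subset] by (simp add: FactGroup_def)

lemma q_inv: "x \<in> carrier G \<Longrightarrow> q (inv\<^bsub>G\<^esub> x) = inv\<^bsub>Q\<^esub> (q x)"
  by (rule Q.inv_equality[symmetric]) (auto simp flip: q_mult q_one)

text \<open>Clearing the inverse of g gives an intertwining relation between \<phi> and g in the
  quotient group. In this form lifting pairs can be composed and inverted.\<close>

lemma lifts_iff:
  assumes \<phi>: "\<phi> \<in> Aut G P" and g: "g \<in> carrier G"
  shows "lifts \<phi> g \<longleftrightarrow> (\<forall>u\<in>P. q g \<otimes>\<^bsub>Q\<^esub> q (\<phi> u) = q u \<otimes>\<^bsub>Q\<^esub> q g)"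
  unfolding lifts_conj_def
proof (intro ball_cong refl)
  fix u assume u: "u \<in> P"
  have "q (conj_by G u g) = inv\<^bsub>Q\<^esub> q g \<otimes>\<^bsub>Q\<^esub> (q u \<otimes>\<^bsub>Q\<^esub> q g)"
    using u g by (simp add: conj_by_def q_mult q_inv Q.m_assoc)
  then show "q (\<phi> u) = q (conj_by G u g) \<longleftrightarrow> q g \<otimes>\<^bsub>Q\<^esub> q (\<phi> u) = q u \<otimes>\<^bsub>Q\<^esub> q g"
    using u g Aut_closed[OF \<phi> u] by (metis P_carrier Q.inv_solve_left Q.m_closed q_closed)
qed

lemma lifts_cong: "q g = q g' \<Longrightarrow> g \<in> carrier G \<Longrightarrow> g' \<in> carrier G \<Longrightarrow> \<phi> \<in> Aut G P \<Longrightarrow> lifts \<phi> g \<longleftrightarrow> lifts \<phi> g'"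
  by (simp add: lifts_iff)

text \<open>Together with \<open>lifts_inv\<close> this makes the lifting pairs (\<phi>, g) a
  subgroup of Aut(P) x G. The subgroup, normality and correspondence statements below are all read
  off from it.\<close>

lemma lifts_mult:
  assumes c: "\<phi> \<in> Aut G P" "\<psi> \<in> Aut G P" "g \<in> carrier G" "g' \<in> carrier G" and l: "lifts \<phi> g" "lifts \<psi> g'"
  shows "lifts (\<phi> \<otimes>\<^bsub>Ag\<^esub> \<psi>) (g \<otimes>\<^bsub>G\<^esub> g')"
proof -
  have "q (g \<otimes>\<^bsub>G\<^esub> g') \<otimes>\<^bsub>Q\<^esub> q ((\<phi> \<otimes>\<^bsub>Ag\<^esub> \<psi>) u) = q u \<otimes>\<^bsub>Q\<^esub> q (g \<otimes>\<^bsub>G\<^esub> g')" if u: "u \<in> P" for u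
  proof -
    note v = Aut_closed[OF c(1) u] Aut_closed[OF c(2) Aut_closed[OF c(1) u]]
    have "q g \<otimes>\<^bsub>Q\<^esub> (q g' \<otimes>\<^bsub>Q\<^esub> q (\<psi> (\<phi> u))) = q g \<otimes>\<^bsub>Q\<^esub> (q (\<phi> u) \<otimes>\<^bsub>Q\<^esub> q g')"
      using l(2) c v by (simp add: lifts_iff)
    also have "\<dots> = q g \<otimes>\<^bsub>Q\<^esub> q (\<phi> u) \<otimes>\<^bsub>Q\<^esub> q g'"
      using c u v by (simp add: Q.m_assoc)
    also have "\<dots> = q u \<otimes>\<^bsub>Q\<^esub> q g \<otimes>\<^bsub>Q\<^esub> q g'"
      using l(1) c u by (simp add: lifts_iff)
    finally show ?thesis using c u v by (simp add: q_mult Aut_apply_mult Q.m_assoc)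
  qed
  then show ?thesis using c by (simp add: lifts_iff)
qed

lemma lifts_one_one: "lifts \<one>\<^bsub>Ag\<^esub> \<one>\<^bsub>G\<^esub>"
  using lifts_iff[OF Ag.one_closed H.one_closed] by (simp add: q_one Aut_apply_one)

lemma lifts_inv:
  assumes c: "\<phi> \<in> Aut G P" "g \<in> carrier G" and l: "lifts \<phi> g"
  shows "lifts (inv\<^bsub>Ag\<^esub> \<phi>) (inv\<^bsub>G\<^esub> g)"
proof -
  have "q (inv\<^bsub>G\<^esub> g) \<otimes>\<^bsub>Q\<^esub> q ((inv\<^bsub>Ag\<^esub> \<phi>) u) = q u \<otimes>\<^bsub>Q\<^esub> q (inv\<^bsub>G\<^esub> g)" if u: "u \<in> P" for u
  proof -
    let ?v = "(inv\<^bsub>Ag\<^esub> \<phi>) u"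
    have v: "?v \<in> P" "\<phi> ?v = u"
      using Aut_inv_apply[OF H.is_group P c(1) u] Aut_closed[OF _ u] by auto
    then have "q g \<otimes>\<^bsub>Q\<^esub> q u = q ?v \<otimes>\<^bsub>Q\<^esub> q g" using l v(1) unfolding lifts_iff[OF c] by force
    then have "q ?v = q g \<otimes>\<^bsub>Q\<^esub> q u \<otimes>\<^bsub>Q\<^esub> inv\<^bsub>Q\<^esub> q g"
      using c u v(1) by (simp add: Q.m_assoc)
    then show ?thesis using c u v(1) by (simp add: q_inv Q.m_assoc)
  qed
  then show ?thesis using c by (simp add: lifts_iff)
qed

lemma lifts_one_iff: "g \<in> U' \<longleftrightarrow> g \<in> carrier G \<and> lifts \<one>\<^bsub>Ag\<^esub> g"
  by (auto simp: cent_preimage_def centralizer_def image_in_quot_def lifts_iff Aut_apply_one)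

lemma K1_iff: "\<phi> \<in> K1 \<longleftrightarrow> \<phi> \<in> Aut G P \<and> lifts \<phi> \<one>\<^bsub>G\<^esub>"
  by (auto simp: Aut_quot_one_def lifts_conj_def conj_by_def)

lemma K_iff: "\<phi> \<in> K \<longleftrightarrow> \<phi> \<in> Aut G P \<and> (\<exists>g\<in>carrier G. lifts \<phi> g)"
  by (simp add: Aut_quot_def)

lemma K1_K: "K1 \<subseteq> K"
  using H.one_closed unfolding K1_iff K_iff subset_iff by blast

text \<open>U is the projection of the lifting pairs to G. If \<phi> lifts g, conjugation by g
  permutes the image of P because \<phi> permutes P, which puts the coset of g into the
  normalizer.\<close>

lemma U_iff: "g \<in> U \<longleftrightarrow> g \<in> carrier G \<and> (\<exists>\<phi>\<in>Aut G P. lifts \<phi> g)"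
proof
  assume "g \<in> U"
  then obtain g' \<phi> where g: "g \<in> carrier G" "g' \<in> q g" "\<phi> \<in> K" "lifts \<phi> g'"
    by (auto simp: norm_preimage_def norm_quot_def)
  have g': "g' \<in> carrier G" using H.r_coset_subset_G[OF H.subset g(1)] g(2) by blast
  have "q g = q g'" using H.repr_independence[OF g(2,1) H.subgroup_axioms] .
  then show "g \<in> carrier G \<and> (\<exists>\<phi>\<in>Aut G P. lifts \<phi> g)"
    using g g' lifts_cong[of g g' \<phi>] unfolding K_iff by blast
next
  assume "g \<in> carrier G \<and> (\<exists>\<phi>\<in>Aut G P. lifts \<phi> g)"
  then obtain \<phi> where g: "g \<in> carrier G" and \<phi>: "\<phi> \<in> Aut G P" "lifts \<phi> g" by blast
  have conj: "q g \<otimes>\<^bsub>Q\<^esub> q (\<phi> v) \<otimes>\<^bsub>Q\<^esub> inv\<^bsub>Q\<^esub> q g = q v" if "v \<in> P" for v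
    using \<phi> g that Aut_closed[OF \<phi>(1) that] by (simp add: lifts_iff Q.m_assoc)
  have "q g <#\<^bsub>Q\<^esub> image_in_quot G H P #>\<^bsub>Q\<^esub> inv\<^bsub>Q\<^esub> q g = (\<lambda>u. q g \<otimes>\<^bsub>Q\<^esub> q u \<otimes>\<^bsub>Q\<^esub> inv\<^bsub>Q\<^esub> q g) ` P"
    by (auto simp: l_coset_def r_coset_def image_in_quot_def)
  also have "\<dots> = (\<lambda>u. q g \<otimes>\<^bsub>Q\<^esub> q u \<otimes>\<^bsub>Q\<^esub> inv\<^bsub>Q\<^esub> q g) ` \<phi> ` P"
    using Aut_bij[OF \<phi>(1)] by (simp add: bij_betw_def)
  also have "\<dots> = image_in_quot G H P"
    unfolding image_in_quot_def image_image by (rule image_cong[OF refl conj])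
  finally have "q g \<in> normalizer Q (image_in_quot G H P)"
    using g by (auto simp: normalizer_def stabilizer_def image_in_quot_def)
  moreover have "g \<in> q g" by (rule H.rcos_self[OF g H.subgroup_axioms])
  moreover have "\<phi> \<in> K" using g \<phi> unfolding K_iff by blast
  ultimately show "g \<in> U"
    using g \<phi> unfolding norm_preimage_def norm_quot_def by blast
qed

lemma K_subgroup: "subgroup K Ag"
proof (rule Ag.subgroupI)
  show "K \<noteq> {}" using lifts_one_one Ag.one_closed H.one_closed K_iff by blast
  fix \<phi> assume "\<phi> \<in> K"
  then show "inv\<^bsub>Ag\<^esub> \<phi> \<in> K" using lifts_inv H.inv_closed by (fastforce simp: K_iff)
next
  fix \<phi> \<psi> assume "\<phi> \<in> K" "\<psi> \<in> K"
  then show "\<phi> \<otimes>\<^bsub>Ag\<^esub> \<psi> \<in> K" using lifts_mult H.m_closed by (fastforce simp: K_iff)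
qed (auto simp: K_iff)

lemma K1_subgroup: "subgroup K1 Ag"
proof (rule Ag.subgroupI)
  show "K1 \<noteq> {}" using lifts_one_one Ag.one_closed K1_iff by blast
  fix \<phi> assume "\<phi> \<in> K1"
  then show "inv\<^bsub>Ag\<^esub> \<phi> \<in> K1" using lifts_inv[of \<phi> "\<one>\<^bsub>G\<^esub>"] by (simp add: K1_iff)
next
  fix \<phi> \<psi> assume "\<phi> \<in> K1" "\<psi> \<in> K1"
  then show "\<phi> \<otimes>\<^bsub>Ag\<^esub> \<psi> \<in> K1" using lifts_mult[of \<phi> \<psi> "\<one>\<^bsub>G\<^esub>" "\<one>\<^bsub>G\<^esub>"] by (simp add: K1_iff)
qed (auto simp: K1_iff)

lemma U_subgroup: "subgroup U G"
proof (rule H.subgroupI)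
  show "U \<noteq> {}" using lifts_one_one Ag.one_closed H.one_closed U_iff by blast
  fix g assume "g \<in> U"
  then show "inv\<^bsub>G\<^esub> g \<in> U" using lifts_inv Ag.inv_closed H.inv_closed unfolding U_iff by blast
next
  fix g g' assume "g \<in> U" "g' \<in> U"
  then show "g \<otimes>\<^bsub>G\<^esub> g' \<in> U" using lifts_mult Ag.m_closed H.m_closed unfolding U_iff by blast
qed (simp add: U_iff subset_iff)

lemma U'_subgroup: "subgroup U' G"
proof (rule H.subgroupI)
  show "U' \<noteq> {}" using lifts_one_one H.one_closed lifts_one_iff by blast
  fix g assume "g \<in> U'"
  then show "inv\<^bsub>G\<^esub> g \<in> U'" using lifts_inv[of "\<one>\<^bsub>Ag\<^esub>" g] by (simp add: lifts_one_iff)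
next
  fix g g' assume "g \<in> U'" "g' \<in> U'"
  then show "g \<otimes>\<^bsub>G\<^esub> g' \<in> U'"
    using lifts_mult[of "\<one>\<^bsub>Ag\<^esub>" "\<one>\<^bsub>Ag\<^esub>" g g'] by (simp add: lifts_one_iff)
qed (simp add: lifts_one_iff subset_iff)

lemma U'_U: "U' \<subseteq> U"
  using Ag.one_closed unfolding lifts_one_iff U_iff subset_iff by blast

lemma U'_normal: "U' \<lhd> G\<lparr>carrier := U\<rparr>"
proof (rule group.normal_invI)
  show "group (G\<lparr>carrier := U\<rparr>)" by (rule subgroup.subgroup_is_group[OF U_subgroup H.is_group])
  show "subgroup U' (G\<lparr>carrier := U\<rparr>)" by (rule H.subgroup_incl[OF U'_subgroup U_subgroup U'_U])
  fix x h assume x: "x \<in> carrier (G\<lparr>carrier := U\<rparr>)" and h: "h \<in> U'"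
  then obtain \<phi> where \<phi>: "\<phi> \<in> Aut G P" "lifts \<phi> x" "x \<in> carrier G" by (auto simp: U_iff)
  have h': "h \<in> carrier G" "lifts \<one>\<^bsub>Ag\<^esub> h" using h by (auto simp: lifts_one_iff)
  \<comment> \<open>Conjugating the lifting pair (1, h) by (\<phi>, x) leaves 1 in the first place
    and the conjugate of h in the second.\<close>
  have "lifts (\<phi> \<otimes>\<^bsub>Ag\<^esub> \<one>\<^bsub>Ag\<^esub> \<otimes>\<^bsub>Ag\<^esub> inv\<^bsub>Ag\<^esub> \<phi>) (x \<otimes>\<^bsub>G\<^esub> h \<otimes>\<^bsub>G\<^esub> inv\<^bsub>G\<^esub> x)"
    using \<phi> h' by (intro lifts_mult lifts_inv) auto
  then have "x \<otimes>\<^bsub>G\<^esub> h \<otimes>\<^bsub>G\<^esub> inv\<^bsub>G\<^esub> x \<in> U'" using \<phi> h' by (simp add: lifts_one_iff)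
  then show "x \<otimes>\<^bsub>G\<lparr>carrier := U\<rparr>\<^esub> h \<otimes>\<^bsub>G\<lparr>carrier := U\<rparr>\<^esub> inv\<^bsub>G\<lparr>carrier := U\<rparr>\<^esub> x \<in> U'"
    using x by (simp add: H.m_inv_consistent[OF U_subgroup])
qed

lemma K1_normal: "K1 \<lhd> Ag\<lparr>carrier := K\<rparr>"
proof (rule group.normal_invI)
  show "group (Ag\<lparr>carrier := K\<rparr>)" by (rule subgroup.subgroup_is_group[OF K_subgroup Ag.is_group])
  show "subgroup K1 (Ag\<lparr>carrier := K\<rparr>)" by (rule Ag.subgroup_incl[OF K1_subgroup K_subgroup K1_K])
  fix x h assume x: "x \<in> carrier (Ag\<lparr>carrier := K\<rparr>)" and h: "h \<in> K1"
  then obtain g where g: "g \<in> carrier G" "lifts x g" "x \<in> Aut G P" by (auto simp: K_iff)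
  have h': "h \<in> Aut G P" "lifts h \<one>\<^bsub>G\<^esub>" using h by (auto simp: K1_iff)
  have "lifts (x \<otimes>\<^bsub>Ag\<^esub> h \<otimes>\<^bsub>Ag\<^esub> inv\<^bsub>Ag\<^esub> x) (g \<otimes>\<^bsub>G\<^esub> \<one>\<^bsub>G\<^esub> \<otimes>\<^bsub>G\<^esub> inv\<^bsub>G\<^esub> g)"
    using g h' by (intro lifts_mult lifts_inv) auto
  then have "x \<otimes>\<^bsub>Ag\<^esub> h \<otimes>\<^bsub>Ag\<^esub> inv\<^bsub>Ag\<^esub> x \<in> K1" using g h' by (simp add: K1_iff)
  then show "x \<otimes>\<^bsub>Ag\<lparr>carrier := K\<rparr>\<^esub> h \<otimes>\<^bsub>Ag\<lparr>carrier := K\<rparr>\<^esub> inv\<^bsub>Ag\<lparr>carrier := K\<rparr>\<^esub> x \<in> K1"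
    using x by (simp add: Ag.m_inv_consistent[OF K_subgroup])
qed

text \<open>In the group of lifting pairs the fibre over a given \<phi> is a coset of the fibre over
  1, which is U'. Varying \<phi> in its class multiplies by pairs (\<kappa>, 1) and leaves the
  second entry unchanged.\<close>

lemma class_corr_eq:
  assumes \<phi>: "\<phi> \<in> Aut G P" and g: "g \<in> carrier G" and l: "lifts \<phi> g"
  shows "class_corr G H P (K1 #>\<^bsub>Ag\<^esub> \<phi>) = U' #>\<^bsub>G\<^esub> g"
proof (intro equalityI subsetI)
  fix x assume "x \<in> class_corr G H P (K1 #>\<^bsub>Ag\<^esub> \<phi>)"
  then obtain \<kappa> where \<kappa>: "\<kappa> \<in> Aut G P" "lifts \<kappa> \<one>\<^bsub>G\<^esub>" and x: "x \<in> carrier G" "lifts (\<kappa> \<otimes>\<^bsub>Ag\<^esub> \<phi>) x"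
    by (auto simp: class_corr_def r_coset_def K1_iff U_iff)
  \<comment> \<open>The pair (\<kappa>\<phi>, x) is divided by (\<kappa>, 1) on the left and by
    (\<phi>, g) on the right, so that the first entry becomes 1.\<close>
  have "lifts (inv\<^bsub>Ag\<^esub> \<kappa> \<otimes>\<^bsub>Ag\<^esub> (\<kappa> \<otimes>\<^bsub>Ag\<^esub> \<phi>) \<otimes>\<^bsub>Ag\<^esub> inv\<^bsub>Ag\<^esub> \<phi>) (inv\<^bsub>G\<^esub> \<one>\<^bsub>G\<^esub> \<otimes>\<^bsub>G\<^esub> x \<otimes>\<^bsub>G\<^esub> inv\<^bsub>G\<^esub> g)"
    using \<kappa> x \<phi> g l by (intro lifts_mult lifts_inv) auto
  then have "x \<otimes>\<^bsub>G\<^esub> inv\<^bsub>G\<^esub> g \<in> U'" using \<kappa> x \<phi> g by (simp add: lifts_one_iff)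
  then show "x \<in> U' #>\<^bsub>G\<^esub> g"
    unfolding r_coset_def using x g by (auto intro!: bexI[of _ "x \<otimes>\<^bsub>G\<^esub> inv\<^bsub>G\<^esub> g"] simp: H.m_assoc)
next
  fix x assume "x \<in> U' #>\<^bsub>G\<^esub> g"
  then obtain c where c: "c \<in> carrier G" "lifts \<one>\<^bsub>Ag\<^esub> c" "x = c \<otimes>\<^bsub>G\<^esub> g"
    by (auto simp: r_coset_def lifts_one_iff)
  have "lifts (\<one>\<^bsub>Ag\<^esub> \<otimes>\<^bsub>Ag\<^esub> \<phi>) x" unfolding c(3) using c \<phi> g l by (intro lifts_mult) auto
  then have "lifts \<phi> x" using \<phi> by simp
  moreover have "\<phi> \<in> K1 #>\<^bsub>Ag\<^esub> \<phi>" by (rule Ag.rcos_self[OF \<phi> K1_subgroup])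
  moreover have "x \<in> U" using calculation c g \<phi> by (auto simp: U_iff)
  ultimately show "x \<in> class_corr G H P (K1 #>\<^bsub>Ag\<^esub> \<phi>)" by (auto simp: class_corr_def)
qed

lemma carrier_KK1: "carrier (KK1 G H P) = (\<lambda>\<phi>. K1 #>\<^bsub>Ag\<^esub> \<phi>) ` K"
  by (auto simp: KK1_def FactGroup_def RCOSETS_def r_coset_def)

lemma carrier_UU': "carrier (UU' G H P) = (\<lambda>g. U' #>\<^bsub>G\<^esub> g) ` U"
  by (auto simp: UU'_def FactGroup_def RCOSETS_def r_coset_def)

lemma mult_KK1:
  assumes "\<phi> \<in> K" "\<psi> \<in> K"
  shows "(K1 #>\<^bsub>Ag\<^esub> \<phi>) \<otimes>\<^bsub>KK1 G H P\<^esub> (K1 #>\<^bsub>Ag\<^esub> \<psi>) = K1 #>\<^bsub>Ag\<^esub> (\<phi> \<otimes>\<^bsub>Ag\<^esub> \<psi>)"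
  using normal.rcos_sum[OF K1_normal, of \<phi> \<psi>] assms
  by (simp add: KK1_def FactGroup_def r_coset_def set_mult_def)

lemma mult_UU':
  assumes "g \<in> U" "g' \<in> U"
  shows "(U' #>\<^bsub>G\<^esub> g) \<otimes>\<^bsub>UU' G H P\<^esub> (U' #>\<^bsub>G\<^esub> g') = U' #>\<^bsub>G\<^esub> (g \<otimes>\<^bsub>G\<^esub> g')"
  using normal.rcos_sum[OF U'_normal, of g g'] assms
  by (simp add: UU'_def FactGroup_def r_coset_def set_mult_def)

lemma group_UU': "group (UU' G H P)"
  unfolding UU'_def by (rule normal.factorgroup_is_group[OF U'_normal])

lemma one_UU': "\<one>\<^bsub>UU' G H P\<^esub> = U'"
  by (simp add: UU'_def FactGroup_def)

lemma KE: assumes "\<phi> \<in> K" obtains g where "\<phi> \<in> Aut G P" "g \<in> carrier G" "g \<in> U" "lifts \<phi> g"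
  using assms by (auto simp: K_iff U_iff)

text \<open>By \<open>class_corr_eq\<close> the image of a class can be computed from any lifting
  pair. Products of pairs give multiplicativity, the two projections give totality and
  surjectivity.\<close>

lemma class_corr_iso: "class_corr G H P \<in> iso (KK1 G H P) (UU' G H P)"
proof -
  have hom: "class_corr G H P \<in> hom (KK1 G H P) (UU' G H P)"
  proof (rule homI)
    fix x assume "x \<in> carrier (KK1 G H P)"
    then obtain \<phi> where "x = K1 #>\<^bsub>Ag\<^esub> \<phi>" "\<phi> \<in> K" by (auto simp: carrier_KK1)
    then show "class_corr G H P x \<in> carrier (UU' G H P)"
      by (metis KE class_corr_eq carrier_UU' imageI)
  next
    fix x y assume "x \<in> carrier (KK1 G H P)" "y \<in> carrier (KK1 G H P)"
    then obtain \<phi> \<psi> where xy: "x = K1 #>\<^bsub>Ag\<^esub> \<phi>" "\<phi> \<in> K" "y = K1 #>\<^bsub>Ag\<^esub> \<psi>" "\<psi> \<in> K"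
      by (auto simp: carrier_KK1)
    from KE[OF xy(2)] obtain g where g: "\<phi> \<in> Aut G P" "g \<in> carrier G" "g \<in> U" "lifts \<phi> g" .
    from KE[OF xy(4)] obtain g' where g': "\<psi> \<in> Aut G P" "g' \<in> carrier G" "g' \<in> U" "lifts \<psi> g'" .
    show "class_corr G H P (x \<otimes>\<^bsub>KK1 G H P\<^esub> y) = class_corr G H P x \<otimes>\<^bsub>UU' G H P\<^esub> class_corr G H P y"
      using xy g g' class_corr_eq[OF Ag.m_closed[OF g(1) g'(1)] H.m_closed[OF g(2) g'(2)] lifts_mult]
      by (simp add: mult_KK1 mult_UU' class_corr_eq)
  qed
  have "inj_on (class_corr G H P) (carrier (KK1 G H P))"
  proof (rule inj_onI)
    fix x y assume "x \<in> carrier (KK1 G H P)" "y \<in> carrier (KK1 G H P)" and eq: "class_corr G H P x = class_corr G H P y"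
    then obtain \<phi> \<psi> where xy: "x = K1 #>\<^bsub>Ag\<^esub> \<phi>" "\<phi> \<in> K" "y = K1 #>\<^bsub>Ag\<^esub> \<psi>" "\<psi> \<in> K"
      by (auto simp: carrier_KK1)
    from KE[OF xy(2)] obtain g where g: "\<phi> \<in> Aut G P" "g \<in> carrier G" "g \<in> U" "lifts \<phi> g" .
    have \<psi>: "\<psi> \<in> Aut G P" using xy K_iff by blast
    have "g \<in> class_corr G H P x"
      unfolding xy class_corr_eq[OF g(1,2,4)] by (rule H.rcos_self[OF g(2) U'_subgroup])
    then have "g \<in> class_corr G H P y" using eq by simp
    then obtain \<kappa> where \<kappa>: "\<kappa> \<in> K1" "lifts (\<kappa> \<otimes>\<^bsub>Ag\<^esub> \<psi>) g" by (auto simp: xy class_corr_def r_coset_def)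
    have \<kappa>': "\<kappa> \<in> Aut G P" using \<kappa> K1_iff by blast
    \<comment> \<open>Both (\<phi>, g) and (\<kappa>\<psi>, g) are lifting pairs; their quotient has
      second entry 1, so its first entry lies in K1.\<close>
    have "lifts (\<phi> \<otimes>\<^bsub>Ag\<^esub> inv\<^bsub>Ag\<^esub> (\<kappa> \<otimes>\<^bsub>Ag\<^esub> \<psi>)) (g \<otimes>\<^bsub>G\<^esub> inv\<^bsub>G\<^esub> g)"
      using g \<kappa> \<kappa>' \<psi> by (intro lifts_mult lifts_inv) auto
    then have "\<phi> \<otimes>\<^bsub>Ag\<^esub> inv\<^bsub>Ag\<^esub> (\<kappa> \<otimes>\<^bsub>Ag\<^esub> \<psi>) \<in> K1" using g \<kappa>' \<psi> by (simp add: K1_iff)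
    then have "\<phi> \<otimes>\<^bsub>Ag\<^esub> inv\<^bsub>Ag\<^esub> (\<kappa> \<otimes>\<^bsub>Ag\<^esub> \<psi>) \<otimes>\<^bsub>Ag\<^esub> \<kappa> \<in> K1" using \<kappa> subgroup.m_closed[OF K1_subgroup] by blast
    moreover have "\<phi> \<otimes>\<^bsub>Ag\<^esub> inv\<^bsub>Ag\<^esub> (\<kappa> \<otimes>\<^bsub>Ag\<^esub> \<psi>) \<otimes>\<^bsub>Ag\<^esub> \<kappa> \<otimes>\<^bsub>Ag\<^esub> \<psi> = \<phi>"
      using g \<kappa>' \<psi> by (simp add: Ag.m_assoc)
    ultimately have "\<phi> \<in> K1 #>\<^bsub>Ag\<^esub> \<psi>" unfolding r_coset_def by blast
    then show "x = y" unfolding xy using Ag.repr_independence[OF _ \<psi> K1_subgroup] by simp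
  qed
  moreover have "carrier (UU' G H P) \<subseteq> class_corr G H P ` carrier (KK1 G H P)"
  proof
    fix x assume "x \<in> carrier (UU' G H P)"
    then obtain g where g: "g \<in> U" "x = U' #>\<^bsub>G\<^esub> g" by (auto simp: carrier_UU')
    then obtain \<phi> where \<phi>: "g \<in> carrier G" "\<phi> \<in> Aut G P" "lifts \<phi> g" by (auto simp: U_iff)
    then have "x = class_corr G H P (K1 #>\<^bsub>Ag\<^esub> \<phi>)" using g class_corr_eq by simp
    moreover have "\<phi> \<in> K" using \<phi> by (auto simp: K_iff)
    ultimately show "x \<in> class_corr G H P ` carrier (KK1 G H P)" by (auto simp: carrier_KK1)
  qed
  ultimately show ?thesis
    using hom by (auto simp: iso_def bij_betw_def hom_def)
qed

end

section \<open>Twisted traces\<close>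

lemma (in abelian_subgroup) a_coset_eq_iff:
  assumes "x \<in> carrier G" "y \<in> carrier G"
  shows "H +> x = H +> y \<longleftrightarrow> x \<ominus> y \<in> H"
proof -
  have "x \<ominus> y \<in> H \<longleftrightarrow> x \<in> H +> y"
    using a_rcos_module[of y x] assms abelian_group_axioms by (simp add: a_minus_def)
  also have "\<dots> \<longleftrightarrow> H +> x = H +> y"
    using a_repr_independence'[of x y] a_rcos_self[of x] assms by metis
  finally show ?thesis by simp
qed

text \<open>The additive counterpart of \<open>cls_Union\<close>: it evaluates a map on a quotient
  that is written as a union over a coset.\<close>

lemma (in abelian_subgroup) a_coset_UN:
  assumes x: "x \<in> carrier G" and F: "\<And>y. y \<in> carrier G \<Longrightarrow> y \<ominus> x \<in> H \<Longrightarrow> F y = F x"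
  shows "(\<Union>y\<in>H +> x. F y) = F x"
proof -
  have "F y = F x" if y: "y \<in> H +> x" for y
  proof (rule F)
    show yG: "y \<in> carrier G" using a_elemrcos_carrier[OF x y] .
    show "y \<ominus> x \<in> H" using a_repr_independence'[OF y x] a_coset_eq_iff[OF yG x] by simp
  qed
  then show ?thesis using a_rcos_self[OF x] by blast
qed

text \<open>Only the interior structure of A enters here; the decomposition of A along G/H is added
  later, in \<open>graded_brauer\<close>.\<close>

locale brauer = G: group G + A: assoc_algebra R A
  for G :: "'g monoid" and R :: "'r ring" and A :: "('r, 'a) module" +
  fixes \<iota> :: "'g \<Rightarrow> 'a" and P :: "'g set" and J :: "'r set"
  assumes \<iota>: "\<iota> \<in> hom G (units_of A)" and P: "subgroup P G" and finite_P: "finite P"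
    and J: "ideal J R"
begin

sublocale J: ideal J R by (rule J)

abbreviation "Ag \<equiv> Aut_grp G P"
abbreviation "Fix \<equiv> br_fixed A \<iota>"
abbreviation "D \<equiv> br_ker G P J A \<iota>"
abbreviation "V \<equiv> br_quot G P J A \<iota>"
abbreviation "N \<equiv> ext_brauer G P J A \<iota>"

lemma \<iota>_closed [simp]: "g \<in> carrier G \<Longrightarrow> \<iota> g \<in> carrier A"
  using \<iota> by (auto simp: hom_def units_of_carrier Units_def)

lemma \<iota>_mult: "g \<in> carrier G \<Longrightarrow> h \<in> carrier G \<Longrightarrow> \<iota> (g \<otimes>\<^bsub>G\<^esub> h) = \<iota> g \<otimes>\<^bsub>A\<^esub> \<iota> h"
  using \<iota> by (auto simp: hom_def units_of_mult)

lemma \<iota>_one: "\<iota> \<one>\<^bsub>G\<^esub> = \<one>\<^bsub>A\<^esub>"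
  using hom_one[OF \<iota> G.is_group A.units_group] by (simp add: units_of_one)

lemma P_carrier [simp, intro]: "u \<in> P \<Longrightarrow> u \<in> carrier G"
  using subgroup.subset[OF P] by auto

lemma P_inv [simp, intro]: "u \<in> P \<Longrightarrow> inv\<^bsub>G\<^esub> u \<in> P"
  using subgroup.m_inv_closed[OF P] .

lemma P_mult [simp, intro]: "u \<in> P \<Longrightarrow> v \<in> P \<Longrightarrow> u \<otimes>\<^bsub>G\<^esub> v \<in> P"
  using subgroup.m_closed[OF P] .

lemma \<iota>_cancel [simp]:
  "g \<in> carrier G \<Longrightarrow> \<iota> g \<otimes>\<^bsub>A\<^esub> \<iota> (inv\<^bsub>G\<^esub> g) = \<one>\<^bsub>A\<^esub>" "g \<in> carrier G \<Longrightarrow> \<iota> (inv\<^bsub>G\<^esub> g) \<otimes>\<^bsub>A\<^esub> \<iota> g = \<one>\<^bsub>A\<^esub>"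
  by (simp_all add: \<iota>_one flip: \<iota>_mult)

lemma \<iota>_cancel_left [simp]:
  assumes "g \<in> carrier G" "a \<in> carrier A"
  shows "\<iota> g \<otimes>\<^bsub>A\<^esub> (\<iota> (inv\<^bsub>G\<^esub> g) \<otimes>\<^bsub>A\<^esub> a) = a" "\<iota> (inv\<^bsub>G\<^esub> g) \<otimes>\<^bsub>A\<^esub> (\<iota> g \<otimes>\<^bsub>A\<^esub> a) = a"
  using assms by (simp_all flip: A.m_assoc)

sublocale Ag: group Ag by (rule Aut_grp_group[OF G.is_group P])

lemma Aut_P [simp, intro]: "\<phi> \<in> Aut G P \<Longrightarrow> u \<in> P \<Longrightarrow> \<phi> u \<in> P"
  by (rule Aut_closed)

lemma Aut_inv_elem: "\<phi> \<in> Aut G P \<Longrightarrow> u \<in> P \<Longrightarrow> \<phi> (inv\<^bsub>G\<^esub> u) = inv\<^bsub>G\<^esub> (\<phi> u)"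
proof (rule G.inv_equality[symmetric])
  assume *: "\<phi> \<in> Aut G P" "u \<in> P"
  then have "\<phi> (inv\<^bsub>G\<^esub> u) \<otimes>\<^bsub>G\<^esub> \<phi> u = \<phi> \<one>\<^bsub>G\<^esub>" by (simp flip: Aut_hom)
  moreover have "\<phi> \<one>\<^bsub>G\<^esub> = \<one>\<^bsub>G\<^esub>"
    using Aut_hom[OF *(1), of "\<one>\<^bsub>G\<^esub>" "\<one>\<^bsub>G\<^esub>"] subgroup.one_closed[OF P] *
    by (metis G.l_one G.one_closed G.r_cancel_one' P_carrier Aut_P)
  ultimately show "\<phi> (inv\<^bsub>G\<^esub> u) \<otimes>\<^bsub>G\<^esub> \<phi> u = \<one>\<^bsub>G\<^esub>" by simp
qed auto

lemma FixD: "m \<in> Fix M \<phi> Q \<Longrightarrow> u \<in> Q \<Longrightarrow> \<iota> u \<otimes>\<^bsub>A\<^esub> m = m \<otimes>\<^bsub>A\<^esub> \<iota> (\<phi> u)"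
  by (simp add: br_fixed_def)

lemma Fix_subset: "Fix M \<phi> Q \<subseteq> M" by (auto simp: br_fixed_def)

lemma Fix_carrier: "m \<in> Fix (carrier A) \<phi> Q \<Longrightarrow> m \<in> carrier A" by (simp add: br_fixed_def)

lemma Fix_submodule:
  assumes M: "submodule M R A" and \<phi>: "\<phi> \<in> Aut G P" and Q: "Q \<subseteq> P"
  shows "submodule (Fix M \<phi> Q) R A"
proof (rule A.submoduleI)
  note E = A.submoduleE[OF M]
  have c: "x \<in> carrier A" if "x \<in> M" for x using E that by auto
  have i: "\<iota> u \<in> carrier A" "\<iota> (\<phi> u) \<in> carrier A" if "u \<in> Q" for u
    using that Q \<phi> by auto
  show "Fix M \<phi> Q \<subseteq> carrier A" using c by (auto simp: br_fixed_def)
  show "\<zero>\<^bsub>A\<^esub> \<in> Fix M \<phi> Q"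
    using i subgroup.one_closed[OF submodule.axioms(1)[OF M]] by (auto simp: br_fixed_def)
  show "\<ominus>\<^bsub>A\<^esub> a \<in> Fix M \<phi> Q" if "a \<in> Fix M \<phi> Q" for a
    using that i c E by (auto simp: br_fixed_def A.r_minus A.l_minus)
  show "a \<oplus>\<^bsub>A\<^esub> b \<in> Fix M \<phi> Q" if "a \<in> Fix M \<phi> Q" "b \<in> Fix M \<phi> Q" for a b
    using that i c E by (auto simp: br_fixed_def A.r_distr A.l_distr)
  show "r \<odot>\<^bsub>A\<^esub> a \<in> Fix M \<phi> Q" if "r \<in> carrier R" "a \<in> Fix M \<phi> Q" for r a
    using that i c E by (auto simp: br_fixed_def A.smult_mult_left A.smult_mult_right)
qed

text \<open>Intertwiners compose: u passes a as \<phi>(u) and then b as \<psi>(\<phi>(u)). The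
  subgroup for b is a separate Q', since left multiplication of a trace pairs different
  subgroups.\<close>

lemma Fix_mult:
  assumes "a \<in> Fix (carrier A) \<phi> Q" "b \<in> Fix (carrier A) \<psi> Q'" "\<And>u. u \<in> Q \<Longrightarrow> \<phi> u \<in> Q'"
    "Q \<subseteq> P" "\<phi> \<in> Aut G P" "\<psi> \<in> Aut G P"
  shows "a \<otimes>\<^bsub>A\<^esub> b \<in> Fix (carrier A) (\<phi> \<otimes>\<^bsub>Ag\<^esub> \<psi>) Q"
proof -
  have ab: "a \<in> carrier A" "b \<in> carrier A" using assms Fix_carrier by auto
  have "\<iota> u \<otimes>\<^bsub>A\<^esub> (a \<otimes>\<^bsub>A\<^esub> b) = a \<otimes>\<^bsub>A\<^esub> b \<otimes>\<^bsub>A\<^esub> \<iota> (\<psi> (\<phi> u))" if u: "u \<in> Q" for u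
  proof -
    have uP: "u \<in> P" "\<phi> u \<in> P" "\<psi> (\<phi> u) \<in> P" using u assms by auto
    have "\<iota> u \<otimes>\<^bsub>A\<^esub> (a \<otimes>\<^bsub>A\<^esub> b) = a \<otimes>\<^bsub>A\<^esub> (\<iota> (\<phi> u) \<otimes>\<^bsub>A\<^esub> b)"
      using FixD[OF assms(1) u] ab uP by (simp flip: A.m_assoc)
    also have "\<dots> = a \<otimes>\<^bsub>A\<^esub> (b \<otimes>\<^bsub>A\<^esub> \<iota> (\<psi> (\<phi> u)))"
      using FixD[OF assms(2) assms(3)[OF u]] by simp
    finally show ?thesis using ab uP by (simp add: A.m_assoc)
  qed
  moreover have "(\<phi> \<otimes>\<^bsub>Ag\<^esub> \<psi>) u = \<psi> (\<phi> u)" if "u \<in> Q" for u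
    using that assms by (auto simp: Aut_apply_mult)
  ultimately show ?thesis using ab by (simp add: br_fixed_def)
qed

section \<open>Traces and the kernel of the Brauer map\<close>

definition trace_sum :: "('g \<Rightarrow> 'g) \<Rightarrow> 'g set \<Rightarrow> 'a \<Rightarrow> 'a" where
  "trace_sum \<phi> T c = (\<Oplus>\<^bsub>A\<^esub>u\<in>T. \<iota> (inv\<^bsub>G\<^esub> u) \<otimes>\<^bsub>A\<^esub> c \<otimes>\<^bsub>A\<^esub> \<iota> (\<phi> u))"

lemma br_trace_eq:
  "br_trace G P A \<iota> M \<phi> Q = {trace_sum \<phi> T c | c T. c \<in> Fix M \<phi> Q \<and> right_transversal G Q P T}"
  by (simp add: br_trace_def trace_sum_def)

lemma transversal_subset: "right_transversal G Q P T \<Longrightarrow> T \<subseteq> P"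
  by (simp add: right_transversal_def)

lemma trace_sum_closed [simp]:
  "\<phi> \<in> Aut G P \<Longrightarrow> T \<subseteq> P \<Longrightarrow> c \<in> carrier A \<Longrightarrow> trace_sum \<phi> T c \<in> carrier A"
  unfolding trace_sum_def by (intro A.finsum_closed) auto

lemma additive_trace_sum:
  assumes h: "h \<in> carrier A \<rightarrow> carrier A" "\<And>x y. x \<in> carrier A \<Longrightarrow> y \<in> carrier A \<Longrightarrow> h (x \<oplus>\<^bsub>A\<^esub> y) = h x \<oplus>\<^bsub>A\<^esub> h y"
    and "\<phi> \<in> Aut G P" "T \<subseteq> P" "c \<in> carrier A"
  shows "h (trace_sum \<phi> T c) = (\<Oplus>\<^bsub>A\<^esub>u\<in>T. h (\<iota> (inv\<^bsub>G\<^esub> u) \<otimes>\<^bsub>A\<^esub> c \<otimes>\<^bsub>A\<^esub> \<iota> (\<phi> u)))"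
  unfolding trace_sum_def
proof (rule finsum_hom(2)[where T="carrier A"])
  show "h \<zero>\<^bsub>A\<^esub> = \<zero>\<^bsub>A\<^esub>"
  proof -
    have "h \<zero>\<^bsub>A\<^esub> \<in> carrier A" using h(1) by auto
    then show ?thesis using h(2)[of "\<zero>\<^bsub>A\<^esub>" "\<zero>\<^bsub>A\<^esub>"] by (metis A.add.r_cancel_one' A.l_zero A.zero_closed)
  qed
  show "finite T" using assms finite_P finite_subset by blast
qed (use assms A.abelian_monoid_axioms in auto)

text \<open>Proper subgroups of P are taken as subgroups of G, so that cosets and transversals can
  be handled by the coset lemmas for G.\<close>

definition br_gens :: "'a set \<Rightarrow> ('g \<Rightarrow> 'g) \<Rightarrow> 'a set" where
  "br_gens M \<phi> = {trace_sum \<phi> T c | c T Q. subgroup Q G \<and> Q \<subset> P \<and> c \<in> Fix M \<phi> Q \<and> right_transversal G Q P T} \<union>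
      {r \<odot>\<^bsub>A\<^esub> m | r m. r \<in> J \<and> m \<in> Fix M \<phi> P}"

lemma D_eq: "D M \<phi> = generate (add_monoid A) (br_gens M \<phi>)"
proof -
  have "subgroup Q (G\<lparr>carrier := P\<rparr>) \<longleftrightarrow> subgroup Q G \<and> Q \<subseteq> P" for Q
    using G.incl_subgroup[OF P] G.subgroup_incl[OF _ P] subgroup.subset[of Q "G\<lparr>carrier := P\<rparr>"] by auto
  then have "br_gens M \<phi> = (\<Union>Q\<in>{Q. subgroup Q (G\<lparr>carrier := P\<rparr>) \<and> Q \<noteq> P}. br_trace G P A \<iota> M \<phi> Q) \<union>
      {r \<odot>\<^bsub>A\<^esub> m | r m. r \<in> J \<and> m \<in> Fix M \<phi> P}"
    by (simp add: br_gens_def br_trace_eq psubset_eq) blast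
  then show ?thesis by (simp add: br_ker_def)
qed

lemma br_gens_carrier:
  assumes "M \<subseteq> carrier A" "\<phi> \<in> Aut G P" shows "br_gens M \<phi> \<subseteq> carrier A"
proof
  have c: "m \<in> carrier A" if "m \<in> Fix M \<phi> Q" for m Q using that Fix_subset assms(1) by blast
  fix x assume "x \<in> br_gens M \<phi>"
  then consider c T Q where "x = trace_sum \<phi> T c" "c \<in> Fix M \<phi> Q" "right_transversal G Q P T"
    | r m where "x = r \<odot>\<^bsub>A\<^esub> m" "r \<in> J" "m \<in> Fix M \<phi> P"
    unfolding br_gens_def by blast
  then show "x \<in> carrier A"
  proof cases
    case 1
    then show ?thesis using trace_sum_closed[OF assms(2) transversal_subset] c by blast
  next
    case 2
    then show ?thesis using A.smult_closed c J.a_subset by blast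
  qed
qed

lemma D_subgroup: "M \<subseteq> carrier A \<Longrightarrow> \<phi> \<in> Aut G P \<Longrightarrow> subgroup (D M \<phi>) (add_monoid A)"
  unfolding D_eq by (rule A.add.generate_is_subgroup[OF br_gens_carrier])

lemma D_abelian_subgroup:
  assumes "M \<subseteq> carrier A" "\<phi> \<in> Aut G P" shows "abelian_subgroup (D M \<phi>) A"
  by (rule abelian_subgroupI3) (use D_subgroup[OF assms] A.abelian_group_axioms in \<open>auto intro: additive_subgroupI\<close>)

lemma D_trace:
  "subgroup Q G \<Longrightarrow> Q \<subset> P \<Longrightarrow> c \<in> Fix M \<phi> Q \<Longrightarrow> right_transversal G Q P T \<Longrightarrow> trace_sum \<phi> T c \<in> D M \<phi>"
  unfolding D_eq br_gens_def by (rule generate.incl) blast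

lemma D_J: "r \<in> J \<Longrightarrow> m \<in> Fix M \<phi> P \<Longrightarrow> r \<odot>\<^bsub>A\<^esub> m \<in> D M \<phi>"
  unfolding D_eq br_gens_def by (rule generate.incl) blast

text \<open>The induction principle for the kernel: whether an additive map sends it into a subgroup
  is decided on traces from proper subgroups and on J-multiples of fixed elements.\<close>

lemma D_image:
  assumes h: "h \<in> carrier A \<rightarrow> carrier A" "\<And>x y. x \<in> carrier A \<Longrightarrow> y \<in> carrier A \<Longrightarrow> h (x \<oplus>\<^bsub>A\<^esub> y) = h x \<oplus>\<^bsub>A\<^esub> h y"
    and M: "M \<subseteq> carrier A" "\<phi> \<in> Aut G P" and T: "subgroup T (add_monoid A)"
    and tr: "\<And>Q S c. subgroup Q G \<Longrightarrow> Q \<subset> P \<Longrightarrow> c \<in> Fix M \<phi> Q \<Longrightarrow> right_transversal G Q P S \<Longrightarrow> h (trace_sum \<phi> S c) \<in> T"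
    and Jm: "\<And>r m. r \<in> J \<Longrightarrow> m \<in> Fix M \<phi> P \<Longrightarrow> h (r \<odot>\<^bsub>A\<^esub> m) \<in> T"
    and x: "x \<in> D M \<phi>"
  shows "h x \<in> T"
proof -
  have "h \<in> hom (add_monoid A) (add_monoid A)" using h by (auto simp: hom_def)
  then interpret h: group_hom "add_monoid A" "add_monoid A" h
    by (simp add: group_hom_def group_hom_axioms_def A.a_group)
  have g: "h y \<in> T" if "y \<in> br_gens M \<phi>" for y using that tr Jm by (auto simp: br_gens_def)
  have c: "y \<in> carrier A" if "y \<in> generate (add_monoid A) (br_gens M \<phi>)" for y
    using A.add.generate_in_carrier[OF br_gens_carrier[OF M]] that by simp
  from x show ?thesis unfolding D_eq
  proof (induct rule: generate.induct)
    case one show ?case using h.hom_one subgroup.one_closed[OF T] by simp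
  next
    case (incl y) then show ?case by (rule g)
  next
    case (inv y)
    then have "y \<in> carrier A" using br_gens_carrier[OF M] by auto
    then show ?case using subgroup.m_inv_closed[OF T g[OF inv]] h.hom_inv[of y] by simp
  next
    case (eng y z)
    then show ?case using h.hom_mult[of y z] c subgroup.m_closed[OF T] by simp
  qed
qed

lemma D_smult:
  assumes M: "submodule M R A" "\<phi> \<in> Aut G P" and r: "r \<in> carrier R" and x: "x \<in> D M \<phi>"
  shows "r \<odot>\<^bsub>A\<^esub> x \<in> D M \<phi>"
proof (rule D_image[where h="\<lambda>x. r \<odot>\<^bsub>A\<^esub> x", OF _ _ _ M(2) _ _ _ x])
  show Mc: "M \<subseteq> carrier A" using A.submoduleE(1)[OF M(1)] .
  then show "subgroup (D M \<phi>) (add_monoid A)" by (rule D_subgroup[OF _ M(2)])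
  fix Q S c assume Q: "subgroup Q G" "Q \<subset> P" "c \<in> Fix M \<phi> Q" "right_transversal G Q P S"
  have c: "c \<in> carrier A" and S: "S \<subseteq> P" using Q Mc Fix_subset transversal_subset by blast+
  have "r \<odot>\<^bsub>A\<^esub> trace_sum \<phi> S c = (\<Oplus>\<^bsub>A\<^esub>u\<in>S. r \<odot>\<^bsub>A\<^esub> (\<iota> (inv\<^bsub>G\<^esub> u) \<otimes>\<^bsub>A\<^esub> c \<otimes>\<^bsub>A\<^esub> \<iota> (\<phi> u)))"
    by (rule additive_trace_sum) (use r M S c in \<open>auto simp: A.smult_r_distr\<close>)
  also have "\<dots> = trace_sum \<phi> S (r \<odot>\<^bsub>A\<^esub> c)"
    unfolding trace_sum_def using r M S c
    by (intro A.finsum_cong' refl) (auto simp: A.smult_mult_left A.smult_mult_right subset_iff)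
  finally show "r \<odot>\<^bsub>A\<^esub> trace_sum \<phi> S c \<in> D M \<phi>"
    using D_trace[OF Q(1,2) _ Q(4)] submodule.smult_closed[OF Fix_submodule[OF M] r Q(3)] Q(2) by auto
next
  fix s m assume s: "s \<in> J" "m \<in> Fix M \<phi> P"
  have "m \<in> carrier A" using s Fix_subset A.submoduleE(1)[OF M(1)] by blast
  then have "r \<odot>\<^bsub>A\<^esub> (s \<odot>\<^bsub>A\<^esub> m) = (r \<otimes>\<^bsub>R\<^esub> s) \<odot>\<^bsub>A\<^esub> m"
    using r s J.a_subset by (auto simp: A.smult_assoc1)
  then show "r \<odot>\<^bsub>A\<^esub> (s \<odot>\<^bsub>A\<^esub> m) \<in> D M \<phi>" using D_J[OF J.I_l_closed[OF s(1) r] s(2)] by simp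
qed (use r in \<open>auto simp: A.smult_r_distr\<close>)

lemma carrier_submodule: "submodule (carrier A) R A" by (rule A.carrier_is_submodule)

text \<open>The summands \<open>u\<^sup>-\<^sup>1 c \<phi>(u)\<close> of a trace depend only on the coset \<open>Qu\<close>, so that the trace
  does not depend on the transversal and is fixed by \<open>P\<close>.\<close>
lemma trace_sum_transversal:
  assumes Q: "subgroup Q G" "Q \<subseteq> P" and \<phi>: "\<phi> \<in> Aut G P" and c: "c \<in> Fix (carrier A) \<phi> Q"
    and T: "right_transversal G Q P T" and T': "right_transversal G Q P T'"
  shows "trace_sum \<phi> T c = trace_sum \<phi> T' c"
proof -
  have cA: "c \<in> carrier A" using Fix_carrier[OF c] .
  let ?f = "\<lambda>u. \<iota> (inv\<^bsub>G\<^esub> u) \<otimes>\<^bsub>A\<^esub> c \<otimes>\<^bsub>A\<^esub> \<iota> (\<phi> u)"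
  have f_coset: "?f w = ?f u" if w: "w \<in> Q #>\<^bsub>G\<^esub> u" and u: "u \<in> P" for w u
  proof -
    obtain v where v: "v \<in> Q" "w = v \<otimes>\<^bsub>G\<^esub> u" using w by (auto simp: r_coset_def)
    have vP: "v \<in> P" using v Q by auto
    have "?f w = \<iota> (inv\<^bsub>G\<^esub> u) \<otimes>\<^bsub>A\<^esub> (\<iota> (inv\<^bsub>G\<^esub> v) \<otimes>\<^bsub>A\<^esub> (c \<otimes>\<^bsub>A\<^esub> \<iota> (\<phi> v))) \<otimes>\<^bsub>A\<^esub> \<iota> (\<phi> u)"
      using u vP \<phi> cA unfolding v(2) by (simp add: G.inv_mult_group \<iota>_mult Aut_hom A.m_assoc)
    also have "c \<otimes>\<^bsub>A\<^esub> \<iota> (\<phi> v) = \<iota> v \<otimes>\<^bsub>A\<^esub> c" using FixD[OF c v(1)] by simp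
    finally show ?thesis using u vP \<phi> cA by simp
  qed
  have TP: "T \<subseteq> P" "T' \<subseteq> P" using T T' transversal_subset by auto
  define r where "r u = (THE t. t \<in> T' \<and> u \<in> Q #>\<^bsub>G\<^esub> t)" for u
  have r: "r u \<in> T'" "u \<in> Q #>\<^bsub>G\<^esub> r u" if "u \<in> P" for u
  proof -
    have "\<exists>!t. t \<in> T' \<and> u \<in> Q #>\<^bsub>G\<^esub> t" using T' that by (auto simp: right_transversal_def)
    from theI'[OF this] show "r u \<in> T'" "u \<in> Q #>\<^bsub>G\<^esub> r u" by (auto simp: r_def)
  qed
  have uniq: "t = t'" if "t \<in> T" "t' \<in> T" "u \<in> P" "u \<in> Q #>\<^bsub>G\<^esub> t" "u \<in> Q #>\<^bsub>G\<^esub> t'" for t t' u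
    using T that unfolding right_transversal_def by blast
  have uniq': "t = t'" if "t \<in> T'" "t' \<in> T'" "u \<in> P" "u \<in> Q #>\<^bsub>G\<^esub> t" "u \<in> Q #>\<^bsub>G\<^esub> t'" for t t' u
    using T' that unfolding right_transversal_def by blast
  have sym: "v \<in> Q #>\<^bsub>G\<^esub> u" if "u \<in> Q #>\<^bsub>G\<^esub> v" "v \<in> P" for u v
    using G.repr_independence[OF that(1) _ Q(1)] G.rcos_self[OF _ Q(1), of v] that(2) by auto
  have bij: "bij_betw r T T'"
  proof (rule bij_betw_imageI)
    show "inj_on r T"
    proof (rule inj_onI)
      fix t t' assume t: "t \<in> T" "t' \<in> T" and eq: "r t = r t'"
      have "r t \<in> P" using r t TP by blast
      moreover have "r t \<in> Q #>\<^bsub>G\<^esub> t" "r t \<in> Q #>\<^bsub>G\<^esub> t'"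
        using sym r t TP eq by (metis subsetD)+
      ultimately show "t = t'" using uniq t by blast
    qed
    show "r ` T = T'"
    proof (intro equalityI subsetI)
      fix t' assume t': "t' \<in> T'"
      then obtain t where t: "t \<in> T" "t' \<in> Q #>\<^bsub>G\<^esub> t" using T TP unfolding right_transversal_def by blast
      then have "t \<in> Q #>\<^bsub>G\<^esub> t'" using sym TP t' by blast
      then have "r t = t'" using uniq'[of "r t" t' t] r t t' TP by blast
      then show "t' \<in> r ` T" using t by blast
    qed (use r TP in blast)
  qed
  have "trace_sum \<phi> T' c = (\<Oplus>\<^bsub>A\<^esub>u\<in>T. ?f (r u))"
    unfolding trace_sum_def using TP \<phi> cA by (intro A.finsum_bij[OF bij]) auto
  also have "\<dots> = trace_sum \<phi> T c"
  proof -
    have eq: "?f (r u) = ?f u" if "u \<in> T" for u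
    proof -
      have "u \<in> P" "r u \<in> P" using that TP r(1)[of u] by blast+
      then show ?thesis using f_coset[OF r(2)] by metis
    qed
    show ?thesis
      unfolding trace_sum_def using TP \<phi> cA by (intro A.finsum_cong' refl eq) auto
  qed
  finally show ?thesis by simp
qed

lemma trace_sum_Fix:
  assumes Q: "subgroup Q G" "Q \<subseteq> P" and \<phi>: "\<phi> \<in> Aut G P" and c: "c \<in> Fix (carrier A) \<phi> Q"
    and T: "right_transversal G Q P T"
  shows "trace_sum \<phi> T c \<in> Fix (carrier A) \<phi> P"
proof -
  have cA: "c \<in> carrier A" using Fix_carrier[OF c] .
  have TP: "T \<subseteq> P" using T transversal_subset by auto
  have QG: "Q \<subseteq> carrier G" using Q by auto
  have "\<iota> v \<otimes>\<^bsub>A\<^esub> trace_sum \<phi> T c = trace_sum \<phi> T c \<otimes>\<^bsub>A\<^esub> \<iota> (\<phi> v)" if v: "v \<in> P" for v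
  proof -
    \<comment> \<open>With T also Tv^-1 is a transversal. Comparing the traces over these two
      transversals produces the commutation with v.\<close>
    let ?T = "(\<lambda>t. t \<otimes>\<^bsub>G\<^esub> inv\<^bsub>G\<^esub> v) ` T"
    have bij: "bij_betw (\<lambda>t. t \<otimes>\<^bsub>G\<^esub> inv\<^bsub>G\<^esub> v) T ?T"
    proof (rule bij_betw_imageI[OF inj_onI refl])
      fix x y assume "x \<in> T" "y \<in> T" "x \<otimes>\<^bsub>G\<^esub> inv\<^bsub>G\<^esub> v = y \<otimes>\<^bsub>G\<^esub> inv\<^bsub>G\<^esub> v"
      then show "x = y" using TP v G.right_cancel[of "inv\<^bsub>G\<^esub> v" x y] by (simp add: subset_iff)
    qed
    have mem: "u \<in> Q #>\<^bsub>G\<^esub> (t \<otimes>\<^bsub>G\<^esub> inv\<^bsub>G\<^esub> v) \<longleftrightarrow> u \<otimes>\<^bsub>G\<^esub> v \<in> Q #>\<^bsub>G\<^esub> t" if "u \<in> P" "t \<in> P" for u t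
    proof
      assume "u \<in> Q #>\<^bsub>G\<^esub> (t \<otimes>\<^bsub>G\<^esub> inv\<^bsub>G\<^esub> v)"
      then obtain x where "x \<in> Q" "u = x \<otimes>\<^bsub>G\<^esub> (t \<otimes>\<^bsub>G\<^esub> inv\<^bsub>G\<^esub> v)" by (auto simp: r_coset_def)
      then show "u \<otimes>\<^bsub>G\<^esub> v \<in> Q #>\<^bsub>G\<^esub> t"
        using that v QG by (auto simp: r_coset_def G.m_assoc subset_iff)
    next
      assume "u \<otimes>\<^bsub>G\<^esub> v \<in> Q #>\<^bsub>G\<^esub> t"
      then obtain x where x: "x \<in> Q" "u \<otimes>\<^bsub>G\<^esub> v = x \<otimes>\<^bsub>G\<^esub> t" by (auto simp: r_coset_def)
      have "u = u \<otimes>\<^bsub>G\<^esub> v \<otimes>\<^bsub>G\<^esub> inv\<^bsub>G\<^esub> v" using that v by (simp add: G.m_assoc)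
      also have "\<dots> = x \<otimes>\<^bsub>G\<^esub> (t \<otimes>\<^bsub>G\<^esub> inv\<^bsub>G\<^esub> v)"
        unfolding x(2) using that v QG x(1) by (simp add: G.m_assoc subset_iff)
      finally have "u = x \<otimes>\<^bsub>G\<^esub> (t \<otimes>\<^bsub>G\<^esub> inv\<^bsub>G\<^esub> v)" .
      then show "u \<in> Q #>\<^bsub>G\<^esub> (t \<otimes>\<^bsub>G\<^esub> inv\<^bsub>G\<^esub> v)" using x by (auto simp: r_coset_def)
    qed
    have T': "right_transversal G Q P ?T"
      unfolding right_transversal_def
    proof (intro conjI ballI)
      show "?T \<subseteq> P" using TP v by auto
      fix u assume u: "u \<in> P"
      then obtain t where t: "t \<in> T" "u \<otimes>\<^bsub>G\<^esub> v \<in> Q #>\<^bsub>G\<^esub> t"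
        and un: "\<And>t'. t' \<in> T \<Longrightarrow> u \<otimes>\<^bsub>G\<^esub> v \<in> Q #>\<^bsub>G\<^esub> t' \<Longrightarrow> t' = t"
        using T v unfolding right_transversal_def by (metis P_mult)
      show "\<exists>!t. t \<in> ?T \<and> u \<in> Q #>\<^bsub>G\<^esub> t"
      proof (rule ex1I[of _ "t \<otimes>\<^bsub>G\<^esub> inv\<^bsub>G\<^esub> v"])
        show "t \<otimes>\<^bsub>G\<^esub> inv\<^bsub>G\<^esub> v \<in> ?T \<and> u \<in> Q #>\<^bsub>G\<^esub> (t \<otimes>\<^bsub>G\<^esub> inv\<^bsub>G\<^esub> v)"
          using t TP u mem by auto
        fix s assume "s \<in> ?T \<and> u \<in> Q #>\<^bsub>G\<^esub> s"
        then obtain t' where t': "t' \<in> T" "s = t' \<otimes>\<^bsub>G\<^esub> inv\<^bsub>G\<^esub> v" "u \<in> Q #>\<^bsub>G\<^esub> (t' \<otimes>\<^bsub>G\<^esub> inv\<^bsub>G\<^esub> v)" by auto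
        have "t' \<in> P" using t' TP by blast
        with mem[OF u this] t' un show "s = t \<otimes>\<^bsub>G\<^esub> inv\<^bsub>G\<^esub> v" by auto
      qed
    qed
    have "trace_sum \<phi> T c = trace_sum \<phi> ?T c" by (rule trace_sum_transversal[OF Q \<phi> c T T'])
    also have "\<dots> = (\<Oplus>\<^bsub>A\<^esub>t\<in>T. \<iota> (inv\<^bsub>G\<^esub> (t \<otimes>\<^bsub>G\<^esub> inv\<^bsub>G\<^esub> v)) \<otimes>\<^bsub>A\<^esub> c \<otimes>\<^bsub>A\<^esub> \<iota> (\<phi> (t \<otimes>\<^bsub>G\<^esub> inv\<^bsub>G\<^esub> v)))"
      unfolding trace_sum_def using TP v \<phi> cA by (intro A.finsum_bij[OF bij]) auto
    finally have eq: "trace_sum \<phi> T c \<otimes>\<^bsub>A\<^esub> \<iota> (\<phi> v) =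
        (\<Oplus>\<^bsub>A\<^esub>t\<in>T. \<iota> (inv\<^bsub>G\<^esub> (t \<otimes>\<^bsub>G\<^esub> inv\<^bsub>G\<^esub> v)) \<otimes>\<^bsub>A\<^esub> c \<otimes>\<^bsub>A\<^esub> \<iota> (\<phi> (t \<otimes>\<^bsub>G\<^esub> inv\<^bsub>G\<^esub> v))) \<otimes>\<^bsub>A\<^esub> \<iota> (\<phi> v)"
      by simp
    also have "\<dots> = (\<Oplus>\<^bsub>A\<^esub>t\<in>T. \<iota> v \<otimes>\<^bsub>A\<^esub> (\<iota> (inv\<^bsub>G\<^esub> t) \<otimes>\<^bsub>A\<^esub> c \<otimes>\<^bsub>A\<^esub> \<iota> (\<phi> t)))"
    proof -
      have "\<iota> (inv\<^bsub>G\<^esub> (t \<otimes>\<^bsub>G\<^esub> inv\<^bsub>G\<^esub> v)) \<otimes>\<^bsub>A\<^esub> c \<otimes>\<^bsub>A\<^esub> \<iota> (\<phi> (t \<otimes>\<^bsub>G\<^esub> inv\<^bsub>G\<^esub> v)) \<otimes>\<^bsub>A\<^esub> \<iota> (\<phi> v) =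
          \<iota> v \<otimes>\<^bsub>A\<^esub> (\<iota> (inv\<^bsub>G\<^esub> t) \<otimes>\<^bsub>A\<^esub> c \<otimes>\<^bsub>A\<^esub> \<iota> (\<phi> t))" if t: "t \<in> T" for t
      proof -
        have tP: "t \<in> P" using t TP by auto
        have 1: "\<iota> (inv\<^bsub>G\<^esub> (t \<otimes>\<^bsub>G\<^esub> inv\<^bsub>G\<^esub> v)) = \<iota> v \<otimes>\<^bsub>A\<^esub> \<iota> (inv\<^bsub>G\<^esub> t)"
          using tP v by (simp add: G.inv_mult_group \<iota>_mult)
        have "\<phi> t \<in> P" "\<phi> v \<in> P" using tP v \<phi> by auto
        then have 2: "\<iota> (\<phi> (t \<otimes>\<^bsub>G\<^esub> inv\<^bsub>G\<^esub> v)) \<otimes>\<^bsub>A\<^esub> \<iota> (\<phi> v) = \<iota> (\<phi> t)"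
          using tP v \<phi> by (simp add: Aut_hom Aut_inv_elem \<iota>_mult A.m_assoc)
        show ?thesis unfolding 1 using 2 tP v \<phi> cA by (simp add: A.m_assoc)
      qed
      then show ?thesis using TP v \<phi> cA finite_subset[OF TP finite_P]
        by (subst A.finsum_ldistr) (auto intro!: A.finsum_cong')
    qed
    also have "\<dots> = \<iota> v \<otimes>\<^bsub>A\<^esub> trace_sum \<phi> T c"
      unfolding trace_sum_def using TP v \<phi> cA finite_subset[OF TP finite_P]
      by (intro A.finsum_rdistr[symmetric]) auto
    finally show ?thesis by simp
  qed
  then show ?thesis using TP cA \<phi> by (simp add: br_fixed_def)
qed

text \<open>It ensures that every representative of a class consists of fixed elements, as the
  product of two classes, a union over all representatives, requires.\<close>

lemma D_Fix:
  assumes \<phi>: "\<phi> \<in> Aut G P" shows "D (carrier A) \<phi> \<subseteq> Fix (carrier A) \<phi> P"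
proof
  fix x assume x: "x \<in> D (carrier A) \<phi>"
  have sub: "submodule (Fix (carrier A) \<phi> P) R A" by (rule Fix_submodule[OF carrier_submodule \<phi>]) simp
  show "x \<in> Fix (carrier A) \<phi> P"
    by (rule D_image[where h="\<lambda>x. x", OF _ _ _ \<phi> submodule.axioms(1)[OF sub] _ _ x])
       (use \<phi> trace_sum_Fix submodule.smult_closed[OF sub] J.a_subset in auto)
qed

section \<open>Frobenius reciprocity for twisted traces\<close>

text \<open>Since a intertwines v with \<phi>(v), moving it past u^-1 replaces u by \<phi>^-1(u).
  Hence a times the trace of c from Q is the trace of ac from \<phi>^-1(Q), with the transversal
  transported by \<chi> = \<phi>^-1; the new subgroup is again proper.\<close>

lemma D_mult_left:
  assumes \<phi>: "\<phi> \<in> Aut G P" and \<psi>: "\<psi> \<in> Aut G P"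
    and a: "a \<in> Fix (carrier A) \<phi> P" and x: "x \<in> D (carrier A) \<psi>"
  shows "a \<otimes>\<^bsub>A\<^esub> x \<in> D (carrier A) (\<phi> \<otimes>\<^bsub>Ag\<^esub> \<psi>)"
proof (rule D_image[where h="\<lambda>x. a \<otimes>\<^bsub>A\<^esub> x", OF _ _ _ \<psi> _ _ _ x])
  have aA: "a \<in> carrier A" using Fix_carrier[OF a] .
  show "subgroup (D (carrier A) (\<phi> \<otimes>\<^bsub>Ag\<^esub> \<psi>)) (add_monoid A)"
    using \<phi> \<psi> by (intro D_subgroup) auto
  define \<chi> where "\<chi> = inv\<^bsub>Ag\<^esub> \<phi>"
  have \<chi>: "\<chi> \<in> Aut G P" "\<And>u. u \<in> P \<Longrightarrow> \<chi> (\<phi> u) = u" "\<And>u. u \<in> P \<Longrightarrow> \<phi> (\<chi> u) = u"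
    using Aut_inv_apply[OF G.is_group P \<phi>] \<phi> by (auto simp: \<chi>_def)
  fix Q S c assume Q: "subgroup Q G" "Q \<subset> P" "c \<in> Fix (carrier A) \<psi> Q" "right_transversal G Q P S"
  have cA: "c \<in> carrier A" using Fix_carrier[OF Q(3)] .
  have SP: "S \<subseteq> P" using Q transversal_subset by auto
  have QP: "Q \<subseteq> P" using Q by auto
  have inj: "inj_on \<chi> P" using Aut_bij[OF \<chi>(1)] by (simp add: bij_betw_def)
  have Q': "subgroup (\<chi> ` Q) G"
  proof (rule G.subgroupI)
    show "\<chi> ` Q \<subseteq> carrier G" using \<chi> QP by auto
    show "\<chi> ` Q \<noteq> {}" using subgroup.one_closed[OF Q(1)] by auto
    show "inv\<^bsub>G\<^esub> b \<in> \<chi> ` Q" if b: "b \<in> \<chi> ` Q" for b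
    proof -
      obtain y where y: "y \<in> Q" "b = \<chi> y" using b by auto
      then have "inv\<^bsub>G\<^esub> b = \<chi> (inv\<^bsub>G\<^esub> y)" using Aut_inv_elem[OF \<chi>(1)] QP by auto
      then show ?thesis using subgroup.m_inv_closed[OF Q(1) y(1)] by auto
    qed
    show "b \<otimes>\<^bsub>G\<^esub> b' \<in> \<chi> ` Q" if b: "b \<in> \<chi> ` Q" "b' \<in> \<chi> ` Q" for b b'
    proof -
      obtain y y' where y: "y \<in> Q" "b = \<chi> y" "y' \<in> Q" "b' = \<chi> y'" using b by auto
      then have "b \<otimes>\<^bsub>G\<^esub> b' = \<chi> (y \<otimes>\<^bsub>G\<^esub> y')" using Aut_hom[OF \<chi>(1), of y y'] subsetD[OF QP] by simp
      then show ?thesis using subgroup.m_closed[OF Q(1) y(1,3)] by auto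
    qed
  qed
  have Q'P: "\<chi> ` Q \<subset> P"
  proof -
    have "\<chi> ` Q \<subseteq> P" using \<chi> QP by auto
    moreover have "\<chi> ` Q \<noteq> \<chi> ` P" using inj_on_image_eq_iff[OF inj QP] Q by auto
    moreover have "\<chi> ` P = P" using Aut_bij[OF \<chi>(1)] by (simp add: bij_betw_def)
    ultimately show ?thesis by auto
  qed
  have mem: "u \<in> (\<chi> ` Q) #>\<^bsub>G\<^esub> \<chi> t \<longleftrightarrow> \<phi> u \<in> Q #>\<^bsub>G\<^esub> t" if "u \<in> P" "t \<in> P" for u t
  proof
    assume "u \<in> (\<chi> ` Q) #>\<^bsub>G\<^esub> \<chi> t"
    then obtain y where y: "y \<in> Q" "u = \<chi> y \<otimes>\<^bsub>G\<^esub> \<chi> t" by (auto simp: r_coset_def)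
    then have "u = \<chi> (y \<otimes>\<^bsub>G\<^esub> t)" "y \<in> P" using Aut_hom[OF \<chi>(1)] QP that by auto
    then show "\<phi> u \<in> Q #>\<^bsub>G\<^esub> t" using \<chi> y that by (auto simp: r_coset_def)
  next
    assume "\<phi> u \<in> Q #>\<^bsub>G\<^esub> t"
    then obtain y where y: "y \<in> Q" "\<phi> u = y \<otimes>\<^bsub>G\<^esub> t" by (auto simp: r_coset_def)
    then have "u = \<chi> (y \<otimes>\<^bsub>G\<^esub> t)" "y \<in> P" using \<chi>(2)[OF that(1)] QP by auto
    then show "u \<in> (\<chi> ` Q) #>\<^bsub>G\<^esub> \<chi> t" using Aut_hom[OF \<chi>(1)] y that by (auto simp: r_coset_def)
  qed
  have T': "right_transversal G (\<chi> ` Q) P (\<chi> ` S)"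
    unfolding right_transversal_def
  proof (intro conjI ballI)
    show "\<chi> ` S \<subseteq> P" using \<chi> SP by auto
    fix u assume u: "u \<in> P"
    then obtain t where t: "t \<in> S" "\<phi> u \<in> Q #>\<^bsub>G\<^esub> t"
      and un: "\<And>t'. t' \<in> S \<Longrightarrow> \<phi> u \<in> Q #>\<^bsub>G\<^esub> t' \<Longrightarrow> t' = t"
      using Q(4) \<phi> unfolding right_transversal_def by (metis Aut_P)
    show "\<exists>!t. t \<in> \<chi> ` S \<and> u \<in> \<chi> ` Q #>\<^bsub>G\<^esub> t"
    proof (rule ex1I[of _ "\<chi> t"])
      show "\<chi> t \<in> \<chi> ` S \<and> u \<in> \<chi> ` Q #>\<^bsub>G\<^esub> \<chi> t" using t SP u mem by auto
      fix s assume "s \<in> \<chi> ` S \<and> u \<in> \<chi> ` Q #>\<^bsub>G\<^esub> s"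
      then obtain t' where t': "t' \<in> S" "s = \<chi> t'" "u \<in> \<chi> ` Q #>\<^bsub>G\<^esub> \<chi> t'" by auto
      have "t' \<in> P" using t' SP by blast
      with mem[OF u this] t' un show "s = \<chi> t" by auto
    qed
  qed
  have acF: "a \<otimes>\<^bsub>A\<^esub> c \<in> Fix (carrier A) (\<phi> \<otimes>\<^bsub>Ag\<^esub> \<psi>) (\<chi> ` Q)"
  proof (rule Fix_mult[OF _ Q(3)])
    show "a \<in> Fix (carrier A) \<phi> (\<chi> ` Q)" using a Q'P by (auto simp: br_fixed_def)
  qed (use \<chi> \<phi> \<psi> QP Q'P in auto)
  have bij: "bij_betw \<chi> S (\<chi> ` S)" using inj_on_subset[OF inj SP] by (simp add: bij_betw_def)
  have "a \<otimes>\<^bsub>A\<^esub> trace_sum \<psi> S c = (\<Oplus>\<^bsub>A\<^esub>u\<in>S. a \<otimes>\<^bsub>A\<^esub> (\<iota> (inv\<^bsub>G\<^esub> u) \<otimes>\<^bsub>A\<^esub> c \<otimes>\<^bsub>A\<^esub> \<iota> (\<psi> u)))"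
    by (rule additive_trace_sum) (use aA \<psi> SP cA in \<open>auto simp: A.r_distr\<close>)
  also have "\<dots> = (\<Oplus>\<^bsub>A\<^esub>u\<in>S. \<iota> (inv\<^bsub>G\<^esub> \<chi> u) \<otimes>\<^bsub>A\<^esub> (a \<otimes>\<^bsub>A\<^esub> c) \<otimes>\<^bsub>A\<^esub> \<iota> ((\<phi> \<otimes>\<^bsub>Ag\<^esub> \<psi>) (\<chi> u)))"
  proof (rule A.finsum_cong'[OF refl])
    fix u assume "u \<in> S"
    then have u: "u \<in> P" using SP by auto
    have \<chi>u: "\<chi> u \<in> P" using \<chi> u by auto
    have 1: "(\<phi> \<otimes>\<^bsub>Ag\<^esub> \<psi>) (\<chi> u) = \<psi> u" using \<chi> \<phi> \<psi> u by (simp add: Aut_apply_mult)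
    have "\<iota> (inv\<^bsub>G\<^esub> \<chi> u) \<otimes>\<^bsub>A\<^esub> a = a \<otimes>\<^bsub>A\<^esub> \<iota> (inv\<^bsub>G\<^esub> u)"
      using FixD[OF a P_inv[OF \<chi>u]] Aut_inv_elem[OF \<phi> \<chi>u] \<chi>(3)[OF u] by simp
    then have "\<iota> (inv\<^bsub>G\<^esub> \<chi> u) \<otimes>\<^bsub>A\<^esub> (a \<otimes>\<^bsub>A\<^esub> c) = a \<otimes>\<^bsub>A\<^esub> (\<iota> (inv\<^bsub>G\<^esub> u) \<otimes>\<^bsub>A\<^esub> c)"
      using aA cA u \<chi>u by (simp flip: A.m_assoc)
    then show "a \<otimes>\<^bsub>A\<^esub> (\<iota> (inv\<^bsub>G\<^esub> u) \<otimes>\<^bsub>A\<^esub> c \<otimes>\<^bsub>A\<^esub> \<iota> (\<psi> u)) =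
        \<iota> (inv\<^bsub>G\<^esub> \<chi> u) \<otimes>\<^bsub>A\<^esub> (a \<otimes>\<^bsub>A\<^esub> c) \<otimes>\<^bsub>A\<^esub> \<iota> ((\<phi> \<otimes>\<^bsub>Ag\<^esub> \<psi>) (\<chi> u))"
      unfolding 1 using aA cA u \<psi> by (simp add: A.m_assoc)
  qed (use aA cA SP \<chi> \<phi> \<psi> in \<open>auto simp: subset_iff Aut_apply_mult\<close>)
  also have "\<dots> = trace_sum (\<phi> \<otimes>\<^bsub>Ag\<^esub> \<psi>) (\<chi> ` S) (a \<otimes>\<^bsub>A\<^esub> c)"
    unfolding trace_sum_def
    by (rule A.finsum_bij[OF bij, symmetric]) (use aA cA SP \<chi> \<phi> \<psi> in \<open>auto simp: subset_iff Aut_apply_mult\<close>)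
  finally show "a \<otimes>\<^bsub>A\<^esub> trace_sum \<psi> S c \<in> D (carrier A) (\<phi> \<otimes>\<^bsub>Ag\<^esub> \<psi>)"
    using D_trace[OF Q' Q'P acF T'] by simp
next
  fix r m assume r: "r \<in> J" "m \<in> Fix (carrier A) \<psi> P"
  have "a \<otimes>\<^bsub>A\<^esub> m \<in> Fix (carrier A) (\<phi> \<otimes>\<^bsub>Ag\<^esub> \<psi>) P"
    by (rule Fix_mult[OF a r(2)]) (use \<phi> \<psi> in auto)
  then have "r \<odot>\<^bsub>A\<^esub> (a \<otimes>\<^bsub>A\<^esub> m) \<in> D (carrier A) (\<phi> \<otimes>\<^bsub>Ag\<^esub> \<psi>)" by (rule D_J[OF r(1)])
  then show "a \<otimes>\<^bsub>A\<^esub> (r \<odot>\<^bsub>A\<^esub> m) \<in> D (carrier A) (\<phi> \<otimes>\<^bsub>Ag\<^esub> \<psi>)"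
    using A.smult_mult_right[of r a m] r J.a_subset Fix_carrier a by auto
qed (use Fix_carrier[OF a] in \<open>auto simp: A.r_distr\<close>)

text \<open>On this side b stands behind \<phi>(u) and turns it into \<psi>(\<phi>(u)), so the trace
  of c times b is the trace of cb over the same subgroup and the same transversal.\<close>

lemma D_mult_right:
  assumes \<phi>: "\<phi> \<in> Aut G P" and \<psi>: "\<psi> \<in> Aut G P"
    and b: "b \<in> Fix (carrier A) \<psi> P" and x: "x \<in> D (carrier A) \<phi>"
  shows "x \<otimes>\<^bsub>A\<^esub> b \<in> D (carrier A) (\<phi> \<otimes>\<^bsub>Ag\<^esub> \<psi>)"
proof (rule D_image[where h="\<lambda>x. x \<otimes>\<^bsub>A\<^esub> b", OF _ _ _ \<phi> _ _ _ x])
  have bA: "b \<in> carrier A" using Fix_carrier[OF b] .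
  show "subgroup (D (carrier A) (\<phi> \<otimes>\<^bsub>Ag\<^esub> \<psi>)) (add_monoid A)"
    using \<phi> \<psi> by (intro D_subgroup) auto
  fix Q S c assume Q: "subgroup Q G" "Q \<subset> P" "c \<in> Fix (carrier A) \<phi> Q" "right_transversal G Q P S"
  have cA: "c \<in> carrier A" using Fix_carrier[OF Q(3)] .
  have SP: "S \<subseteq> P" using Q transversal_subset by auto
  have cbF: "c \<otimes>\<^bsub>A\<^esub> b \<in> Fix (carrier A) (\<phi> \<otimes>\<^bsub>Ag\<^esub> \<psi>) Q"
    by (rule Fix_mult[OF Q(3) b]) (use Q \<phi> \<psi> in auto)
  have "trace_sum \<phi> S c \<otimes>\<^bsub>A\<^esub> b = (\<Oplus>\<^bsub>A\<^esub>u\<in>S. \<iota> (inv\<^bsub>G\<^esub> u) \<otimes>\<^bsub>A\<^esub> c \<otimes>\<^bsub>A\<^esub> \<iota> (\<phi> u) \<otimes>\<^bsub>A\<^esub> b)"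
    by (rule additive_trace_sum) (use bA \<phi> SP cA in \<open>auto simp: A.l_distr\<close>)
  also have "\<dots> = trace_sum (\<phi> \<otimes>\<^bsub>Ag\<^esub> \<psi>) S (c \<otimes>\<^bsub>A\<^esub> b)"
    unfolding trace_sum_def
  proof (rule A.finsum_cong'[OF refl])
    fix u assume "u \<in> S"
    then have u: "u \<in> P" "\<phi> u \<in> P" "\<psi> (\<phi> u) \<in> P" using SP \<phi> \<psi> by auto
    then show "\<iota> (inv\<^bsub>G\<^esub> u) \<otimes>\<^bsub>A\<^esub> c \<otimes>\<^bsub>A\<^esub> \<iota> (\<phi> u) \<otimes>\<^bsub>A\<^esub> b =
        \<iota> (inv\<^bsub>G\<^esub> u) \<otimes>\<^bsub>A\<^esub> (c \<otimes>\<^bsub>A\<^esub> b) \<otimes>\<^bsub>A\<^esub> \<iota> ((\<phi> \<otimes>\<^bsub>Ag\<^esub> \<psi>) u)"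
      using bA cA \<phi> \<psi> FixD[OF b u(2)] by (simp add: A.m_assoc Aut_apply_mult)
  qed (use bA cA SP \<phi> \<psi> in \<open>auto simp: subset_iff Aut_apply_mult\<close>)
  finally show "trace_sum \<phi> S c \<otimes>\<^bsub>A\<^esub> b \<in> D (carrier A) (\<phi> \<otimes>\<^bsub>Ag\<^esub> \<psi>)"
    using D_trace[OF Q(1,2) cbF Q(4)] by simp
next
  fix r m assume r: "r \<in> J" "m \<in> Fix (carrier A) \<phi> P"
  have "m \<otimes>\<^bsub>A\<^esub> b \<in> Fix (carrier A) (\<phi> \<otimes>\<^bsub>Ag\<^esub> \<psi>) P"
    by (rule Fix_mult[OF r(2) b]) (use \<phi> \<psi> in auto)
  then have "r \<odot>\<^bsub>A\<^esub> (m \<otimes>\<^bsub>A\<^esub> b) \<in> D (carrier A) (\<phi> \<otimes>\<^bsub>Ag\<^esub> \<psi>)" by (rule D_J[OF r(1)])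
  then show "r \<odot>\<^bsub>A\<^esub> m \<otimes>\<^bsub>A\<^esub> b \<in> D (carrier A) (\<phi> \<otimes>\<^bsub>Ag\<^esub> \<psi>)"
    using A.smult_mult_left[of r m b] r J.a_subset Fix_carrier b by auto
qed (use Fix_carrier[OF b] in \<open>auto simp: A.l_distr\<close>)

end

section \<open>The extended Brauer quotient as an algebra\<close>

context brauer
begin

section \<open>Brauer quotients as modules over the residue field\<close>

abbreviation "k \<equiv> R Quot J"
abbreviation "red \<equiv> \<lambda>r. J +>\<^bsub>R\<^esub> r"

lemma k_cring: "cring k" by (rule J.quotient_is_cring[OF A.R.is_cring])

lemma red_hom: "red \<in> ring_hom R k" by (rule J.rcos_ring_hom)

lemma red_surj: "red ` carrier R = carrier k"
  by (auto simp: FactRing_def A_RCOSETS_def RCOSETS_def a_r_coset_def)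

abbreviation "cl M \<phi> \<equiv> \<lambda>x. D M \<phi> +>\<^bsub>A\<^esub> x"

lemma cl_add:
  assumes "M \<subseteq> carrier A" "\<phi> \<in> Aut G P" "x \<in> carrier A" "y \<in> carrier A"
  shows "cl M \<phi> (x \<oplus>\<^bsub>A\<^esub> y) = cl M \<phi> x \<oplus>\<^bsub>V M \<phi>\<^esub> cl M \<phi> y"
  using abelian_subgroup.a_rcos_sum[OF D_abelian_subgroup] assms by (simp add: br_quot_def Let_def)

lemma cl_zero:
  assumes "M \<subseteq> carrier A" "\<phi> \<in> Aut G P" shows "cl M \<phi> \<zero>\<^bsub>A\<^esub> = \<zero>\<^bsub>V M \<phi>\<^esub>"
  using A.a_coset_add_zero[of "D M \<phi>"] subgroup.subset[OF D_subgroup[OF assms]] by (simp add: br_quot_def Let_def)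

lemma zero_V: "\<zero>\<^bsub>V M \<phi>\<^esub> = D M \<phi>" by (simp add: br_quot_def Let_def)

lemma carrier_V: "carrier (V M \<phi>) = cl M \<phi> ` Fix M \<phi> P"
  by (auto simp: br_quot_def Let_def)

lemma cl_eq_iff:
  assumes "M \<subseteq> carrier A" "\<phi> \<in> Aut G P" "x \<in> carrier A" "y \<in> carrier A"
  shows "cl M \<phi> x = cl M \<phi> y \<longleftrightarrow> x \<ominus>\<^bsub>A\<^esub> y \<in> D M \<phi>"
  using abelian_subgroup.a_coset_eq_iff[OF D_abelian_subgroup] assms by blast

text \<open>The scalar product is a double union, over a residue class and over a coset. The inner
  union collapses because the kernel is stable under R, the outer one because J times a fixed
  element lies in the kernel; there m must be fixed.\<close>

lemma cl_smult:
  assumes M: "submodule M R A" and \<phi>: "\<phi> \<in> Aut G P" and r: "r \<in> carrier R" and m: "m \<in> Fix M \<phi> P"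
  shows "cl M \<phi> (r \<odot>\<^bsub>A\<^esub> m) = red r \<odot>\<^bsub>V M \<phi>\<^esub> cl M \<phi> m"
proof -
  note Mc = A.submoduleE(1)[OF M]
  interpret D: abelian_subgroup "D M \<phi>" A by (rule D_abelian_subgroup[OF Mc \<phi>])
  have mA: "m \<in> carrier A" using m Mc Fix_subset by blast
  have "(\<Union>x\<in>cl M \<phi> m. cl M \<phi> (s \<odot>\<^bsub>A\<^esub> x)) = cl M \<phi> (s \<odot>\<^bsub>A\<^esub> m)" if s: "s \<in> carrier R" for s
  proof (rule D.a_coset_UN[OF mA])
    fix y assume y: "y \<in> carrier A" "y \<ominus>\<^bsub>A\<^esub> m \<in> D M \<phi>"
    have "s \<odot>\<^bsub>A\<^esub> (y \<ominus>\<^bsub>A\<^esub> m) \<in> D M \<phi>" by (rule D_smult[OF M \<phi> s y(2)])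
    moreover have "s \<odot>\<^bsub>A\<^esub> (y \<ominus>\<^bsub>A\<^esub> m) = s \<odot>\<^bsub>A\<^esub> y \<ominus>\<^bsub>A\<^esub> s \<odot>\<^bsub>A\<^esub> m"
      using s y mA by (simp add: a_minus_def A.smult_r_distr A.smult_r_minus)
    ultimately show "cl M \<phi> (s \<odot>\<^bsub>A\<^esub> y) = cl M \<phi> (s \<odot>\<^bsub>A\<^esub> m)"
      using cl_eq_iff[OF Mc \<phi>] s y mA by simp
  qed
  then have "red r \<odot>\<^bsub>V M \<phi>\<^esub> cl M \<phi> m = (\<Union>s\<in>red r. cl M \<phi> (s \<odot>\<^bsub>A\<^esub> m))"
    using J.a_elemrcos_carrier[OF r] by (simp add: br_quot_def Let_def)
  also have "\<dots> = cl M \<phi> (r \<odot>\<^bsub>A\<^esub> m)"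
  proof (rule J.a_coset_UN[OF r])
    fix s assume s: "s \<in> carrier R" "s \<ominus>\<^bsub>R\<^esub> r \<in> J"
    have "(s \<ominus>\<^bsub>R\<^esub> r) \<odot>\<^bsub>A\<^esub> m \<in> D M \<phi>" by (rule D_J[OF s(2) m])
    moreover have "(s \<ominus>\<^bsub>R\<^esub> r) \<odot>\<^bsub>A\<^esub> m = s \<odot>\<^bsub>A\<^esub> m \<ominus>\<^bsub>A\<^esub> r \<odot>\<^bsub>A\<^esub> m"
      using s r mA by (simp add: a_minus_def A.smult_l_distr A.smult_l_minus)
    ultimately show "cl M \<phi> (s \<odot>\<^bsub>A\<^esub> m) = cl M \<phi> (r \<odot>\<^bsub>A\<^esub> m)"
      using cl_eq_iff[OF Mc \<phi>] s r mA by simp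
  qed
  finally show ?thesis by simp
qed

lemma V_module:
  assumes M: "submodule M R A" and \<phi>: "\<phi> \<in> Aut G P"
  shows "module k (V M \<phi>)"
proof -
  note Mc = A.submoduleE(1)[OF M]
  have sub: "submodule (Fix M \<phi> P) R A" by (rule Fix_submodule[OF M \<phi>]) simp
  have FA: "x \<in> carrier A" if "x \<in> Fix M \<phi> P" for x using that Mc Fix_subset by blast
  show ?thesis
    by (rule module_surj[where \<rho>=red and h="cl M \<phi>",
          OF submodule.submodule_is_module[OF sub A.module_axioms] k_cring red_hom red_surj])
       (use carrier_V FA in \<open>auto simp: cl_add cl_zero cl_smult Mc M \<phi>\<close>)
qed

text \<open>Reciprocity on both sides makes the product of classes independent of representatives.
  The inner union is removed for an arbitrary fixed x first, then the outer union reduces x to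
  a.\<close>

lemma cl_mult:
  assumes \<phi>: "\<phi> \<in> Aut G P" and \<psi>: "\<psi> \<in> Aut G P"
    and a: "a \<in> Fix (carrier A) \<phi> P" and b: "b \<in> Fix (carrier A) \<psi> P"
  shows "(\<Union>x\<in>cl (carrier A) \<phi> a. \<Union>y\<in>cl (carrier A) \<psi> b. cl (carrier A) (\<phi> \<otimes>\<^bsub>Ag\<^esub> \<psi>) (x \<otimes>\<^bsub>A\<^esub> y)) =
    cl (carrier A) (\<phi> \<otimes>\<^bsub>Ag\<^esub> \<psi>) (a \<otimes>\<^bsub>A\<^esub> b)"
proof -
  interpret D1: abelian_subgroup "D (carrier A) \<phi>" A by (rule D_abelian_subgroup[OF subset_refl \<phi>])
  interpret D2: abelian_subgroup "D (carrier A) \<psi>" A by (rule D_abelian_subgroup[OF subset_refl \<psi>])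
  have c: "\<phi> \<otimes>\<^bsub>Ag\<^esub> \<psi> \<in> Aut G P" using \<phi> \<psi> by simp
  have aA: "a \<in> carrier A" and bA: "b \<in> carrier A" using a b Fix_carrier by auto
  have sub: "submodule (Fix (carrier A) \<phi> P) R A" by (rule Fix_submodule[OF carrier_submodule \<phi>]) simp
  have 1: "(\<Union>y\<in>cl (carrier A) \<psi> b. cl (carrier A) (\<phi> \<otimes>\<^bsub>Ag\<^esub> \<psi>) (x \<otimes>\<^bsub>A\<^esub> y)) =
      cl (carrier A) (\<phi> \<otimes>\<^bsub>Ag\<^esub> \<psi>) (x \<otimes>\<^bsub>A\<^esub> b)" if x: "x \<in> Fix (carrier A) \<phi> P" for x
  proof (rule D2.a_coset_UN[OF bA])
    fix y assume y: "y \<in> carrier A" "y \<ominus>\<^bsub>A\<^esub> b \<in> D (carrier A) \<psi>"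
    have xA: "x \<in> carrier A" using x Fix_carrier by auto
    have "x \<otimes>\<^bsub>A\<^esub> (y \<ominus>\<^bsub>A\<^esub> b) \<in> D (carrier A) (\<phi> \<otimes>\<^bsub>Ag\<^esub> \<psi>)" by (rule D_mult_left[OF \<phi> \<psi> x y(2)])
    moreover have "x \<otimes>\<^bsub>A\<^esub> (y \<ominus>\<^bsub>A\<^esub> b) = x \<otimes>\<^bsub>A\<^esub> y \<ominus>\<^bsub>A\<^esub> x \<otimes>\<^bsub>A\<^esub> b"
      using xA y bA by (simp add: a_minus_def A.r_distr A.r_minus)
    ultimately show "cl (carrier A) (\<phi> \<otimes>\<^bsub>Ag\<^esub> \<psi>) (x \<otimes>\<^bsub>A\<^esub> y) = cl (carrier A) (\<phi> \<otimes>\<^bsub>Ag\<^esub> \<psi>) (x \<otimes>\<^bsub>A\<^esub> b)"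
      using cl_eq_iff[OF subset_refl c] xA y bA by simp
  qed
  \<comment> \<open>Representatives of the class of a differ from a by elements of the kernel, which
    are fixed by \<open>D_Fix\<close>; so the collapse of the inner union is available for each of
    them.\<close>
  have x_Fix: "x \<in> Fix (carrier A) \<phi> P" if x: "x \<in> carrier A" "x \<ominus>\<^bsub>A\<^esub> a \<in> D (carrier A) \<phi>" for x
  proof -
    have "x \<ominus>\<^bsub>A\<^esub> a \<in> Fix (carrier A) \<phi> P" using D_Fix[OF \<phi>] x by auto
    then have "(x \<ominus>\<^bsub>A\<^esub> a) \<oplus>\<^bsub>A\<^esub> a \<in> Fix (carrier A) \<phi> P" using A.submoduleE(5)[OF sub] a by blast
    then show ?thesis using x aA by (simp add: a_minus_def A.a_assoc A.l_neg)
  qed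
  show ?thesis
  proof (subst D1.a_coset_UN[OF aA])
    fix x assume x: "x \<in> carrier A" "x \<ominus>\<^bsub>A\<^esub> a \<in> D (carrier A) \<phi>"
    have "(x \<ominus>\<^bsub>A\<^esub> a) \<otimes>\<^bsub>A\<^esub> b \<in> D (carrier A) (\<phi> \<otimes>\<^bsub>Ag\<^esub> \<psi>)" by (rule D_mult_right[OF \<phi> \<psi> b x(2)])
    moreover have "(x \<ominus>\<^bsub>A\<^esub> a) \<otimes>\<^bsub>A\<^esub> b = x \<otimes>\<^bsub>A\<^esub> b \<ominus>\<^bsub>A\<^esub> a \<otimes>\<^bsub>A\<^esub> b"
      using aA x bA by (simp add: a_minus_def A.l_distr A.l_minus)
    ultimately show "(\<Union>y\<in>cl (carrier A) \<psi> b. cl (carrier A) (\<phi> \<otimes>\<^bsub>Ag\<^esub> \<psi>) (x \<otimes>\<^bsub>A\<^esub> y)) =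
       (\<Union>y\<in>cl (carrier A) \<psi> b. cl (carrier A) (\<phi> \<otimes>\<^bsub>Ag\<^esub> \<psi>) (a \<otimes>\<^bsub>A\<^esub> y))"
      using cl_eq_iff[OF subset_refl c] aA x bA 1[OF a] 1[OF x_Fix[OF x]] by simp
  qed (rule 1[OF a])
qed

sublocale X: G_algebra Ag R A "\<lambda>a \<phi>. a"
  by (intro G_algebra_trivial Ag.is_group A.assoc_algebra_axioms finite_Aut finite_P)

text \<open>For the trivial action these rules are tautologies on which the simplifier loops.\<close>
declare X.act_closed [simp del] X.act_unit [simp del] X.act_zero [simp del]

section \<open>Families of fixed elements and their classes\<close>

text \<open>Representatives of the elements of \<open>ext_brauer\<close>. Outside L the entry is
  zero itself and not merely an element of the kernel, so that supports multiply exactly.\<close>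

definition fams :: "'a set \<Rightarrow> ('g \<Rightarrow> 'g) set \<Rightarrow> (('g \<Rightarrow> 'g) \<Rightarrow> 'a) set" where
  "fams M L = {f \<in> carrier X.S. \<forall>\<phi>\<in>Aut G P. f \<phi> \<in> Fix M \<phi> P \<and> (\<phi> \<notin> L \<longrightarrow> f \<phi> = \<zero>\<^bsub>A\<^esub>)}"

lemma fams_carrier: "f \<in> fams M L \<Longrightarrow> f \<in> carrier X.S"
  and fams_Fix: "f \<in> fams M L \<Longrightarrow> \<phi> \<in> Aut G P \<Longrightarrow> f \<phi> \<in> Fix M \<phi> P"
  and fams_out: "f \<in> fams M L \<Longrightarrow> \<phi> \<in> Aut G P \<Longrightarrow> \<phi> \<notin> L \<Longrightarrow> f \<phi> = \<zero>\<^bsub>A\<^esub>"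
  unfolding fams_def by blast+

lemma famsI:
  "f \<in> carrier X.S \<Longrightarrow> (\<And>\<phi>. \<phi> \<in> Aut G P \<Longrightarrow> f \<phi> \<in> Fix M \<phi> P) \<Longrightarrow>
   (\<And>\<phi>. \<phi> \<in> Aut G P \<Longrightarrow> \<phi> \<notin> L \<Longrightarrow> f \<phi> = \<zero>\<^bsub>A\<^esub>) \<Longrightarrow> f \<in> fams M L"
  unfolding fams_def by blast

definition cls_fam :: "'a set \<Rightarrow> (('g \<Rightarrow> 'g) \<Rightarrow> 'a) \<Rightarrow> ('g \<Rightarrow> 'g) \<Rightarrow> 'a set" where
  "cls_fam M f = (\<lambda>\<phi>\<in>Aut G P. cl M \<phi> (f \<phi>))"

lemma Fix_zero: "submodule M R A \<Longrightarrow> \<phi> \<in> Aut G P \<Longrightarrow> \<zero>\<^bsub>A\<^esub> \<in> Fix M \<phi> P"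
  using subgroup.one_closed[OF submodule.axioms(1)[OF Fix_submodule[of M \<phi> P]]] by simp

lemma fams_submodule:
  assumes M: "submodule M R A" shows "submodule (fams M L) R X.S"
proof (rule X.S.submoduleI)
  have E: "submodule (Fix M \<phi> P) R A" if "\<phi> \<in> Aut G P" for \<phi> by (rule Fix_submodule[OF M that]) simp
  note E' = A.submoduleE[OF E]
  show "fams M L \<subseteq> carrier X.S" using fams_carrier by blast
  show "\<zero>\<^bsub>X.S\<^esub> \<in> fams M L" by (rule famsI) (simp_all add: Fix_zero[OF M], simp_all add: X.skew_zero Fix_zero[OF M])
  show "\<ominus>\<^bsub>X.S\<^esub> f \<in> fams M L" if f: "f \<in> fams M L" for f
    by (rule famsI) (simp_all add: X.skew_minus_apply fams_carrier[OF f] fams_Fix[OF f] fams_out[OF f] E'(3))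
  show "f \<oplus>\<^bsub>X.S\<^esub> f' \<in> fams M L" if f: "f \<in> fams M L" "f' \<in> fams M L" for f f'
  proof (rule famsI)
    show "f \<oplus>\<^bsub>X.S\<^esub> f' \<in> carrier X.S" using f[THEN fams_carrier] by simp
  qed (simp_all add: X.skew_add f[THEN fams_Fix] f[THEN fams_out] E'(5))
  show "r \<odot>\<^bsub>X.S\<^esub> f \<in> fams M L" if r: "r \<in> carrier R" and f: "f \<in> fams M L" for r f
  proof (rule famsI)
    show "r \<odot>\<^bsub>X.S\<^esub> f \<in> carrier X.S" using fams_carrier[OF f] r by simp
  qed (simp_all add: X.skew_smult r fams_Fix[OF f] fams_out[OF f] E'(4))
qed

lemma N_add: "f \<oplus>\<^bsub>N M L\<^esub> f' = (\<lambda>\<phi>\<in>Aut G P. f \<phi> \<oplus>\<^bsub>V M \<phi>\<^esub> f' \<phi>)"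
  and N_zero: "\<zero>\<^bsub>N M L\<^esub> = (\<lambda>\<phi>\<in>Aut G P. \<zero>\<^bsub>V M \<phi>\<^esub>)"
  and N_one: "\<one>\<^bsub>N M L\<^esub> = (\<lambda>\<phi>\<in>Aut G P. if \<phi> = \<one>\<^bsub>Ag\<^esub> then cl M \<phi> \<one>\<^bsub>A\<^esub> else \<zero>\<^bsub>V M \<phi>\<^esub>)"
  and N_smult: "c \<odot>\<^bsub>N M L\<^esub> f = (\<lambda>\<phi>\<in>Aut G P. c \<odot>\<^bsub>V M \<phi>\<^esub> f \<phi>)"
  and N_mult: "f \<otimes>\<^bsub>N M L\<^esub> f' = (\<lambda>\<chi>\<in>Aut G P. \<Oplus>\<^bsub>V M \<chi>\<^esub>\<phi>\<in>Aut G P.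
        \<Union>a\<in>f \<phi>. \<Union>b\<in>f' (inv\<^bsub>Ag\<^esub> \<phi> \<otimes>\<^bsub>Ag\<^esub> \<chi>). cl M \<chi> (a \<otimes>\<^bsub>A\<^esub> b))"
  and carrier_N: "carrier (N M L) =
      {f \<in> (\<Pi>\<^sub>E \<phi>\<in>Aut G P. carrier (V M \<phi>)). \<forall>\<phi>\<in>Aut G P - L. f \<phi> = \<zero>\<^bsub>V M \<phi>\<^esub>}"
  by (simp_all add: ext_brauer_def Let_def)

lemma cls_fam_surj:
  assumes M: "submodule M R A" shows "cls_fam M ` fams M L = carrier (N M L)"
proof (intro equalityI subsetI)
  note Mc = A.submoduleE(1)[OF M]
  fix f assume "f \<in> cls_fam M ` fams M L"
  then obtain f' where f': "f' \<in> fams M L" "f = cls_fam M f'" by blast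
  have "f' \<phi> \<in> Fix M \<phi> P" if "\<phi> \<in> Aut G P" for \<phi> by (rule fams_Fix[OF f'(1) that])
  moreover have "f \<phi> = \<zero>\<^bsub>V M \<phi>\<^esub>" if "\<phi> \<in> Aut G P" "\<phi> \<notin> L" for \<phi>
    using that fams_out[OF f'(1) that] by (simp add: f'(2) cls_fam_def cl_zero[OF Mc])
  ultimately show "f \<in> carrier (N M L)"
    by (simp add: carrier_N f'(2) cls_fam_def carrier_V)
next
  note Mc = A.submoduleE(1)[OF M]
  fix f assume f: "f \<in> carrier (N M L)"
  have "\<exists>m. m \<in> Fix M \<phi> P \<and> f \<phi> = cl M \<phi> m" if "\<phi> \<in> Aut G P" for \<phi>
    using f that by (auto simp: carrier_N carrier_V)
  then obtain m where m: "\<And>\<phi>. \<phi> \<in> Aut G P \<Longrightarrow> m \<phi> \<in> Fix M \<phi> P \<and> f \<phi> = cl M \<phi> (m \<phi>)" by metis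
  \<comment> \<open>Outside L the chosen representative is replaced by zero; the class is zero there
    in any case.\<close>
  define m' where "m' = (\<lambda>\<phi>\<in>Aut G P. if \<phi> \<in> L then m \<phi> else \<zero>\<^bsub>A\<^esub>)"
  have mF: "m' \<phi> \<in> Fix M \<phi> P" if "\<phi> \<in> Aut G P" for \<phi>
    using m[OF that] Fix_zero[OF M that] that by (simp add: m'_def)
  then have "m' \<phi> \<in> carrier A" if "\<phi> \<in> Aut G P" for \<phi> using that Fix_subset Mc by blast
  then have "m' \<in> carrier X.S" unfolding X.carrier_skew by (auto simp: PiE_iff m'_def)
  moreover have "m' \<phi> = \<zero>\<^bsub>A\<^esub>" if "\<phi> \<in> Aut G P" "\<phi> \<notin> L" for \<phi> using that by (simp add: m'_def)
  ultimately have "m' \<in> fams M L" using mF by (intro famsI)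
  moreover have "f = cls_fam M m'"
  proof
    fix \<phi> show "f \<phi> = cls_fam M m' \<phi>"
    proof (cases "\<phi> \<in> Aut G P")
      case True
      then show ?thesis using f m[of \<phi>] by (auto simp: cls_fam_def m'_def carrier_N cl_zero[OF Mc])
    next
      case False
      then show ?thesis using f by (auto simp: cls_fam_def carrier_N PiE_def extensional_def)
    qed
  qed
  ultimately show "f \<in> cls_fam M ` fams M L" by blast
qed

lemma fams_apply: "submodule M R A \<Longrightarrow> f \<in> fams M L \<Longrightarrow> \<phi> \<in> Aut G P \<Longrightarrow> f \<phi> \<in> Fix M \<phi> P \<and> f \<phi> \<in> carrier A"
  using fams_Fix fams_carrier X.skew_closed by blast

lemma cls_fam_add:
  assumes M: "submodule M R A" and f: "f \<in> fams M L" "f' \<in> fams M L"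
  shows "cls_fam M (f \<oplus>\<^bsub>X.S\<^esub> f') = cls_fam M f \<oplus>\<^bsub>N M L\<^esub> cls_fam M f'"
  unfolding cls_fam_def N_add
proof (rule restrict_ext)
  fix \<phi> assume \<phi>: "\<phi> \<in> Aut G P"
  show "cl M \<phi> ((f \<oplus>\<^bsub>X.S\<^esub> f') \<phi>) =
      (\<lambda>\<phi>\<in>Aut G P. cl M \<phi> (f \<phi>)) \<phi> \<oplus>\<^bsub>V M \<phi>\<^esub> (\<lambda>\<phi>\<in>Aut G P. cl M \<phi> (f' \<phi>)) \<phi>"
    using \<phi> fams_apply[OF M f(1) \<phi>] fams_apply[OF M f(2) \<phi>] A.submoduleE(1)[OF M]
    by (simp add: X.skew_add cl_add)
qed

lemma cls_fam_zero:
  assumes M: "submodule M R A" shows "cls_fam M \<zero>\<^bsub>X.S\<^esub> = \<zero>\<^bsub>N M L\<^esub>"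
  unfolding cls_fam_def N_zero using A.submoduleE(1)[OF M]
  by (auto intro!: restrict_ext simp: X.skew_zero cl_zero)

lemma cls_fam_smult:
  assumes M: "submodule M R A" and r: "r \<in> carrier R" and f: "f \<in> fams M L"
  shows "cls_fam M (r \<odot>\<^bsub>X.S\<^esub> f) = red r \<odot>\<^bsub>N M L\<^esub> cls_fam M f"
  unfolding cls_fam_def N_smult
proof (rule restrict_ext)
  fix \<phi> assume \<phi>: "\<phi> \<in> Aut G P"
  show "cl M \<phi> ((r \<odot>\<^bsub>X.S\<^esub> f) \<phi>) = red r \<odot>\<^bsub>V M \<phi>\<^esub> (\<lambda>\<phi>\<in>Aut G P. cl M \<phi> (f \<phi>)) \<phi>"
    using \<phi> fams_apply[OF M f \<phi>] r by (simp add: X.skew_smult cl_smult[OF M])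
qed

lemma N_module: assumes M: "submodule M R A" shows "module k (N M L)"
proof -
  have sub: "submodule (fams M L) R X.S" by (rule fams_submodule[OF M])
  show ?thesis
    by (rule module_surj[where \<rho>=red and h="cls_fam M",
          OF submodule.submodule_is_module[OF sub X.S.module_axioms] k_cring red_hom red_surj])
       (use cls_fam_surj[OF M, of L] in \<open>auto simp: cls_fam_add[OF M] cls_fam_zero[OF M] cls_fam_smult[OF M]\<close>)
qed

lemma mult_terms_Fix:
  assumes f: "f \<in> fams (carrier A) L1" "f' \<in> fams (carrier A) L2" and c: "\<phi> \<in> Aut G P" "\<chi> \<in> Aut G P"
  shows "f \<phi> \<otimes>\<^bsub>A\<^esub> f' (inv\<^bsub>Ag\<^esub> \<phi> \<otimes>\<^bsub>Ag\<^esub> \<chi>) \<in> Fix (carrier A) \<chi> P"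
proof -
  have "f \<phi> \<otimes>\<^bsub>A\<^esub> f' (inv\<^bsub>Ag\<^esub> \<phi> \<otimes>\<^bsub>Ag\<^esub> \<chi>) \<in> Fix (carrier A) (\<phi> \<otimes>\<^bsub>Ag\<^esub> (inv\<^bsub>Ag\<^esub> \<phi> \<otimes>\<^bsub>Ag\<^esub> \<chi>)) P"
    using fams_Fix[OF f(1)] fams_Fix[OF f(2)] c by (intro Fix_mult[where Q'=P]) auto
  then show ?thesis using c by simp
qed

text \<open>Three support sets are kept apart because there are two uses: all equal to a subgroup,
  for closure under products, and the degree sets of two components and of their product, for the
  grading.\<close>

lemma fams_mult:
  assumes L: "\<And>\<phi> \<psi>. \<phi> \<in> L1 \<Longrightarrow> \<psi> \<in> L2 \<Longrightarrow> \<phi> \<otimes>\<^bsub>Ag\<^esub> \<psi> \<in> L"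
    and f: "f \<in> fams (carrier A) L1" "f' \<in> fams (carrier A) L2"
  shows "f \<otimes>\<^bsub>X.S\<^esub> f' \<in> fams (carrier A) L"
proof (rule famsI)
  show "f \<otimes>\<^bsub>X.S\<^esub> f' \<in> carrier X.S" using fams_carrier[OF f(1)] fams_carrier[OF f(2)] by simp
  fix \<chi> assume \<chi>: "\<chi> \<in> Aut G P"
  have sub: "submodule (Fix (carrier A) \<chi> P) R A" by (rule Fix_submodule[OF carrier_submodule \<chi>]) simp
  have eq: "(f \<otimes>\<^bsub>X.S\<^esub> f') \<chi> = (\<Oplus>\<^bsub>A\<^esub>\<phi>\<in>Aut G P. f \<phi> \<otimes>\<^bsub>A\<^esub> f' (inv\<^bsub>Ag\<^esub> \<phi> \<otimes>\<^bsub>Ag\<^esub> \<chi>))"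
    using \<chi> by (simp add: X.skew_mult)
  show "(f \<otimes>\<^bsub>X.S\<^esub> f') \<chi> \<in> Fix (carrier A) \<chi> P"
    unfolding eq
    by (rule finsum_hom(1)[where T="Fix (carrier A) \<chi> P" and h="\<lambda>x. x" and N=A])
       (use A.submoduleE[OF sub] Fix_zero[OF carrier_submodule \<chi>] mult_terms_Fix[OF f _ \<chi>] finite_Aut[OF finite_P]
         A.abelian_monoid_axioms in auto)
  assume nL: "\<chi> \<notin> L"
  show "(f \<otimes>\<^bsub>X.S\<^esub> f') \<chi> = \<zero>\<^bsub>A\<^esub>"
    unfolding eq
  proof (rule A.add.finprod_one_eqI)
    fix \<phi> assume \<phi>: "\<phi> \<in> Aut G P"
    have fz: "\<And>\<psi>. \<psi> \<in> Aut G P \<Longrightarrow> \<psi> \<notin> L1 \<Longrightarrow> f \<psi> = \<zero>\<^bsub>A\<^esub>" "\<And>\<psi>. \<psi> \<in> Aut G P \<Longrightarrow> \<psi> \<notin> L2 \<Longrightarrow> f' \<psi> = \<zero>\<^bsub>A\<^esub>"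
      "\<And>\<psi>. \<psi> \<in> Aut G P \<Longrightarrow> f \<psi> \<in> carrier A" "\<And>\<psi>. \<psi> \<in> Aut G P \<Longrightarrow> f' \<psi> \<in> carrier A"
      using fams_out[OF f(1)] fams_out[OF f(2)] fams_carrier[OF f(1)] fams_carrier[OF f(2)] by auto
    have c: "inv\<^bsub>Ag\<^esub> \<phi> \<otimes>\<^bsub>Ag\<^esub> \<chi> \<in> Aut G P" using \<phi> \<chi> by simp
    have "\<phi> \<notin> L1 \<or> inv\<^bsub>Ag\<^esub> \<phi> \<otimes>\<^bsub>Ag\<^esub> \<chi> \<notin> L2"
    proof (rule ccontr)
      assume "\<not> ?thesis"
      then have "\<phi> \<otimes>\<^bsub>Ag\<^esub> (inv\<^bsub>Ag\<^esub> \<phi> \<otimes>\<^bsub>Ag\<^esub> \<chi>) \<in> L" using L by blast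
      then show False using nL \<phi> \<chi> by simp
    qed
    then show "f \<phi> \<otimes>\<^bsub>A\<^esub> f' (inv\<^bsub>Ag\<^esub> \<phi> \<otimes>\<^bsub>Ag\<^esub> \<chi>) = \<zero>\<^bsub>A\<^esub>"
      using fz(1)[OF \<phi>] fz(2)[OF c] fz(3)[OF \<phi>] fz(4)[OF c] by auto
  qed
qed

text \<open>The multiplication of \<open>ext_brauer\<close> does not mention L, so L, L1 and L2 are
  independent. Products of components of different degrees are thereby computed inside the algebra
  for K.\<close>

lemma cls_fam_mult:
  assumes f: "f \<in> fams (carrier A) L1" "f' \<in> fams (carrier A) L2"
  shows "cls_fam (carrier A) (f \<otimes>\<^bsub>X.S\<^esub> f') = cls_fam (carrier A) f \<otimes>\<^bsub>N (carrier A) L\<^esub> cls_fam (carrier A) f'"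
  unfolding N_mult unfolding cls_fam_def
proof (rule restrict_ext)
  fix \<chi> assume \<chi>: "\<chi> \<in> Aut G P"
  let ?C = "cl (carrier A)" and ?V = "V (carrier A) \<chi>"
  let ?t = "\<lambda>\<phi>. f \<phi> \<otimes>\<^bsub>A\<^esub> f' (inv\<^bsub>Ag\<^esub> \<phi> \<otimes>\<^bsub>Ag\<^esub> \<chi>)"
  interpret V: module k ?V by (rule V_module[OF carrier_submodule \<chi>])
  have sub: "submodule (Fix (carrier A) \<chi> P) R A" by (rule Fix_submodule[OF carrier_submodule \<chi>]) simp
  have "?C \<chi> ((f \<otimes>\<^bsub>X.S\<^esub> f') \<chi>) = (\<Oplus>\<^bsub>?V\<^esub>\<phi>\<in>Aut G P. ?C \<chi> (?t \<phi>))"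
  proof -
    have "?C \<chi> (\<Oplus>\<^bsub>A\<^esub>\<phi>\<in>Aut G P. ?t \<phi>) = (\<Oplus>\<^bsub>?V\<^esub>\<phi>\<in>Aut G P. ?C \<chi> (?t \<phi>))"
    proof (rule finsum_hom(2)[where T="Fix (carrier A) \<chi> P"])
      show "Fix (carrier A) \<chi> P \<subseteq> carrier A" by (rule Fix_subset)
      show "?C \<chi> (x \<oplus>\<^bsub>A\<^esub> y) = ?C \<chi> x \<oplus>\<^bsub>?V\<^esub> ?C \<chi> y"
        if "x \<in> Fix (carrier A) \<chi> P" "y \<in> Fix (carrier A) \<chi> P" for x y
        using that Fix_carrier by (intro cl_add \<chi>) auto
      show "?C \<chi> \<zero>\<^bsub>A\<^esub> = \<zero>\<^bsub>?V\<^esub>" by (rule cl_zero[OF subset_refl \<chi>])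
    qed (use A.submoduleE[OF sub] Fix_zero[OF carrier_submodule \<chi>] mult_terms_Fix[OF f _ \<chi>] finite_Aut[OF finite_P]
         A.abelian_monoid_axioms V.M.abelian_monoid_axioms carrier_V in auto)
    then show ?thesis using \<chi> by (simp add: X.skew_mult)
  qed
  also have "\<dots> = (\<Oplus>\<^bsub>?V\<^esub>\<phi>\<in>Aut G P. \<Union>a\<in>restrict (\<lambda>\<phi>. ?C \<phi> (f \<phi>)) (Aut G P) \<phi>.
      \<Union>b\<in>restrict (\<lambda>\<phi>. ?C \<phi> (f' \<phi>)) (Aut G P) (inv\<^bsub>Ag\<^esub> \<phi> \<otimes>\<^bsub>Ag\<^esub> \<chi>). ?C \<chi> (a \<otimes>\<^bsub>A\<^esub> b))"
  proof (rule V.M.finsum_cong'[OF refl, symmetric])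
    fix \<phi> assume \<phi>: "\<phi> \<in> Aut G P"
    have c: "inv\<^bsub>Ag\<^esub> \<phi> \<otimes>\<^bsub>Ag\<^esub> \<chi> \<in> Aut G P" using \<phi> \<chi> by simp
    have e: "\<phi> \<otimes>\<^bsub>Ag\<^esub> (inv\<^bsub>Ag\<^esub> \<phi> \<otimes>\<^bsub>Ag\<^esub> \<chi>) = \<chi>" using \<phi> \<chi> by simp
    show "(\<Union>a\<in>restrict (\<lambda>\<phi>. ?C \<phi> (f \<phi>)) (Aut G P) \<phi>.
      \<Union>b\<in>restrict (\<lambda>\<phi>. ?C \<phi> (f' \<phi>)) (Aut G P) (inv\<^bsub>Ag\<^esub> \<phi> \<otimes>\<^bsub>Ag\<^esub> \<chi>). ?C \<chi> (a \<otimes>\<^bsub>A\<^esub> b)) = ?C \<chi> (?t \<phi>)"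
      using cl_mult[OF \<phi> c, of "f \<phi>" "f' (inv\<^bsub>Ag\<^esub> \<phi> \<otimes>\<^bsub>Ag\<^esub> \<chi>)"] fams_Fix[OF f(1) \<phi>] fams_Fix[OF f(2) c] \<phi> c unfolding e
      by simp
  qed (use mult_terms_Fix[OF f _ \<chi>] carrier_V in auto)
  finally show "?C \<chi> ((f \<otimes>\<^bsub>X.S\<^esub> f') \<chi>) = \<dots>" .
qed

lemma one_fams: assumes "subgroup L Ag" shows "\<one>\<^bsub>X.S\<^esub> \<in> fams (carrier A) L"
proof (rule famsI)
  fix \<phi> assume \<phi>: "\<phi> \<in> Aut G P"
  show "\<one>\<^bsub>X.S\<^esub> \<phi> \<in> Fix (carrier A) \<phi> P"
    using \<phi> Fix_zero[OF carrier_submodule \<phi>] by (auto simp: X.skew_one br_fixed_def Aut_apply_one)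
  show "\<one>\<^bsub>X.S\<^esub> \<phi> = \<zero>\<^bsub>A\<^esub>" if "\<phi> \<notin> L"
    using \<phi> that subgroup.one_closed[OF assms] by (auto simp: X.skew_one)
qed simp

lemma cls_fam_single:
  assumes "\<phi> \<in> Aut G P"
  shows "cls_fam M (X.single \<phi> a) = (\<lambda>\<psi>\<in>Aut G P. if \<psi> = \<phi> then cl M \<psi> a else cl M \<psi> \<zero>\<^bsub>A\<^esub>)"
  by (auto simp: cls_fam_def X.single_def intro!: restrict_ext)

lemma cls_fam_one: "cls_fam (carrier A) \<one>\<^bsub>X.S\<^esub> = \<one>\<^bsub>N (carrier A) L\<^esub>"
  unfolding X.skew_one_single cls_fam_single[OF Ag.one_closed] N_one
  by (auto intro!: restrict_ext simp: cl_zero)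

lemma N_algebra:
  assumes L: "subgroup L Ag" shows "assoc_algebra k (N (carrier A) L)"
proof -
  have sub: "submodule (fams (carrier A) L) R X.S" by (rule fams_submodule[OF carrier_submodule])
  have alg: "assoc_algebra R (X.S\<lparr>carrier := fams (carrier A) L\<rparr>)"
    by (rule assoc_algebra_sub[OF X.S.assoc_algebra_axioms sub one_fams[OF L] fams_mult[OF subgroup.m_closed[OF L]]])
  show ?thesis
    by (rule assoc_algebra_surj[where \<rho>=red and h="cls_fam (carrier A)", OF alg k_cring red_hom red_surj])
       (use cls_fam_surj[OF carrier_submodule, of L] in
         \<open>auto simp: cls_fam_add[OF carrier_submodule] cls_fam_zero[OF carrier_submodule]
            cls_fam_smult[OF carrier_submodule] cls_fam_mult cls_fam_one\<close>)
qed

section \<open>The interior structure given by the normalizer of P\<close>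

lemma \<iota>_Fix: assumes "x \<in> normalizer G P" shows "\<iota> x \<in> Fix (carrier A) (conj_aut G P x) P"
proof -
  have x: "x \<in> carrier G" using normalizer_conj(1)[OF G.is_group P assms] .
  then show ?thesis
    by (auto simp: br_fixed_def conj_aut_def conj_by_def G.m_assoc simp flip: \<iota>_mult)
qed

lemma struct_eq:
  assumes "x \<in> normalizer G P"
  shows "ext_brauer_struct G P J A \<iota> x = cls_fam (carrier A) (X.single (conj_aut G P x) (\<iota> x))"
  unfolding cls_fam_single[OF conj_aut_Aut[OF G.is_group P assms]] ext_brauer_struct_def
  by (auto intro!: restrict_ext simp: cl_zero zero_V)

lemma single_fams:
  assumes "\<phi> \<in> Aut G P" "a \<in> Fix M \<phi> P" "\<phi> \<in> L" "submodule M R A"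
  shows "X.single \<phi> a \<in> fams M L"
proof -
  have "a \<in> carrier A" using assms Fix_subset A.submoduleE(1)[OF assms(4)] by blast
  then have "X.single \<phi> a \<in> carrier X.S" by simp
  then show ?thesis
  proof (rule famsI)
    fix \<psi> assume \<psi>: "\<psi> \<in> Aut G P"
    show "X.single \<phi> a \<psi> \<in> Fix M \<psi> P"
      using assms(2) \<psi> Fix_zero[OF assms(4) \<psi>] by (simp add: X.single_def)
    show "X.single \<phi> a \<psi> = \<zero>\<^bsub>A\<^esub>" if "\<psi> \<notin> L" using that \<psi> assms(3) by (auto simp: X.single_def)
  qed
qed

lemma struct_closed:
  assumes "x \<in> normalizer G P" "conj_aut G P x \<in> L"
  shows "ext_brauer_struct G P J A \<iota> x \<in> carrier (N (carrier A) L)"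
proof -
  have "X.single (conj_aut G P x) (\<iota> x) \<in> fams (carrier A) L"
    using assms by (intro single_fams conj_aut_Aut \<iota>_Fix G.is_group P carrier_submodule)
  then show ?thesis
    unfolding struct_eq[OF assms(1)] cls_fam_surj[OF carrier_submodule, symmetric] by (rule imageI)
qed

lemma normalizer_subgroup: "subgroup (normalizer G P) G"
  by (rule G.normalizer_imp_subgroup) auto

lemma conj_aut_one: "conj_aut G P \<one>\<^bsub>G\<^esub> = \<one>\<^bsub>Ag\<^esub>"
  by (auto simp: conj_aut_def conj_by_def Aut_one)

lemma conj_aut_inv:
  assumes x: "x \<in> normalizer G P"
  shows "conj_aut G P (inv\<^bsub>G\<^esub> x) = inv\<^bsub>Ag\<^esub> conj_aut G P x"
proof (rule Ag.inv_equality[symmetric])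
  have x': "inv\<^bsub>G\<^esub> x \<in> normalizer G P" using subgroup.m_inv_closed[OF normalizer_subgroup x] .
  have xG: "x \<in> carrier G" using normalizer_conj(1)[OF G.is_group P x] .
  show "conj_aut G P (inv\<^bsub>G\<^esub> x) \<otimes>\<^bsub>Ag\<^esub> conj_aut G P x = \<one>\<^bsub>Ag\<^esub>"
    using conj_aut_mult[OF G.is_group P x' x] xG by (simp add: conj_aut_one)
qed (use conj_aut_Aut[OF G.is_group P] subgroup.m_inv_closed[OF normalizer_subgroup] x in auto)

lemma norm_in_subgroup: assumes L: "subgroup L Ag" shows "subgroup (norm_in G P L) G"
proof (rule G.subgroupI)
  note n = subgroup.one_closed[OF normalizer_subgroup] subgroup.m_inv_closed[OF normalizer_subgroup]
    subgroup.m_closed[OF normalizer_subgroup] subgroup.subset[OF normalizer_subgroup]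
  note l = subgroup.one_closed[OF L] subgroup.m_inv_closed[OF L] subgroup.m_closed[OF L]
  show "norm_in G P L \<noteq> {}" using n l conj_aut_one by (auto simp: norm_in_def intro!: exI[of _ "\<one>\<^bsub>G\<^esub>"])
  show "norm_in G P L \<subseteq> carrier G" using n by (auto simp: norm_in_def)
  show "inv\<^bsub>G\<^esub> x \<in> norm_in G P L" if "x \<in> norm_in G P L" for x
    using that n l by (auto simp: norm_in_def conj_aut_inv)
  show "x \<otimes>\<^bsub>G\<^esub> y \<in> norm_in G P L" if "x \<in> norm_in G P L" "y \<in> norm_in G P L" for x y
    using that n l by (auto simp: norm_in_def conj_aut_mult[OF G.is_group P])
qed

text \<open>The identity holds already between the representing families, each concentrated in a
  single degree; passing to classes preserves it.\<close>

lemma struct_mult: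
  assumes x: "x \<in> norm_in G P L" and y: "y \<in> norm_in G P L"
  shows "ext_brauer_struct G P J A \<iota> (x \<otimes>\<^bsub>G\<^esub> y) =
    ext_brauer_struct G P J A \<iota> x \<otimes>\<^bsub>N (carrier A) L\<^esub> ext_brauer_struct G P J A \<iota> y"
proof -
  have x': "x \<in> normalizer G P" "conj_aut G P x \<in> L" and y': "y \<in> normalizer G P" "conj_aut G P y \<in> L"
    using x y by (auto simp: norm_in_def)
  note A = conj_aut_Aut[OF G.is_group P x'(1)] conj_aut_Aut[OF G.is_group P y'(1)]
    normalizer_conj(1)[OF G.is_group P x'(1)] normalizer_conj(1)[OF G.is_group P y'(1)]
  have f: "X.single (conj_aut G P z) (\<iota> z) \<in> fams (carrier A) L" if "z \<in> norm_in G P L" for z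
    using that by (intro single_fams conj_aut_Aut \<iota>_Fix G.is_group P carrier_submodule) (auto simp: norm_in_def)
  have "X.single (conj_aut G P (x \<otimes>\<^bsub>G\<^esub> y)) (\<iota> (x \<otimes>\<^bsub>G\<^esub> y)) =
      X.single (conj_aut G P x) (\<iota> x) \<otimes>\<^bsub>X.S\<^esub> X.single (conj_aut G P y) (\<iota> y)"
    using A by (simp add: X.single_mult_single conj_aut_mult[OF G.is_group P x'(1) y'(1)] \<iota>_mult)
  then show ?thesis
    using x' y' subgroup.m_closed[OF normalizer_subgroup]
    by (simp add: struct_eq cls_fam_mult[OF f[OF x] f[OF y]])
qed

lemma N_interior:
  assumes L: "subgroup L Ag"
  shows "interior_algebra k (G\<lparr>carrier := norm_in G P L\<rparr>) (ext_brauer_struct G P J A \<iota>) (N (carrier A) L)"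
  unfolding interior_algebra_def
proof (intro conjI)
  let ?s = "ext_brauer_struct G P J A \<iota>" and ?N = "N (carrier A) L"
  note S = norm_in_subgroup[OF L]
  show "group (G\<lparr>carrier := norm_in G P L\<rparr>)" by (rule subgroup.subgroup_is_group[OF S G.is_group])
  show "assoc_algebra k ?N" by (rule N_algebra[OF L])
  then interpret N: assoc_algebra k ?N .
  have one: "?s \<one>\<^bsub>G\<^esub> = \<one>\<^bsub>?N\<^esub>"
    using subgroup.one_closed[OF normalizer_subgroup]
    by (simp add: struct_eq conj_aut_one \<iota>_one cls_fam_one flip: X.skew_one_single)
  have cl: "?s x \<in> carrier ?N" if "x \<in> norm_in G P L" for x
    using that struct_closed by (auto simp: norm_in_def)
  have "?s x \<in> Units ?N" if x: "x \<in> norm_in G P L" for x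
  proof -
    have x': "inv\<^bsub>G\<^esub> x \<in> norm_in G P L" "x \<in> carrier G"
      using x subgroup.m_inv_closed[OF S] subgroup.subset[OF S] by auto
    have "?s x \<otimes>\<^bsub>?N\<^esub> ?s (inv\<^bsub>G\<^esub> x) = \<one>\<^bsub>?N\<^esub>" "?s (inv\<^bsub>G\<^esub> x) \<otimes>\<^bsub>?N\<^esub> ?s x = \<one>\<^bsub>?N\<^esub>"
      using x x' by (simp_all add: one flip: struct_mult)
    then show ?thesis using cl[OF x] cl[OF x'(1)] unfolding Units_def by blast
  qed
  then show "?s \<in> hom (G\<lparr>carrier := norm_in G P L\<rparr>) (units_of ?N)"
    by (intro homI) (auto simp: units_of_carrier units_of_mult struct_mult)
qed

end

section \<open>Fixed cosets and orbit sums\<close>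

context brauer
begin

section \<open>Dependence on the submodule M and on the index set L\<close>

lemma Fix_mono: "M \<subseteq> M' \<Longrightarrow> Fix M \<phi> Q \<subseteq> Fix M' \<phi> Q"
  by (auto simp: br_fixed_def)

lemma D_mono:
  assumes "M \<subseteq> M'" shows "D M \<phi> \<subseteq> D M' \<phi>"
  unfolding D_eq
proof (rule A.add.mono_generate)
  show "br_gens M \<phi> \<subseteq> br_gens M' \<phi>"
    using Fix_mono[OF assms] unfolding br_gens_def by blast
qed

text \<open>Taking the union enlarges a coset of the kernel for M to a coset of the kernel for A. No
  injectivity is claimed: for general M, traces of elements outside M may fall into M. For coset
  components \<open>proj\<close> will provide a left inverse.\<close>

lemma incl_cl:
  assumes M: "M \<subseteq> carrier A" and \<phi>: "\<phi> \<in> Aut G P" and m: "m \<in> carrier A"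
  shows "br_incl G P J A \<iota> \<phi> (cl M \<phi> m) = cl (carrier A) \<phi> m"
proof -
  interpret DM: abelian_subgroup "D M \<phi>" A by (rule D_abelian_subgroup[OF M \<phi>])
  show ?thesis
    unfolding br_incl_def
    by (rule DM.a_coset_UN[OF m]) (use D_mono[OF M] cl_eq_iff[OF subset_refl \<phi>] m in blast)
qed

lemma incl_D:
  assumes M: "M \<subseteq> carrier A" and \<phi>: "\<phi> \<in> Aut G P"
  shows "br_incl G P J A \<iota> \<phi> (D M \<phi>) = D (carrier A) \<phi>"
  using incl_cl[OF M \<phi> A.zero_closed] by (simp add: cl_zero[OF M \<phi>] cl_zero[OF subset_refl \<phi>] zero_V)

lemma incl_lin_map:
  assumes M: "submodule M R A" and \<phi>: "\<phi> \<in> Aut G P"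
  shows "br_incl G P J A \<iota> \<phi> \<in> lin_map k (V M \<phi>) (V (carrier A) \<phi>)"
proof -
  note Mc = A.submoduleE(1)[OF M]
  have FA: "x \<in> carrier A" if "x \<in> Fix M \<phi> P" for x using that Mc Fix_subset by blast
  have FF: "x \<in> Fix (carrier A) \<phi> P" if "x \<in> Fix M \<phi> P" for x using that Fix_mono[OF Mc] by blast
  have "br_incl G P J A \<iota> \<phi> y \<in> carrier (V (carrier A) \<phi>)" if "y \<in> carrier (V M \<phi>)" for y
    using that FF by (auto simp: carrier_V incl_cl[OF Mc \<phi>] FA)
  moreover have "br_incl G P J A \<iota> \<phi> (x \<oplus>\<^bsub>V M \<phi>\<^esub> y) =
      br_incl G P J A \<iota> \<phi> x \<oplus>\<^bsub>V (carrier A) \<phi>\<^esub> br_incl G P J A \<iota> \<phi> y"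
    if "x \<in> carrier (V M \<phi>)" "y \<in> carrier (V M \<phi>)" for x y
    using that by (auto simp: carrier_V FA incl_cl[OF Mc \<phi>] \<phi> Mc simp flip: cl_add)
  moreover have "br_incl G P J A \<iota> \<phi> (c \<odot>\<^bsub>V M \<phi>\<^esub> x) = c \<odot>\<^bsub>V (carrier A) \<phi>\<^esub> br_incl G P J A \<iota> \<phi> x"
    if c: "c \<in> carrier k" and x: "x \<in> carrier (V M \<phi>)" for c x
  proof -
    obtain r where r: "r \<in> carrier R" "c = red r" using c red_surj by blast
    obtain m where m: "m \<in> Fix M \<phi> P" "x = cl M \<phi> m" using x by (auto simp: carrier_V)
    show ?thesis
      using r m cl_smult[OF M \<phi> r(1) m(1)] cl_smult[OF carrier_submodule \<phi> r(1) FF[OF m(1)]]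
      by (simp add: incl_cl[OF Mc \<phi>] FA flip: cl_smult[OF M \<phi> r(1) m(1)])
  qed
  ultimately show ?thesis by (auto simp: lin_map_def)
qed

text \<open>Families are indexed by all of Aut(P) and only the carrier depends on L. A graded
  component is therefore literally the record for a smaller index set.\<close>

lemma N_carrier_eq: "(N M L)\<lparr>carrier := carrier (N M L')\<rparr> = N M L'"
  by (simp add: ext_brauer_def Let_def)

lemma N_cong: "carrier (N M L) = carrier (N M L') \<Longrightarrow> N M L = N M L'"
  using N_carrier_eq[of M L L'] N_carrier_eq[of M L' L'] by (simp add: ext_brauer_def Let_def)

lemma carrier_N_mono: "L \<subseteq> L' \<Longrightarrow> carrier (N M L) \<subseteq> carrier (N M L')"
  by (auto simp: carrier_N)

lemma N_apply: "f \<in> carrier (N M L) \<Longrightarrow> \<phi> \<in> Aut G P \<Longrightarrow> f \<phi> \<in> carrier (V M \<phi>)"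
  by (auto simp: carrier_N)

lemma N_eqI:
  assumes "f \<in> carrier (N M L)" "f' \<in> carrier (N M L)" "\<And>\<phi>. \<phi> \<in> Aut G P \<Longrightarrow> f \<phi> = f' \<phi>"
  shows "f = f'"
  using assms by (intro PiE_ext[of f _ _ f']) (auto simp: carrier_N)

lemma N_finsum_apply:
  assumes M: "submodule M R A" and I: "finite I" and f: "\<And>i. i \<in> I \<Longrightarrow> f i \<in> carrier (N M L)" and \<phi>: "\<phi> \<in> Aut G P"
  shows "(\<Oplus>\<^bsub>N M L\<^esub>i\<in>I. f i) \<phi> = (\<Oplus>\<^bsub>V M \<phi>\<^esub>i\<in>I. f i \<phi>)"
proof -
  interpret N: module k "N M L" by (rule N_module[OF M])
  interpret V: module k "V M \<phi>" by (rule V_module[OF M \<phi>])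
  show ?thesis
  proof (rule finsum_hom(2)[where h="\<lambda>f. f \<phi>" and T="carrier (N M L)"])
    show "x \<phi> \<in> carrier (V M \<phi>)" if "x \<in> carrier (N M L)" for x using that \<phi> by (rule N_apply)
    show "(x \<oplus>\<^bsub>N M L\<^esub> y) \<phi> = x \<phi> \<oplus>\<^bsub>V M \<phi>\<^esub> y \<phi>" for x y using \<phi> by (simp add: N_add)
    show "\<zero>\<^bsub>N M L\<^esub> \<phi> = \<zero>\<^bsub>V M \<phi>\<^esub>" using \<phi> by (simp add: N_zero)
  qed (use I f N.M.abelian_monoid_axioms V.M.abelian_monoid_axioms in auto)
qed

text \<open>The coordinate of a family in the i-th summand is its truncation to \<open>LL i\<close>.
  Each \<phi> in L lies in exactly one of these sets, so in degree \<phi> the sum of the truncations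
  has a single term.\<close>

lemma N_grading:
  assumes I: "finite I" and L: "\<And>i. i \<in> I \<Longrightarrow> LL i \<subseteq> L"
    and part: "\<And>\<phi>. \<phi> \<in> L \<Longrightarrow> \<exists>!i. i \<in> I \<and> \<phi> \<in> LL i"
  shows "is_direct_sum k I (\<lambda>i. N (carrier A) (LL i)) (\<lambda>i a. a) (N (carrier A) L)"
proof (rule is_direct_sumI[where q="\<lambda>i f. \<lambda>\<phi>\<in>Aut G P. if \<phi> \<in> LL i then f \<phi> else \<zero>\<^bsub>V (carrier A) \<phi>\<^esub>", OF I])
  let ?V = "V (carrier A)" and ?N = "N (carrier A) L"
  let ?q = "\<lambda>i f. \<lambda>\<phi>\<in>Aut G P. if \<phi> \<in> LL i then f \<phi> else \<zero>\<^bsub>?V \<phi>\<^esub>"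
  have Vm: "module k (?V \<phi>)" if "\<phi> \<in> Aut G P" for \<phi> by (rule V_module[OF carrier_submodule that])
  have Vz: "\<zero>\<^bsub>?V \<phi>\<^esub> \<in> carrier (?V \<phi>)" "\<zero>\<^bsub>?V \<phi>\<^esub> \<oplus>\<^bsub>?V \<phi>\<^esub> \<zero>\<^bsub>?V \<phi>\<^esub> = \<zero>\<^bsub>?V \<phi>\<^esub>" if "\<phi> \<in> Aut G P" for \<phi>
  proof -
    interpret V: module k "?V \<phi>" by (rule Vm[OF that])
    show "\<zero>\<^bsub>?V \<phi>\<^esub> \<in> carrier (?V \<phi>)" "\<zero>\<^bsub>?V \<phi>\<^esub> \<oplus>\<^bsub>?V \<phi>\<^esub> \<zero>\<^bsub>?V \<phi>\<^esub> = \<zero>\<^bsub>?V \<phi>\<^esub>" by auto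
  qed
  show "module k ?N" "module k (N (carrier A) (LL i))" for i by (rule N_module[OF carrier_submodule])+
  show "(\<lambda>a. a) \<in> lin_map k (N (carrier A) (LL i)) ?N" if "i \<in> I" for i
    using carrier_N_mono[OF L[OF that]] by (auto simp: lin_map_def N_add N_smult)
  show qc: "?q i f \<in> carrier (N (carrier A) (LL i))" if "i \<in> I" "f \<in> carrier ?N" for i f
    using that Vz by (auto simp: carrier_N)
  show "?q i (f \<oplus>\<^bsub>?N\<^esub> f') = ?q i f \<oplus>\<^bsub>N (carrier A) (LL i)\<^esub> ?q i f'" for i f f'
    by (auto simp: N_add Vz intro!: restrict_ext)
  have out: "f \<phi> = \<zero>\<^bsub>?V \<phi>\<^esub>" if "f \<in> carrier (N (carrier A) L0)" "\<phi> \<in> Aut G P" "\<phi> \<notin> L0" for f \<phi> L0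
    using that by (auto simp: carrier_N)
  have un: "\<phi> \<notin> LL i" if "\<phi> \<in> LL j" "i \<in> I" "j \<in> I" "i \<noteq> j" for \<phi> i j
    using part[of \<phi>] L that by blast
  show "?q i f = f" if i: "i \<in> I" and f: "f \<in> carrier (N (carrier A) (LL i))" for i f
  proof (rule N_eqI[OF qc[OF i] f])
    show "f \<in> carrier ?N" using f carrier_N_mono[OF L[OF i]] by blast
  qed (use out[OF f] in auto)
  show "?q i f = \<zero>\<^bsub>N (carrier A) (LL i)\<^esub>" if "i \<in> I" "j \<in> I" "i \<noteq> j" "f \<in> carrier (N (carrier A) (LL j))" for i j f
    unfolding N_zero
  proof (rule restrict_ext)
    fix \<phi> assume "\<phi> \<in> Aut G P"
    then show "(if \<phi> \<in> LL i then f \<phi> else \<zero>\<^bsub>?V \<phi>\<^esub>) = \<zero>\<^bsub>?V \<phi>\<^esub>"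
      using un[of \<phi> i j] that out[OF that(4)] by auto
  qed
  show "(\<Oplus>\<^bsub>?N\<^esub>i\<in>I. ?q i f) = f" if f: "f \<in> carrier ?N" for f
  proof -
    interpret N: module k ?N by (rule N_module[OF carrier_submodule])
    have q': "?q i f \<in> carrier ?N" if "i \<in> I" for i
      using qc[OF that f] carrier_N_mono[OF L[OF that]] by blast
    show ?thesis
    proof (rule N_eqI[OF _ f])
      show "(\<Oplus>\<^bsub>?N\<^esub>i\<in>I. ?q i f) \<in> carrier ?N" using q' by (intro N.M.finsum_closed) auto
      fix \<phi> assume \<phi>: "\<phi> \<in> Aut G P"
      interpret V: module k "?V \<phi>" by (rule Vm[OF \<phi>])
      have f\<phi>: "f \<phi> \<in> carrier (?V \<phi>)" by (rule N_apply[OF f \<phi>])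
      have "(\<Oplus>\<^bsub>?N\<^esub>i\<in>I. ?q i f) \<phi> = (\<Oplus>\<^bsub>?V \<phi>\<^esub>i\<in>I. ?q i f \<phi>)"
        by (rule N_finsum_apply[OF carrier_submodule I q' \<phi>])
      also have "\<dots> = f \<phi>"
      proof (cases "\<phi> \<in> L")
        case True
        then obtain i where i: "i \<in> I" "\<phi> \<in> LL i" using part by blast
        have "(\<Oplus>\<^bsub>?V \<phi>\<^esub>j\<in>I. ?q j f \<phi>) = (\<Oplus>\<^bsub>?V \<phi>\<^esub>j\<in>I. if j = i then f \<phi> else \<zero>\<^bsub>?V \<phi>\<^esub>)"
          using i un[OF i(2) _ i(1)] \<phi> f\<phi> by (intro V.M.finsum_cong' refl) auto
        also have "\<dots> = f \<phi>" by (rule finsum_single[OF V.M.abelian_monoid_axioms I i(1) f\<phi>])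
        finally show ?thesis .
      next
        case False
        have f0: "f \<phi> = \<zero>\<^bsub>?V \<phi>\<^esub>" by (rule out[OF f \<phi> False])
        then have "(\<Oplus>\<^bsub>?V \<phi>\<^esub>i\<in>I. ?q i f \<phi>) = \<zero>\<^bsub>?V \<phi>\<^esub>"
          using \<phi> by (intro V.M.add.finprod_one_eqI) simp
        then show ?thesis using f0 by simp
      qed
      finally show "(\<Oplus>\<^bsub>?N\<^esub>i\<in>I. ?q i f) \<phi> = f \<phi>" .
    qed
  qed
qed

text \<open>The additional property lets the uniqueness clause of a transversal be applied to one of
  its own elements.\<close>

lemma transversal_exists:
  assumes Q: "subgroup Q G" "Q \<subseteq> P"
  obtains T where "right_transversal G Q P T" "\<And>t. t \<in> T \<Longrightarrow> t \<in> Q #>\<^bsub>G\<^esub> t"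
proof -
  define r where "r u = (SOME t. t \<in> Q #>\<^bsub>G\<^esub> u)" for u
  have r: "r u \<in> Q #>\<^bsub>G\<^esub> u" if "u \<in> P" for u
    unfolding r_def by (rule someI) (rule G.rcos_self[OF P_carrier[OF that] Q(1)])
  have rP: "r u \<in> P" if "u \<in> P" for u using r[OF that] Q(2) that by (auto simp: r_coset_def)
  have eq: "Q #>\<^bsub>G\<^esub> r u = Q #>\<^bsub>G\<^esub> u" if "u \<in> P" for u
    using G.repr_independence[OF r[OF that] P_carrier[OF that] Q(1)] by simp
  have self: "u \<in> Q #>\<^bsub>G\<^esub> u" if "u \<in> P" for u using G.rcos_self[OF P_carrier[OF that] Q(1)] .
  have "right_transversal G Q P (r ` P)"
    unfolding right_transversal_def
  proof (intro conjI ballI)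
    fix u assume u: "u \<in> P"
    show "\<exists>!t. t \<in> r ` P \<and> u \<in> Q #>\<^bsub>G\<^esub> t"
    proof (rule ex1I[of _ "r u"])
      show "r u \<in> r ` P \<and> u \<in> Q #>\<^bsub>G\<^esub> r u" using u self eq by auto
      fix t assume "t \<in> r ` P \<and> u \<in> Q #>\<^bsub>G\<^esub> t"
      then obtain v where v: "v \<in> P" "t = r v" "u \<in> Q #>\<^bsub>G\<^esub> v" using eq by auto
      then have "Q #>\<^bsub>G\<^esub> v = Q #>\<^bsub>G\<^esub> u" using G.repr_independence[OF v(3) _ Q(1)] by simp
      then show "t = r u" unfolding v(2) r_def by simp
    qed
  qed (use rP in auto)
  then show ?thesis using that self rP by blast
qed

end

section \<open>Interior algebras graded by G/H and the action of P on cosets\<close>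

text \<open>Orthogonal projections summing to the identity and compatible with translation are all
  that the decomposition needs; the tensor construction of A is no longer visible from here
  on.\<close>

locale graded_brauer = brauer G R A \<iota> P J + H: normal H G
  for G :: "'g monoid" and R :: "'r ring" and A :: "('r, 'a) module" and \<iota> P J H +
  fixes \<pi> :: "'g set \<Rightarrow> 'a \<Rightarrow> 'a"
  assumes finite_G: "finite (carrier G)"
    and \<pi>_lin: "C \<in> rcosets\<^bsub>G\<^esub> H \<Longrightarrow> \<pi> C \<in> lin_map R A A"
    and \<pi>_\<pi>: "C \<in> rcosets\<^bsub>G\<^esub> H \<Longrightarrow> C' \<in> rcosets\<^bsub>G\<^esub> H \<Longrightarrow> a \<in> carrier A \<Longrightarrow>
      \<pi> C (\<pi> C' a) = (if C = C' then \<pi> C a else \<zero>\<^bsub>A\<^esub>)"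
    and \<pi>_sum: "a \<in> carrier A \<Longrightarrow> a = (\<Oplus>\<^bsub>A\<^esub>C\<in>rcosets\<^bsub>G\<^esub> H. \<pi> C a)"
    and \<pi>_translate: "C \<in> rcosets\<^bsub>G\<^esub> H \<Longrightarrow> u \<in> carrier G \<Longrightarrow> v \<in> carrier G \<Longrightarrow> a \<in> carrier A \<Longrightarrow>
      \<pi> ((\<lambda>x. u \<otimes>\<^bsub>G\<^esub> x \<otimes>\<^bsub>G\<^esub> v) ` C) (\<iota> u \<otimes>\<^bsub>A\<^esub> a \<otimes>\<^bsub>A\<^esub> \<iota> v) = \<iota> u \<otimes>\<^bsub>A\<^esub> \<pi> C a \<otimes>\<^bsub>A\<^esub> \<iota> v"
begin

sublocale qa: quotient_automorphisms H G P
  by (intro quotient_automorphisms.intro H.normal_axioms quotient_automorphisms_axioms.intro P)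

lemma finite_rcosets: "finite (rcosets\<^bsub>G\<^esub> H)"
  using finite_G by (simp add: RCOSETS_def)

lemma \<pi>_closed [simp]: "C \<in> rcosets\<^bsub>G\<^esub> H \<Longrightarrow> a \<in> carrier A \<Longrightarrow> \<pi> C a \<in> carrier A"
  and \<pi>_add: "C \<in> rcosets\<^bsub>G\<^esub> H \<Longrightarrow> a \<in> carrier A \<Longrightarrow> b \<in> carrier A \<Longrightarrow> \<pi> C (a \<oplus>\<^bsub>A\<^esub> b) = \<pi> C a \<oplus>\<^bsub>A\<^esub> \<pi> C b"
  and \<pi>_smult: "C \<in> rcosets\<^bsub>G\<^esub> H \<Longrightarrow> r \<in> carrier R \<Longrightarrow> a \<in> carrier A \<Longrightarrow> \<pi> C (r \<odot>\<^bsub>A\<^esub> a) = r \<odot>\<^bsub>A\<^esub> \<pi> C a"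
  using \<pi>_lin[of C] by (auto simp: lin_map_def)

lemma \<pi>_zero: assumes "C \<in> rcosets\<^bsub>G\<^esub> H" shows "\<pi> C \<zero>\<^bsub>A\<^esub> = \<zero>\<^bsub>A\<^esub>"
  using \<pi>_smult[OF assms A.R.zero_closed A.zero_closed] assms by simp

lemma \<pi>_minus: assumes "C \<in> rcosets\<^bsub>G\<^esub> H" "a \<in> carrier A" shows "\<pi> C (\<ominus>\<^bsub>A\<^esub> a) = \<ominus>\<^bsub>A\<^esub> \<pi> C a"
  by (rule A.minus_equality[symmetric])
     (use assms \<pi>_add[of C "\<ominus>\<^bsub>A\<^esub> a" a] \<pi>_zero in \<open>auto simp: A.l_neg\<close>)

definition part :: "'g set \<Rightarrow> 'a set" where "part C = \<pi> C ` carrier A"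

lemma part_iff: "C \<in> rcosets\<^bsub>G\<^esub> H \<Longrightarrow> m \<in> part C \<longleftrightarrow> m \<in> carrier A \<and> \<pi> C m = m"
  unfolding part_def by (auto simp: \<pi>_\<pi>) (metis imageI)

lemma part_submodule: assumes C: "C \<in> rcosets\<^bsub>G\<^esub> H" shows "submodule (part C) R A"
  by (rule A.submoduleI) (auto simp: part_iff[OF C] \<pi>_add \<pi>_smult \<pi>_zero \<pi>_minus C)

lemma part_carrier: "C \<in> rcosets\<^bsub>G\<^esub> H \<Longrightarrow> part C \<subseteq> carrier A"
  by (auto simp: part_iff)

text \<open>The action of \<open>P\<close> on the cosets induced by \<open>m \<mapsto> u\<^sup>-\<^sup>1 m \<phi>(u)\<close>.\<close>
definition move :: "('g \<Rightarrow> 'g) \<Rightarrow> 'g \<Rightarrow> 'g set \<Rightarrow> 'g set" where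
  "move \<phi> u C = (\<lambda>x. inv\<^bsub>G\<^esub> u \<otimes>\<^bsub>G\<^esub> x \<otimes>\<^bsub>G\<^esub> \<phi> u) ` C"

text \<open>The cosets over which the decomposition of degree \<phi> runs, described through lifting
  as in the theorem; \<open>fixed_iff\<close> justifies the name.\<close>

definition fixed :: "('g \<Rightarrow> 'g) \<Rightarrow> 'g set set" where
  "fixed \<phi> = {C \<in> rcosets\<^bsub>G\<^esub> H. \<forall>z\<in>C. qa.lifts \<phi> z}"

lemma move_coset:
  assumes "\<phi> \<in> Aut G P" "u \<in> P" "z \<in> carrier G"
  shows "move \<phi> u (qa.q z) = qa.q (inv\<^bsub>G\<^esub> u \<otimes>\<^bsub>G\<^esub> z \<otimes>\<^bsub>G\<^esub> \<phi> u)"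
  unfolding move_def using assms by (intro H.r_coset_translate) auto

lemma rcosetsE:
  assumes "C \<in> rcosets\<^bsub>G\<^esub> H" obtains z where "z \<in> carrier G" "C = qa.q z"
  using assms by (auto simp: RCOSETS_def)

lemma q_rcosets: "z \<in> carrier G \<Longrightarrow> qa.q z \<in> rcosets\<^bsub>G\<^esub> H"
  using G.rcosetsI[OF H.subset] .

lemma coset_eq: "C \<in> rcosets\<^bsub>G\<^esub> H \<Longrightarrow> z \<in> C \<Longrightarrow> z \<in> carrier G \<and> C = qa.q z"
  by (metis G.repr_independence H.rcosets_carrier H.subgroup_axioms G.is_group rcosetsE subsetD)

lemma move_closed: "\<phi> \<in> Aut G P \<Longrightarrow> u \<in> P \<Longrightarrow> C \<in> rcosets\<^bsub>G\<^esub> H \<Longrightarrow> move \<phi> u C \<in> rcosets\<^bsub>G\<^esub> H"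
  by (elim rcosetsE) (simp add: move_coset q_rcosets)

lemma move_move:
  assumes \<phi>: "\<phi> \<in> Aut G P" and u: "u \<in> P" and v: "v \<in> P" and C: "C \<in> rcosets\<^bsub>G\<^esub> H"
  shows "move \<phi> v (move \<phi> u C) = move \<phi> (u \<otimes>\<^bsub>G\<^esub> v) C"
proof -
  obtain z where z: "z \<in> carrier G" "C = qa.q z" using C by (rule rcosetsE)
  have c: "\<phi> u \<in> carrier G" "\<phi> v \<in> carrier G" using \<phi> u v by auto
  have "inv\<^bsub>G\<^esub> v \<otimes>\<^bsub>G\<^esub> (inv\<^bsub>G\<^esub> u \<otimes>\<^bsub>G\<^esub> z \<otimes>\<^bsub>G\<^esub> \<phi> u) \<otimes>\<^bsub>G\<^esub> \<phi> v = inv\<^bsub>G\<^esub> (u \<otimes>\<^bsub>G\<^esub> v) \<otimes>\<^bsub>G\<^esub> z \<otimes>\<^bsub>G\<^esub> \<phi> (u \<otimes>\<^bsub>G\<^esub> v)"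
    using z \<phi> u v c by (simp add: Aut_hom G.inv_mult_group G.m_assoc)
  then show ?thesis using z \<phi> u v c by (simp add: move_coset)
qed

lemma Aut_fix_one: "\<phi> \<in> Aut G P \<Longrightarrow> \<phi> \<one>\<^bsub>G\<^esub> = \<one>\<^bsub>G\<^esub>"
  using Aut_hom[of \<phi> G P "\<one>\<^bsub>G\<^esub>" "\<one>\<^bsub>G\<^esub>"] subgroup.one_closed[OF P]
  by (metis G.l_one G.one_closed G.r_cancel_one' P_carrier Aut_P)

lemma move_one: "\<phi> \<in> Aut G P \<Longrightarrow> C \<in> rcosets\<^bsub>G\<^esub> H \<Longrightarrow> move \<phi> \<one>\<^bsub>G\<^esub> C = C"
  using subgroup.one_closed[OF P] by (elim rcosetsE) (simp add: move_coset Aut_fix_one)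

lemma move_inv:
  assumes "\<phi> \<in> Aut G P" "u \<in> P" "C \<in> rcosets\<^bsub>G\<^esub> H"
  shows "move \<phi> (inv\<^bsub>G\<^esub> u) (move \<phi> u C) = C"
  using move_move[OF assms(1,2) P_inv[OF assms(2)] assms(3)] assms move_one by simp

text \<open>In the quotient group, invariance of the coset of z under u is the intertwining relation
  of \<open>lifts_iff\<close> multiplied by the inverse of u.\<close>

lemma lifts_iff_move:
  assumes \<phi>: "\<phi> \<in> Aut G P" and z: "z \<in> carrier G"
  shows "qa.lifts \<phi> z \<longleftrightarrow> (\<forall>u\<in>P. move \<phi> u (qa.q z) = qa.q z)"
  unfolding qa.lifts_iff[OF \<phi> z]
proof (intro ball_cong refl)
  fix u assume u: "u \<in> P"
  have c: "\<phi> u \<in> carrier G" "u \<in> carrier G" using \<phi> u by auto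
  have "move \<phi> u (qa.q z) = inv\<^bsub>qa.Q\<^esub> qa.q u \<otimes>\<^bsub>qa.Q\<^esub> (qa.q z \<otimes>\<^bsub>qa.Q\<^esub> qa.q (\<phi> u))"
    using move_coset[OF \<phi> u z] c z by (simp add: qa.q_mult qa.q_inv qa.Q.m_assoc)
  then show "qa.q z \<otimes>\<^bsub>qa.Q\<^esub> qa.q (\<phi> u) = qa.q u \<otimes>\<^bsub>qa.Q\<^esub> qa.q z \<longleftrightarrow> move \<phi> u (qa.q z) = qa.q z"
    using c z qa.q_closed qa.Q.inv_solve_left'[of "qa.q z" "qa.q u" "qa.q z \<otimes>\<^bsub>qa.Q\<^esub> qa.q (\<phi> u)"]
    by auto
qed

lemma fixed_iff:
  assumes \<phi>: "\<phi> \<in> Aut G P" and C: "C \<in> rcosets\<^bsub>G\<^esub> H"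
  shows "C \<in> fixed \<phi> \<longleftrightarrow> (\<forall>u\<in>P. move \<phi> u C = C)"
proof -
  have "(\<forall>z\<in>C. qa.lifts \<phi> z) \<longleftrightarrow> (\<forall>u\<in>P. move \<phi> u C = C)"
  proof -
    have "qa.lifts \<phi> z \<longleftrightarrow> (\<forall>u\<in>P. move \<phi> u C = C)" if "z \<in> C" for z
      using coset_eq[OF C that] lifts_iff_move[OF \<phi>] by metis
    moreover have "\<exists>z. z \<in> C" using C G.rcos_self[OF _ H.subgroup_axioms] by (metis rcosetsE)
    ultimately show ?thesis by blast
  qed
  then show ?thesis using C by (simp add: fixed_def)
qed

lemma mem_fixed_iff:
  assumes "\<phi> \<in> Aut G P" "z \<in> carrier G"
  shows "qa.q z \<in> fixed \<phi> \<longleftrightarrow> qa.lifts \<phi> z"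
  using fixed_iff[OF assms(1) q_rcosets[OF assms(2)]] lifts_iff_move[OF assms] by simp

lemma fixed_rcosets: "C \<in> fixed \<phi> \<Longrightarrow> C \<in> rcosets\<^bsub>G\<^esub> H"
  by (simp add: fixed_def)

lemma finite_fixed: "finite (fixed \<phi>)"
  using finite_rcosets by (simp add: fixed_def)

lemma \<pi>_move:
  assumes "\<phi> \<in> Aut G P" "u \<in> P" "C \<in> rcosets\<^bsub>G\<^esub> H" "a \<in> carrier A"
  shows "\<pi> (move \<phi> u C) (\<iota> (inv\<^bsub>G\<^esub> u) \<otimes>\<^bsub>A\<^esub> a \<otimes>\<^bsub>A\<^esub> \<iota> (\<phi> u)) = \<iota> (inv\<^bsub>G\<^esub> u) \<otimes>\<^bsub>A\<^esub> \<pi> C a \<otimes>\<^bsub>A\<^esub> \<iota> (\<phi> u)"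
  unfolding move_def using assms by (intro \<pi>_translate) auto

lemma Fix_conj:
  assumes "a \<in> Fix (carrier A) \<phi> Q" "\<phi> \<in> Aut G P" "u \<in> Q" "Q \<subseteq> P"
  shows "\<iota> (inv\<^bsub>G\<^esub> u) \<otimes>\<^bsub>A\<^esub> a \<otimes>\<^bsub>A\<^esub> \<iota> (\<phi> u) = a"
proof -
  have c: "a \<in> carrier A" "u \<in> P" "\<phi> u \<in> P" using assms Fix_carrier by auto
  then have "\<iota> (inv\<^bsub>G\<^esub> u) \<otimes>\<^bsub>A\<^esub> a \<otimes>\<^bsub>A\<^esub> \<iota> (\<phi> u) = \<iota> (inv\<^bsub>G\<^esub> u) \<otimes>\<^bsub>A\<^esub> (\<iota> u \<otimes>\<^bsub>A\<^esub> a)"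
    using FixD[OF assms(1,3)] by (simp add: A.m_assoc)
  then show ?thesis using c by simp
qed

text \<open>The components of a fixed element along an orbit of cosets are twisted conjugates of one
  another, so one of them determines the rest.\<close>

lemma \<pi>_Fix_move:
  assumes "a \<in> Fix (carrier A) \<phi> Q" "\<phi> \<in> Aut G P" "u \<in> Q" "Q \<subseteq> P" "C \<in> rcosets\<^bsub>G\<^esub> H"
  shows "\<pi> (move \<phi> u C) a = \<iota> (inv\<^bsub>G\<^esub> u) \<otimes>\<^bsub>A\<^esub> \<pi> C a \<otimes>\<^bsub>A\<^esub> \<iota> (\<phi> u)"
  using \<pi>_move[of \<phi> u C a] Fix_conj[OF assms(1-4)] assms Fix_carrier by auto

text \<open>Q is P or the subgroup of a trace when C is a fixed coset, and the stabilizer of C when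
  the orbit is nontrivial.\<close>

lemma \<pi>_Fix:
  assumes a: "a \<in> Fix (carrier A) \<phi> Q" and \<phi>: "\<phi> \<in> Aut G P" and Q: "Q \<subseteq> P" and C: "C \<in> rcosets\<^bsub>G\<^esub> H"
    and st: "\<And>u. u \<in> Q \<Longrightarrow> move \<phi> u C = C"
  shows "\<pi> C a \<in> Fix (part C) \<phi> Q"
proof -
  have aA: "a \<in> carrier A" using Fix_carrier[OF a] .
  have "\<iota> u \<otimes>\<^bsub>A\<^esub> \<pi> C a = \<pi> C a \<otimes>\<^bsub>A\<^esub> \<iota> (\<phi> u)" if u: "u \<in> Q" for u
  proof -
    have c: "u \<in> carrier G" "\<phi> u \<in> carrier G" using u Q \<phi> by auto
    have "\<pi> C a = \<iota> (inv\<^bsub>G\<^esub> u) \<otimes>\<^bsub>A\<^esub> \<pi> C a \<otimes>\<^bsub>A\<^esub> \<iota> (\<phi> u)"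
      using \<pi>_Fix_move[OF a \<phi> u Q C] st[OF u] by simp
    then have "\<iota> u \<otimes>\<^bsub>A\<^esub> \<pi> C a = \<iota> u \<otimes>\<^bsub>A\<^esub> (\<iota> (inv\<^bsub>G\<^esub> u) \<otimes>\<^bsub>A\<^esub> \<pi> C a \<otimes>\<^bsub>A\<^esub> \<iota> (\<phi> u))" by simp
    then show ?thesis using c aA C by (simp add: A.m_assoc)
  qed
  moreover have "\<pi> C a \<in> part C" using aA by (auto simp: part_def)
  ultimately show ?thesis by (simp add: br_fixed_def)
qed

text \<open>The image of a trace is the trace of a projected element, hence a trace formed inside
  the component. That sharper target is what makes \<open>proj\<close> well defined with values in
  the Brauer quotient of the component.\<close>

lemma \<pi>_D:
  assumes \<phi>: "\<phi> \<in> Aut G P" and C: "C \<in> fixed \<phi>" and x: "x \<in> D (carrier A) \<phi>"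
  shows "\<pi> C x \<in> D (part C) \<phi>"
proof (rule D_image[where h="\<pi> C", OF _ _ subset_refl \<phi> _ _ _ x])
  have CR: "C \<in> rcosets\<^bsub>G\<^esub> H" using C by (rule fixed_rcosets)
  have st: "move \<phi> u C = C" if "u \<in> P" for u using C fixed_iff[OF \<phi> CR] that by blast
  show "subgroup (D (part C) \<phi>) (add_monoid A)" by (rule D_subgroup[OF part_carrier[OF CR] \<phi>])
  show "\<pi> C \<in> carrier A \<rightarrow> carrier A" using CR by auto
  show "\<pi> C (x \<oplus>\<^bsub>A\<^esub> y) = \<pi> C x \<oplus>\<^bsub>A\<^esub> \<pi> C y" if "x \<in> carrier A" "y \<in> carrier A" for x y
    using \<pi>_add[OF CR that] .
  fix Q S c assume Q: "subgroup Q G" "Q \<subset> P" "c \<in> Fix (carrier A) \<phi> Q" "right_transversal G Q P S"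
  have cA: "c \<in> carrier A" using Fix_carrier[OF Q(3)] .
  have SP: "S \<subseteq> P" using Q transversal_subset by auto
  have QP: "Q \<subseteq> P" using Q by auto
  have "\<pi> C (trace_sum \<phi> S c) = (\<Oplus>\<^bsub>A\<^esub>u\<in>S. \<pi> C (\<iota> (inv\<^bsub>G\<^esub> u) \<otimes>\<^bsub>A\<^esub> c \<otimes>\<^bsub>A\<^esub> \<iota> (\<phi> u)))"
    by (rule additive_trace_sum) (use CR \<pi>_add \<phi> SP cA in auto)
  also have "\<dots> = trace_sum \<phi> S (\<pi> C c)"
    unfolding trace_sum_def
  proof (rule A.finsum_cong'[OF refl])
    fix u assume "u \<in> S"
    then have u: "u \<in> P" using SP by auto
    show "\<pi> C (\<iota> (inv\<^bsub>G\<^esub> u) \<otimes>\<^bsub>A\<^esub> c \<otimes>\<^bsub>A\<^esub> \<iota> (\<phi> u)) = \<iota> (inv\<^bsub>G\<^esub> u) \<otimes>\<^bsub>A\<^esub> \<pi> C c \<otimes>\<^bsub>A\<^esub> \<iota> (\<phi> u)"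
      using \<pi>_move[OF \<phi> u CR cA] st[OF u] by simp
  qed (use cA CR SP \<phi> in \<open>auto simp: subset_iff\<close>)
  finally show "\<pi> C (trace_sum \<phi> S c) \<in> D (part C) \<phi>"
    using D_trace[OF Q(1,2) \<pi>_Fix[OF Q(3) \<phi> QP CR] Q(4)] st QP by auto
next
  have CR: "C \<in> rcosets\<^bsub>G\<^esub> H" using C by (rule fixed_rcosets)
  have st: "move \<phi> u C = C" if "u \<in> P" for u using C fixed_iff[OF \<phi> CR] that by blast
  fix r m assume r: "r \<in> J" "m \<in> Fix (carrier A) \<phi> P"
  then show "\<pi> C (r \<odot>\<^bsub>A\<^esub> m) \<in> D (part C) \<phi>"
    using D_J[OF r(1) \<pi>_Fix[OF r(2) \<phi> subset_refl CR st]] \<pi>_smult[OF CR, of r m] Fix_carrier J.a_subset by auto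
qed

text \<open>A nontrivial \<open>P\<close>-orbit of cosets contributes a trace from the stabilizer.\<close>
lemma orbit_sum_D:
  assumes \<phi>: "\<phi> \<in> Aut G P" and a: "a \<in> Fix (carrier A) \<phi> P" and C: "C \<in> rcosets\<^bsub>G\<^esub> H" "C \<notin> fixed \<phi>"
  shows "(\<Oplus>\<^bsub>A\<^esub>C'\<in>(\<lambda>u. move \<phi> u C) ` P. \<pi> C' a) \<in> D (carrier A) \<phi>"
proof -
  have aA: "a \<in> carrier A" using Fix_carrier[OF a] .
  define Q where "Q = {u \<in> P. move \<phi> u C = C}"
  have QP: "Q \<subset> P" using C fixed_iff[OF \<phi> C(1)] by (auto simp: Q_def)
  have Qsub: "subgroup Q G"
  proof (rule G.subgroupI)
    show "Q \<noteq> {}" using move_one[OF \<phi> C(1)] subgroup.one_closed[OF P] by (auto simp: Q_def)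
    show "inv\<^bsub>G\<^esub> u \<in> Q" if "u \<in> Q" for u using that move_inv[OF \<phi> _ C(1), of u] by (auto simp: Q_def)
    show "u \<otimes>\<^bsub>G\<^esub> v \<in> Q" if "u \<in> Q" "v \<in> Q" for u v
      using that move_move[OF \<phi> _ _ C(1), of u v] by (auto simp: Q_def)
  qed (auto simp: Q_def)
  obtain T where T: "right_transversal G Q P T" and self: "\<And>t. t \<in> T \<Longrightarrow> t \<in> Q #>\<^bsub>G\<^esub> t"
    using transversal_exists[OF Qsub] QP by blast
  have TP: "T \<subseteq> P" using T transversal_subset by auto
  \<comment> \<open>Orbit and stabilizer: elements of P move C to the same coset exactly if they lie
    in the same coset of Q, so T enumerates the orbit without repetition.\<close>
  have bij: "bij_betw (\<lambda>u. move \<phi> u C) T ((\<lambda>u. move \<phi> u C) ` P)"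
  proof (rule bij_betw_imageI)
    show "inj_on (\<lambda>u. move \<phi> u C) T"
    proof (rule inj_onI)
      fix t t' assume t: "t \<in> T" "t' \<in> T" and eq: "move \<phi> t C = move \<phi> t' C"
      have tP: "t \<in> P" "t' \<in> P" using t TP by auto
      have "move \<phi> (t \<otimes>\<^bsub>G\<^esub> inv\<^bsub>G\<^esub> t') C = move \<phi> (inv\<^bsub>G\<^esub> t') (move \<phi> t' C)"
        using move_move[OF \<phi> tP(1) P_inv[OF tP(2)] C(1)] eq by simp
      also have "\<dots> = C" by (rule move_inv[OF \<phi> tP(2) C(1)])
      finally have "t \<otimes>\<^bsub>G\<^esub> inv\<^bsub>G\<^esub> t' \<in> Q" using tP by (simp add: Q_def)
      moreover have "t = t \<otimes>\<^bsub>G\<^esub> inv\<^bsub>G\<^esub> t' \<otimes>\<^bsub>G\<^esub> t'" using tP by (simp add: G.m_assoc)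
      ultimately have "t \<in> Q #>\<^bsub>G\<^esub> t'" unfolding r_coset_def by blast
      then show "t = t'" using T t self tP unfolding right_transversal_def by blast
    qed
    show "(\<lambda>u. move \<phi> u C) ` T = (\<lambda>u. move \<phi> u C) ` P"
    proof (intro equalityI subsetI)
      fix X assume "X \<in> (\<lambda>u. move \<phi> u C) ` P"
      then obtain u where u: "u \<in> P" "X = move \<phi> u C" by auto
      then obtain t where t: "t \<in> T" "u \<in> Q #>\<^bsub>G\<^esub> t" using T unfolding right_transversal_def by blast
      then obtain x where x: "x \<in> Q" "u = x \<otimes>\<^bsub>G\<^esub> t" by (auto simp: r_coset_def)
      have "move \<phi> u C = move \<phi> t (move \<phi> x C)"
        using move_move[OF \<phi> _ _ C(1), of x t] x t TP by (auto simp: Q_def)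
      then have "X = move \<phi> t C" using x u by (simp add: Q_def)
      then show "X \<in> (\<lambda>u. move \<phi> u C) ` T" using t by auto
    qed (use TP in auto)
  qed
  have "(\<Oplus>\<^bsub>A\<^esub>C'\<in>(\<lambda>u. move \<phi> u C) ` P. \<pi> C' a) = (\<Oplus>\<^bsub>A\<^esub>u\<in>T. \<pi> (move \<phi> u C) a)"
    by (rule A.finsum_bij[OF bij]) (use move_closed[OF \<phi> _ C(1)] aA in auto)
  also have "\<dots> = trace_sum \<phi> T (\<pi> C a)"
    unfolding trace_sum_def
    by (rule A.finsum_cong'[OF refl])
       (use \<pi>_Fix_move[OF a \<phi> _ subset_refl C(1)] TP aA C \<phi> in \<open>auto simp: subset_iff\<close>)
  also have "\<dots> \<in> D (carrier A) \<phi>"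
  proof (rule D_trace[OF Qsub QP _ T])
    have "a \<in> Fix (carrier A) \<phi> Q" using a QP by (auto simp: br_fixed_def)
    then have "\<pi> C a \<in> Fix (part C) \<phi> Q" by (rule \<pi>_Fix[OF _ \<phi> _ C(1)]) (use QP in \<open>auto simp: Q_def\<close>)
    then show "\<pi> C a \<in> Fix (carrier A) \<phi> Q" using Fix_mono[OF part_carrier[OF C(1)]] by blast
  qed
  finally show ?thesis .
qed

text \<open>A stable set without fixed cosets is exhausted orbit by orbit. Orbits are disjoint, so
  what remains after removing one is again stable and the induction applies.\<close>

lemma stable_sum_D:
  assumes \<phi>: "\<phi> \<in> Aut G P" and a: "a \<in> Fix (carrier A) \<phi> P"
    and X: "X \<subseteq> rcosets\<^bsub>G\<^esub> H" "\<And>C u. C \<in> X \<Longrightarrow> u \<in> P \<Longrightarrow> move \<phi> u C \<in> X" "X \<inter> fixed \<phi> = {}"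
  shows "(\<Oplus>\<^bsub>A\<^esub>C\<in>X. \<pi> C a) \<in> D (carrier A) \<phi>"
proof -
  have "finite X" using X(1) finite_rcosets finite_subset by blast
  then show ?thesis using X
  proof (induct X rule: finite_psubset_induct)
    case (psubset X)
    note Dsub = D_subgroup[OF subset_refl \<phi>]
    have aA: "a \<in> carrier A" using Fix_carrier[OF a] .
    show ?case
    proof (cases "X = {}")
      case True
      then show ?thesis using subgroup.one_closed[OF Dsub] by simp
    next
      case False
      then obtain C where C: "C \<in> X" by blast
      let ?O = "(\<lambda>u. move \<phi> u C) ` P"
      have CR: "C \<in> rcosets\<^bsub>G\<^esub> H" "C \<notin> fixed \<phi>" using C psubset.prems by auto
      have O: "?O \<subseteq> X" using psubset.prems(2)[OF C] by auto
      have CO: "C \<in> ?O" using move_one[OF \<phi> CR(1)] subgroup.one_closed[OF P] by (metis imageI)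
      have "(\<Oplus>\<^bsub>A\<^esub>C'\<in>X - ?O. \<pi> C' a) \<in> D (carrier A) \<phi>"
      proof (rule psubset.hyps)
        show "X - ?O \<subset> X" using CO O C by blast
        fix C' u assume C': "C' \<in> X - ?O" and u: "u \<in> P"
        have C'R: "C' \<in> rcosets\<^bsub>G\<^esub> H" using C' psubset.prems by auto
        have "move \<phi> u C' \<notin> ?O"
        proof
          assume "move \<phi> u C' \<in> ?O"
          then obtain v where v: "v \<in> P" "move \<phi> u C' = move \<phi> v C" by auto
          have "C' = move \<phi> (inv\<^bsub>G\<^esub> u) (move \<phi> v C)" using move_inv[OF \<phi> u C'R] v by simp
          also have "\<dots> = move \<phi> (v \<otimes>\<^bsub>G\<^esub> inv\<^bsub>G\<^esub> u) C" by (rule move_move[OF \<phi> v(1) P_inv[OF u] CR(1)])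
          finally show False using C' v u by blast
        qed
        then show "move \<phi> u C' \<in> X - ?O" using psubset.prems(2) C' u by auto
      qed (use psubset.prems in auto)
      moreover have "(\<Oplus>\<^bsub>A\<^esub>C'\<in>?O. \<pi> C' a) \<in> D (carrier A) \<phi>" by (rule orbit_sum_D[OF \<phi> a CR])
      moreover have "(\<Oplus>\<^bsub>A\<^esub>C'\<in>X. \<pi> C' a) = (\<Oplus>\<^bsub>A\<^esub>C'\<in>?O. \<pi> C' a) \<oplus>\<^bsub>A\<^esub> (\<Oplus>\<^bsub>A\<^esub>C'\<in>X - ?O. \<pi> C' a)"
      proof -
        have "X = ?O \<union> (X - ?O)" using O by auto
        moreover have "(\<Oplus>\<^bsub>A\<^esub>C'\<in>?O \<union> (X - ?O). \<pi> C' a) = (\<Oplus>\<^bsub>A\<^esub>C'\<in>?O. \<pi> C' a) \<oplus>\<^bsub>A\<^esub> (\<Oplus>\<^bsub>A\<^esub>C'\<in>X - ?O. \<pi> C' a)"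
          using psubset.hyps(1) finite_P O psubset.prems(1) aA
          by (intro A.finsum_Un_disjoint) (auto simp: subset_iff)
        ultimately show ?thesis by simp
      qed
      ultimately show ?thesis using subgroup.m_closed[OF Dsub] by simp
    qed
  qed
qed

text \<open>The difference is the sum of the components at the remaining cosets. These form a stable
  set, because moving back from a fixed coset leads to that coset itself.\<close>

lemma fixed_sum_D:
  assumes \<phi>: "\<phi> \<in> Aut G P" and a: "a \<in> Fix (carrier A) \<phi> P"
  shows "a \<ominus>\<^bsub>A\<^esub> (\<Oplus>\<^bsub>A\<^esub>C\<in>fixed \<phi>. \<pi> C a) \<in> D (carrier A) \<phi>"
proof -
  let ?X = "rcosets\<^bsub>G\<^esub> H - fixed \<phi>"
  have aA: "a \<in> carrier A" using Fix_carrier[OF a] .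
  have c: "(\<Oplus>\<^bsub>A\<^esub>C\<in>fixed \<phi>. \<pi> C a) \<in> carrier A" "(\<Oplus>\<^bsub>A\<^esub>C\<in>?X. \<pi> C a) \<in> carrier A"
    using aA fixed_rcosets by (auto intro!: A.finsum_closed)
  have "(\<Oplus>\<^bsub>A\<^esub>C\<in>fixed \<phi> \<union> ?X. \<pi> C a) = (\<Oplus>\<^bsub>A\<^esub>C\<in>fixed \<phi>. \<pi> C a) \<oplus>\<^bsub>A\<^esub> (\<Oplus>\<^bsub>A\<^esub>C\<in>?X. \<pi> C a)"
    using finite_rcosets finite_fixed aA fixed_rcosets by (intro A.finsum_Un_disjoint) auto
  moreover have "fixed \<phi> \<union> ?X = rcosets\<^bsub>G\<^esub> H" using fixed_rcosets by auto
  ultimately have "a = (\<Oplus>\<^bsub>A\<^esub>C\<in>fixed \<phi>. \<pi> C a) \<oplus>\<^bsub>A\<^esub> (\<Oplus>\<^bsub>A\<^esub>C\<in>?X. \<pi> C a)"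
    using \<pi>_sum[OF aA] by simp
  then have "a \<ominus>\<^bsub>A\<^esub> (\<Oplus>\<^bsub>A\<^esub>C\<in>fixed \<phi>. \<pi> C a) = (\<Oplus>\<^bsub>A\<^esub>C\<in>?X. \<pi> C a)"
    using c aA by (metis A.add.inv_solve_right' A.a_comm A.minus_eq)
  moreover have "(\<Oplus>\<^bsub>A\<^esub>C\<in>?X. \<pi> C a) \<in> D (carrier A) \<phi>"
  proof (rule stable_sum_D[OF \<phi> a])
    fix C u assume C: "C \<in> ?X" and u: "u \<in> P"
    have CR: "C \<in> rcosets\<^bsub>G\<^esub> H" using C by auto
    have mR: "move \<phi> u C \<in> rcosets\<^bsub>G\<^esub> H" by (rule move_closed[OF \<phi> u CR])
    have "move \<phi> u C \<notin> fixed \<phi>"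
    proof
      assume "move \<phi> u C \<in> fixed \<phi>"
      then have "move \<phi> (inv\<^bsub>G\<^esub> u) (move \<phi> u C) = move \<phi> u C"
        using fixed_iff[OF \<phi> mR] u by blast
      then have "move \<phi> u C = C" using move_inv[OF \<phi> u CR] by simp
      then show False using \<open>move \<phi> u C \<in> fixed \<phi>\<close> C by simp
    qed
    then show "move \<phi> u C \<in> ?X" using mR by simp
  qed auto
  ultimately show ?thesis by simp
qed

section \<open>Splitting a Brauer quotient over the fixed cosets\<close>

text \<open>For a fixed coset C, the retraction of A(\<Delta>) onto the Brauer quotient of the
  component, induced by \<open>\<pi> C\<close>.\<close>

definition proj :: "'g set \<Rightarrow> ('g \<Rightarrow> 'g) \<Rightarrow> 'a set \<Rightarrow> 'a set" where
  "proj C \<phi> Y = (\<Union>x\<in>Y. cl (part C) \<phi> (\<pi> C x))"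

lemma proj_cl:
  assumes \<phi>: "\<phi> \<in> Aut G P" and C: "C \<in> fixed \<phi>" and a: "a \<in> carrier A"
  shows "proj C \<phi> (cl (carrier A) \<phi> a) = cl (part C) \<phi> (\<pi> C a)"
proof -
  have CR: "C \<in> rcosets\<^bsub>G\<^esub> H" using C by (rule fixed_rcosets)
  interpret DA: abelian_subgroup "D (carrier A) \<phi>" A by (rule D_abelian_subgroup[OF subset_refl \<phi>])
  show ?thesis
    unfolding proj_def
  proof (rule DA.a_coset_UN[OF a])
    fix y assume y: "y \<in> carrier A" "y \<ominus>\<^bsub>A\<^esub> a \<in> D (carrier A) \<phi>"
    have "\<pi> C (y \<ominus>\<^bsub>A\<^esub> a) = \<pi> C y \<ominus>\<^bsub>A\<^esub> \<pi> C a"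
      using y a CR by (simp add: a_minus_def \<pi>_add \<pi>_minus)
    then show "cl (part C) \<phi> (\<pi> C y) = cl (part C) \<phi> (\<pi> C a)"
      using \<pi>_D[OF \<phi> C y(2)] cl_eq_iff[OF part_carrier[OF CR] \<phi>] y a CR by simp
  qed
qed

context
  fixes \<phi> assumes \<phi>: "\<phi> \<in> Aut G P"
begin

lemma fixed_Fix: "C \<in> fixed \<phi> \<Longrightarrow> a \<in> Fix (carrier A) \<phi> P \<Longrightarrow> \<pi> C a \<in> Fix (part C) \<phi> P"
  using \<pi>_Fix[OF _ \<phi> subset_refl] fixed_rcosets fixed_iff[OF \<phi>] by blast

lemma proj_closed:
  assumes C: "C \<in> fixed \<phi>" and Y: "Y \<in> carrier (V (carrier A) \<phi>)"
  shows "proj C \<phi> Y \<in> carrier (V (part C) \<phi>)"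
  using Y proj_cl[OF \<phi> C] fixed_Fix[OF C] Fix_carrier by (auto simp: carrier_V)

lemma proj_add:
  assumes C: "C \<in> fixed \<phi>" and Y: "Y \<in> carrier (V (carrier A) \<phi>)" "Z \<in> carrier (V (carrier A) \<phi>)"
  shows "proj C \<phi> (Y \<oplus>\<^bsub>V (carrier A) \<phi>\<^esub> Z) = proj C \<phi> Y \<oplus>\<^bsub>V (part C) \<phi>\<^esub> proj C \<phi> Z"
proof -
  have CR: "C \<in> rcosets\<^bsub>G\<^esub> H" using C by (rule fixed_rcosets)
  obtain y z where yz: "y \<in> carrier A" "z \<in> carrier A" "Y = cl (carrier A) \<phi> y" "Z = cl (carrier A) \<phi> z"
    using Y Fix_carrier unfolding carrier_V by blast
  then have "Y \<oplus>\<^bsub>V (carrier A) \<phi>\<^esub> Z = cl (carrier A) \<phi> (y \<oplus>\<^bsub>A\<^esub> z)" using \<phi> by (simp add: cl_add)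
  then show ?thesis
    using yz CR by (simp add: proj_cl[OF \<phi> C] \<pi>_add cl_add[OF part_carrier[OF CR] \<phi>])
qed

lemma proj_incl:
  assumes C: "C \<in> fixed \<phi>" and C': "C' \<in> fixed \<phi>" and Y: "Y \<in> carrier (V (part C') \<phi>)"
  shows "proj C \<phi> (br_incl G P J A \<iota> \<phi> Y) = (if C = C' then Y else \<zero>\<^bsub>V (part C) \<phi>\<^esub>)"
proof -
  have CR: "C \<in> rcosets\<^bsub>G\<^esub> H" "C' \<in> rcosets\<^bsub>G\<^esub> H" using C C' fixed_rcosets by auto
  obtain m where m: "m \<in> part C'" "Y = cl (part C') \<phi> m" using Y Fix_subset unfolding carrier_V by blast
  have mA: "m \<in> carrier A" "\<pi> C' m = m" using m part_iff[OF CR(2)] by auto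
  have "proj C \<phi> (br_incl G P J A \<iota> \<phi> Y) = cl (part C) \<phi> (\<pi> C m)"
    using m mA by (simp add: incl_cl[OF part_carrier[OF CR(2)] \<phi>] proj_cl[OF \<phi> C])
  moreover have "\<pi> C m = (if C = C' then m else \<zero>\<^bsub>A\<^esub>)" using \<pi>_\<pi>[OF CR mA(1)] mA by (cases "C = C'") simp_all
  ultimately show ?thesis using m cl_zero[OF part_carrier[OF CR(1)] \<phi>] by auto
qed

text \<open>By \<open>fixed_sum_D\<close> an element and the sum of its fixed components have the
  same class. With \<open>proj_incl\<close> this shows that the maps \<open>proj\<close> are
  coordinates as \<open>is_direct_sumI\<close> requires.\<close>

lemma sum_incl_proj:
  assumes Y: "Y \<in> carrier (V (carrier A) \<phi>)"
  shows "(\<Oplus>\<^bsub>V (carrier A) \<phi>\<^esub>C\<in>fixed \<phi>. br_incl G P J A \<iota> \<phi> (proj C \<phi> Y)) = Y"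
proof -
  let ?V = "V (carrier A) \<phi>"
  interpret V: module k ?V by (rule V_module[OF carrier_submodule \<phi>])
  obtain a where a: "a \<in> Fix (carrier A) \<phi> P" "Y = cl (carrier A) \<phi> a" using Y by (auto simp: carrier_V)
  have aA: "a \<in> carrier A" using Fix_carrier[OF a(1)] .
  have sub: "submodule (Fix (carrier A) \<phi> P) R A" by (rule Fix_submodule[OF carrier_submodule \<phi>]) simp
  have F: "\<pi> C a \<in> Fix (carrier A) \<phi> P" if "C \<in> fixed \<phi>" for C
    using fixed_Fix[OF that a(1)] Fix_mono[OF part_carrier[OF fixed_rcosets[OF that]]] by blast
  have c: "(\<Oplus>\<^bsub>A\<^esub>C\<in>fixed \<phi>. \<pi> C a) \<in> carrier A" using F Fix_carrier by (auto intro!: A.finsum_closed)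
  have "(\<Oplus>\<^bsub>?V\<^esub>C\<in>fixed \<phi>. br_incl G P J A \<iota> \<phi> (proj C \<phi> Y)) = (\<Oplus>\<^bsub>?V\<^esub>C\<in>fixed \<phi>. cl (carrier A) \<phi> (\<pi> C a))"
  proof (rule V.M.finsum_cong'[OF refl])
    show "(\<lambda>C. cl (carrier A) \<phi> (\<pi> C a)) \<in> fixed \<phi> \<rightarrow> carrier ?V" using F by (auto simp: carrier_V)
    fix C assume C: "C \<in> fixed \<phi>"
    show "br_incl G P J A \<iota> \<phi> (proj C \<phi> Y) = cl (carrier A) \<phi> (\<pi> C a)"
      using a aA C fixed_rcosets[OF C]
      by (simp add: proj_cl[OF \<phi> C] incl_cl[OF part_carrier[OF fixed_rcosets[OF C]] \<phi>])
  qed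
  also have "\<dots> = cl (carrier A) \<phi> (\<Oplus>\<^bsub>A\<^esub>C\<in>fixed \<phi>. \<pi> C a)"
  proof (rule finsum_hom(2)[where T="Fix (carrier A) \<phi> P", symmetric])
    show "Fix (carrier A) \<phi> P \<subseteq> carrier A" by (rule Fix_subset)
    show "cl (carrier A) \<phi> (x \<oplus>\<^bsub>A\<^esub> y) = cl (carrier A) \<phi> x \<oplus>\<^bsub>?V\<^esub> cl (carrier A) \<phi> y"
      if "x \<in> Fix (carrier A) \<phi> P" "y \<in> Fix (carrier A) \<phi> P" for x y
      using that Fix_carrier by (intro cl_add \<phi>) auto
    show "cl (carrier A) \<phi> \<zero>\<^bsub>A\<^esub> = \<zero>\<^bsub>?V\<^esub>" by (rule cl_zero[OF subset_refl \<phi>])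
  qed (use A.submoduleE[OF sub] Fix_zero[OF carrier_submodule \<phi>] F finite_fixed
       A.abelian_monoid_axioms V.M.abelian_monoid_axioms carrier_V in auto)
  also have "\<dots> = Y" using fixed_sum_D[OF \<phi> a(1)] cl_eq_iff[OF subset_refl \<phi> aA c] a by simp
  finally show ?thesis .
qed

end

end

section \<open>Direct sum decompositions\<close>

text \<open>The two descriptions of a component are known to agree only for genuine cosets of H, so
  summands can be exchanged only at indices in I.\<close>

lemma is_direct_sum_cong:
  assumes "is_direct_sum R I V j N" "\<And>i. i \<in> I \<Longrightarrow> V i = V' i"
  shows "is_direct_sum R I V' j N"
proof -
  have "(\<Pi>\<^sub>E i\<in>I. carrier (V i)) = (\<Pi>\<^sub>E i\<in>I. carrier (V' i))"
    by (rule PiE_cong) (simp add: assms(2))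
  then show ?thesis using assms by (simp add: is_direct_sum_def)
qed

context quotient_automorphisms
begin

section \<open>Degrees in U modulo U'\<close>

text \<open>The fibre over C of the map from K to U/U'; for an element of U/U' it is a single class
  modulo K1.\<close>

definition degree :: "'g set \<Rightarrow> ('g \<Rightarrow> 'g) set" where
  "degree C = {\<phi> \<in> K. class_corr G H P (K1 #>\<^bsub>Ag\<^esub> \<phi>) = C}"

lemma degree_K: "degree C \<subseteq> K"
  by (auto simp: degree_def)

lemma K_Aut: "K \<subseteq> Aut G P"
  by (auto simp: K_iff)

lemma K_degree: "\<phi> \<in> K \<Longrightarrow> \<exists>!C. C \<in> carrier (UU' G H P) \<and> \<phi> \<in> degree C"
  using class_corr_iso by (auto simp: degree_def iso_def hom_def carrier_KK1 Pi_def)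

lemma degree_mult:
  assumes "\<phi> \<in> degree C" "\<psi> \<in> degree C'"
  shows "\<phi> \<otimes>\<^bsub>Ag\<^esub> \<psi> \<in> degree (C \<otimes>\<^bsub>UU' G H P\<^esub> C')"
proof -
  have \<phi>: "\<phi> \<in> K" "class_corr G H P (K1 #>\<^bsub>Ag\<^esub> \<phi>) = C" and \<psi>: "\<psi> \<in> K" "class_corr G H P (K1 #>\<^bsub>Ag\<^esub> \<psi>) = C'"
    using assms by (auto simp: degree_def)
  have "class_corr G H P ((K1 #>\<^bsub>Ag\<^esub> \<phi>) \<otimes>\<^bsub>KK1 G H P\<^esub> (K1 #>\<^bsub>Ag\<^esub> \<psi>)) = C \<otimes>\<^bsub>UU' G H P\<^esub> C'"
    using class_corr_iso \<phi> \<psi> by (auto simp: iso_def hom_def carrier_KK1)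
  then show ?thesis
    using \<phi> \<psi> subgroup.m_closed[OF K_subgroup] by (simp add: degree_def mult_KK1)
qed

text \<open>Injectivity of the correspondence prevents a second class from mapping to the same
  coset.\<close>

lemma degree_class:
  assumes \<Phi>: "\<Phi> \<in> carrier (KK1 G H P)" shows "degree (class_corr G H P \<Phi>) = \<Phi>"
proof -
  have inj: "inj_on (class_corr G H P) (carrier (KK1 G H P))"
    using class_corr_iso by (simp add: iso_def bij_betw_def)
  obtain \<psi> where \<psi>: "\<psi> \<in> K" "\<Phi> = K1 #>\<^bsub>Ag\<^esub> \<psi>" using \<Phi> by (auto simp: carrier_KK1)
  have \<psi>A: "\<psi> \<in> Aut G P" using \<psi> K_Aut by blast
  show ?thesis
  proof (intro equalityI subsetI)
    fix \<phi> assume "\<phi> \<in> degree (class_corr G H P \<Phi>)"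
    then have \<phi>: "\<phi> \<in> K" "class_corr G H P (K1 #>\<^bsub>Ag\<^esub> \<phi>) = class_corr G H P \<Phi>" by (auto simp: degree_def)
    then have "K1 #>\<^bsub>Ag\<^esub> \<phi> = \<Phi>" using inj_onD[OF inj \<phi>(2)] \<Phi> by (auto simp: carrier_KK1)
    then show "\<phi> \<in> \<Phi>" using Ag.rcos_self[OF _ K1_subgroup, of \<phi>] \<phi> K_Aut by auto
  next
    fix \<phi> assume \<phi>: "\<phi> \<in> \<Phi>"
    then have "K1 #>\<^bsub>Ag\<^esub> \<phi> = \<Phi>" using Ag.repr_independence[OF _ \<psi>A K1_subgroup] \<psi> by simp
    moreover have "\<phi> \<in> K"
      using \<phi> \<psi> subgroup.m_closed[OF K_subgroup] K1_K by (auto simp: r_coset_def)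
    ultimately show "\<phi> \<in> degree (class_corr G H P \<Phi>)" by (simp add: degree_def)
  qed
qed

lemma K1_class: "K1 \<in> carrier (KK1 G H P)" "class_corr G H P K1 = \<one>\<^bsub>UU' G H P\<^esub>"
proof -
  have eq: "K1 #>\<^bsub>Ag\<^esub> \<one>\<^bsub>Ag\<^esub> = K1" by (rule Ag.coset_mult_one[OF subgroup.subset[OF K1_subgroup]])
  then show "K1 \<in> carrier (KK1 G H P)"
    using subgroup.one_closed[OF K_subgroup] by (metis carrier_KK1 imageI)
  show "class_corr G H P K1 = \<one>\<^bsub>UU' G H P\<^esub>"
    using class_corr_eq[OF Ag.one_closed H.one_closed lifts_one_one] eq
      H.coset_mult_one[OF subgroup.subset[OF U'_subgroup]] by (simp add: one_UU')
qed

lemma lifts_conj_aut: assumes x: "x \<in> normalizer G P" shows "lifts (conj_aut G P x) x"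
  by (simp add: lifts_conj_def conj_aut_def)

text \<open>Conjugation by x together with x itself is a lifting pair, so the degree of the interior
  element is the coset of x.\<close>

lemma conj_aut_degree:
  assumes x: "x \<in> normalizer G P" shows "conj_aut G P x \<in> degree (U' #>\<^bsub>G\<^esub> x)"
proof -
  note c = conj_aut_Aut[OF H.is_group P x] normalizer_conj(1)[OF H.is_group P x] lifts_conj_aut[OF x]
  show ?thesis using class_corr_eq[OF c] c by (auto simp: degree_def K_iff)
qed

lemma norm_in_K: "norm_in G P K = normalizer G P"
  using conj_aut_degree degree_K by (auto simp: norm_in_def)

lemma rcosets_sub: "rcosets\<^bsub>G\<lparr>carrier := X\<rparr>\<^esub> H = q ` X"
  by (auto simp: RCOSETS_def r_coset_def)

end

context graded_brauer
begin

section \<open>Decompositions of the extended Brauer quotient\<close>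

lemma fixed_imp_K: "\<phi> \<in> Aut G P \<Longrightarrow> C \<in> fixed \<phi> \<Longrightarrow> \<phi> \<in> qa.K"
  by (metis fixed_rcosets mem_fixed_iff qa.K_iff rcosetsE)

lemma V_trivial:
  assumes \<phi>: "\<phi> \<in> Aut G P" "\<phi> \<notin> qa.K" and Y: "Y \<in> carrier (V (carrier A) \<phi>)"
  shows "Y = \<zero>\<^bsub>V (carrier A) \<phi>\<^esub>"
proof -
  interpret V: module k "V (carrier A) \<phi>" by (rule V_module[OF carrier_submodule \<phi>(1)])
  have "fixed \<phi> = {}" using fixed_imp_K \<phi> by blast
  then show ?thesis using sum_incl_proj[OF \<phi>(1) Y] by simp
qed

text \<open>Outside K every entry of a family is forced to be zero, so the carriers agree; the
  operations do not mention the index set, hence the records are equal.\<close>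

lemma N_Aut_K: "N (carrier A) (Aut G P) = N (carrier A) qa.K"
proof (rule N_cong)
  show "carrier (N (carrier A) (Aut G P)) = carrier (N (carrier A) qa.K)"
    using V_trivial by (auto simp: carrier_N)
qed

lemma incl_closed:
  assumes "C \<in> rcosets\<^bsub>G\<^esub> H" "\<phi> \<in> Aut G P" "Y \<in> carrier (V (part C) \<phi>)"
  shows "br_incl G P J A \<iota> \<phi> Y \<in> carrier (V (carrier A) \<phi>)"
  using incl_lin_map[OF part_submodule[OF assms(1)] assms(2)] assms(3) by (auto simp: lin_map_def)

lemma incl_add:
  assumes "C \<in> rcosets\<^bsub>G\<^esub> H" "\<phi> \<in> Aut G P" "Y \<in> carrier (V (part C) \<phi>)" "Z \<in> carrier (V (part C) \<phi>)"
  shows "br_incl G P J A \<iota> \<phi> (Y \<oplus>\<^bsub>V (part C) \<phi>\<^esub> Z) =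
    br_incl G P J A \<iota> \<phi> Y \<oplus>\<^bsub>V (carrier A) \<phi>\<^esub> br_incl G P J A \<iota> \<phi> Z"
  using incl_lin_map[OF part_submodule[OF assms(1)] assms(2)] assms(3,4) by (auto simp: lin_map_def)

lemma incl_smult:
  assumes "C \<in> rcosets\<^bsub>G\<^esub> H" "\<phi> \<in> Aut G P" "c \<in> carrier k" "Y \<in> carrier (V (part C) \<phi>)"
  shows "br_incl G P J A \<iota> \<phi> (c \<odot>\<^bsub>V (part C) \<phi>\<^esub> Y) = c \<odot>\<^bsub>V (carrier A) \<phi>\<^esub> br_incl G P J A \<iota> \<phi> Y"
  using incl_lin_map[OF part_submodule[OF assms(1)] assms(2)] assms(3,4) by (auto simp: lin_map_def)

lemma V_zero_rules:
  assumes "\<phi> \<in> Aut G P"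
  shows "\<zero>\<^bsub>V (carrier A) \<phi>\<^esub> \<in> carrier (V (carrier A) \<phi>)"
    "\<zero>\<^bsub>V (carrier A) \<phi>\<^esub> \<oplus>\<^bsub>V (carrier A) \<phi>\<^esub> \<zero>\<^bsub>V (carrier A) \<phi>\<^esub> = \<zero>\<^bsub>V (carrier A) \<phi>\<^esub>"
    "c \<in> carrier k \<Longrightarrow> c \<odot>\<^bsub>V (carrier A) \<phi>\<^esub> \<zero>\<^bsub>V (carrier A) \<phi>\<^esub> = \<zero>\<^bsub>V (carrier A) \<phi>\<^esub>"
proof -
  interpret V: module k "V (carrier A) \<phi>" by (rule V_module[OF carrier_submodule assms])
  show "\<zero>\<^bsub>V (carrier A) \<phi>\<^esub> \<in> carrier (V (carrier A) \<phi>)"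
    "\<zero>\<^bsub>V (carrier A) \<phi>\<^esub> \<oplus>\<^bsub>V (carrier A) \<phi>\<^esub> \<zero>\<^bsub>V (carrier A) \<phi>\<^esub> = \<zero>\<^bsub>V (carrier A) \<phi>\<^esub>"
    "c \<in> carrier k \<Longrightarrow> c \<odot>\<^bsub>V (carrier A) \<phi>\<^esub> \<zero>\<^bsub>V (carrier A) \<phi>\<^esub> = \<zero>\<^bsub>V (carrier A) \<phi>\<^esub>"
    by auto
qed

lemma insert_apply:
  "\<psi> \<in> Aut G P \<Longrightarrow> br_insert G P J A \<iota> \<phi> Y \<psi> =
    (if \<psi> = \<phi> then br_incl G P J A \<iota> \<phi> Y else \<zero>\<^bsub>V (carrier A) \<psi>\<^esub>)"
  by (simp add: br_insert_def zero_V)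

lemma insert_lin_map:
  assumes C: "C \<in> rcosets\<^bsub>G\<^esub> H" and \<phi>: "\<phi> \<in> Aut G P" "\<phi> \<in> L"
  shows "br_insert G P J A \<iota> \<phi> \<in> lin_map k (V (part C) \<phi>) (N (carrier A) L)"
proof -
  interpret VC: module k "V (part C) \<phi>" by (rule V_module[OF part_submodule[OF C] \<phi>(1)])
  have cl: "br_insert G P J A \<iota> \<phi> Y \<in> carrier (N (carrier A) L)" if "Y \<in> carrier (V (part C) \<phi>)" for Y
  proof -
    have "br_insert G P J A \<iota> \<phi> Y \<in> extensional (Aut G P)" by (simp add: br_insert_def)
    then show ?thesis
      using incl_closed[OF C \<phi>(1) that] V_zero_rules(1) \<phi>(2)
      by (auto simp: carrier_N PiE_def insert_apply)
  qed
  interpret N: module k "N (carrier A) L" by (rule N_module[OF carrier_submodule])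
  have "br_insert G P J A \<iota> \<phi> (Y \<oplus>\<^bsub>V (part C) \<phi>\<^esub> Z) =
      br_insert G P J A \<iota> \<phi> Y \<oplus>\<^bsub>N (carrier A) L\<^esub> br_insert G P J A \<iota> \<phi> Z"
    if Y: "Y \<in> carrier (V (part C) \<phi>)" and Z: "Z \<in> carrier (V (part C) \<phi>)" for Y Z
  proof (rule N_eqI)
    show "br_insert G P J A \<iota> \<phi> Y \<oplus>\<^bsub>N (carrier A) L\<^esub> br_insert G P J A \<iota> \<phi> Z \<in> carrier (N (carrier A) L)"
      by (rule N.M.a_closed[OF cl[OF Y] cl[OF Z]])
  qed (use Y Z cl incl_add[OF C \<phi>(1)] V_zero_rules in \<open>auto simp: insert_apply N_add\<close>)
  moreover have "br_insert G P J A \<iota> \<phi> (c \<odot>\<^bsub>V (part C) \<phi>\<^esub> Y) =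
      c \<odot>\<^bsub>N (carrier A) L\<^esub> br_insert G P J A \<iota> \<phi> Y"
    if c: "c \<in> carrier k" and Y: "Y \<in> carrier (V (part C) \<phi>)" for c Y
  proof (rule N_eqI)
    show "c \<odot>\<^bsub>N (carrier A) L\<^esub> br_insert G P J A \<iota> \<phi> Y \<in> carrier (N (carrier A) L)"
      by (rule N.smult_closed[OF c cl[OF Y]])
  qed (use c Y cl incl_smult[OF C \<phi>(1)] V_zero_rules in \<open>auto simp: insert_apply N_smult\<close>)
  ultimately show ?thesis using cl by (auto simp: lin_map_def)
qed

text \<open>The decomposition over automorphisms is refined by the one over fixed cosets: the
  coordinate of a family f at (\<phi>, C) is \<open>proj C \<phi> (f \<phi>)\<close>.\<close>

lemma N_direct_sum_pairs:
  assumes L: "L \<subseteq> Aut G P"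
  shows "is_direct_sum k {(\<phi>, C). \<phi> \<in> L \<and> C \<in> fixed \<phi>} (\<lambda>(\<phi>, C). V (part C) \<phi>)
    (\<lambda>(\<phi>, C). br_insert G P J A \<iota> \<phi>) (N (carrier A) L)"
proof -
  let ?I = "{(\<phi>, C). \<phi> \<in> L \<and> C \<in> fixed \<phi>}" and ?N = "N (carrier A) L" and ?V = "V (carrier A)"
  let ?j = "br_insert G P J A \<iota>"
  interpret N: module k ?N by (rule N_module[OF carrier_submodule])
  have fin: "finite ?I"
  proof (rule finite_subset)
    show "?I \<subseteq> Aut G P \<times> (rcosets\<^bsub>G\<^esub> H)" using L fixed_rcosets by auto
  qed (use finite_Aut[OF finite_P] finite_rcosets in simp)
  have mem: "\<phi> \<in> Aut G P" "\<phi> \<in> L" "C \<in> fixed \<phi>" "C \<in> rcosets\<^bsub>G\<^esub> H" if "(\<phi>, C) \<in> ?I" for \<phi> C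
    using that L fixed_rcosets by auto
  have pc: "proj C \<phi> (f \<phi>) \<in> carrier (V (part C) \<phi>)" if "(\<phi>, C) \<in> ?I" "f \<in> carrier ?N" for \<phi> C f
    by (rule proj_closed[OF mem(1,3)[OF that(1)] N_apply[OF that(2) mem(1)[OF that(1)]]])
  have jc: "?j \<phi> Y \<in> carrier ?N" if "(\<phi>, C) \<in> ?I" "Y \<in> carrier (V (part C) \<phi>)" for \<phi> C Y
    using insert_lin_map[OF mem(4,1,2)[OF that(1)]] that(2) by (auto simp: lin_map_def)
  have sum: "(\<Oplus>\<^bsub>?N\<^esub>i\<in>?I. ?j (fst i) (proj (snd i) (fst i) (f (fst i)))) = f" if f: "f \<in> carrier ?N" for f
  proof (rule N_eqI[OF _ f])
    let ?F = "\<lambda>i. ?j (fst i) (proj (snd i) (fst i) (f (fst i)))"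
    have F: "?F i \<in> carrier ?N" if "i \<in> ?I" for i
      using jc[of "fst i" "snd i"] pc[of "fst i" "snd i" f] that f by auto
    then show "(\<Oplus>\<^bsub>?N\<^esub>i\<in>?I. ?F i) \<in> carrier ?N" by (intro N.M.finsum_closed) blast
    fix \<psi> assume \<psi>: "\<psi> \<in> Aut G P"
    interpret V: module k "?V \<psi>" by (rule V_module[OF carrier_submodule \<psi>])
    have f\<psi>: "f \<psi> \<in> carrier (?V \<psi>)" by (rule N_apply[OF f \<psi>])
    have eval: "?F i \<psi> = (if fst i = \<psi> then br_incl G P J A \<iota> \<psi> (proj (snd i) \<psi> (f \<psi>)) else \<zero>\<^bsub>?V \<psi>\<^esub>)" for i
      using insert_apply[OF \<psi>] by auto
    have "(\<Oplus>\<^bsub>?N\<^esub>i\<in>?I. ?F i) \<psi> = (\<Oplus>\<^bsub>?V \<psi>\<^esub>i\<in>?I. ?F i \<psi>)"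
      by (rule N_finsum_apply[OF carrier_submodule fin F \<psi>])
    also have "\<dots> = f \<psi>"
    proof (cases "\<psi> \<in> L")
      case True
      \<comment> \<open>At \<psi> only pairs with first entry \<psi> contribute, which leaves the
        sum over the fixed cosets of \<psi> treated in \<open>sum_incl_proj\<close>.\<close>
      have "(\<Oplus>\<^bsub>?V \<psi>\<^esub>i\<in>?I. ?F i \<psi>) = (\<Oplus>\<^bsub>?V \<psi>\<^esub>i\<in>Pair \<psi> ` fixed \<psi>. ?F i \<psi>)"
      proof (rule V.M.add.finprod_mono_neutral_cong_right[OF fin])
        show "Pair \<psi> ` fixed \<psi> \<subseteq> ?I" using True by auto
        show "?F i \<psi> = \<zero>\<^bsub>?V \<psi>\<^esub>" if "i \<in> ?I - Pair \<psi> ` fixed \<psi>" for i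
          unfolding eval using that by auto
        show "(\<lambda>i. ?F i \<psi>) \<in> ?I \<rightarrow> carrier (?V \<psi>)" using N_apply[OF F \<psi>] by blast
      qed simp
      also have "\<dots> = (\<Oplus>\<^bsub>?V \<psi>\<^esub>C\<in>fixed \<psi>. ?F (\<psi>, C) \<psi>)"
      proof (rule V.M.finsum_bij)
        show "bij_betw (Pair \<psi>) (fixed \<psi>) (Pair \<psi> ` fixed \<psi>)" by (auto simp: bij_betw_def inj_on_def)
        show "?F i \<psi> \<in> carrier (?V \<psi>)" if "i \<in> Pair \<psi> ` fixed \<psi>" for i
          using N_apply[OF F \<psi>, of i] that True by auto
      qed
      also have "\<dots> = f \<psi>" unfolding eval using sum_incl_proj[OF \<psi> f\<psi>] by simp
      finally show ?thesis .
    next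
      case False
      have "(\<Oplus>\<^bsub>?V \<psi>\<^esub>i\<in>?I. ?F i \<psi>) = \<zero>\<^bsub>?V \<psi>\<^esub>"
        unfolding eval using False by (intro V.M.add.finprod_one_eqI) auto
      then show ?thesis using f False \<psi> by (auto simp: carrier_N)
    qed
    finally show "(\<Oplus>\<^bsub>?N\<^esub>i\<in>?I. ?F i) \<psi> = f \<psi>" .
  qed
  \<comment> \<open>With \<open>fst\<close> and \<open>snd\<close> in place of pattern abstractions
    the hypotheses can be discharged for a single index variable; the form with pairs is restored at
    the end.\<close>
  have "is_direct_sum k ?I (\<lambda>i. V (part (snd i)) (fst i)) (\<lambda>i. ?j (fst i)) ?N"
  proof (rule is_direct_sumI[where q="\<lambda>i f. proj (snd i) (fst i) (f (fst i))", OF fin N.module_axioms])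
    show "module k (V (part (snd i)) (fst i))" if "i \<in> ?I" for i
      using mem[of "fst i" "snd i"] that by (intro V_module part_submodule) auto
    show "?j (fst i) \<in> lin_map k (V (part (snd i)) (fst i)) ?N" if "i \<in> ?I" for i
      using mem[of "fst i" "snd i"] that by (intro insert_lin_map) auto
    show "proj (snd i) (fst i) (f (fst i)) \<in> carrier (V (part (snd i)) (fst i))" if "i \<in> ?I" "f \<in> carrier ?N" for i f
      using pc[of "fst i" "snd i" f] that by auto
    show "proj (snd i) (fst i) ((f \<oplus>\<^bsub>?N\<^esub> f') (fst i)) =
        proj (snd i) (fst i) (f (fst i)) \<oplus>\<^bsub>V (part (snd i)) (fst i)\<^esub> proj (snd i) (fst i) (f' (fst i))"
      if "i \<in> ?I" "f \<in> carrier ?N" "f' \<in> carrier ?N" for i f f'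
    proof -
      have m: "fst i \<in> Aut G P" "snd i \<in> fixed (fst i)" using mem[of "fst i" "snd i"] that by auto
      then show ?thesis
        using proj_add[OF m N_apply[OF that(2) m(1)] N_apply[OF that(3) m(1)]] by (simp add: N_add)
    qed
    show "proj (snd i) (fst i) (?j (fst i) Y (fst i)) = Y" if "i \<in> ?I" "Y \<in> carrier (V (part (snd i)) (fst i))" for i Y
    proof -
      have m: "fst i \<in> Aut G P" "snd i \<in> fixed (fst i)" using mem[of "fst i" "snd i"] that by auto
      then show ?thesis using proj_incl[OF m m(2) that(2)] by (simp add: insert_apply)
    qed
    show "proj (snd i) (fst i) (?j (fst i') Y (fst i)) = \<zero>\<^bsub>V (part (snd i)) (fst i)\<^esub>"
      if i: "i \<in> ?I" "i' \<in> ?I" "i \<noteq> i'" and Y: "Y \<in> carrier (V (part (snd i')) (fst i'))" for i i' Y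
    proof -
      have m: "fst i \<in> Aut G P" "snd i \<in> fixed (fst i)" "snd i' \<in> fixed (fst i')" using mem[of "fst i" "snd i"] i by auto
      \<comment> \<open>Different pairs differ in the coset, where orthogonality of the projections
        applies, or in the automorphism, where the inserted family is zero.\<close>
      show ?thesis
      proof (cases "fst i = fst i'")
        case True
        then have "snd i \<noteq> snd i'" using i by (metis prod.collapse)
        then show ?thesis using True m proj_incl[OF m(1,2), of "snd i'" Y] Y by (simp add: insert_apply)
      next
        case False
        have "proj (snd i) (fst i) \<zero>\<^bsub>?V (fst i)\<^esub> = \<zero>\<^bsub>V (part (snd i)) (fst i)\<^esub>"
          using proj_cl[OF m(1,2) A.zero_closed] \<pi>_zero[OF fixed_rcosets[OF m(2)]]
            cl_zero[OF subset_refl m(1)] cl_zero[OF part_carrier[OF fixed_rcosets[OF m(2)]] m(1)] by simp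
        then show ?thesis using False m by (simp add: insert_apply)
      qed
    qed
  qed (rule sum)
  then show ?thesis by (simp add: case_prod_unfold)
qed

lemma incl_zero_V:
  "C \<in> rcosets\<^bsub>G\<^esub> H \<Longrightarrow> \<phi> \<in> Aut G P \<Longrightarrow> br_incl G P J A \<iota> \<phi> \<zero>\<^bsub>V (part C) \<phi>\<^esub> = \<zero>\<^bsub>V (carrier A) \<phi>\<^esub>"
  using incl_D[OF part_carrier] by (simp add: zero_V)

lemma ext_incl_lin_map:
  assumes C: "C \<in> rcosets\<^bsub>G\<^esub> H" and L: "L \<subseteq> Aut G P"
  shows "ext_brauer_incl G P J A \<iota> \<in> lin_map k (N (part C) L) (N (carrier A) L)"
proof -
  let ?j = "ext_brauer_incl G P J A \<iota>"
  have a: "?j f \<phi> = br_incl G P J A \<iota> \<phi> (f \<phi>)" if "\<phi> \<in> Aut G P" for f \<phi>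
    using that by (simp add: ext_brauer_incl_def)
  have cl: "?j f \<in> carrier (N (carrier A) L)" if f: "f \<in> carrier (N (part C) L)" for f
  proof -
    have "?j f \<in> extensional (Aut G P)" by (simp add: ext_brauer_incl_def)
    moreover have "?j f \<phi> \<in> carrier (V (carrier A) \<phi>)" if "\<phi> \<in> Aut G P" for \<phi>
      using incl_closed[OF C that N_apply[OF f that]] a[OF that] by simp
    moreover have "?j f \<phi> = \<zero>\<^bsub>V (carrier A) \<phi>\<^esub>" if "\<phi> \<in> Aut G P - L" for \<phi>
      using that f incl_zero_V[OF C] a by (simp add: carrier_N)
    ultimately show ?thesis by (simp add: carrier_N PiE_def)
  qed
  interpret N: module k "N (carrier A) L" by (rule N_module[OF carrier_submodule])
  interpret NC: module k "N (part C) L" by (rule N_module[OF part_submodule[OF C]])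
  have "?j (f \<oplus>\<^bsub>N (part C) L\<^esub> f') = ?j f \<oplus>\<^bsub>N (carrier A) L\<^esub> ?j f'"
    if f: "f \<in> carrier (N (part C) L)" "f' \<in> carrier (N (part C) L)" for f f'
  proof (rule N_eqI[of _ "carrier A" L])
    fix \<phi> assume \<phi>: "\<phi> \<in> Aut G P"
    then show "?j (f \<oplus>\<^bsub>N (part C) L\<^esub> f') \<phi> = (?j f \<oplus>\<^bsub>N (carrier A) L\<^esub> ?j f') \<phi>"
      using incl_add[OF C \<phi> N_apply[OF f(1) \<phi>] N_apply[OF f(2) \<phi>]] by (simp add: a N_add)
  qed (use f cl in auto)
  moreover have "?j (c \<odot>\<^bsub>N (part C) L\<^esub> f) = c \<odot>\<^bsub>N (carrier A) L\<^esub> ?j f"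
    if f: "f \<in> carrier (N (part C) L)" and c: "c \<in> carrier k" for f c
  proof (rule N_eqI[of _ "carrier A" L])
    fix \<phi> assume \<phi>: "\<phi> \<in> Aut G P"
    then show "?j (c \<odot>\<^bsub>N (part C) L\<^esub> f) \<phi> = (c \<odot>\<^bsub>N (carrier A) L\<^esub> ?j f) \<phi>"
      using incl_smult[OF C \<phi> c N_apply[OF f \<phi>]] by (simp add: a N_smult)
  qed (use f c cl in auto)
  ultimately show ?thesis using cl by (auto simp: lin_map_def)
qed

text \<open>If every \<phi> in L has the same fixed cosets, the pairs form a product of L and X. The
  sum may then run over X, with all of L inside each summand.\<close>

lemma N_direct_sum_parts:
  assumes L: "L \<subseteq> Aut G P" and X: "X \<subseteq> rcosets\<^bsub>G\<^esub> H" and fX: "\<And>\<phi>. \<phi> \<in> L \<Longrightarrow> fixed \<phi> = X"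
  shows "is_direct_sum k X (\<lambda>C. N (part C) L) (\<lambda>C. ext_brauer_incl G P J A \<iota>) (N (carrier A) L)"
proof -
  let ?N = "N (carrier A) L" and ?V = "V (carrier A)" and ?j = "ext_brauer_incl G P J A \<iota>"
  let ?q = "\<lambda>C f. \<lambda>\<phi>\<in>Aut G P. if \<phi> \<in> L then proj C \<phi> (f \<phi>) else \<zero>\<^bsub>V (part C) \<phi>\<^esub>"
  interpret N: module k ?N by (rule N_module[OF carrier_submodule])
  have fin: "finite X" using X finite_rcosets finite_subset by blast
  have a: "?j f \<phi> = br_incl G P J A \<iota> \<phi> (f \<phi>)" if "\<phi> \<in> Aut G P" for f \<phi>
    using that by (simp add: ext_brauer_incl_def)
  have CR: "C \<in> rcosets\<^bsub>G\<^esub> H" if "C \<in> X" for C using X that by auto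
  have CF: "C \<in> fixed \<phi>" if "C \<in> X" "\<phi> \<in> L" for C \<phi> using fX that by auto
  have jc: "?j f \<in> carrier ?N" if "C \<in> X" "f \<in> carrier (N (part C) L)" for C f
    using ext_incl_lin_map[OF CR[OF that(1)] L] that(2) by (auto simp: lin_map_def)
  have out: "f \<phi> = \<zero>\<^bsub>V M \<phi>\<^esub>" if "f \<in> carrier (N M L)" "\<phi> \<in> Aut G P" "\<phi> \<notin> L" for f \<phi> M
    using that by (auto simp: carrier_N)
  have qc: "?q C f \<in> carrier (N (part C) L)" if C: "C \<in> X" and f: "f \<in> carrier ?N" for C f
  proof -
    have "(if \<phi> \<in> L then proj C \<phi> (f \<phi>) else \<zero>\<^bsub>V (part C) \<phi>\<^esub>) \<in> carrier (V (part C) \<phi>)" if \<phi>: "\<phi> \<in> Aut G P" for \<phi>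
    proof -
      interpret VC: module k "V (part C) \<phi>" by (rule V_module[OF part_submodule[OF CR[OF C]] \<phi>])
      show ?thesis using proj_closed[OF \<phi> CF[OF C] N_apply[OF f \<phi>]] by simp
    qed
    then show ?thesis by (simp add: carrier_N)
  qed
  show ?thesis
  proof (rule is_direct_sumI[where q="?q", OF fin N.module_axioms])
    show "module k (N (part C) L)" if "C \<in> X" for C by (rule N_module[OF part_submodule[OF CR[OF that]]])
    show "?j \<in> lin_map k (N (part C) L) ?N" if "C \<in> X" for C by (rule ext_incl_lin_map[OF CR[OF that] L])
    show "?q C f \<in> carrier (N (part C) L)" if "C \<in> X" "f \<in> carrier ?N" for C f by (rule qc[OF that])
    show "?q C (f \<oplus>\<^bsub>?N\<^esub> f') = ?q C f \<oplus>\<^bsub>N (part C) L\<^esub> ?q C f'"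
      if C: "C \<in> X" and f: "f \<in> carrier ?N" "f' \<in> carrier ?N" for C f f'
      unfolding N_add
    proof (rule restrict_ext)
      fix \<phi> assume \<phi>: "\<phi> \<in> Aut G P"
      interpret VC: module k "V (part C) \<phi>" by (rule V_module[OF part_submodule[OF CR[OF C]] \<phi>])
      show "(if \<phi> \<in> L then proj C \<phi> ((\<lambda>\<phi>\<in>Aut G P. f \<phi> \<oplus>\<^bsub>?V \<phi>\<^esub> f' \<phi>) \<phi>) else \<zero>\<^bsub>V (part C) \<phi>\<^esub>) =
          ?q C f \<phi> \<oplus>\<^bsub>V (part C) \<phi>\<^esub> ?q C f' \<phi>"
        using proj_add[OF \<phi> CF[OF C] N_apply[OF f(1) \<phi>] N_apply[OF f(2) \<phi>]] \<phi> by simp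
    qed
    show "?q C (?j f) = f" if C: "C \<in> X" and f: "f \<in> carrier (N (part C) L)" for C f
    proof (rule N_eqI[OF qc[OF C jc[OF C f]] f])
      fix \<phi> assume \<phi>: "\<phi> \<in> Aut G P"
      show "?q C (?j f) \<phi> = f \<phi>"
        using proj_incl[OF \<phi> CF[OF C] CF[OF C] N_apply[OF f \<phi>]] out[OF f \<phi>] \<phi> a by simp
    qed
    show "?q C (?j f) = \<zero>\<^bsub>N (part C) L\<^esub>"
      if C: "C \<in> X" "C' \<in> X" "C \<noteq> C'" and f: "f \<in> carrier (N (part C') L)" for C C' f
      unfolding N_zero
    proof (rule restrict_ext)
      fix \<phi> assume \<phi>: "\<phi> \<in> Aut G P"
      show "(if \<phi> \<in> L then proj C \<phi> (?j f \<phi>) else \<zero>\<^bsub>V (part C) \<phi>\<^esub>) = \<zero>\<^bsub>V (part C) \<phi>\<^esub>"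
        using proj_incl[OF \<phi> CF[OF C(1)] CF[OF C(2)] N_apply[OF f \<phi>]] C(3) \<phi> a by simp
    qed
    show "(\<Oplus>\<^bsub>?N\<^esub>C\<in>X. ?j (?q C f)) = f" if f: "f \<in> carrier ?N" for f
    proof (rule N_eqI[OF _ f])
      have F: "?j (?q C f) \<in> carrier ?N" if "C \<in> X" for C by (rule jc[OF that qc[OF that f]])
      then show "(\<Oplus>\<^bsub>?N\<^esub>C\<in>X. ?j (?q C f)) \<in> carrier ?N" by (intro N.M.finsum_closed) blast
      fix \<phi> assume \<phi>: "\<phi> \<in> Aut G P"
      interpret V: module k "?V \<phi>" by (rule V_module[OF carrier_submodule \<phi>])
      have "(\<Oplus>\<^bsub>?N\<^esub>C\<in>X. ?j (?q C f)) \<phi> = (\<Oplus>\<^bsub>?V \<phi>\<^esub>C\<in>X. ?j (?q C f) \<phi>)"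
        by (rule N_finsum_apply[OF carrier_submodule fin F \<phi>])
      also have "\<dots> = f \<phi>"
      proof (cases "\<phi> \<in> L")
        case True
        have "(\<Oplus>\<^bsub>?V \<phi>\<^esub>C\<in>X. ?j (?q C f) \<phi>) = (\<Oplus>\<^bsub>?V \<phi>\<^esub>C\<in>fixed \<phi>. br_incl G P J A \<iota> \<phi> (proj C \<phi> (f \<phi>)))"
        proof (rule V.M.finsum_cong')
          show "X = fixed \<phi>" using fX[OF True] by simp
          show "(\<lambda>C. br_incl G P J A \<iota> \<phi> (proj C \<phi> (f \<phi>))) \<in> fixed \<phi> \<rightarrow> carrier (?V \<phi>)"
            using incl_closed[OF fixed_rcosets \<phi> proj_closed[OF \<phi> _ N_apply[OF f \<phi>]]] by blast
        qed (use True \<phi> a in simp)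
        then show ?thesis using sum_incl_proj[OF \<phi> N_apply[OF f \<phi>]] by simp
      next
        case False
        have "(\<Oplus>\<^bsub>?V \<phi>\<^esub>C\<in>X. ?j (?q C f) \<phi>) = \<zero>\<^bsub>?V \<phi>\<^esub>"
          using a[OF \<phi>] incl_zero_V[OF CR \<phi>] False \<phi> by (intro V.M.add.finprod_one_eqI) simp
        then show ?thesis using out[OF f \<phi> False] by simp
      qed
      finally show "(\<Oplus>\<^bsub>?N\<^esub>C\<in>X. ?j (?q C f)) \<phi> = f \<phi>" .
    qed
  qed
qed

section \<open>The grading by U modulo U' and its components\<close>

lemma grade_eq: "grade G H P J A \<iota> C = carrier (N (carrier A) (qa.degree C))"
  by (simp add: grade_def qa.degree_def)

text \<open>The direct sum is the partition of K into degrees. Multiplicativity is checked on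
  representing families, whose supports multiply as the degrees do.\<close>

lemma N_graded: "graded_algebra k (UU' G H P) (grade G H P J A \<iota>) (N (carrier A) qa.K)"
  unfolding graded_algebra_def grade_eq N_carrier_eq
proof (intro conjI ballI)
  interpret N: module k "N (carrier A) qa.K" by (rule N_module[OF carrier_submodule])
  show "group (UU' G H P)" by (rule qa.group_UU')
  show "assoc_algebra k (N (carrier A) qa.K)" by (rule N_algebra[OF qa.K_subgroup])
  show "submodule (carrier (N (carrier A) (qa.degree i))) k (N (carrier A) qa.K)" for i
    by (rule N.module_incl_imp_submodule)
       (simp_all add: carrier_N_mono qa.degree_K N_carrier_eq N_module[OF carrier_submodule])
  show "is_direct_sum k (carrier (UU' G H P)) (\<lambda>i. N (carrier A) (qa.degree i)) (\<lambda>i a. a) (N (carrier A) qa.K)"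
  proof (rule N_grading)
    have "finite qa.U" using finite_G subgroup.subset[OF qa.U_subgroup] finite_subset by blast
    then show "finite (carrier (UU' G H P))" by (simp add: qa.carrier_UU')
  qed (use qa.degree_K qa.K_Aut qa.K_degree in auto)
  fix i j a b assume "a \<in> carrier (N (carrier A) (qa.degree i))" "b \<in> carrier (N (carrier A) (qa.degree j))"
  then obtain f f' where f: "f \<in> fams (carrier A) (qa.degree i)" "f' \<in> fams (carrier A) (qa.degree j)"
    "a = cls_fam (carrier A) f" "b = cls_fam (carrier A) f'"
    unfolding cls_fam_surj[OF carrier_submodule, symmetric] by blast
  have "f \<otimes>\<^bsub>X.S\<^esub> f' \<in> fams (carrier A) (qa.degree (i \<otimes>\<^bsub>UU' G H P\<^esub> j))"
    by (rule fams_mult[OF qa.degree_mult f(1,2)])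
  then show "a \<otimes>\<^bsub>N (carrier A) qa.K\<^esub> b \<in> carrier (N (carrier A) (qa.degree (i \<otimes>\<^bsub>UU' G H P\<^esub> j)))"
    unfolding f(3,4) cls_fam_mult[OF f(1,2), symmetric] cls_fam_surj[OF carrier_submodule, symmetric] by (rule imageI)
qed

text \<open>For \<phi> in K1 the pair (\<phi>, 1) lifts, so multiplying or dividing by it shows that
  (\<phi>, z) lifts exactly if (1, z) does, that is, if z lies in U'.\<close>

lemma fixed_K1:
  assumes "\<phi> \<in> qa.K1" shows "fixed \<phi> = rcosets\<^bsub>G\<lparr>carrier := qa.U'\<rparr>\<^esub> H"
proof -
  have \<phi>: "\<phi> \<in> Aut G P" "qa.lifts \<phi> \<one>\<^bsub>G\<^esub>" using assms by (auto simp: qa.K1_iff)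
  have iff: "qa.lifts \<phi> z \<longleftrightarrow> z \<in> qa.U'" if z: "z \<in> carrier G" for z
  proof
    assume "qa.lifts \<phi> z"
    then have "qa.lifts (inv\<^bsub>Ag\<^esub> \<phi> \<otimes>\<^bsub>Ag\<^esub> \<phi>) (inv\<^bsub>G\<^esub> \<one>\<^bsub>G\<^esub> \<otimes>\<^bsub>G\<^esub> z)"
      using \<phi> z by (intro qa.lifts_mult qa.lifts_inv) auto
    then show "z \<in> qa.U'" using \<phi> z by (simp add: qa.lifts_one_iff)
  next
    assume "z \<in> qa.U'"
    then have "qa.lifts (\<phi> \<otimes>\<^bsub>Ag\<^esub> \<one>\<^bsub>Ag\<^esub>) (\<one>\<^bsub>G\<^esub> \<otimes>\<^bsub>G\<^esub> z)"
      using \<phi> z by (intro qa.lifts_mult) (auto simp: qa.lifts_one_iff)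
    then show "qa.lifts \<phi> z" using \<phi> z by simp
  qed
  show ?thesis
    unfolding qa.rcosets_sub
  proof (intro equalityI subsetI)
    fix C assume C: "C \<in> fixed \<phi>"
    then obtain z where z: "z \<in> carrier G" "C = qa.q z" using fixed_rcosets rcosetsE by metis
    then show "C \<in> qa.q ` qa.U'" using C mem_fixed_iff[OF \<phi>(1) z(1)] iff[OF z(1)] by auto
  next
    fix C assume "C \<in> qa.q ` qa.U'"
    then obtain z where z: "z \<in> qa.U'" "C = qa.q z" by auto
    then have "z \<in> carrier G" by (simp add: qa.lifts_one_iff)
    then show "C \<in> fixed \<phi>" using z mem_fixed_iff[OF \<phi>(1)] iff by simp
  qed
qed

text \<open>If a member of \<Phi> lifts every z in C, then these z lie in U and in the coset
  corresponding to \<Phi>. So the index set of the theorem consists of the pairs over which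
  \<open>N_direct_sum_pairs\<close> sums.\<close>

lemma class_pairs:
  assumes \<Phi>: "\<Phi> \<in> carrier (KK1 G H P)"
  shows "{(\<phi>, C). C \<in> rcosets\<^bsub>G\<lparr>carrier := qa.U\<rparr>\<^esub> H \<and> C \<subseteq> class_corr G H P \<Phi> \<and> \<phi> \<in> \<Phi> \<and>
      (\<forall>z\<in>C. lifts_conj G H P \<phi> z)} = {(\<phi>, C). \<phi> \<in> \<Phi> \<and> C \<in> fixed \<phi>}"
proof -
  have \<Phi>A: "\<phi> \<in> Aut G P" if "\<phi> \<in> \<Phi>" for \<phi>
    using that qa.degree_class[OF \<Phi>] qa.degree_K qa.K_Aut by blast
  have "C \<in> rcosets\<^bsub>G\<lparr>carrier := qa.U\<rparr>\<^esub> H \<and> C \<subseteq> class_corr G H P \<Phi> \<and> \<phi> \<in> \<Phi> \<and>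
      (\<forall>z\<in>C. lifts_conj G H P \<phi> z) \<longleftrightarrow> \<phi> \<in> \<Phi> \<and> C \<in> fixed \<phi>" for \<phi> C
  proof
    assume *: "C \<in> rcosets\<^bsub>G\<lparr>carrier := qa.U\<rparr>\<^esub> H \<and> C \<subseteq> class_corr G H P \<Phi> \<and> \<phi> \<in> \<Phi> \<and>
      (\<forall>z\<in>C. lifts_conj G H P \<phi> z)"
    then have "C \<in> rcosets\<^bsub>G\<^esub> H"
      using q_rcosets subgroup.subset[OF qa.U_subgroup] by (auto simp: qa.rcosets_sub)
    then show "\<phi> \<in> \<Phi> \<and> C \<in> fixed \<phi>" using * by (simp add: fixed_def)
  next
    assume *: "\<phi> \<in> \<Phi> \<and> C \<in> fixed \<phi>"
    then have CR: "C \<in> rcosets\<^bsub>G\<^esub> H" and l: "\<And>z. z \<in> C \<Longrightarrow> qa.lifts \<phi> z" by (auto simp: fixed_def)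
    have U: "z \<in> qa.U" if "z \<in> C" for z
      using coset_eq[OF CR that] l[OF that] \<Phi>A * unfolding qa.U_iff by blast
    obtain z where z: "z \<in> carrier G" "C = qa.q z" using CR by (rule rcosetsE)
    have "z \<in> C" using z G.rcos_self[OF z(1) H.subgroup_axioms] by simp
    then have "C \<in> rcosets\<^bsub>G\<lparr>carrier := qa.U\<rparr>\<^esub> H" using U z by (auto simp: qa.rcosets_sub)
    moreover have "C \<subseteq> class_corr G H P \<Phi>" using U l * by (auto simp: class_corr_def)
    ultimately show "C \<in> rcosets\<^bsub>G\<lparr>carrier := qa.U\<rparr>\<^esub> H \<and> C \<subseteq> class_corr G H P \<Phi> \<and> \<phi> \<in> \<Phi> \<and>
      (\<forall>z\<in>C. lifts_conj G H P \<phi> z)" using * l by blast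
  qed
  then show ?thesis by blast
qed

end

lemma interior_imp_induced:
  assumes "interior_G_algebra R G H B act \<sigma>" "finite (carrier G)"
  shows "induced_G_algebra G R B act H \<sigma>"
proof -
  interpret I: interior_G_algebra R G H B act \<sigma> by fact
  show ?thesis
    by unfold_locales
       (use assms(2) I.act_hom I.act_one I.act_mult I.struct_hom I.struct_equivariant I.act_interior in auto)
qed

theorem theorem4p4:
  fixes R :: "'r ring" and J :: "'r set" and p :: nat
    and G :: "'g monoid" and H P :: "'g set"
    and B :: "('r, 'b) module" and act :: "'b \<Rightarrow> 'g \<Rightarrow> 'b" and \<sigma> :: "('g \<Rightarrow> 'r) \<Rightarrow> 'b"
    and A :: "('r, ('g \<Rightarrow> 'b) set) module" and \<iota> :: "'g \<Rightarrow> ('g \<Rightarrow> 'b) set"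
    and Bz :: "'g set \<Rightarrow> ('g \<Rightarrow> 'b) set set"
    and N :: "('g \<Rightarrow> 'b) set set \<Rightarrow> ('g \<Rightarrow> 'g) set \<Rightarrow>
              ('r set, ('g \<Rightarrow> 'g) \<Rightarrow> ('g \<Rightarrow> 'b) set set) module"
    and K K1 :: "('g \<Rightarrow> 'g) set" and U U' :: "'g set"
  assumes "complete_dvr R J p"
    and "group G" and "finite (carrier G)" and "H \<lhd> G"
    and "subgroup P G" and "\<exists>n. card P = p ^ n"
    and "interior_G_algebra R G H B act \<sigma>"
    and "A = induced_algebra R G H B act \<sigma>"
    and "\<iota> = tens R G H B act \<sigma> \<one>\<^bsub>B\<^esub>"
    and "Bz = tens_part R G H B act \<sigma>"
    and "N = ext_brauer G P J A \<iota>"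
    and "K = Aut_quot G H P" and "K1 = Aut_quot_one G H P"
    and "U = norm_preimage G H P" and "U' = cent_preimage G H P"
  shows "N (carrier A) (Aut G P) = N (carrier A) K
    \<and> class_corr G H P \<in> iso (KK1 G H P) (UU' G H P)
    \<and> graded_algebra (R Quot J) (UU' G H P) (grade G H P J A \<iota>) (N (carrier A) K)
    \<and> interior_algebra (R Quot J) (G\<lparr>carrier := normalizer G P\<rparr>)
        (ext_brauer_struct G P J A \<iota>) (N (carrier A) K)
    \<and> (\<forall>x\<in>normalizer G P. ext_brauer_struct G P J A \<iota> x \<in> grade G H P J A \<iota> (U' #>\<^bsub>G\<^esub> x))
    \<and> (N (carrier A) K)\<lparr>carrier := grade G H P J A \<iota> \<one>\<^bsub>UU' G H P\<^esub>\<rparr> = N (carrier A) K1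
    \<and> interior_algebra (R Quot J) (G\<lparr>carrier := norm_in G P K1\<rparr>)
        (ext_brauer_struct G P J A \<iota>) (N (carrier A) K1)
    \<and> is_direct_sum (R Quot J) (rcosets\<^bsub>G\<lparr>carrier := U'\<rparr>\<^esub> H)
        (\<lambda>C. N (Bz C) K1) (\<lambda>C. ext_brauer_incl G P J A \<iota>) (N (carrier A) K1)
    \<and> (\<forall>\<Phi>\<in>carrier (KK1 G H P). \<forall>g\<in>carrier (UU' G H P). class_corr G H P \<Phi> = g \<longrightarrow>
        is_direct_sum (R Quot J)
          {(\<phi>, C). C \<in> rcosets\<^bsub>G\<lparr>carrier := U\<rparr>\<^esub> H \<and> C \<subseteq> g \<and> \<phi> \<in> \<Phi> \<and>
             (\<forall>z\<in>C. lifts_conj G H P \<phi> z)}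
          (\<lambda>(\<phi>, C). br_quot G P J A \<iota> (Bz C) \<phi>)
          (\<lambda>(\<phi>, C). br_insert G P J A \<iota> \<phi>)
          ((N (carrier A) K)\<lparr>carrier := grade G H P J A \<iota> g\<rparr>))"
proof -
  have ind: "induced_G_algebra G R B act H \<sigma>"
    by (rule interior_imp_induced[OF assms(7,3)])
  interpret ind: induced_G_algebra G R B act H \<sigma> by (rule ind)
  have A: "A = ind.A" and \<iota>: "\<iota> = ind.\<iota>"
    using assms(8,9) by (simp_all add: ind.\<iota>_def)
  have J: "ideal J R"
    using complete_dvr.maximal[OF assms(1)] by (rule maximalideal.axioms(1))
  have finP: "finite P" using subgroup.subset[OF assms(5)] assms(3) finite_subset by blast
  have br: "brauer G R A \<iota> P J"
    unfolding A \<iota> brauer_def brauer_axioms_def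
    using assms(2,5) ind.A.assoc_algebra_axioms ind.\<iota>_hom finP J by blast
  have gb: "graded_brauer G R A \<iota> P J H ind.\<pi>"
    unfolding graded_brauer_def graded_brauer_axioms_def
    using br assms(3,4) ind.\<pi>_lin_map ind.\<pi>_\<pi> ind.\<pi>_sum ind.\<pi>_translate unfolding A \<iota> by blast
  interpret gb: graded_brauer G R A \<iota> P J H ind.\<pi> by (rule gb)
  \<comment> \<open>The passage from images of projections back to sets of tensors; it holds for
    genuine cosets, which is why \<open>is_direct_sum_cong\<close> is needed below.\<close>
  have part: "gb.part C = Bz C" if "C \<in> rcosets\<^bsub>G\<^esub> H" for C
    using ind.tens_part_eq[OF that] unfolding gb.part_def unfolding assms(10) A by simp
  have N: "N = gb.N" and K: "K = gb.qa.K" and K1: "K1 = gb.qa.K1" and U: "U = gb.qa.U" and U': "U' = gb.qa.U'"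
    using assms(11-15) by auto
  \<comment> \<open>The identity of U/U' is the image of the class K1, so the identity component is
    indexed by K1.\<close>
  have K1_deg: "gb.qa.degree \<one>\<^bsub>UU' G H P\<^esub> = K1"
    using gb.qa.degree_class[OF gb.qa.K1_class(1)] gb.qa.K1_class(2) K1 by simp
  show ?thesis
  proof (intro conjI)
    show "N (carrier A) (Aut G P) = N (carrier A) K" unfolding N K by (rule gb.N_Aut_K)
    show "class_corr G H P \<in> iso (KK1 G H P) (UU' G H P)" by (rule gb.qa.class_corr_iso)
    show "graded_algebra (R Quot J) (UU' G H P) (grade G H P J A \<iota>) (N (carrier A) K)"
      unfolding N K by (rule gb.N_graded)
    show "interior_algebra (R Quot J) (G\<lparr>carrier := normalizer G P\<rparr>) (ext_brauer_struct G P J A \<iota>) (N (carrier A) K)"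
      using gb.N_interior[OF gb.qa.K_subgroup] unfolding N K gb.qa.norm_in_K .
    show "\<forall>x\<in>normalizer G P. ext_brauer_struct G P J A \<iota> x \<in> grade G H P J A \<iota> (U' #>\<^bsub>G\<^esub> x)"
      unfolding gb.grade_eq U' using gb.struct_closed gb.qa.conj_aut_degree by blast
    show "(N (carrier A) K)\<lparr>carrier := grade G H P J A \<iota> \<one>\<^bsub>UU' G H P\<^esub>\<rparr> = N (carrier A) K1"
      unfolding gb.grade_eq K1_deg N by (rule gb.N_carrier_eq)
    show "interior_algebra (R Quot J) (G\<lparr>carrier := norm_in G P K1\<rparr>) (ext_brauer_struct G P J A \<iota>) (N (carrier A) K1)"
      unfolding N K1 by (rule gb.N_interior[OF gb.qa.K1_subgroup])
    show "is_direct_sum (R Quot J) (rcosets\<^bsub>G\<lparr>carrier := U'\<rparr>\<^esub> H)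
        (\<lambda>C. N (Bz C) K1) (\<lambda>C. ext_brauer_incl G P J A \<iota>) (N (carrier A) K1)"
    proof -
      have X: "rcosets\<^bsub>G\<lparr>carrier := U'\<rparr>\<^esub> H \<subseteq> rcosets\<^bsub>G\<^esub> H"
        using gb.q_rcosets subgroup.subset[OF gb.qa.U'_subgroup] unfolding U' gb.qa.rcosets_sub by blast
      have K1A: "K1 \<subseteq> Aut G P" using gb.qa.K1_K gb.qa.K_Aut K1 by blast
      \<comment> \<open>All automorphisms in K1 have the same fixed cosets, those of H in U', so the
        decomposition by cosets applies.\<close>
      show ?thesis
        by (rule is_direct_sum_cong[OF gb.N_direct_sum_parts[OF K1A X, folded N]])
           (use gb.fixed_K1 part X in \<open>auto simp: K1 U'\<close>)
    qed
    show "\<forall>\<Phi>\<in>carrier (KK1 G H P). \<forall>g\<in>carrier (UU' G H P). class_corr G H P \<Phi> = g \<longrightarrow>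
        is_direct_sum (R Quot J)
          {(\<phi>, C). C \<in> rcosets\<^bsub>G\<lparr>carrier := U\<rparr>\<^esub> H \<and> C \<subseteq> g \<and> \<phi> \<in> \<Phi> \<and>
             (\<forall>z\<in>C. lifts_conj G H P \<phi> z)}
          (\<lambda>(\<phi>, C). br_quot G P J A \<iota> (Bz C) \<phi>)
          (\<lambda>(\<phi>, C). br_insert G P J A \<iota> \<phi>)
          ((N (carrier A) K)\<lparr>carrier := grade G H P J A \<iota> g\<rparr>)"
    proof (intro ballI impI)
      fix \<Phi> g assume \<Phi>: "\<Phi> \<in> carrier (KK1 G H P)" and g: "class_corr G H P \<Phi> = g"
      \<comment> \<open>The component at g is indexed by the class \<Phi> itself, which makes the
        decomposition over pairs applicable with L = \<Phi>.\<close>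
      have deg: "gb.qa.degree g = \<Phi>" using gb.qa.degree_class[OF \<Phi>] g by simp
      have \<Phi>A: "\<Phi> \<subseteq> Aut G P" using deg gb.qa.degree_K gb.qa.K_Aut by blast
      show "is_direct_sum (R Quot J)
          {(\<phi>, C). C \<in> rcosets\<^bsub>G\<lparr>carrier := U\<rparr>\<^esub> H \<and> C \<subseteq> g \<and> \<phi> \<in> \<Phi> \<and>
             (\<forall>z\<in>C. lifts_conj G H P \<phi> z)}
          (\<lambda>(\<phi>, C). br_quot G P J A \<iota> (Bz C) \<phi>)
          (\<lambda>(\<phi>, C). br_insert G P J A \<iota> \<phi>)
          ((N (carrier A) K)\<lparr>carrier := grade G H P J A \<iota> g\<rparr>)"
        unfolding gb.grade_eq gb.qa.degree_class[OF \<Phi>] N gb.N_carrier_eq U g[symmetric] gb.class_pairs[OF \<Phi>]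
        by (rule is_direct_sum_cong[OF gb.N_direct_sum_pairs[OF \<Phi>A]])
           (use part gb.fixed_rcosets in auto)
    qed
  qed
qed

end
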